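(* Let $A=\mathbb{S}^{nc}(V)$ and let $I\subset A$ be the ideal generated by the family $g=\{g_i\}$. Then $A/I$ is a twisted ring on $F$ if $V$ is simple, and a twisted ring on $K$ if $V$ is non-simple. Furthermore, $A$ is noetherian.
   Context: $K_0,K_1$ are fields of characteristic $\neq 2$ and $V$ is a $K_0$-$K_1$-bimodule of rank two: $\dim_{K_0}V=\dim V_{K_1}=2$. For $i\in\mathbb{Z}$ put $K_i=K_0$ if $i$ is even, $K_i=K_1$ if $i$ is odd. For fields $L,M$ and an $L$-$M$-bimodule $W$, the right dual $W^*=\operatorname{Hom}_M(W_M,M)$ and left dual ${}^*W=\operatorname{Hom}_L({}_LW,L)$ are $M$-$L$-bimodules via $(a\psi b)(v)=a\psi(bv)$, respectively $(a\phi b)(v)=b\phi(va)$. Put $V^{0*}=V$, $V^{i*}=(V^{(i-1)*})^*$ for $i>0$, $V^{i*}={}^*(V^{(i+1)*})$ for $i<0$; $V^{i*}$ is a $K_i$-$K_{i+1}$-bimodule of rank two, and $V^{(i+1)*}$ is canonically the right dual of $V^{i*}$ for every $i$. A $\mathbb{Z}$-indexed algebra $D$ consists of abelian groups $D_{ij}$ ($i,j\in\mathbb{Z}$) with associative biadditive multiplications $D_{ij}\times D_{jl}\to D_{il}$ and units $e_i\in D_{ii}$. A (graded) right $D$-module is $M=\bigoplus_iM_i$ with multiplications $M_i\times D_{ij}\to M_j$; left modules are defined symmetrically. $D$ is noetherian if all $e_iD$ are noetherian right modules and all $De_i$ are noetherian left modules. Let $T$ be the tensor $\mathbb{Z}$-indexed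 algebra: $T_{ij}=0$ for $i>j$, $T_{ii}=K_i$, $T_{ij}=V^{i*}\otimes_{K_{i+1}}\cdots\otimes_{K_{j-1}}V^{(j-1)*}$ for $i<j$. Let $Q_i\subset V^{i*}\otimes V^{(i+1)*}\cong\operatorname{End}_{K_{i+1}}(V^{i*})$ be the image of $K_i$ acting by left multiplication; it is generated by $\sum_s x_s\otimes x_s^*$ for any right basis $\{x_s\}$ of $V^{i*}$ with dual basis $\{x_s^*\}$. The non-commutative symmetric algebra is $A=\mathbb{S}^{nc}(V)=T/R$, $R$ the ideal generated by all $Q_i$. Definition of $g$, $F$, $K$. (a) $V$ simple: there are a field $F$ and embeddings $\iota_j:K_j\to F$ with $[F:\iota_j(K_j)]=2$ ($j=0,1$) such that $V\cong{}_0F_1$, i.e. $F$ with left action via $\iota_0$ and right action via $\iota_1$; ${}_1F_0$ is $F$ with left action via $\iota_1$ and right action via $\iota_0$. With $\sigma_j$ the generator of $\operatorname{Gal}(F/\iota_j(K_j))$ and $\operatorname{tr}_j(a)=\iota_j^{-1}(\frac12(a+\sigma_j(a)))$, the maps $a\mapsto[b\mapsto\operatorname{tr}_1(ba)]$ and $a\mapsto[b\mapsto\operatorname{tr}_0(ba)]$ identify ${}_0F_1^*={}_1F_0$ and ${}_1F_0^*={}_0F_1$, so $V^{i*}={}_0F_1$ for $i$ even, ${}_1F_0$ for $i$ odd. Choose $w_j\in F$ with $w_j^2\in\iota_j(K_j)$ and $w_j\notin\iota_0(K_0)\cup\iota_1(K_1)$. Then $g_i\in A_{i,i+2}$ is the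 image of $w_1\otimes1+1\otimes w_1\in F\otimes_{K_1}F$ for $i$ even and of $w_0\otimes1+1\otimes w_0\in F\otimes_{K_0}F$ for $i$ odd. (b) $V$ non-simple: one identifies $K_0=K_1=K$ and $V=K^2$ with usual left action and right action $v\cdot a=v\,\phi(a)$ (row vectors), with $\phi(a)=\begin{pmatrix}\sigma(a)&0\\0&\tau(a)\end{pmatrix}$, $\sigma,\tau\in\operatorname{Aut}K$, or $\phi(a)=\begin{pmatrix}\sigma(a)&\eta(a)\\0&\sigma(a)\end{pmatrix}$, $\sigma\in\operatorname{Aut}K$, $\eta$ a $(\sigma,\sigma)$-derivation. Put $x_0=(1,0)$, $y_0=(0,1)$ and let $\{x_{i+1},y_{i+1}\}\subset V^{(i+1)*}$ be the basis dual to $\{x_i,y_i\}\subset V^{i*}$ for all $i\in\mathbb{Z}$. Then $g_i\in A_{i,i+1}$ is $y_i$ for $i$ even and $x_i$ for $i$ odd. Twisted rings: for a field $E$ and automorphisms $\theta_i\in\operatorname{Aut}E$, $i\in\mathbb{Z}$, the full twisted ring $C(E;\theta)$ is the $\mathbb{Z}$-indexed algebra with $C_{ij}=E$ and multiplication $C_{ij}\times C_{jl}\to C_{il}$, $a\cdot b=a\,\theta_{i+1}\theta_{i+2}\cdots\theta_j(b)$ if $i\le j$ and $a\cdot b=a\,\theta_i^{-1}\theta_{i-1}^{-1}\cdots\theta_{j+1}^{-1}(b)$ if $i>j$. A twisted ring on $E$ is ($\mathbb{Z}$-indexed algebra isomorphic to) a subring $B$ of some $C=C(E;\theta)$ for which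 there is $d\in\mathbb{N}$ with $B_{ij}=C_{ij}$ whenever $j-i\ge d$. *)

theory Defs
  imports
    "HOL-Algebra.Free_Abelian_Groups"
    "HOL-Algebra.Embedded_Algebras"
    "HOL-Algebra.QuotRing"
    "Jordan_Normal_Form.Missing_VectorSpace"
begin

section \<open>Bimodules over two fields\<close>

text \<open>
  Both fields have their elements in one type \<open>'k\<close>. This costs no generality (two fields over
  different types embed in the sum type) and allows families indexed by the integers.
\<close>

record ('k, 'w) bimod = "('k, 'w) module" +
  rsmult :: "['w, 'k] \<Rightarrow> 'w" (infixl \<open>\<triangleleft>\<index>\<close> 70)

text \<open>The right scalar multiplication, written on the left (the scalars commute).\<close>

definition right_mod :: "('k, 'w) bimod \<Rightarrow> ('k, 'w) module" where
  "right_mod W = \<lparr>carrier = carrier W, monoid.mult = monoid.mult W, one = one W,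
     zero = zero W, add = add W, smult = (\<lambda>a v. v \<triangleleft>\<^bsub>W\<^esub> a)\<rparr>"

definition bimodule :: "'k ring \<Rightarrow> 'k ring \<Rightarrow> ('k, 'w) bimod \<Rightarrow> bool" where
  "bimodule L M W \<longleftrightarrow> vectorspace L W \<and> vectorspace M (right_mod W) \<and>
     (\<forall>a\<in>carrier L. \<forall>v\<in>carrier W. \<forall>b\<in>carrier M.
        (a \<odot>\<^bsub>W\<^esub> v) \<triangleleft>\<^bsub>W\<^esub> b = a \<odot>\<^bsub>W\<^esub> (v \<triangleleft>\<^bsub>W\<^esub> b))"

definition rank_two :: "'k ring \<Rightarrow> 'k ring \<Rightarrow> ('k, 'w) bimod \<Rightarrow> bool" where
  "rank_two L M W \<longleftrightarrow>
     vectorspace.fin_dim L W \<and> vectorspace.dim L W = 2 \<and>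
     vectorspace.fin_dim M (right_mod W) \<and> vectorspace.dim M (right_mod W) = 2"

definition bimod_iso ::
  "'k ring \<Rightarrow> 'k ring \<Rightarrow> ('k, 'u) bimod \<Rightarrow> ('k, 'w) bimod \<Rightarrow> ('u \<Rightarrow> 'w) \<Rightarrow> bool" where
  "bimod_iso L M U W f \<longleftrightarrow> bij_betw f (carrier U) (carrier W) \<and>
     (\<forall>u\<in>carrier U. \<forall>v\<in>carrier U. f (u \<oplus>\<^bsub>U\<^esub> v) = f u \<oplus>\<^bsub>W\<^esub> f v) \<and>
     (\<forall>a\<in>carrier L. \<forall>u\<in>carrier U. f (a \<odot>\<^bsub>U\<^esub> u) = a \<odot>\<^bsub>W\<^esub> f u) \<and>
     (\<forall>b\<in>carrier M. \<forall>u\<in>carrier U. f (u \<triangleleft>\<^bsub>U\<^esub> b) = f u \<triangleleft>\<^bsub>W\<^esub> b)"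

definition subbimodule :: "'k ring \<Rightarrow> 'k ring \<Rightarrow> 'w set \<Rightarrow> ('k, 'w) bimod \<Rightarrow> bool" where
  "subbimodule L M N W \<longleftrightarrow> submodule L N W \<and> submodule M N (right_mod W)"

definition simple_bimodule :: "'k ring \<Rightarrow> 'k ring \<Rightarrow> ('k, 'w) bimod \<Rightarrow> bool" where
  "simple_bimodule L M W \<longleftrightarrow> carrier W \<noteq> {\<zero>\<^bsub>W\<^esub>} \<and>
     (\<forall>N. subbimodule L M N W \<longrightarrow> N = {\<zero>\<^bsub>W\<^esub>} \<or> N = carrier W)"

text \<open>
  The duals of an \<open>L\<close>-\<open>M\<close>-bimodule \<open>W\<close>. Functionals are extended by \<open>undefined\<close> outside
  \<open>carrier W\<close>; the ring multiplication and unit of the record are junk, as for \<open>module\<close>.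
\<close>

definition right_dual :: "'k ring \<Rightarrow> ('k, 'w) bimod \<Rightarrow> ('k, 'w \<Rightarrow> 'k) bimod" where
  "right_dual M W =
    \<lparr>carrier = {\<psi> \<in> carrier W \<rightarrow>\<^sub>E carrier M.
        (\<forall>u\<in>carrier W. \<forall>v\<in>carrier W. \<psi> (u \<oplus>\<^bsub>W\<^esub> v) = \<psi> u \<oplus>\<^bsub>M\<^esub> \<psi> v) \<and>
        (\<forall>v\<in>carrier W. \<forall>b\<in>carrier M. \<psi> (v \<triangleleft>\<^bsub>W\<^esub> b) = \<psi> v \<otimes>\<^bsub>M\<^esub> b)},
     monoid.mult = undefined, one = undefined,
     zero = (\<lambda>v\<in>carrier W. \<zero>\<^bsub>M\<^esub>),
     add = (\<lambda>\<psi> \<chi>. \<lambda>v\<in>carrier W. \<psi> v \<oplus>\<^bsub>M\<^esub> \<chi> v),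
     smult = (\<lambda>a \<psi>. \<lambda>v\<in>carrier W. a \<otimes>\<^bsub>M\<^esub> \<psi> v),
     rsmult = (\<lambda>\<psi> b. \<lambda>v\<in>carrier W. \<psi> (b \<odot>\<^bsub>W\<^esub> v))\<rparr>"

definition left_dual :: "'k ring \<Rightarrow> ('k, 'w) bimod \<Rightarrow> ('k, 'w \<Rightarrow> 'k) bimod" where
  "left_dual L W =
    \<lparr>carrier = {\<phi> \<in> carrier W \<rightarrow>\<^sub>E carrier L.
        (\<forall>u\<in>carrier W. \<forall>v\<in>carrier W. \<phi> (u \<oplus>\<^bsub>W\<^esub> v) = \<phi> u \<oplus>\<^bsub>L\<^esub> \<phi> v) \<and>
        (\<forall>v\<in>carrier W. \<forall>a\<in>carrier L. \<phi> (a \<odot>\<^bsub>W\<^esub> v) = a \<otimes>\<^bsub>L\<^esub> \<phi> v)},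
     monoid.mult = undefined, one = undefined,
     zero = (\<lambda>v\<in>carrier W. \<zero>\<^bsub>L\<^esub>),
     add = (\<lambda>\<phi> \<chi>. \<lambda>v\<in>carrier W. \<phi> v \<oplus>\<^bsub>L\<^esub> \<chi> v),
     smult = (\<lambda>a \<phi>. \<lambda>v\<in>carrier W. \<phi> (v \<triangleleft>\<^bsub>W\<^esub> a)),
     rsmult = (\<lambda>\<phi> b. \<lambda>v\<in>carrier W. b \<otimes>\<^bsub>L\<^esub> \<phi> v)\<rparr>"

definition alt :: "'a \<Rightarrow> 'a \<Rightarrow> int \<Rightarrow> 'a" where
  "alt x0 x1 i = (if even i then x0 else x1)"

text \<open>
  The iterated duals \<open>W i\<close> of \<open>V\<close>. As the type of \<open>right_dual M V\<close> differs from that of \<open>V\<close>,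
  the family consists of bimodules over one type together with evaluation maps
  \<open>ev i \<psi> v\<close>, the value of \<open>\<psi> \<in> W (i + 1)\<close> at \<open>v \<in> W i\<close>, that identify
  \<open>W (i + 1)\<close> with the right dual of \<open>W i\<close> for \<open>i \<ge> 0\<close>, and \<open>W i\<close> with the left dual of
  \<open>W (i + 1)\<close> for \<open>i < 0\<close>. Every \<open>V\<close> of rank two has such a family over its own element type,
  because all iterated duals have the cardinality of \<open>V\<close>; it is unique up to unique isomorphism.
\<close>

definition iterated_duals ::
  "(int \<Rightarrow> 'k ring) \<Rightarrow> ('k, 'w) bimod \<Rightarrow> (int \<Rightarrow> ('k, 'w) bimod) \<Rightarrow>
   (int \<Rightarrow> 'w \<Rightarrow> 'w \<Rightarrow> 'k) \<Rightarrow> bool" where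
  "iterated_duals K V W ev \<longleftrightarrow> W 0 = V \<and>
     (\<forall>i. bimodule (K i) (K (i + 1)) (W i)) \<and>
     (\<forall>i\<ge>0. bimod_iso (K (i + 1)) (K (i + 2)) (W (i + 1)) (right_dual (K (i + 1)) (W i))
        (\<lambda>\<psi>. \<lambda>v\<in>carrier (W i). ev i \<psi> v)) \<and>
     (\<forall>i<0. bimod_iso (K i) (K (i + 1)) (W i) (left_dual (K (i + 1)) (W (i + 1)))
        (\<lambda>v. \<lambda>\<psi>\<in>carrier (W (i + 1)). ev i \<psi> v))"

section \<open>Algebras indexed by the integers\<close>

text \<open>The additive groups \<open>comp D i j\<close> are \<open>monoid\<close> records, hence written multiplicatively.\<close>

record 'd zring =
  comp :: "int \<Rightarrow> int \<Rightarrow> 'd monoid"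
  zmult :: "int \<Rightarrow> int \<Rightarrow> int \<Rightarrow> 'd \<Rightarrow> 'd \<Rightarrow> 'd"
  zone :: "int \<Rightarrow> 'd"

locale zalgebra =
  fixes D :: "'d zring"
  assumes comp_group: "comm_group (comp D i j)"
    and mult_closed: "\<lbrakk>x \<in> carrier (comp D i j); y \<in> carrier (comp D j l)\<rbrakk> \<Longrightarrow>
      zmult D i j l x y \<in> carrier (comp D i l)"
    and one_closed: "zone D i \<in> carrier (comp D i i)"
    and mult_add_left:
      "\<lbrakk>x \<in> carrier (comp D i j); x' \<in> carrier (comp D i j); y \<in> carrier (comp D j l)\<rbrakk> \<Longrightarrow>
      zmult D i j l (x \<otimes>\<^bsub>comp D i j\<^esub> x') y =
      zmult D i j l x y \<otimes>\<^bsub>comp D i l\<^esub> zmult D i j l x' y"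
    and mult_add_right:
      "\<lbrakk>x \<in> carrier (comp D i j); y \<in> carrier (comp D j l); y' \<in> carrier (comp D j l)\<rbrakk> \<Longrightarrow>
      zmult D i j l x (y \<otimes>\<^bsub>comp D j l\<^esub> y') =
      zmult D i j l x y \<otimes>\<^bsub>comp D i l\<^esub> zmult D i j l x y'"
    and mult_assoc:
      "\<lbrakk>x \<in> carrier (comp D i j); y \<in> carrier (comp D j l); z \<in> carrier (comp D l m)\<rbrakk> \<Longrightarrow>
      zmult D i l m (zmult D i j l x y) z = zmult D i j m x (zmult D j l m y z)"
    and one_left: "x \<in> carrier (comp D i j) \<Longrightarrow> zmult D i i j (zone D i) x = x"
    and one_right: "x \<in> carrier (comp D i j) \<Longrightarrow> zmult D i j j x (zone D j) = x"

definition zideal :: "'d zring \<Rightarrow> (int \<Rightarrow> int \<Rightarrow> 'd set) \<Rightarrow> bool" where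
  "zideal D J \<longleftrightarrow> (\<forall>i j. subgroup (J i j) (comp D i j)) \<and>
     (\<forall>i j l. \<forall>x\<in>J i j. \<forall>y\<in>carrier (comp D j l). zmult D i j l x y \<in> J i l) \<and>
     (\<forall>i j l. \<forall>x\<in>carrier (comp D i j). \<forall>y\<in>J j l. zmult D i j l x y \<in> J i l)"

definition zideal_gen ::
  "'d zring \<Rightarrow> (int \<Rightarrow> int \<Rightarrow> 'd set) \<Rightarrow> int \<Rightarrow> int \<Rightarrow> 'd set" where
  "zideal_gen D S i j = \<Inter>{J i j |J. zideal D J \<and> (\<forall>k l. S k l \<subseteq> J k l)}"

definition zproj :: "'d zring \<Rightarrow> (int \<Rightarrow> int \<Rightarrow> 'd set) \<Rightarrow> int \<Rightarrow> int \<Rightarrow> 'd \<Rightarrow> 'd set" where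
  "zproj D J i j x = J i j #>\<^bsub>comp D i j\<^esub> x"

text \<open>The union in the product is over equal cosets if \<open>J\<close> is an ideal (cf. \<open>rcoset_mult\<close>).\<close>

definition zquot :: "'d zring \<Rightarrow> (int \<Rightarrow> int \<Rightarrow> 'd set) \<Rightarrow> 'd set zring" where
  "zquot D J =
    \<lparr>comp = (\<lambda>i j. comp D i j Mod J i j),
     zmult = (\<lambda>i j l X Y. \<Union>x\<in>X. \<Union>y\<in>Y. zproj D J i l (zmult D i j l x y)),
     zone = (\<lambda>i. zproj D J i i (zone D i))\<rparr>"

definition zsubring :: "'d zring \<Rightarrow> (int \<Rightarrow> int \<Rightarrow> 'd set) \<Rightarrow> bool" where
  "zsubring D B \<longleftrightarrow> (\<forall>i j. subgroup (B i j) (comp D i j)) \<and>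
     (\<forall>i j l. \<forall>x\<in>B i j. \<forall>y\<in>B j l. zmult D i j l x y \<in> B i l) \<and>
     (\<forall>i. zone D i \<in> B i i)"

definition zrestrict :: "'d zring \<Rightarrow> (int \<Rightarrow> int \<Rightarrow> 'd set) \<Rightarrow> 'd zring" where
  "zrestrict D B = D\<lparr>comp := (\<lambda>i j. (comp D i j)\<lparr>carrier := B i j\<rparr>)\<rparr>"

definition zring_iso :: "'d zring \<Rightarrow> 'e zring \<Rightarrow> (int \<Rightarrow> int \<Rightarrow> 'd \<Rightarrow> 'e) \<Rightarrow> bool" where
  "zring_iso D E h \<longleftrightarrow> (\<forall>i j. h i j \<in> iso (comp D i j) (comp E i j)) \<and>
     (\<forall>i j l. \<forall>x\<in>carrier (comp D i j). \<forall>y\<in>carrier (comp D j l).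
        h i l (zmult D i j l x y) = zmult E i j l (h i j x) (h j l y)) \<and>
     (\<forall>i. h i i (zone D i) = zone E i)"

definition zop :: "'d zring \<Rightarrow> 'd zring" where
  "zop D = \<lparr>comp = (\<lambda>i j. comp D j i), zmult = (\<lambda>i j l x y. zmult D l j i y x), zone = zone D\<rparr>"

record ('d, 'm) zmod =
  mcomp :: "int \<Rightarrow> 'm monoid"
  mact :: "int \<Rightarrow> int \<Rightarrow> 'm \<Rightarrow> 'd \<Rightarrow> 'm"

locale right_zmodule = zalgebra D
  for D :: "'d zring" and M :: "('d, 'm) zmod" +
  assumes mcomp_group: "comm_group (mcomp M i)"
    and act_closed: "\<lbrakk>m \<in> carrier (mcomp M i); x \<in> carrier (comp D i j)\<rbrakk> \<Longrightarrow>
      mact M i j m x \<in> carrier (mcomp M j)"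
    and act_add_left:
      "\<lbrakk>m \<in> carrier (mcomp M i); m' \<in> carrier (mcomp M i); x \<in> carrier (comp D i j)\<rbrakk> \<Longrightarrow>
      mact M i j (m \<otimes>\<^bsub>mcomp M i\<^esub> m') x = mact M i j m x \<otimes>\<^bsub>mcomp M j\<^esub> mact M i j m' x"
    and act_add_right:
      "\<lbrakk>m \<in> carrier (mcomp M i); x \<in> carrier (comp D i j); x' \<in> carrier (comp D i j)\<rbrakk> \<Longrightarrow>
      mact M i j m (x \<otimes>\<^bsub>comp D i j\<^esub> x') = mact M i j m x \<otimes>\<^bsub>mcomp M j\<^esub> mact M i j m x'"
    and act_assoc:
      "\<lbrakk>m \<in> carrier (mcomp M i); x \<in> carrier (comp D i j); y \<in> carrier (comp D j l)\<rbrakk> \<Longrightarrow>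
      mact M j l (mact M i j m x) y = mact M i l m (zmult D i j l x y)"
    and act_one: "m \<in> carrier (mcomp M i) \<Longrightarrow> mact M i i m (zone D i) = m"

definition zsubmodule :: "'d zring \<Rightarrow> ('d, 'm) zmod \<Rightarrow> (int \<Rightarrow> 'm set) \<Rightarrow> bool" where
  "zsubmodule D M N \<longleftrightarrow> (\<forall>i. subgroup (N i) (mcomp M i)) \<and>
     (\<forall>i j. \<forall>m\<in>N i. \<forall>x\<in>carrier (comp D i j). mact M i j m x \<in> N j)"

definition noetherian_zmodule :: "'d zring \<Rightarrow> ('d, 'm) zmod \<Rightarrow> bool" where
  "noetherian_zmodule D M \<longleftrightarrow> right_zmodule D M \<and>
     (\<forall>N :: nat \<Rightarrow> int \<Rightarrow> 'm set.
        (\<forall>n. zsubmodule D M (N n)) \<and> (\<forall>n i. N n i \<subseteq> N (Suc n) i) \<longrightarrow>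
        (\<exists>n. \<forall>m\<ge>n. N m = N n))"

text \<open>The right module \<open>e\<^sub>i D\<close>; the left module \<open>D e\<^sub>i\<close> is \<open>e\<^sub>i\<close> times the opposite algebra.\<close>

definition principal_zmodule :: "'d zring \<Rightarrow> int \<Rightarrow> ('d, 'd) zmod" where
  "principal_zmodule D i = \<lparr>mcomp = comp D i, mact = zmult D i\<rparr>"

definition noetherian_zring :: "'d zring \<Rightarrow> bool" where
  "noetherian_zring D \<longleftrightarrow>
     (\<forall>i. noetherian_zmodule D (principal_zmodule D i)) \<and>
     (\<forall>i. noetherian_zmodule (zop D) (principal_zmodule (zop D) i))"

section \<open>Twisted rings\<close>

definition twist :: "'e ring \<Rightarrow> (int \<Rightarrow> 'e \<Rightarrow> 'e) \<Rightarrow> int \<Rightarrow> int \<Rightarrow> 'e \<Rightarrow> 'e" where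
  "twist E \<theta> i j =
     (if i \<le> j then foldr (\<lambda>k h. \<theta> k \<circ> h) [i + 1..j] id
      else foldr (\<lambda>k h. inv_into (carrier E) (\<theta> k) \<circ> h) (rev [j + 1..i]) id)"

definition full_twisted_ring :: "'e ring \<Rightarrow> (int \<Rightarrow> 'e \<Rightarrow> 'e) \<Rightarrow> 'e zring" where
  "full_twisted_ring E \<theta> =
    \<lparr>comp = (\<lambda>i j. add_monoid E),
     zmult = (\<lambda>i j l a b. a \<otimes>\<^bsub>E\<^esub> twist E \<theta> i j b),
     zone = (\<lambda>i. \<one>\<^bsub>E\<^esub>)\<rparr>"

definition twisted_ring_on :: "'e ring \<Rightarrow> 'd zring \<Rightarrow> bool" where
  "twisted_ring_on E D \<longleftrightarrow> field E \<and> zalgebra D \<and>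
     (\<exists>\<theta> B h. \<exists>d::nat. (\<forall>i. \<theta> i \<in> ring_iso E E) \<and>
        zsubring (full_twisted_ring E \<theta>) B \<and>
        (\<forall>i j. int d \<le> j - i \<longrightarrow> B i j = carrier E) \<and>
        zring_iso D (zrestrict (full_twisted_ring E \<theta>) B) h)"

section \<open>The non-commutative symmetric algebra\<close>

text \<open>
  A word \<open>(a, [v\<^sub>i, \<dots>, v\<^sub>j\<^sub>-\<^sub>1])\<close> stands for \<open>a v\<^sub>i \<otimes> \<dots> \<otimes> v\<^sub>j\<^sub>-\<^sub>1\<close>. The scalar makes the case
  \<open>i = j\<close>, where the tensor algebra is \<open>K i\<close>, uniform with the case \<open>i < j\<close>: the component is
  constructed as \<open>K i \<otimes> W i \<otimes> \<dots> \<otimes> W (j - 1)\<close>. There are no words if \<open>i > j\<close>.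
\<close>

definition words :: "(int \<Rightarrow> 'k ring) \<Rightarrow> (int \<Rightarrow> ('k, 'w) bimod) \<Rightarrow> int \<Rightarrow> int \<Rightarrow>
    ('k \<times> 'w list) set" where
  "words K W i j = {(a, vs). a \<in> carrier (K i) \<and> int (length vs) = j - i \<and>
     (\<forall>n<length vs. vs ! n \<in> carrier (W (i + int n)))}"

definition word_mult :: "(int \<Rightarrow> 'k ring) \<Rightarrow> (int \<Rightarrow> ('k, 'w) bimod) \<Rightarrow> int \<Rightarrow> int \<Rightarrow>
    'k \<times> 'w list \<Rightarrow> 'k \<times> 'w list \<Rightarrow> 'k \<times> 'w list" where
  "word_mult K W i j p q = (case p of (a, vs) \<Rightarrow> case q of (b, ws) \<Rightarrow>
     if vs = [] then (a \<otimes>\<^bsub>K i\<^esub> b, ws)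
     else (a, butlast vs @ (last vs \<triangleleft>\<^bsub>W (j - 1)\<^esub> b) # ws))"

definition word_algebra :: "(int \<Rightarrow> 'k ring) \<Rightarrow> (int \<Rightarrow> ('k, 'w) bimod) \<Rightarrow>
    ('k \<times> 'w list \<Rightarrow>\<^sub>0 int) zring" where
  "word_algebra K W =
    \<lparr>comp = (\<lambda>i j. free_Abelian_group (words K W i j)),
     zmult = (\<lambda>i j l x y.
       frag_extend (\<lambda>p. frag_extend (\<lambda>q. frag_of (word_mult K W i j p q)) y) x),
     zone = (\<lambda>i. frag_of (\<one>\<^bsub>K i\<^esub>, []))\<rparr>"

definition tensor_relators :: "(int \<Rightarrow> 'k ring) \<Rightarrow> (int \<Rightarrow> ('k, 'w) bimod) \<Rightarrow> int \<Rightarrow> int \<Rightarrow>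
    ('k \<times> 'w list \<Rightarrow>\<^sub>0 int) set" where
  "tensor_relators K W i j =
     {frag_of (a \<oplus>\<^bsub>K i\<^esub> b, vs) - frag_of (a, vs) - frag_of (b, vs) |a b vs.
        (a, vs) \<in> words K W i j \<and> (b, vs) \<in> words K W i j} \<union>
     {frag_of (a, us @ (v \<oplus>\<^bsub>W (i + int (length us))\<^esub> w) # vs) -
        frag_of (a, us @ v # vs) - frag_of (a, us @ w # vs) |a us v w vs.
        (a, us @ v # vs) \<in> words K W i j \<and> (a, us @ w # vs) \<in> words K W i j} \<union>
     {frag_of (a \<otimes>\<^bsub>K i\<^esub> b, v # vs) - frag_of (a, (b \<odot>\<^bsub>W i\<^esub> v) # vs) |a b v vs.
        (a, v # vs) \<in> words K W i j \<and> b \<in> carrier (K i)} \<union>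
     {frag_of (a, us @ (v \<triangleleft>\<^bsub>W (i + int (length us))\<^esub> b) # w # vs) -
        frag_of (a, us @ v # (b \<odot>\<^bsub>W (i + int (length us) + 1)\<^esub> w) # vs) |a us v b w vs.
        (a, us @ v # w # vs) \<in> words K W i j \<and> b \<in> carrier (K (i + int (length us) + 1))}"

definition tensor_ideal :: "(int \<Rightarrow> 'k ring) \<Rightarrow> (int \<Rightarrow> ('k, 'w) bimod) \<Rightarrow> int \<Rightarrow> int \<Rightarrow>
    ('k \<times> 'w list \<Rightarrow>\<^sub>0 int) set" where
  "tensor_ideal K W i j =
     generate (free_Abelian_group (words K W i j)) (tensor_relators K W i j)"

definition tensor_algebra :: "(int \<Rightarrow> 'k ring) \<Rightarrow> (int \<Rightarrow> ('k, 'w) bimod) \<Rightarrow>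
    ('k \<times> 'w list \<Rightarrow>\<^sub>0 int) set zring" where
  "tensor_algebra K W = zquot (word_algebra K W) (tensor_ideal K W)"

definition tensor :: "(int \<Rightarrow> 'k ring) \<Rightarrow> (int \<Rightarrow> ('k, 'w) bimod) \<Rightarrow> int \<Rightarrow> 'w list \<Rightarrow>
    ('k \<times> 'w list \<Rightarrow>\<^sub>0 int) set" where
  "tensor K W i vs =
     zproj (word_algebra K W) (tensor_ideal K W) i (i + int (length vs)) (frag_of (\<one>\<^bsub>K i\<^esub>, vs))"

text \<open>
  The tensor \<open>\<Sum> u\<^sub>s \<otimes> \<psi>\<^sub>s\<close> corresponds to the endomorphism \<open>v \<mapsto> \<Sum> u\<^sub>s \<psi>\<^sub>s(v)\<close> of \<open>W i\<close>;
  \<open>nc_relators\<close> collects the tensors whose endomorphism is left multiplication by a scalar.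
\<close>

definition nc_relators :: "(int \<Rightarrow> 'k ring) \<Rightarrow> (int \<Rightarrow> ('k, 'w) bimod) \<Rightarrow>
    (int \<Rightarrow> 'w \<Rightarrow> 'w \<Rightarrow> 'k) \<Rightarrow> int \<Rightarrow> ('k \<times> 'w list \<Rightarrow>\<^sub>0 int) set set" where
  "nc_relators K W ev i =
     {finprod (comp (tensor_algebra K W) i (i + 2)) (\<lambda>s. tensor K W i [u s, \<psi> s]) {..<n}
       |(n::nat) u \<psi>.
       (\<forall>s<n. u s \<in> carrier (W i) \<and> \<psi> s \<in> carrier (W (i + 1))) \<and>
       (\<exists>a\<in>carrier (K i). \<forall>v\<in>carrier (W i).
          (\<Oplus>\<^bsub>W i\<^esub>s\<in>{..<n}. u s \<triangleleft>\<^bsub>W i\<^esub> ev i (\<psi> s) v) = a \<odot>\<^bsub>W i\<^esub> v)}"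

definition nc_ideal :: "(int \<Rightarrow> 'k ring) \<Rightarrow> (int \<Rightarrow> ('k, 'w) bimod) \<Rightarrow>
    (int \<Rightarrow> 'w \<Rightarrow> 'w \<Rightarrow> 'k) \<Rightarrow> int \<Rightarrow> int \<Rightarrow> ('k \<times> 'w list \<Rightarrow>\<^sub>0 int) set set" where
  "nc_ideal K W ev = zideal_gen (tensor_algebra K W)
     (\<lambda>i j. if j = i + 2 then nc_relators K W ev i else {})"

definition nc_symmetric_algebra :: "(int \<Rightarrow> 'k ring) \<Rightarrow> (int \<Rightarrow> ('k, 'w) bimod) \<Rightarrow>
    (int \<Rightarrow> 'w \<Rightarrow> 'w \<Rightarrow> 'k) \<Rightarrow> ('k \<times> 'w list \<Rightarrow>\<^sub>0 int) set set zring" where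
  "nc_symmetric_algebra K W ev = zquot (tensor_algebra K W) (nc_ideal K W ev)"

definition nc_tensor :: "(int \<Rightarrow> 'k ring) \<Rightarrow> (int \<Rightarrow> ('k, 'w) bimod) \<Rightarrow>
    (int \<Rightarrow> 'w \<Rightarrow> 'w \<Rightarrow> 'k) \<Rightarrow> int \<Rightarrow> 'w list \<Rightarrow> ('k \<times> 'w list \<Rightarrow>\<^sub>0 int) set set" where
  "nc_tensor K W ev i vs =
     zproj (tensor_algebra K W) (nc_ideal K W ev) i (i + int (length vs)) (tensor K W i vs)"

section \<open>The normal family for simple bimodules\<close>

definition field_bimod :: "'f ring \<Rightarrow> ('k \<Rightarrow> 'f) \<Rightarrow> ('k \<Rightarrow> 'f) \<Rightarrow> ('k, 'f) bimod" where
  "field_bimod F \<alpha> \<beta> = \<lparr>carrier = carrier F, monoid.mult = monoid.mult F, one = one F,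
     zero = zero F, add = add F,
     smult = (\<lambda>a v. \<alpha> a \<otimes>\<^bsub>F\<^esub> v), rsmult = (\<lambda>v b. v \<otimes>\<^bsub>F\<^esub> \<beta> b)\<rparr>"

definition gal :: "'f ring \<Rightarrow> 'f set \<Rightarrow> ('f \<Rightarrow> 'f) set" where
  "gal F L = {s \<in> ring_iso F F. \<forall>x\<in>L. s x = x}"

definition gal_generator :: "'f ring \<Rightarrow> 'f set \<Rightarrow> ('f \<Rightarrow> 'f) \<Rightarrow> bool" where
  "gal_generator F L s \<longleftrightarrow> s \<in> gal F L \<and>
     (\<forall>t\<in>gal F L. \<exists>n. \<forall>x\<in>carrier F. t x = (s ^^ n) x)"

definition half_trace :: "'k ring \<Rightarrow> 'f ring \<Rightarrow> ('k \<Rightarrow> 'f) \<Rightarrow> ('f \<Rightarrow> 'f) \<Rightarrow> 'f \<Rightarrow> 'k" where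
  "half_trace k F \<iota> s a = inv_into (carrier k) \<iota>
     (inv\<^bsub>F\<^esub> (\<one>\<^bsub>F\<^esub> \<oplus>\<^bsub>F\<^esub> \<one>\<^bsub>F\<^esub>) \<otimes>\<^bsub>F\<^esub> (a \<oplus>\<^bsub>F\<^esub> s a))"

text \<open>
  The isomorphism \<open>f 0\<close> from \<open>V\<close> to \<open>F\<close>, propagated to all iterated duals by the trace pairings.
  The families \<open>\<iota>\<close> and \<open>\<sigma>\<close> are alternating, as \<open>K\<close>.
\<close>

definition simple_presentation :: "(int \<Rightarrow> 'k ring) \<Rightarrow> (int \<Rightarrow> ('k, 'w) bimod) \<Rightarrow>
    (int \<Rightarrow> 'w \<Rightarrow> 'w \<Rightarrow> 'k) \<Rightarrow> 'f ring \<Rightarrow> (int \<Rightarrow> 'k \<Rightarrow> 'f) \<Rightarrow> (int \<Rightarrow> 'f \<Rightarrow> 'f) \<Rightarrow>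
    (int \<Rightarrow> 'w \<Rightarrow> 'f) \<Rightarrow> bool" where
  "simple_presentation K W ev F \<iota> \<sigma> f \<longleftrightarrow> field F \<and>
     (\<forall>i. \<iota> i \<in> ring_hom (K i) F) \<and>
     (\<forall>i. ring.dimension F 2 (\<iota> i ` carrier (K i)) (carrier F)) \<and>
     (\<forall>i. gal_generator F (\<iota> i ` carrier (K i)) (\<sigma> i)) \<and>
     (\<forall>i. bimod_iso (K i) (K (i + 1)) (W i) (field_bimod F (\<iota> i) (\<iota> (i + 1))) (f i)) \<and>
     (\<forall>i. \<forall>\<psi>\<in>carrier (W (i + 1)). \<forall>v\<in>carrier (W i).
        ev i \<psi> v = half_trace (K (i + 1)) F (\<iota> (i + 1)) (\<sigma> (i + 1)) (f i v \<otimes>\<^bsub>F\<^esub> f (i + 1) \<psi>))"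

definition admissible_roots :: "(int \<Rightarrow> 'k ring) \<Rightarrow> 'f ring \<Rightarrow> (int \<Rightarrow> 'k \<Rightarrow> 'f) \<Rightarrow>
    (int \<Rightarrow> 'f) \<Rightarrow> bool" where
  "admissible_roots K F \<iota> w \<longleftrightarrow> (\<forall>i. w i \<in> carrier F \<and>
     w i \<otimes>\<^bsub>F\<^esub> w i \<in> \<iota> i ` carrier (K i) \<and>
     w i \<notin> \<iota> 0 ` carrier (K 0) \<union> \<iota> 1 ` carrier (K 1))"

definition simple_g :: "(int \<Rightarrow> 'k ring) \<Rightarrow> (int \<Rightarrow> ('k, 'w) bimod) \<Rightarrow>
    (int \<Rightarrow> 'w \<Rightarrow> 'w \<Rightarrow> 'k) \<Rightarrow> 'f ring \<Rightarrow> (int \<Rightarrow> 'w \<Rightarrow> 'f) \<Rightarrow> (int \<Rightarrow> 'f) \<Rightarrow> int \<Rightarrow>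
    ('k \<times> 'w list \<Rightarrow>\<^sub>0 int) set set" where
  "simple_g K W ev F f w i =
     (let r = (\<lambda>j. inv_into (carrier (W j)) (f j)) in
      nc_tensor K W ev i [r i (w (i + 1)), r (i + 1) \<one>\<^bsub>F\<^esub>]
      \<otimes>\<^bsub>comp (nc_symmetric_algebra K W ev) i (i + 2)\<^esub>
      nc_tensor K W ev i [r i \<one>\<^bsub>F\<^esub>, r (i + 1) (w (i + 1))])"

definition simple_ideal :: "(int \<Rightarrow> 'k ring) \<Rightarrow> (int \<Rightarrow> ('k, 'w) bimod) \<Rightarrow>
    (int \<Rightarrow> 'w \<Rightarrow> 'w \<Rightarrow> 'k) \<Rightarrow> 'f ring \<Rightarrow> (int \<Rightarrow> 'w \<Rightarrow> 'f) \<Rightarrow> (int \<Rightarrow> 'f) \<Rightarrow> int \<Rightarrow> int \<Rightarrow>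
    ('k \<times> 'w list \<Rightarrow>\<^sub>0 int) set set set" where
  "simple_ideal K W ev F f w = zideal_gen (nc_symmetric_algebra K W ev)
     (\<lambda>i j. if j = i + 2 then {simple_g K W ev F f w i} else {})"

section \<open>The normal family for non-simple bimodules\<close>

definition is_derivation :: "'e ring \<Rightarrow> ('e \<Rightarrow> 'e) \<Rightarrow> ('e \<Rightarrow> 'e) \<Rightarrow> bool" where
  "is_derivation E \<sigma> \<eta> \<longleftrightarrow> \<eta> \<in> carrier E \<rightarrow> carrier E \<and>
     (\<forall>a\<in>carrier E. \<forall>b\<in>carrier E. \<eta> (a \<oplus>\<^bsub>E\<^esub> b) = \<eta> a \<oplus>\<^bsub>E\<^esub> \<eta> b \<and>
        \<eta> (a \<otimes>\<^bsub>E\<^esub> b) = \<sigma> a \<otimes>\<^bsub>E\<^esub> \<eta> b \<oplus>\<^bsub>E\<^esub> \<eta> a \<otimes>\<^bsub>E\<^esub> \<sigma> b)"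

text \<open>
  Row vectors \<open>(p, q)\<close> over \<open>E\<close>, on which \<open>\<kappa>1 b\<close> acts from the right by the matrix with rows
  \<open>(\<sigma>, \<eta>)\<close> and \<open>(0, \<tau>)\<close>. The isomorphisms \<open>\<kappa>0\<close> and \<open>\<kappa>1\<close> identify the two given fields with \<open>E\<close>.
\<close>

definition plane_bimod :: "'e ring \<Rightarrow> ('k \<Rightarrow> 'e) \<Rightarrow> ('k \<Rightarrow> 'e) \<Rightarrow> ('e \<Rightarrow> 'e) \<Rightarrow> ('e \<Rightarrow> 'e) \<Rightarrow>
    ('e \<Rightarrow> 'e) \<Rightarrow> ('k, 'e \<times> 'e) bimod" where
  "plane_bimod E \<kappa>0 \<kappa>1 \<sigma> \<eta> \<tau> =
    \<lparr>carrier = carrier E \<times> carrier E, monoid.mult = undefined, one = undefined,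
     zero = (\<zero>\<^bsub>E\<^esub>, \<zero>\<^bsub>E\<^esub>),
     add = (\<lambda>(p, q) (p', q'). (p \<oplus>\<^bsub>E\<^esub> p', q \<oplus>\<^bsub>E\<^esub> q')),
     smult = (\<lambda>a (p, q). (\<kappa>0 a \<otimes>\<^bsub>E\<^esub> p, \<kappa>0 a \<otimes>\<^bsub>E\<^esub> q)),
     rsmult = (\<lambda>(p, q) b. (p \<otimes>\<^bsub>E\<^esub> \<sigma> (\<kappa>1 b), p \<otimes>\<^bsub>E\<^esub> \<eta> (\<kappa>1 b) \<oplus>\<^bsub>E\<^esub> q \<otimes>\<^bsub>E\<^esub> \<tau> (\<kappa>1 b)))\<rparr>"

definition nonsimple_presentation :: "'k ring \<Rightarrow> 'k ring \<Rightarrow> ('k, 'w) bimod \<Rightarrow> 'e ring \<Rightarrow>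
    ('k \<Rightarrow> 'e) \<Rightarrow> ('k \<Rightarrow> 'e) \<Rightarrow> ('e \<Rightarrow> 'e) \<Rightarrow> ('e \<Rightarrow> 'e) \<Rightarrow> ('e \<Rightarrow> 'e) \<Rightarrow> ('w \<Rightarrow> 'e \<times> 'e) \<Rightarrow>
    bool" where
  "nonsimple_presentation K0 K1 V E \<kappa>0 \<kappa>1 \<sigma> \<eta> \<tau> f \<longleftrightarrow> field E \<and>
     \<kappa>0 \<in> ring_iso K0 E \<and> \<kappa>1 \<in> ring_iso K1 E \<and> \<sigma> \<in> ring_iso E E \<and> \<tau> \<in> ring_iso E E \<and>
     ((\<forall>a\<in>carrier E. \<eta> a = \<zero>\<^bsub>E\<^esub>) \<or>
      (\<forall>a\<in>carrier E. \<tau> a = \<sigma> a) \<and> is_derivation E \<sigma> \<eta>) \<and>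
     bimod_iso K0 K1 V (plane_bimod E \<kappa>0 \<kappa>1 \<sigma> \<eta> \<tau>) f"

text \<open>
  Since the bimodules have rank two, the orthogonality relations alone force \<open>x i\<close>, \<open>y i\<close> and
  \<open>x (i + 1)\<close>, \<open>y (i + 1)\<close> to be dual bases.
\<close>

definition dual_bases :: "(int \<Rightarrow> 'k ring) \<Rightarrow> (int \<Rightarrow> ('k, 'w) bimod) \<Rightarrow>
    (int \<Rightarrow> 'w \<Rightarrow> 'w \<Rightarrow> 'k) \<Rightarrow> (int \<Rightarrow> 'w) \<Rightarrow> (int \<Rightarrow> 'w) \<Rightarrow> bool" where
  "dual_bases K W ev x y \<longleftrightarrow>
     (\<forall>i. x i \<in> carrier (W i) \<and> y i \<in> carrier (W i) \<and>
        ev i (x (i + 1)) (x i) = \<one>\<^bsub>K (i + 1)\<^esub> \<and> ev i (x (i + 1)) (y i) = \<zero>\<^bsub>K (i + 1)\<^esub> \<and>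
        ev i (y (i + 1)) (x i) = \<zero>\<^bsub>K (i + 1)\<^esub> \<and> ev i (y (i + 1)) (y i) = \<one>\<^bsub>K (i + 1)\<^esub>)"

definition nonsimple_g :: "(int \<Rightarrow> 'k ring) \<Rightarrow> (int \<Rightarrow> ('k, 'w) bimod) \<Rightarrow>
    (int \<Rightarrow> 'w \<Rightarrow> 'w \<Rightarrow> 'k) \<Rightarrow> (int \<Rightarrow> 'w) \<Rightarrow> (int \<Rightarrow> 'w) \<Rightarrow> int \<Rightarrow>
    ('k \<times> 'w list \<Rightarrow>\<^sub>0 int) set set" where
  "nonsimple_g K W ev x y i = nc_tensor K W ev i [if even i then y i else x i]"

definition nonsimple_ideal :: "(int \<Rightarrow> 'k ring) \<Rightarrow> (int \<Rightarrow> ('k, 'w) bimod) \<Rightarrow>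
    (int \<Rightarrow> 'w \<Rightarrow> 'w \<Rightarrow> 'k) \<Rightarrow> (int \<Rightarrow> 'w) \<Rightarrow> (int \<Rightarrow> 'w) \<Rightarrow> int \<Rightarrow> int \<Rightarrow>
    ('k \<times> 'w list \<Rightarrow>\<^sub>0 int) set set set" where
  "nonsimple_ideal K W ev x y = zideal_gen (nc_symmetric_algebra K W ev)
     (\<lambda>i j. if j = i + 1 then {nonsimple_g K W ev x y i} else {})"

end

(*
  Noetherianity. Let G_l = A_{il} for fixed i. The universal property of A, applied to the
  endomorphism algebra of a module built by hand, shows that the complex
  G_l -> G_{l+1} (x) V^{(l+1)*} -> G_{l+2} -> 0 is exact in the middle. Measure subspaces by the
  lengths of their chains. Exactness makes the ranks of a graded submodule N convex in the
  degree, while rk G_{l+2} <= 2 rk G_{l+1} - rk G_l; so the increments of the ranks of a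
  saturated N are integers that increase and stay bounded by 1. Hence they are eventually
  constant, which bounds the degrees of generators and yields the ascending chain condition.
  Reading all indices backwards exchanges left and right modules.

  Twisted rings. If V is simple, the identifications of V^{i*} with F extend to a homomorphism
  from A to C(F; sigma), because sigma(w) = -w gives 1 + w^{-1} sigma(w) = 0, and it kills
  w (x) 1 + 1 (x) w. Modulo I one has v (x) u = v sigma(u) (x) 1, so every element of degree at
  least 2 is congruent to p (x) 1, and the kernel is I by induction on the degree. If V is not
  simple, K_i g_i = g_i K_{i+1} for every i; the coefficient at the basis vector z_i different
  from g_i defines a homomorphism from A to a full twisted ring, and every element of positive
  degree is congruent to some p z_i modulo I.
*)

theory Submission
  imports Defs
begin

section \<open>Algebras indexed by the integers: homomorphisms, generated ideals, quotients\<close>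

section \<open>Homomorphisms, ideals and quotients\<close>

text \<open>The bound rk G_{l+2} <= 2 rk G_{l+1} - rk G_l also needs the first map of the complex to
  be injective, that is, no nonzero q in G_l may be annihilated by V^{l*}. The universal property
  yields exactness only in the middle. Injectivity is drawn from convexity: the elements that
  repeated multiplication brings to zero would form spaces whose ranks grow with every step down in
  degree, although A_{il} = 0 for l < i. No basis and no normal form of A enters, and noetherianity
  is proved without the family g and without the distinction between simple and non-simple V. A
  second obstacle is sidedness. G (x) W is formed with a left basis of W but measured as a right
  space, so every iterated dual must have rank two on both sides. One of the two ranks passes to a
  dual through dual bases; the other is obtained from an invariant nondegenerate form on the
  bimodule. In the quotients, membership in I is decided by degree: the target C(E; theta) has no
  zero divisors, so a product with a factor of nonzero image lies in the kernel only if its other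
  factor, of lower degree, does.\<close>

definition zhom :: "'d zring \<Rightarrow> 'e zring \<Rightarrow> (int \<Rightarrow> int \<Rightarrow> 'd \<Rightarrow> 'e) \<Rightarrow> bool" where
  "zhom D E h \<longleftrightarrow> (\<forall>i j. h i j \<in> hom (comp D i j) (comp E i j)) \<and>
     (\<forall>i j l. \<forall>x\<in>carrier (comp D i j). \<forall>y\<in>carrier (comp D j l).
        h i l (zmult D i j l x y) = zmult E i j l (h i j x) (h j l y)) \<and>
     (\<forall>i. h i i (zone D i) = zone E i)"

lemma zhomD:
  assumes "zhom D E h"
  shows "h i j \<in> hom (comp D i j) (comp E i j)"
    and "x \<in> carrier (comp D i j) \<Longrightarrow> h i j x \<in> carrier (comp E i j)"
    and "\<lbrakk>x \<in> carrier (comp D i j); y \<in> carrier (comp D i j)\<rbrakk> \<Longrightarrow>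
      h i j (x \<otimes>\<^bsub>comp D i j\<^esub> y) = h i j x \<otimes>\<^bsub>comp E i j\<^esub> h i j y"
    and "\<lbrakk>x \<in> carrier (comp D i j); y \<in> carrier (comp D j l)\<rbrakk> \<Longrightarrow>
      h i l (zmult D i j l x y) = zmult E i j l (h i j x) (h j l y)"
    and "h i i (zone D i) = zone E i"
  using assms unfolding zhom_def hom_def by blast+

lemma zhom_compose:
  assumes g: "zhom D E g" and h: "zhom E F h"
  shows "zhom D F (\<lambda>i j x. h i j (g i j x))"
  unfolding zhom_def
proof (intro conjI allI ballI)
  show "(\<lambda>x. h i j (g i j x)) \<in> hom (comp D i j) (comp F i j)" for i j
    using hom_compose[OF zhomD(1)[OF g, of i j] zhomD(1)[OF h, of i j]] by (simp add: o_def)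
qed (simp_all add: zhomD[OF g] zhomD[OF h])

context zalgebra
begin

sublocale comp: comm_group "comp D i j" for i j
  by (rule comp_group)

lemma mult_left_hom:
  "y \<in> carrier (comp D j l) \<Longrightarrow> (\<lambda>x. zmult D i j l x y) \<in> hom (comp D i j) (comp D i l)"
  by (simp add: hom_def mult_closed mult_add_left)

lemma mult_right_hom:
  "x \<in> carrier (comp D i j) \<Longrightarrow> zmult D i j l x \<in> hom (comp D j l) (comp D i l)"
  by (simp add: hom_def mult_closed mult_add_right)

lemma mult_zero_left [simp]:
  assumes "y \<in> carrier (comp D j l)"
  shows "zmult D i j l \<one>\<^bsub>comp D i j\<^esub> y = \<one>\<^bsub>comp D i l\<^esub>"
  using hom_one[OF mult_left_hom[OF assms]] comp.group_axioms by auto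

lemma mult_zero_right [simp]:
  assumes "x \<in> carrier (comp D i j)"
  shows "zmult D i j l x \<one>\<^bsub>comp D j l\<^esub> = \<one>\<^bsub>comp D i l\<^esub>"
  using hom_one[OF mult_right_hom[OF assms]] comp.group_axioms by auto

lemma mult_inv_left:
  assumes "x \<in> carrier (comp D i j)" "y \<in> carrier (comp D j l)"
  shows "zmult D i j l (inv\<^bsub>comp D i j\<^esub> x) y = inv\<^bsub>comp D i l\<^esub> (zmult D i j l x y)"
  using group_hom.hom_inv[of "comp D i j" "comp D i l" "\<lambda>x. zmult D i j l x y"]
    mult_left_hom assms comp.group_axioms unfolding group_hom_def group_hom_axioms_def by blast

lemma mult_inv_right:
  assumes "x \<in> carrier (comp D i j)" "y \<in> carrier (comp D j l)"
  shows "zmult D i j l x (inv\<^bsub>comp D j l\<^esub> y) = inv\<^bsub>comp D i l\<^esub> (zmult D i j l x y)"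
  using group_hom.hom_inv[of "comp D j l" "comp D i l" "zmult D i j l x"]
    mult_right_hom assms comp.group_axioms unfolding group_hom_def group_hom_axioms_def by blast

end

lemma zhom_one_inv:
  assumes "zalgebra D" "zalgebra E" "zhom D E h"
  shows "h i j \<one>\<^bsub>comp D i j\<^esub> = \<one>\<^bsub>comp E i j\<^esub>"
    and "x \<in> carrier (comp D i j) \<Longrightarrow> h i j (inv\<^bsub>comp D i j\<^esub> x) = inv\<^bsub>comp E i j\<^esub> h i j x"
proof -
  interpret D: zalgebra D by fact
  interpret E: zalgebra E by fact
  interpret group_hom "comp D i j" "comp E i j" "h i j"
    using zhomD(1)[OF assms(3)] by unfold_locales
  show "h i j \<one>\<^bsub>comp D i j\<^esub> = \<one>\<^bsub>comp E i j\<^esub>" by (rule hom_one)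
  show "x \<in> carrier (comp D i j) \<Longrightarrow> h i j (inv\<^bsub>comp D i j\<^esub> x) = inv\<^bsub>comp E i j\<^esub> h i j x"
    by (rule hom_inv)
qed

lemma zidealD:
  assumes "zideal D J"
  shows "subgroup (J i j) (comp D i j)"
    and "x \<in> J i j \<Longrightarrow> x \<in> carrier (comp D i j)"
    and "\<lbrakk>x \<in> J i j; y \<in> carrier (comp D j l)\<rbrakk> \<Longrightarrow> zmult D i j l x y \<in> J i l"
    and "\<lbrakk>x \<in> carrier (comp D i j); y \<in> J j l\<rbrakk> \<Longrightarrow> zmult D i j l x y \<in> J i l"
  using assms unfolding zideal_def by (blast dest: subgroup.mem_carrier)+

locale zquotient = zalgebra D for D :: "'d zring" +
  fixes J
  assumes ideal: "zideal D J"
begin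

lemma J_sub: "subgroup (J i j) (comp D i j)" by (rule zidealD(1)[OF ideal])

lemma J_normal: "J i j \<lhd> comp D i j"
  using J_sub comp.normal_iff_subgroup by blast

lemma proj_eq_iff:
  assumes "x \<in> carrier (comp D i j)" "y \<in> carrier (comp D i j)"
  shows "zproj D J i j x = zproj D J i j y \<longleftrightarrow> x \<otimes>\<^bsub>comp D i j\<^esub> inv\<^bsub>comp D i j\<^esub> y \<in> J i j"
  using comp.repr_independence[OF _ assms(2) J_sub] comp.rcos_self[OF assms(1) J_sub]
    subgroup.rcos_module[OF J_sub comp.group_axioms assms(2,1)]
  unfolding zproj_def by auto

lemma carrier_quot: "carrier (comp (zquot D J) i j) = zproj D J i j ` carrier (comp D i j)"
  by (auto simp: zquot_def FactGroup_def RCOSETS_def zproj_def)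

lemma proj_in [simp]: "x \<in> carrier (comp D i j) \<Longrightarrow> zproj D J i j x \<in> carrier (comp (zquot D J) i j)"
  by (simp add: carrier_quot)

lemma quot_elem:
  assumes "X \<in> carrier (comp (zquot D J) i j)"
  obtains x where "x \<in> carrier (comp D i j)" "X = zproj D J i j x"
  using assms unfolding carrier_quot by blast

lemma proj_add:
  assumes "x \<in> carrier (comp D i j)" "y \<in> carrier (comp D i j)"
  shows "zproj D J i j (x \<otimes>\<^bsub>comp D i j\<^esub> y) = zproj D J i j x \<otimes>\<^bsub>comp (zquot D J) i j\<^esub> zproj D J i j y"
  using normal.rcos_sum[OF J_normal assms] by (simp add: zproj_def zquot_def FactGroup_def)

lemma quot_one: "\<one>\<^bsub>comp (zquot D J) i j\<^esub> = J i j"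
  by (simp add: zquot_def FactGroup_def)

lemma proj_zero_iff:
  assumes "x \<in> carrier (comp D i j)"
  shows "zproj D J i j x = \<one>\<^bsub>comp (zquot D J) i j\<^esub> \<longleftrightarrow> x \<in> J i j"
  using comp.coset_join1 comp.coset_join2 J_sub assms unfolding quot_one zproj_def by metis

lemma proj_mult:
  assumes "x \<in> carrier (comp D i j)" "y \<in> carrier (comp D j l)"
  shows "zmult (zquot D J) i j l (zproj D J i j x) (zproj D J j l y) = zproj D J i l (zmult D i j l x y)"
proof -
  have eq: "zproj D J i l (zmult D i j l x' y') = zproj D J i l (zmult D i j l x y)"
    if x': "x' \<in> zproj D J i j x" and y': "y' \<in> zproj D J j l y" for x' y'
  proof -
    obtain a where a: "a \<in> J i j" "x' = a \<otimes>\<^bsub>comp D i j\<^esub> x"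
      using x' by (auto simp: zproj_def r_coset_def)
    obtain b where b: "b \<in> J j l" "y' = b \<otimes>\<^bsub>comp D j l\<^esub> y"
      using y' by (auto simp: zproj_def r_coset_def)
    note c = assms zidealD(2)[OF ideal a(1)] zidealD(2)[OF ideal b(1)]
    let ?m = "zmult D i j l"
    have "?m x' y' = (?m a b \<otimes>\<^bsub>comp D i l\<^esub> ?m a y \<otimes>\<^bsub>comp D i l\<^esub> ?m x b) \<otimes>\<^bsub>comp D i l\<^esub> ?m x y"
      using c by (simp add: a(2) b(2) mult_add_left mult_add_right mult_closed comp.m_ac)
    moreover have "?m a b \<otimes>\<^bsub>comp D i l\<^esub> ?m a y \<otimes>\<^bsub>comp D i l\<^esub> ?m x b \<in> J i l"
      using c zidealD(3,4)[OF ideal] a(1) b(1) J_sub by (meson subgroup.m_closed)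
    ultimately have "?m x' y' \<in> zproj D J i l (?m x y)"
      by (auto simp: zproj_def r_coset_def)
    then show ?thesis
      using comp.repr_independence J_sub mult_closed[OF assms] unfolding zproj_def by metis
  qed
  have "x \<in> zproj D J i j x" "y \<in> zproj D J j l y"
    using comp.rcos_self J_sub assms by (auto simp: zproj_def)
  moreover have "(\<Union>x'\<in>zproj D J i j x. \<Union>y'\<in>zproj D J j l y. zproj D J i l (zmult D i j l x' y')) =
      (\<Union>x'\<in>zproj D J i j x. \<Union>y'\<in>zproj D J j l y. zproj D J i l (zmult D i j l x y))"
    by (intro SUP_cong refl eq)
  ultimately show ?thesis by (auto simp: zquot_def)
qed

lemma quot_zone: "zone (zquot D J) i = zproj D J i i (zone D i)"
  by (simp add: zquot_def)

lemma zalgebra_quot: "zalgebra (zquot D J)"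
proof -
  note [elim!] = quot_elem
  note [simp] = proj_mult mult_closed proj_add[symmetric] one_closed quot_zone
  show ?thesis
  proof (rule zalgebra.intro)
    show "comm_group (comp (zquot D J) i j)" for i j
      using comp.abelian_FactGroup[OF J_sub] by (simp add: zquot_def)
  next
    fix i j l X Y assume "X \<in> carrier (comp (zquot D J) i j)" "Y \<in> carrier (comp (zquot D J) j l)"
    then show "zmult (zquot D J) i j l X Y \<in> carrier (comp (zquot D J) i l)"
      by clarsimp
  next
    fix i show "zone (zquot D J) i \<in> carrier (comp (zquot D J) i i)" by simp
  next
    fix i j l X X' Y
    assume "X \<in> carrier (comp (zquot D J) i j)" "X' \<in> carrier (comp (zquot D J) i j)"
      "Y \<in> carrier (comp (zquot D J) j l)"
    then show "zmult (zquot D J) i j l (X \<otimes>\<^bsub>comp (zquot D J) i j\<^esub> X') Y =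
      zmult (zquot D J) i j l X Y \<otimes>\<^bsub>comp (zquot D J) i l\<^esub> zmult (zquot D J) i j l X' Y"
      by (clarsimp simp: mult_add_left)
  next
    fix i j l X Y Y'
    assume "X \<in> carrier (comp (zquot D J) i j)" "Y \<in> carrier (comp (zquot D J) j l)"
      "Y' \<in> carrier (comp (zquot D J) j l)"
    then show "zmult (zquot D J) i j l X (Y \<otimes>\<^bsub>comp (zquot D J) j l\<^esub> Y') =
      zmult (zquot D J) i j l X Y \<otimes>\<^bsub>comp (zquot D J) i l\<^esub> zmult (zquot D J) i j l X Y'"
      by (clarsimp simp: mult_add_right)
  next
    fix i j l m X Y Z
    assume "X \<in> carrier (comp (zquot D J) i j)" "Y \<in> carrier (comp (zquot D J) j l)"
      "Z \<in> carrier (comp (zquot D J) l m)"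
    then show "zmult (zquot D J) i l m (zmult (zquot D J) i j l X Y) Z =
      zmult (zquot D J) i j m X (zmult (zquot D J) j l m Y Z)"
      by (clarsimp simp: mult_assoc)
  next
    fix i j X assume "X \<in> carrier (comp (zquot D J) i j)"
    then show "zmult (zquot D J) i i j (zone (zquot D J) i) X = X"
      and "zmult (zquot D J) i j j X (zone (zquot D J) j) = X"
      by (clarsimp simp: one_left one_right)+
  qed
qed

lemma zhom_proj: "zhom D (zquot D J) (zproj D J)"
  by (simp add: zhom_def hom_def proj_add proj_mult quot_zone)

text \<open>Universal property of the quotient. It is stated as an existence because the induced map
  is given by arbitrary representatives and is controlled only through its values on
  classes.\<close>

lemma lift:
  assumes E: "zalgebra E" and h: "zhom D E h"
    and ker: "\<And>i j x. x \<in> J i j \<Longrightarrow> h i j x = \<one>\<^bsub>comp E i j\<^esub>"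
  obtains h' where "zhom (zquot D J) E h'"
    and "\<And>i j x. x \<in> carrier (comp D i j) \<Longrightarrow> h' i j (zproj D J i j x) = h i j x"
proof -
  interpret E: zalgebra E by fact
  define h' where "h' i j X = h i j (SOME x. x \<in> carrier (comp D i j) \<and> zproj D J i j x = X)" for i j X
  have eq: "h' i j (zproj D J i j x) = h i j x" if x: "x \<in> carrier (comp D i j)" for i j x
  proof -
    define y where "y = (SOME y. y \<in> carrier (comp D i j) \<and> zproj D J i j y = zproj D J i j x)"
    have y: "y \<in> carrier (comp D i j)" "zproj D J i j y = zproj D J i j x"
      using someI[of "\<lambda>y. y \<in> carrier (comp D i j) \<and> zproj D J i j y = zproj D J i j x" x] x
      unfolding y_def by auto
    have "h i j (y \<otimes>\<^bsub>comp D i j\<^esub> inv\<^bsub>comp D i j\<^esub> x) = \<one>\<^bsub>comp E i j\<^esub>"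
      using y proj_eq_iff[OF y(1) x] ker by blast
    then have "h i j y \<otimes>\<^bsub>comp E i j\<^esub> inv\<^bsub>comp E i j\<^esub> h i j x = \<one>\<^bsub>comp E i j\<^esub>"
      using x y zhomD[OF h] zhom_one_inv[OF zalgebra_axioms E h] by simp
    then have "h i j y = h i j x"
      using x y zhomD(2)[OF h] E.comp.inv_equality E.comp.inv_inv E.comp.inv_closed by metis
    then show ?thesis by (simp add: h'_def y_def)
  qed
  have "zhom (zquot D J) E h'"
    unfolding zhom_def
  proof (intro conjI allI ballI)
    show "h' i j \<in> hom (comp (zquot D J) i j) (comp E i j)" for i j
      by (auto simp: hom_def eq proj_add[symmetric] comp.m_closed zhomD[OF h] elim!: quot_elem)
    show "h' i l (zmult (zquot D J) i j l X Y) = zmult E i j l (h' i j X) (h' j l Y)"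
      if "X \<in> carrier (comp (zquot D J) i j)" "Y \<in> carrier (comp (zquot D J) j l)" for i j l X Y
      using that by (auto simp: proj_mult eq mult_closed zhomD[OF h] elim!: quot_elem)
    show "h' i i (zone (zquot D J) i) = zone E i" for i
      using eq[OF one_closed] zhomD(5)[OF h] by (simp add: zquot_def)
  qed
  with eq show thesis by (intro that)
qed

end

lemma zideal_zideal_gen:
  assumes "zalgebra D" "\<And>i j. S i j \<subseteq> carrier (comp D i j)"
  shows "zideal D (zideal_gen D S)"
proof -
  interpret zalgebra D by fact
  define \<J> where "\<J> = {J. zideal D J \<and> (\<forall>k l. S k l \<subseteq> J k l)}"
  have eq: "zideal_gen D S i j = (\<Inter>J\<in>\<J>. J i j)" for i j
    by (auto simp: zideal_gen_def \<J>_def)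
  \<comment> \<open>The whole algebra is an ideal containing \<open>S\<close>, so the intersection
    ranges over a nonempty family.\<close>
  have "(\<lambda>i j. carrier (comp D i j)) \<in> \<J>"
    using assms(2) mult_closed by (simp add: \<J>_def zideal_def comp.subgroup_self)
  then have ne: "\<J> \<noteq> {}" by blast
  have J: "zideal D J" if "J \<in> \<J>" for J using that by (simp add: \<J>_def)
  show ?thesis
    unfolding zideal_def
  proof (intro conjI allI ballI)
    show "subgroup (zideal_gen D S i j) (comp D i j)" for i j
      unfolding eq
      by (rule comp.subgroups_Inter) (use ne J in \<open>auto intro: zidealD(1)\<close>)
  qed (auto simp: eq zidealD(3,4)[OF J])
qed

lemma zideal_gen_incl: "S i j \<subseteq> zideal_gen D S i j"
  by (auto simp: zideal_gen_def)

lemma zideal_gen_le: "\<lbrakk>zideal D J; \<And>k l. S k l \<subseteq> J k l\<rbrakk> \<Longrightarrow> zideal_gen D S i j \<subseteq> J i j"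
  unfolding zideal_gen_def by blast

lemma zideal_kernel:
  assumes D: "zalgebra D" and E: "zalgebra E" and h: "zhom D E h"
  shows "zideal D (\<lambda>i j. {x \<in> carrier (comp D i j). h i j x = \<one>\<^bsub>comp E i j\<^esub>})"
proof -
  interpret D: zalgebra D by fact
  interpret E: zalgebra E by fact
  have "subgroup {x \<in> carrier (comp D i j). h i j x = \<one>\<^bsub>comp E i j\<^esub>} (comp D i j)" for i j
    by (rule D.comp.subgroupI)
      (auto simp: zhomD[OF h] zhom_one_inv[OF D E h] intro!: exI[of _ "\<one>\<^bsub>comp D i j\<^esub>"])
  then show ?thesis
    by (auto simp: zideal_def D.mult_closed zhomD[OF h])
qed

text \<open>The kernel of a homomorphism is an ideal; hence a homomorphism that vanishes on the
  generators vanishes on the generated ideal. No description of the elements of a generated ideal is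
  used.\<close>

lemma zideal_gen_kernel:
  assumes "zalgebra D" "zalgebra E" "zhom D E h" "\<And>k l. S k l \<subseteq> carrier (comp D k l)"
    "\<And>k l s. s \<in> S k l \<Longrightarrow> h k l s = \<one>\<^bsub>comp E k l\<^esub>" "x \<in> zideal_gen D S i j"
  shows "h i j x = \<one>\<^bsub>comp E i j\<^esub>"
  using zideal_gen_le[OF zideal_kernel[OF assms(1-3)], of S i j] assms(4-6) by blast

section \<open>Words, their products and the ideal of tensor relations\<close>

section \<open>The tensor algebra\<close>

lemma right_mod_simps [simp]:
  "carrier (right_mod U) = carrier U" "add (right_mod U) = add U" "zero (right_mod U) = zero U"
  "smult (right_mod U) = (\<lambda>a v. v \<triangleleft>\<^bsub>U\<^esub> a)"
  by (simp_all add: right_mod_def)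

locale bimodules =
  fixes K :: "int \<Rightarrow> 'k ring" and W :: "int \<Rightarrow> ('k, 'w) bimod"
  assumes field_K: "field (K i)" and bimod: "bimodule (K i) (K (i + 1)) (W i)"
begin

sublocale K: field "K i" for i by (rule field_K)
sublocale L: vectorspace "K i" "W i" for i using bimod by (simp add: bimodule_def)

lemma right_vectorspace: "vectorspace (K (i + 1)) (right_mod (W i))"
  using bimod by (simp add: bimodule_def)

lemma r_closed [simp]: "\<lbrakk>v \<in> carrier (W i); b \<in> carrier (K (i + 1))\<rbrakk> \<Longrightarrow> v \<triangleleft>\<^bsub>W i\<^esub> b \<in> carrier (W i)"
  using module.smult_closed[OF vectorspace.axioms(1)[OF right_vectorspace]] by simp

lemma r_add_left: "\<lbrakk>u \<in> carrier (W i); v \<in> carrier (W i); b \<in> carrier (K (i + 1))\<rbrakk> \<Longrightarrow>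
    (u \<oplus>\<^bsub>W i\<^esub> v) \<triangleleft>\<^bsub>W i\<^esub> b = u \<triangleleft>\<^bsub>W i\<^esub> b \<oplus>\<^bsub>W i\<^esub> v \<triangleleft>\<^bsub>W i\<^esub> b"
  using module.smult_r_distr[OF vectorspace.axioms(1)[OF right_vectorspace]] by simp

lemma r_add_right: "\<lbrakk>v \<in> carrier (W i); a \<in> carrier (K (i + 1)); b \<in> carrier (K (i + 1))\<rbrakk> \<Longrightarrow>
    v \<triangleleft>\<^bsub>W i\<^esub> (a \<oplus>\<^bsub>K (i + 1)\<^esub> b) = v \<triangleleft>\<^bsub>W i\<^esub> a \<oplus>\<^bsub>W i\<^esub> v \<triangleleft>\<^bsub>W i\<^esub> b"
  using module.smult_l_distr[OF vectorspace.axioms(1)[OF right_vectorspace]] by simp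

lemma r_assoc: "\<lbrakk>v \<in> carrier (W i); a \<in> carrier (K (i + 1)); b \<in> carrier (K (i + 1))\<rbrakk> \<Longrightarrow>
    v \<triangleleft>\<^bsub>W i\<^esub> a \<triangleleft>\<^bsub>W i\<^esub> b = v \<triangleleft>\<^bsub>W i\<^esub> (a \<otimes>\<^bsub>K (i + 1)\<^esub> b)"
  using module.smult_assoc1[OF vectorspace.axioms(1)[OF right_vectorspace, of i], of b a v]
  by (simp add: K.m_comm)

lemma r_one [simp]: "v \<in> carrier (W i) \<Longrightarrow> v \<triangleleft>\<^bsub>W i\<^esub> \<one>\<^bsub>K (i + 1)\<^esub> = v"
  using module.smult_one[OF vectorspace.axioms(1)[OF right_vectorspace]] by simp

lemma lr_assoc: "\<lbrakk>a \<in> carrier (K i); v \<in> carrier (W i); b \<in> carrier (K (i + 1))\<rbrakk> \<Longrightarrow>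
    (a \<odot>\<^bsub>W i\<^esub> v) \<triangleleft>\<^bsub>W i\<^esub> b = a \<odot>\<^bsub>W i\<^esub> (v \<triangleleft>\<^bsub>W i\<^esub> b)"
  using bimod by (simp add: bimodule_def)

text \<open>The typing condition of \<open>words\<close> in recursive form: the index moves along
  the list, so inductions on lists apply.\<close>

fun letters :: "int \<Rightarrow> 'w list \<Rightarrow> bool" where
  "letters i [] \<longleftrightarrow> True"
| "letters i (v # vs) \<longleftrightarrow> v \<in> carrier (W i) \<and> letters (i + 1) vs"

lemma letters_append [simp]:
  "letters i (us @ vs) \<longleftrightarrow> letters i us \<and> letters (i + int (length us)) vs"
  by (induction us arbitrary: i) (auto simp: algebra_simps)

lemma letters_nth: "letters i vs \<longleftrightarrow> (\<forall>n<length vs. vs ! n \<in> carrier (W (i + int n)))"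
proof (induction vs arbitrary: i)
  case (Cons v vs)
  then show ?case
    by (simp add: All_less_Suc2 ac_simps)
qed simp

lemma words_iff:
  "(a, vs) \<in> words K W i j \<longleftrightarrow> a \<in> carrier (K i) \<and> int (length vs) = j - i \<and> letters i vs"
  by (simp add: words_def letters_nth)

lemma word_mult_closed:
  "\<lbrakk>p \<in> words K W i j; q \<in> words K W j l\<rbrakk> \<Longrightarrow> word_mult K W i j p q \<in> words K W i l"
proof (cases p; cases q)
  fix a vs b ws
  assume "p \<in> words K W i j" "q \<in> words K W j l" "p = (a, vs)" "q = (b, ws)"
  then show ?thesis
    by (cases vs rule: rev_cases) (auto simp: words_iff word_mult_def algebra_simps)
qed

lemma word_mult_assoc:
  assumes "p \<in> words K W i j" "q \<in> words K W j l" "r \<in> words K W l m"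
  shows "word_mult K W i l (word_mult K W i j p q) r = word_mult K W i j p (word_mult K W j l q r)"
proof -
  obtain a vs b ws c us where e: "p = (a, vs)" "q = (b, ws)" "r = (c, us)"
    by (metis surj_pair)
  from assms show ?thesis unfolding e
    \<comment> \<open>The scalar of a right factor is absorbed by the last letter of the left
      factor, or by its scalar if there is no letter; hence both lists are split at their
      ends.\<close>
    by (cases vs rule: rev_cases; cases ws rule: rev_cases)
      (auto simp: words_iff word_mult_def butlast_append algebra_simps K.m_assoc r_assoc
        intro!: r_assoc[of _ "j - 1" b c, simplified])
qed

abbreviation (input) T where "T \<equiv> word_algebra K W"

lemma comp_T [simp]: "comp T i j = free_Abelian_group (words K W i j)"
  by (simp add: word_algebra_def)

lemma zone_T [simp]: "zone T i = frag_of (\<one>\<^bsub>K i\<^esub>, [])"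
  by (simp add: word_algebra_def)

lemma mult_T: "zmult T i j l x y =
    frag_extend (\<lambda>p. frag_extend (\<lambda>q. frag_of (word_mult K W i j p q)) y) x"
  by (simp add: word_algebra_def)

lemma mult_T_of [simp]: "zmult T i j l (frag_of p) (frag_of q) = frag_of (word_mult K W i j p q)"
  by (simp add: mult_T)

lemma mult_T_left:
  "zmult T i j l 0 y = 0" "zmult T i j l (x + x') y = zmult T i j l x y + zmult T i j l x' y"
  "zmult T i j l (x - x') y = zmult T i j l x y - zmult T i j l x' y"
  by (simp_all add: mult_T frag_extend_add frag_extend_diff)

lemma mult_T_right:
  "zmult T i j l x 0 = 0" "zmult T i j l x (y + y') = zmult T i j l x y + zmult T i j l x y'"
  "zmult T i j l x (y - y') = zmult T i j l x y - zmult T i j l x y'"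
proof -
  have *: "frag_extend (\<lambda>p. f p + g p) x = frag_extend f x + frag_extend g x"
    for f g :: "'k \<times> 'w list \<Rightarrow> ('k \<times> 'w list \<Rightarrow>\<^sub>0 int)"
    by (simp add: frag_extend_def frag_cmul_distrib2 sum.distrib)
  show add: "zmult T i j l x (y + y') = zmult T i j l x y + zmult T i j l x y'" for y y'
    by (simp add: mult_T frag_extend_add *)
  show "zmult T i j l x 0 = 0"
    using add[of 0 0] by simp
  show "zmult T i j l x (y - y') = zmult T i j l x y - zmult T i j l x y'"
    using add[of "y - y'" y'] by simp
qed

lemma words_induct [consumes 1, case_names zero diff word]:
  assumes "Poly_Mapping.keys x \<subseteq> words K W i j" "P 0"
    "\<And>x y. \<lbrakk>Poly_Mapping.keys x \<subseteq> words K W i j; Poly_Mapping.keys y \<subseteq> words K W i j; P x; P y\<rbrakk> \<Longrightarrow> P (x - y)"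
    "\<And>p. p \<in> words K W i j \<Longrightarrow> P (frag_of p)"
  shows "P x"
  using assms by (rule free_Abelian_group_induct)

lemma keys_diff_le:
  "\<lbrakk>Poly_Mapping.keys x \<subseteq> S; Poly_Mapping.keys y \<subseteq> S\<rbrakk> \<Longrightarrow> Poly_Mapping.keys (x - y) \<subseteq> S"
  using keys_diff[of x y] by blast

lemma mult_T_closed:
  assumes "Poly_Mapping.keys x \<subseteq> words K W i j" "Poly_Mapping.keys y \<subseteq> words K W j l"
  shows "Poly_Mapping.keys (zmult T i j l x y) \<subseteq> words K W i l"
  using assms(1)
proof (induction rule: words_induct)
  case (word p)
  from assms(2) show ?case
    by (induction rule: words_induct) (simp_all add: mult_T_right word_mult_closed word keys_diff_le)
qed (simp_all add: mult_T_left keys_diff_le)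

lemma mult_T_assoc:
  assumes "Poly_Mapping.keys x \<subseteq> words K W i j" "Poly_Mapping.keys y \<subseteq> words K W j l"
    "Poly_Mapping.keys z \<subseteq> words K W l m"
  shows "zmult T i l m (zmult T i j l x y) z = zmult T i j m x (zmult T j l m y z)"
  using assms(1)
proof (induction rule: words_induct)
  case p: (word p)
  from assms(2) show ?case
  proof (induction rule: words_induct)
    case q: (word q)
    from assms(3) show ?case
      by (induction rule: words_induct)
        (simp_all add: mult_T_right word_mult_assoc[OF p q])
  qed (simp_all add: mult_T_right mult_T_left)
qed (simp_all add: mult_T_left)

lemma zalgebra_T: "zalgebra T"
proof (rule zalgebra.intro)
  fix i j x assume x: "x \<in> carrier (comp T i j)"
  have w: "(\<one>\<^bsub>K i\<^esub>, []) \<in> words K W i i" for i by (simp add: words_iff)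
  from x have x: "Poly_Mapping.keys x \<subseteq> words K W i j" by simp
  then show "zmult T i i j (zone T i) x = x"
  proof (induction rule: words_induct)
    case (word p)
    then show ?case by (cases p) (simp add: word_mult_def words_iff)
  qed (simp_all add: mult_T_right)
  from x show "zmult T i j j x (zone T j) = x"
  proof (induction rule: words_induct)
    case (word p)
    have "word_mult K W i j p (\<one>\<^bsub>K j\<^esub>, []) = p"
    proof (cases p)
      case (Pair a vs)
      show ?thesis
      proof (cases vs rule: rev_cases)
        case (snoc ys y)
        then have "j = i + int (length ys) + 1" using word Pair by (simp add: words_iff)
        with snoc Pair word show ?thesis by (simp add: word_mult_def words_iff)
      qed (use word Pair in \<open>simp add: word_mult_def words_iff\<close>)
    qed
    then show ?case by simp
  qed (simp_all add: mult_T_left)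
qed (simp_all add: mult_T_closed[simplified] mult_T_assoc mult_T_left mult_T_right words_iff
    abelian_free_Abelian_group)

lemma relators1:
  "\<lbrakk>(a, vs) \<in> words K W i j; (b, vs) \<in> words K W i j\<rbrakk> \<Longrightarrow>
   frag_of (a \<oplus>\<^bsub>K i\<^esub> b, vs) - frag_of (a, vs) - frag_of (b, vs) \<in> tensor_relators K W i j"
  unfolding tensor_relators_def by blast

lemma relators2:
  "\<lbrakk>(a, us @ v # vs) \<in> words K W i j; (a, us @ w # vs) \<in> words K W i j; l = i + int (length us)\<rbrakk> \<Longrightarrow>
   frag_of (a, us @ (v \<oplus>\<^bsub>W l\<^esub> w) # vs) - frag_of (a, us @ v # vs) - frag_of (a, us @ w # vs)
   \<in> tensor_relators K W i j"
  unfolding tensor_relators_def by blast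

lemma relators3:
  "\<lbrakk>(a, v # vs) \<in> words K W i j; b \<in> carrier (K i)\<rbrakk> \<Longrightarrow>
   frag_of (a \<otimes>\<^bsub>K i\<^esub> b, v # vs) - frag_of (a, (b \<odot>\<^bsub>W i\<^esub> v) # vs) \<in> tensor_relators K W i j"
  unfolding tensor_relators_def by blast

lemma relators4:
  "\<lbrakk>(a, us @ v # w # vs) \<in> words K W i j; b \<in> carrier (K (i + int (length us) + 1));
    l = i + int (length us); m = i + int (length us) + 1\<rbrakk> \<Longrightarrow>
   frag_of (a, us @ (v \<triangleleft>\<^bsub>W l\<^esub> b) # w # vs) - frag_of (a, us @ v # (b \<odot>\<^bsub>W m\<^esub> w) # vs)
   \<in> tensor_relators K W i j"
  unfolding tensor_relators_def by blast

lemma relatorsE: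
  assumes "r \<in> tensor_relators K W i j"
  obtains (1) a b vs where "(a, vs) \<in> words K W i j" "(b, vs) \<in> words K W i j"
      "r = frag_of (a \<oplus>\<^bsub>K i\<^esub> b, vs) - frag_of (a, vs) - frag_of (b, vs)"
  | (2) a us v w vs where "(a, us @ v # vs) \<in> words K W i j" "(a, us @ w # vs) \<in> words K W i j"
      "r = frag_of (a, us @ (v \<oplus>\<^bsub>W (i + int (length us))\<^esub> w) # vs) -
        frag_of (a, us @ v # vs) - frag_of (a, us @ w # vs)"
  | (3) a b v vs where "(a, v # vs) \<in> words K W i j" "b \<in> carrier (K i)"
      "r = frag_of (a \<otimes>\<^bsub>K i\<^esub> b, v # vs) - frag_of (a, (b \<odot>\<^bsub>W i\<^esub> v) # vs)"
  | (4) a us v b w vs where "(a, us @ v # w # vs) \<in> words K W i j"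
      "b \<in> carrier (K (i + int (length us) + 1))"
      "r = frag_of (a, us @ (v \<triangleleft>\<^bsub>W (i + int (length us))\<^esub> b) # w # vs) -
        frag_of (a, us @ v # (b \<odot>\<^bsub>W (i + int (length us) + 1)\<^esub> w) # vs)"
  using assms unfolding tensor_relators_def by blast

lemma relators_closed: "tensor_relators K W i j \<subseteq> carrier (comp T i j)"
proof
  fix r assume "r \<in> tensor_relators K W i j"
  then show "r \<in> carrier (comp T i j)"
    by (cases rule: relatorsE) (simp_all add: words_iff keys_diff_le)
qed

text \<open>The product of a relator with a word is again a single relator of the same kind, not
  just an element of the generated group. If the altered letter is the last one it absorbs the
  scalar of the word, and a bimodule axiom preserves the relation; otherwise only the tail of the
  words changes.\<close>

lemma relators_mult_right:
  assumes r: "r \<in> tensor_relators K W i j" and q: "q \<in> words K W j l"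
  shows "zmult T i j l r (frag_of q) \<in> tensor_relators K W i l"
proof -
  obtain c ws where q': "q = (c, ws)" by (cases q)
  from r show ?thesis
  proof (cases rule: relatorsE)
    case (1 a b vs)
    note m = word_mult_closed[OF 1(1) q] word_mult_closed[OF 1(2) q]
    from 1 q show ?thesis
      using relators1[of a "snd (word_mult K W i j (a, vs) q)" i l b]
        relators1[of "a \<otimes>\<^bsub>K i\<^esub> c" ws i l "b \<otimes>\<^bsub>K i\<^esub> c"] m
      by (auto simp: mult_T_left q' word_mult_def words_iff K.l_distr split: if_splits)
  next
    case (2 a us v w vs)
    show ?thesis
    proof (cases vs rule: rev_cases)
      case Nil
      then have j: "j = i + int (length us) + 1" using 2 by (simp add: words_iff)
      from 2 q Nil show ?thesis
        using relators2[of a us "v \<triangleleft>\<^bsub>W (j - 1)\<^esub> c" ws i l "w \<triangleleft>\<^bsub>W (j - 1)\<^esub> c" "j - 1"]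
        by (auto simp: mult_T_left q' word_mult_def words_iff r_add_left j ac_simps)
    next
      case (snoc xs x)
      note m = word_mult_closed[OF 2(1) q] word_mult_closed[OF 2(2) q]
      from 2 q snoc show ?thesis
        using relators2[of a us v "xs @ (x \<triangleleft>\<^bsub>W (j - 1)\<^esub> c) # ws" i l w "i + int (length us)"] m
        by (simp add: mult_T_left q' word_mult_def butlast_append)
    qed
  next
    case (3 a b v vs)
    show ?thesis
    proof (cases vs rule: rev_cases)
      case Nil
      then have j: "j = i + 1" using 3 by (simp add: words_iff)
      from 3 q Nil show ?thesis
        using relators3[of a "v \<triangleleft>\<^bsub>W i\<^esub> c" ws i l b]
        by (auto simp: mult_T_left q' word_mult_def words_iff lr_assoc j ac_simps)
    next
      case (snoc xs x)
      from 3 q snoc show ?thesis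
        using relators3[of a v "xs @ (x \<triangleleft>\<^bsub>W (j - 1)\<^esub> c) # ws" i l b] word_mult_closed[OF 3(1) q]
        by (simp add: mult_T_left q' word_mult_def butlast_append)
    qed
  next
    case (4 a us v b w vs)
    show ?thesis
    proof (cases vs rule: rev_cases)
      case Nil
      then have j: "j = i + int (length us) + 2" using 4 by (simp add: words_iff)
      from 4 q Nil show ?thesis
        using relators4[of a us v "w \<triangleleft>\<^bsub>W (j - 1)\<^esub> c" ws i l b "i + int (length us)" "j - 1"]
          lr_assoc[of b "j - 1" w c]
        by (auto simp: mult_T_left q' word_mult_def words_iff j butlast_append ac_simps)
    next
      case (snoc xs x)
      from 4 q snoc show ?thesis
        using relators4[of a us v w "xs @ (x \<triangleleft>\<^bsub>W (j - 1)\<^esub> c) # ws" i l b "i + int (length us)"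
            "i + int (length us) + 1"] word_mult_closed[OF 4(1) q]
        by (simp add: mult_T_left q' word_mult_def butlast_append)
    qed
  qed
qed

text \<open>If the left word has a last letter, this letter absorbs the scalars of the relator.
  Additivity in the scalar then becomes additivity in a letter, and the relation between scalar and
  first letter becomes a balancing relation between neighbouring letters.\<close>

lemma relators_mult_left:
  assumes r: "r \<in> tensor_relators K W j l" and p: "p \<in> words K W i j"
  shows "zmult T i j l (frag_of p) r \<in> tensor_relators K W i l"
proof -
  obtain c ws where p': "p = (c, ws)" by (cases p)
  from r show ?thesis
  proof (cases ws rule: rev_cases)
    case Nil
    then have [simp]: "j = i" using p p' by (simp add: words_iff)
    from r show ?thesis
    proof (cases rule: relatorsE)
      case (1 a b vs)
      then show ?thesis
        using relators1[of "c \<otimes>\<^bsub>K i\<^esub> a" vs i l "c \<otimes>\<^bsub>K i\<^esub> b"] p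
        by (simp add: mult_T_right p' Nil word_mult_def words_iff K.r_distr)
    next
      case (2 a us v w vs)
      then show ?thesis
        using relators2[of "c \<otimes>\<^bsub>K i\<^esub> a" us v vs i l w] p
        by (simp add: mult_T_right p' Nil word_mult_def words_iff)
    next
      case (3 a b v vs)
      then show ?thesis
        using relators3[of "c \<otimes>\<^bsub>K i\<^esub> a" v vs i l b] p
        by (simp add: mult_T_right p' Nil word_mult_def words_iff K.m_assoc)
    next
      case (4 a us v b w vs)
      then show ?thesis
        using relators4[of "c \<otimes>\<^bsub>K i\<^esub> a" us v w vs i l b] p
        by (simp add: mult_T_right p' Nil word_mult_def words_iff)
    qed
  next
    case (snoc xs x)
    then have j: "j = i + int (length xs) + 1" using p p' by (simp add: words_iff)
    from r show ?thesis
    proof (cases rule: relatorsE)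
      case (1 a b vs)
      then show ?thesis
        using relators2[of c xs "x \<triangleleft>\<^bsub>W (j - 1)\<^esub> a" vs i l "x \<triangleleft>\<^bsub>W (j - 1)\<^esub> b" "j - 1"] p
          r_add_right[of x "j - 1" a b]
        by (simp add: mult_T_right p' snoc word_mult_def words_iff j ac_simps)
    next
      case (2 a us v w vs)
      then show ?thesis
        using relators2[of c "xs @ (x \<triangleleft>\<^bsub>W (j - 1)\<^esub> a) # us" v vs i l w "j + int (length us)"] p
        by (simp add: mult_T_right p' snoc word_mult_def words_iff j ac_simps)
    next
      case (3 a b v vs)
      then show ?thesis
        using relators4[of c xs "x \<triangleleft>\<^bsub>W (j - 1)\<^esub> a" v vs i l b "j - 1" j] p
          r_assoc[of x "j - 1" a b]
        by (simp add: mult_T_right p' snoc word_mult_def words_iff j ac_simps)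
    next
      case (4 a us v b w vs)
      then show ?thesis
        using relators4[of c "xs @ (x \<triangleleft>\<^bsub>W (j - 1)\<^esub> a) # us" v w vs i l b "j + int (length us)"
            "j + int (length us) + 1"] p
        by (simp add: mult_T_right p' snoc word_mult_def words_iff j ac_simps)
    qed
  qed
qed

lemma zideal_tensor_ideal: "zideal T (tensor_ideal K W)"
proof -
  interpret T: zalgebra T by (rule zalgebra_T)
  have sub: "subgroup (tensor_ideal K W i j) (comp T i j)" for i j
    using T.comp.generate_is_subgroup[OF relators_closed, of i j] by (simp add: tensor_ideal_def)
  have incl: "tensor_relators K W i j \<subseteq> tensor_ideal K W i j" for i j
    unfolding tensor_ideal_def by (meson generate.incl subsetI)
  have closed: "zmult T i j l x (frag_of q) \<in> tensor_ideal K W i l"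
    if "x \<in> tensor_ideal K W i j" "q \<in> words K W j l" for i j l x q
  proof -
    have q: "frag_of q \<in> carrier (comp T j l)" using that by simp
    \<comment> \<open>The elements whose product with the given word lies in the ideal form a
      subgroup; it contains the relators, hence all that they generate.\<close>
    let ?B = "{x \<in> carrier (comp T i j). zmult T i j l x (frag_of q) \<in> tensor_ideal K W i l}"
    have "subgroup ?B (comp T i j)"
    proof (rule T.comp.subgroupI)
      show "?B \<noteq> {}" using T.mult_zero_left[OF q, of i] subgroup.one_closed[OF sub]
        by (metis (mono_tags, lifting) T.comp.one_closed empty_iff mem_Collect_eq)
      show "inv\<^bsub>comp T i j\<^esub> a \<in> ?B" if "a \<in> ?B" for a
        using that q subgroup.m_inv_closed[OF sub] T.mult_inv_left T.comp.inv_closed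
        by (metis (mono_tags, lifting) mem_Collect_eq)
      show "a \<otimes>\<^bsub>comp T i j\<^esub> b \<in> ?B" if "a \<in> ?B" "b \<in> ?B" for a b
        using that q subgroup.m_closed[OF sub] T.mult_add_left T.comp.m_closed
        by (metis (mono_tags, lifting) mem_Collect_eq)
    qed auto
    moreover have "tensor_relators K W i j \<subseteq> ?B"
      using relators_closed relators_mult_right[OF _ that(2)] incl by blast
    ultimately have "tensor_ideal K W i j \<subseteq> ?B"
      using T.comp.generate_subgroup_incl[of "tensor_relators K W i j" ?B i j]
      by (simp add: tensor_ideal_def)
    then show ?thesis using that by blast
  qed
  have closed': "zmult T i j l (frag_of p) x \<in> tensor_ideal K W i l"
    if "x \<in> tensor_ideal K W j l" "p \<in> words K W i j" for i j l x p
  proof -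
    have p: "frag_of p \<in> carrier (comp T i j)" using that by simp
    let ?B = "{x \<in> carrier (comp T j l). zmult T i j l (frag_of p) x \<in> tensor_ideal K W i l}"
    have "subgroup ?B (comp T j l)"
    proof (rule T.comp.subgroupI)
      show "?B \<noteq> {}" using T.mult_zero_right[OF p, of l] subgroup.one_closed[OF sub]
        by (metis (mono_tags, lifting) T.comp.one_closed empty_iff mem_Collect_eq)
      show "inv\<^bsub>comp T j l\<^esub> a \<in> ?B" if "a \<in> ?B" for a
        using that p subgroup.m_inv_closed[OF sub] T.mult_inv_right T.comp.inv_closed
        by (metis (mono_tags, lifting) mem_Collect_eq)
      show "a \<otimes>\<^bsub>comp T j l\<^esub> b \<in> ?B" if "a \<in> ?B" "b \<in> ?B" for a b
        using that p subgroup.m_closed[OF sub] T.mult_add_right T.comp.m_closed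
        by (metis (mono_tags, lifting) mem_Collect_eq)
    qed auto
    moreover have "tensor_relators K W j l \<subseteq> ?B"
      using relators_closed relators_mult_left[OF _ that(2)] incl by blast
    ultimately have "tensor_ideal K W j l \<subseteq> ?B"
      using T.comp.generate_subgroup_incl[of "tensor_relators K W j l" ?B j l]
      by (simp add: tensor_ideal_def)
    then show ?thesis using that by blast
  qed
  have diff: "x - y \<in> tensor_ideal K W i j" if "x \<in> tensor_ideal K W i j" "y \<in> tensor_ideal K W i j" for i j x y
    using subgroup.m_closed[OF sub that(1) subgroup.m_inv_closed[OF sub that(2)]]
      subgroup.mem_carrier[OF sub that(2)] by simp
  have zero: "0 \<in> tensor_ideal K W i j" for i j
    using subgroup.one_closed[OF sub, of i j] by simp
  show ?thesis
    unfolding zideal_def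
  proof (intro conjI allI ballI)
    fix i j l x y assume x: "x \<in> tensor_ideal K W i j" and "y \<in> carrier (comp T j l)"
    then have "Poly_Mapping.keys y \<subseteq> words K W j l" by simp
    then show "zmult T i j l x y \<in> tensor_ideal K W i l"
      by (induction rule: words_induct) (simp_all add: mult_T_right closed x diff zero)
  next
    fix i j l x y assume "x \<in> carrier (comp T i j)" and y: "y \<in> tensor_ideal K W j l"
    then have "Poly_Mapping.keys x \<subseteq> words K W i j" by simp
    then show "zmult T i j l x y \<in> tensor_ideal K W i l"
      by (induction rule: words_induct) (simp_all add: mult_T_left closed' y diff zero)
  qed (rule sub)
qed

end

section \<open>Homomorphisms out of the tensor algebra\<close>

section \<open>Representations and the universal property\<close>

text \<open>Compatible images of the fields and of the bimodules in \<open>E\<close>: exactly the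
  data that determine a homomorphism from the tensor algebra to \<open>E\<close>.\<close>

locale bimod_rep = bimodules K W + zalgebra E
  for K :: "int \<Rightarrow> 'k ring" and W :: "int \<Rightarrow> ('k, 'w) bimod" and E :: "'e zring" +
  fixes k :: "int \<Rightarrow> 'k \<Rightarrow> 'e" and om :: "int \<Rightarrow> 'w \<Rightarrow> 'e"
  assumes k_closed: "a \<in> carrier (K i) \<Longrightarrow> k i a \<in> carrier (comp E i i)"
    and k_add: "\<lbrakk>a \<in> carrier (K i); b \<in> carrier (K i)\<rbrakk> \<Longrightarrow> k i (a \<oplus>\<^bsub>K i\<^esub> b) = k i a \<otimes>\<^bsub>comp E i i\<^esub> k i b"
    and k_mult: "\<lbrakk>a \<in> carrier (K i); b \<in> carrier (K i)\<rbrakk> \<Longrightarrow> zmult E i i i (k i a) (k i b) = k i (a \<otimes>\<^bsub>K i\<^esub> b)"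
    and k_one: "k i \<one>\<^bsub>K i\<^esub> = zone E i"
    and om_closed: "v \<in> carrier (W i) \<Longrightarrow> om i v \<in> carrier (comp E i (i + 1))"
    and om_add: "\<lbrakk>v \<in> carrier (W i); w \<in> carrier (W i)\<rbrakk> \<Longrightarrow>
      om i (v \<oplus>\<^bsub>W i\<^esub> w) = om i v \<otimes>\<^bsub>comp E i (i + 1)\<^esub> om i w"
    and om_left: "\<lbrakk>a \<in> carrier (K i); v \<in> carrier (W i)\<rbrakk> \<Longrightarrow>
      zmult E i i (i + 1) (k i a) (om i v) = om i (a \<odot>\<^bsub>W i\<^esub> v)"
    and om_right: "\<lbrakk>v \<in> carrier (W i); b \<in> carrier (K (i + 1))\<rbrakk> \<Longrightarrow>
      zmult E i (i + 1) (i + 1) (om i v) (k (i + 1) b) = om i (v \<triangleleft>\<^bsub>W i\<^esub> b)"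
begin

lemma cancel_add:
  assumes "y \<in> carrier (comp E i j)" "z \<in> carrier (comp E i j)"
  shows "y \<otimes>\<^bsub>comp E i j\<^esub> z \<otimes>\<^bsub>comp E i j\<^esub> inv\<^bsub>comp E i j\<^esub> y \<otimes>\<^bsub>comp E i j\<^esub> inv\<^bsub>comp E i j\<^esub> z = \<one>\<^bsub>comp E i j\<^esub>"
  using assms comp.m_comm[OF assms]
  by (metis comp.inv_closed comp.inv_solve_right comp.m_assoc comp.m_closed comp.r_inv)

lemma om_closed': "\<lbrakk>v \<in> carrier (W i); j = i + 1\<rbrakk> \<Longrightarrow> om i v \<in> carrier (comp E i j)"
  using om_closed by simp

text \<open>The end index is carried along because the multiplication of \<open>E\<close> depends on
  it.\<close>

fun wv :: "int \<Rightarrow> int \<Rightarrow> 'w list \<Rightarrow> 'e" where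
  "wv i j [] = zone E i"
| "wv i j (v # vs) = zmult E i (i + 1) j (om i v) (wv (i + 1) j vs)"

lemma wv_closed: "\<lbrakk>letters i vs; int (length vs) = j - i\<rbrakk> \<Longrightarrow> wv i j vs \<in> carrier (comp E i j)"
  by (induction vs arbitrary: i) (auto simp: one_closed intro!: mult_closed om_closed)

lemma wv_append:
  "\<lbrakk>letters i us; letters l vs; int (length us) = l - i; int (length vs) = j - l\<rbrakk> \<Longrightarrow>
   wv i j (us @ vs) = zmult E i l j (wv i l us) (wv l j vs)"
proof (induction us arbitrary: i)
  case Nil
  then show ?case using one_left[OF wv_closed[of l vs j]] by simp
next
  case (Cons u us)
  then show ?case
    using mult_assoc[OF om_closed[of u i] wv_closed[of "i + 1" us l] wv_closed[of l vs j]] by simp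
qed

definition val :: "int \<Rightarrow> int \<Rightarrow> 'k \<times> 'w list \<Rightarrow> 'e" where
  "val i j p = zmult E i i j (k i (fst p)) (wv i j (snd p))"

lemma val_closed: "p \<in> words K W i j \<Longrightarrow> val i j p \<in> carrier (comp E i j)"
  by (cases p) (auto simp: val_def words_iff intro!: mult_closed k_closed wv_closed)

lemma wv_snoc:
  assumes "letters i us" "v \<in> carrier (W (j - 1))" "int (length us) = j - i - 1"
  shows "wv i j (us @ [v]) = zmult E i (j - 1) j (wv i (j - 1) us) (om (j - 1) v)"
  using assms om_closed[of v "j - 1"] one_right[of "om (j - 1) v" "j - 1" j]
    wv_append[of i us "j - 1" "[v]" j] by simp

lemma k_wv_right:
  assumes "letters i us" "v \<in> carrier (W (j - 1))" "int (length us) = j - i - 1" "b \<in> carrier (K j)"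
  shows "wv i j (us @ [v \<triangleleft>\<^bsub>W (j - 1)\<^esub> b]) = zmult E i j j (wv i j (us @ [v])) (k j b)"
  using assms r_closed[of v "j - 1" b] wv_snoc[of i us v j] wv_snoc[of i us "v \<triangleleft>\<^bsub>W (j - 1)\<^esub> b" j]
    om_right[of v "j - 1" b] wv_closed[of i us "j - 1"] om_closed[of v "j - 1"] k_closed[of b j]
    mult_assoc[of "wv i (j - 1) us" i "j - 1" "om (j - 1) v" j "k j b" j]
  by simp

text \<open>In the product word the scalar of the second factor sits inside the last letter of the
  first; \<open>om_right\<close> moves it back to its own factor.\<close>

lemma val_mult:
  assumes p: "p \<in> words K W i j" and q: "q \<in> words K W j l"
  shows "val i l (word_mult K W i j p q) = zmult E i j l (val i j p) (val j l q)"
proof -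
  obtain a vs b ws where e: "p = (a, vs)" "q = (b, ws)" by (metis surj_pair)
  have p': "a \<in> carrier (K i)" "int (length vs) = j - i" "letters i vs"
    and q': "b \<in> carrier (K j)" "int (length ws) = l - j" "letters j ws"
    using p q e by (simp_all add: words_iff)
  note c = k_closed[OF p'(1)] k_closed[OF q'(1)] wv_closed[OF q'(3,2)] wv_closed[OF p'(3,2)]
  show ?thesis
  proof (cases vs rule: rev_cases)
    case Nil
    with p' have [simp]: "j = i" by simp
    show ?thesis
      using c Nil p' q' k_mult[of a i b] one_right[OF c(1)]
        mult_assoc[of "k i a" i i "k i b" i "wv i l ws" l]
      by (simp add: e val_def word_mult_def)
  next
    case (snoc us v)
    have v: "letters i us" "v \<in> carrier (W (j - 1))" "int (length us) = j - i - 1"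
      using p' snoc by (auto simp: algebra_simps)
    have "letters i (us @ [v \<triangleleft>\<^bsub>W (j - 1)\<^esub> b])"
      using v q' p' snoc r_closed[of v "j - 1" b] by simp
    then have "wv i l (us @ (v \<triangleleft>\<^bsub>W (j - 1)\<^esub> b) # ws) =
        zmult E i j l (wv i j (us @ [v \<triangleleft>\<^bsub>W (j - 1)\<^esub> b])) (wv j l ws)"
      using wv_append[of i "us @ [v \<triangleleft>\<^bsub>W (j - 1)\<^esub> b]" j ws l] v q' by simp
    also have "\<dots> = zmult E i j l (zmult E i j j (wv i j vs) (k j b)) (wv j l ws)"
      using k_wv_right v q' snoc by simp
    finally show ?thesis
      using c snoc by (simp add: e val_def word_mult_def butlast_append mult_assoc mult_closed)
  qed
qed

lemma free_hom: "\<exists>h. h \<in> hom (comp (word_algebra K W) i j) (comp E i j) \<and>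
    (\<forall>p\<in>words K W i j. h (frag_of p) = val i j p)"
  using comp.free_Abelian_group_universal[of "val i j" "words K W i j" i j] val_closed
  by (metis comp_T image_subsetI)

definition H0 where
  "H0 i j = (SOME h. h \<in> hom (comp (word_algebra K W) i j) (comp E i j) \<and>
    (\<forall>p\<in>words K W i j. h (frag_of p) = val i j p))"

lemma H0_hom: "H0 i j \<in> hom (comp (word_algebra K W) i j) (comp E i j)"
  and H0_of: "p \<in> words K W i j \<Longrightarrow> H0 i j (frag_of p) = val i j p"
  using someI_ex[OF free_hom] unfolding H0_def by blast+

lemma H0_group_hom: "group_hom (comp (word_algebra K W) i j) (comp E i j) (H0 i j)"
  using H0_hom[of i j] comp.is_group by (simp add: group_hom_def group_hom_axioms_def)

lemma H0_simps:
  "H0 i j 0 = \<one>\<^bsub>comp E i j\<^esub>"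
  "\<lbrakk>Poly_Mapping.keys x \<subseteq> words K W i j; Poly_Mapping.keys y \<subseteq> words K W i j\<rbrakk> \<Longrightarrow>
    H0 i j (x - y) = H0 i j x \<otimes>\<^bsub>comp E i j\<^esub> inv\<^bsub>comp E i j\<^esub> H0 i j y"
  "Poly_Mapping.keys x \<subseteq> words K W i j \<Longrightarrow> H0 i j x \<in> carrier (comp E i j)"
proof -
  interpret group_hom "comp (word_algebra K W) i j" "comp E i j" "H0 i j" by (rule H0_group_hom)
  show "H0 i j 0 = \<one>\<^bsub>comp E i j\<^esub>" using hom_one by simp
  show "Poly_Mapping.keys x \<subseteq> words K W i j \<Longrightarrow> H0 i j x \<in> carrier (comp E i j)"
    using hom_closed by simp
  show "\<lbrakk>Poly_Mapping.keys x \<subseteq> words K W i j; Poly_Mapping.keys y \<subseteq> words K W i j\<rbrakk> \<Longrightarrow>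
    H0 i j (x - y) = H0 i j x \<otimes>\<^bsub>comp E i j\<^esub> inv\<^bsub>comp E i j\<^esub> H0 i j y"
    using hom_mult[of x "- y"] hom_inv[of y] by simp
qed

lemma H0_mult:
  assumes "Poly_Mapping.keys x \<subseteq> words K W i j" and y: "Poly_Mapping.keys y \<subseteq> words K W j l"
  shows "H0 i l (zmult (word_algebra K W) i j l x y) = zmult E i j l (H0 i j x) (H0 j l y)"
  using assms(1)
proof (induction rule: words_induct)
  case (word p)
  from y show ?case
  proof (induction rule: words_induct)
    case (diff u v)
    then show ?case
      using word mult_T_closed[of "frag_of p" i j u l] mult_T_closed[of "frag_of p" i j v l]
      by (simp add: mult_T_right H0_simps mult_add_right mult_inv_right)
  next
    case (word q)
    with \<open>p \<in> words K W i j\<close> show ?case by (simp add: H0_of word_mult_closed val_mult)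
  qed (use word in \<open>simp_all add: mult_T_right H0_simps\<close>)
next
  case (diff u v)
  then show ?case
    using y mult_T_closed[of u i j y l] mult_T_closed[of v i j y l]
    by (simp add: mult_T_left H0_simps mult_add_left mult_inv_left)
qed (use y in \<open>simp_all add: mult_T_left H0_simps\<close>)

lemma zhom_H0: "zhom (word_algebra K W) E H0"
  unfolding zhom_def
proof (intro conjI allI ballI)
  show "H0 i i (zone (word_algebra K W) i) = zone E i" for i
    using H0_of[of "(\<one>\<^bsub>K i\<^esub>, [])" i i] one_left[OF one_closed]
    by (simp add: words_iff val_def k_one)
qed (simp_all add: H0_hom[unfolded comp_T] H0_mult)

lemma wv_mid:
  assumes "letters i us" "v \<in> carrier (W l)" "letters (l + 1) vs" "l = i + int (length us)"
    "j = l + 1 + int (length vs)"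
  shows "wv i j (us @ v # vs) = zmult E i l j (wv i l us) (zmult E l (l + 1) j (om l v) (wv (l + 1) j vs))"
proof -
  have "letters l (v # vs)" "int (length (v # vs)) = j - l" "int (length us) = l - i"
    using assms(2-5) by simp_all
  from wv_append[OF assms(1) this(1,3,2)] show ?thesis by (simp only: wv.simps)
qed

text \<open>Each kind of relator is cancelled by its own axioms: \<open>k_add\<close>, then
  \<open>om_add\<close>, then \<open>k_mult\<close> with \<open>om_left\<close>, then
  \<open>om_right\<close> with \<open>om_left\<close>.\<close>

lemma H0_relators:
  assumes "r \<in> tensor_relators K W i j"
  shows "H0 i j r = \<one>\<^bsub>comp E i j\<^esub>"
  using assms
proof (cases rule: relatorsE)
  case (1 a b vs)
  have "(a \<oplus>\<^bsub>K i\<^esub> b, vs) \<in> words K W i j" using 1 by (simp add: words_iff)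
  moreover have "val i j (a \<oplus>\<^bsub>K i\<^esub> b, vs) = val i j (a, vs) \<otimes>\<^bsub>comp E i j\<^esub> val i j (b, vs)"
    using 1 by (simp add: val_def words_iff k_add mult_add_left k_closed wv_closed)
  ultimately show ?thesis
    using 1 val_closed[OF 1(1)] val_closed[OF 1(2)]
    by (simp add: H0_simps H0_of keys_diff_le cancel_add)
next
  case (2 a us v w vs)
  let ?l = "i + int (length us)"
  have m: "(a, us @ (v \<oplus>\<^bsub>W ?l\<^esub> w) # vs) \<in> words K W i j" using 2 by (simp add: words_iff)
  have e: "wv i j (us @ z # vs) = zmult E i ?l j (wv i ?l us) (zmult E ?l (?l + 1) j (om ?l z) (wv (?l + 1) j vs))"
    if "z \<in> carrier (W ?l)" for z
    by (rule wv_mid) (use that 2 in \<open>simp_all add: words_iff\<close>)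
  have c: "k i a \<in> carrier (comp E i i)" "wv i ?l us \<in> carrier (comp E i ?l)"
    "wv (?l + 1) j vs \<in> carrier (comp E (?l + 1) j)"
    using 2 by (auto simp: words_iff intro!: wv_closed k_closed)
  have "val i j (a, us @ (v \<oplus>\<^bsub>W ?l\<^esub> w) # vs) =
      val i j (a, us @ v # vs) \<otimes>\<^bsub>comp E i j\<^esub> val i j (a, us @ w # vs)"
    using 2 c
    by (simp add: val_def words_iff e om_add mult_add_left mult_add_right mult_closed om_closed)
  with m show ?thesis
    using 2 val_closed[OF 2(1)] val_closed[OF 2(2)]
    by (simp add: H0_simps H0_of keys_diff_le cancel_add)
next
  case (3 a b v vs)
  have "(a \<otimes>\<^bsub>K i\<^esub> b, v # vs) \<in> words K W i j" "(a, (b \<odot>\<^bsub>W i\<^esub> v) # vs) \<in> words K W i j"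
    using 3 by (simp_all add: words_iff)
  moreover have "val i j (a \<otimes>\<^bsub>K i\<^esub> b, v # vs) = val i j (a, (b \<odot>\<^bsub>W i\<^esub> v) # vs)"
    using 3 by (simp add: val_def words_iff k_mult[symmetric] om_left[symmetric] mult_assoc
        k_closed om_closed wv_closed mult_closed)
  ultimately show ?thesis
    using 3 val_closed by (simp add: H0_simps H0_of)
next
  case (4 a us v b w vs)
  let ?l = "i + int (length us)"
  have m: "(a, us @ (v \<triangleleft>\<^bsub>W ?l\<^esub> b) # w # vs) \<in> words K W i j"
    "(a, us @ v # (b \<odot>\<^bsub>W (?l + 1)\<^esub> w) # vs) \<in> words K W i j"
    using 4 by (simp_all add: words_iff)
  have e: "wv i j (us @ z # z' # vs) = zmult E i ?l j (wv i ?l us)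
      (zmult E ?l (?l + 1) j (om ?l z) (zmult E (?l + 1) (?l + 2) j (om (?l + 1) z') (wv (?l + 2) j vs)))"
    if "z \<in> carrier (W ?l)" "z' \<in> carrier (W (?l + 1))" for z z'
  proof -
    have "wv i j (us @ z # z' # vs) = zmult E i ?l j (wv i ?l us) (zmult E ?l (?l + 1) j (om ?l z) (wv (?l + 1) j (z' # vs)))"
      by (rule wv_mid) (use that 4 in \<open>simp_all add: words_iff\<close>)
    then show ?thesis by (simp add: add.assoc)
  qed
  have c: "k (?l + 1) b \<in> carrier (comp E (?l + 1) (?l + 1))" "om ?l v \<in> carrier (comp E ?l (?l + 1))"
    "om (?l + 1) w \<in> carrier (comp E (?l + 1) (?l + 2))"
    "wv (?l + 2) j vs \<in> carrier (comp E (?l + 2) j)"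
    using 4 om_closed[of v ?l] om_closed[of w "?l + 1"]
    by (auto simp: words_iff ac_simps intro!: wv_closed k_closed)
  have "zmult E ?l (?l + 1) j (om ?l (v \<triangleleft>\<^bsub>W ?l\<^esub> b)) (zmult E (?l + 1) (?l + 2) j (om (?l + 1) w) (wv (?l + 2) j vs)) =
    zmult E ?l (?l + 1) j (om ?l v) (zmult E (?l + 1) (?l + 2) j (om (?l + 1) (b \<odot>\<^bsub>W (?l + 1)\<^esub> w)) (wv (?l + 2) j vs))"
    using om_right[of v ?l b, symmetric] om_left[of b "?l + 1" w, symmetric] 4(1,2) c
      mult_assoc[OF c(2) c(1)] mult_assoc[OF c(1) c(3)] mult_closed[OF c(3,4)]
    by (simp add: words_iff add.assoc)
  then have "val i j (a, us @ (v \<triangleleft>\<^bsub>W ?l\<^esub> b) # w # vs) = val i j (a, us @ v # (b \<odot>\<^bsub>W (?l + 1)\<^esub> w) # vs)"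
    using 4(1,2) by (simp add: val_def words_iff e)
  with m show ?thesis
    using 4 val_closed by (simp add: H0_simps H0_of)
qed

lemma H0_tensor_ideal:
  assumes "x \<in> tensor_ideal K W i j"
  shows "H0 i j x = \<one>\<^bsub>comp E i j\<^esub>"
proof -
  interpret group_hom "comp (word_algebra K W) i j" "comp E i j" "H0 i j" by (rule H0_group_hom)
  have "tensor_relators K W i j \<subseteq> kernel (comp (word_algebra K W) i j) (comp E i j) (H0 i j)"
    using H0_relators relators_closed unfolding kernel_def by blast
  from G.generate_subgroup_incl[OF this subgroup_kernel] assms show ?thesis
    by (auto simp: tensor_ideal_def kernel_def)
qed

end

text \<open>Axioms taken at index \<open>i + 1\<close> produce \<open>i + 1 + 1\<close> where
  statements about two letters have \<open>i + 2\<close>.\<close>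

lemma add_one_one [simp]: "(i::int) + 1 + 1 = i + 2"
  by simp

section \<open>Pairings, dual bases and the quadratic relation\<close>

section \<open>Systems of dual bimodules\<close>

text \<open>The dual bases are chosen separately for every \<open>i\<close>: \<open>x1 i\<close>,
  \<open>x2 i\<close> is a right basis of \<open>W i\<close> and \<open>y1 i\<close>,
  \<open>y2 i\<close> the dual left basis of \<open>W (i + 1)\<close>, with no link between
  \<open>y1 i\<close> and \<open>x1 (i + 1)\<close>. The axioms are symmetric in vectors and
  functionals, so that reading the indices backwards gives such a system again.\<close>

locale dual_system = bimodules K W
  for K :: "int \<Rightarrow> 'k ring" and W :: "int \<Rightarrow> ('k, 'w) bimod" +
  fixes pr :: "int \<Rightarrow> 'w \<Rightarrow> 'w \<Rightarrow> 'k" and x1 x2 y1 y2 :: "int \<Rightarrow> 'w"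
  assumes period: "K (i + 2) = K i"
    and pr_closed: "\<lbrakk>v \<in> carrier (W i); \<psi> \<in> carrier (W (i + 1))\<rbrakk> \<Longrightarrow> pr i v \<psi> \<in> carrier (K (i + 1))"
    and pr_add_left: "\<lbrakk>u \<in> carrier (W i); v \<in> carrier (W i); \<psi> \<in> carrier (W (i + 1))\<rbrakk> \<Longrightarrow>
      pr i (u \<oplus>\<^bsub>W i\<^esub> v) \<psi> = pr i u \<psi> \<oplus>\<^bsub>K (i + 1)\<^esub> pr i v \<psi>"
    and pr_add_right: "\<lbrakk>v \<in> carrier (W i); \<psi> \<in> carrier (W (i + 1)); \<chi> \<in> carrier (W (i + 1))\<rbrakk> \<Longrightarrow>
      pr i v (\<psi> \<oplus>\<^bsub>W (i + 1)\<^esub> \<chi>) = pr i v \<psi> \<oplus>\<^bsub>K (i + 1)\<^esub> pr i v \<chi>"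
    and pr_right: "\<lbrakk>v \<in> carrier (W i); b \<in> carrier (K (i + 1)); \<psi> \<in> carrier (W (i + 1))\<rbrakk> \<Longrightarrow>
      pr i (v \<triangleleft>\<^bsub>W i\<^esub> b) \<psi> = pr i v \<psi> \<otimes>\<^bsub>K (i + 1)\<^esub> b"
    and pr_left: "\<lbrakk>v \<in> carrier (W i); a \<in> carrier (K (i + 1)); \<psi> \<in> carrier (W (i + 1))\<rbrakk> \<Longrightarrow>
      pr i v (a \<odot>\<^bsub>W (i + 1)\<^esub> \<psi>) = a \<otimes>\<^bsub>K (i + 1)\<^esub> pr i v \<psi>"
    and pr_mid: "\<lbrakk>v \<in> carrier (W i); c \<in> carrier (K i); \<psi> \<in> carrier (W (i + 1))\<rbrakk> \<Longrightarrow>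
      pr i (c \<odot>\<^bsub>W i\<^esub> v) \<psi> = pr i v (\<psi> \<triangleleft>\<^bsub>W (i + 1)\<^esub> c)"
    and x_in [simp]: "x1 i \<in> carrier (W i)" "x2 i \<in> carrier (W i)"
    and y_in [simp]: "y1 i \<in> carrier (W (i + 1))" "y2 i \<in> carrier (W (i + 1))"
    and expand_left: "v \<in> carrier (W i) \<Longrightarrow>
      x1 i \<triangleleft>\<^bsub>W i\<^esub> pr i v (y1 i) \<oplus>\<^bsub>W i\<^esub> x2 i \<triangleleft>\<^bsub>W i\<^esub> pr i v (y2 i) = v"
    and expand_right: "\<psi> \<in> carrier (W (i + 1)) \<Longrightarrow>
      pr i (x1 i) \<psi> \<odot>\<^bsub>W (i + 1)\<^esub> y1 i \<oplus>\<^bsub>W (i + 1)\<^esub> pr i (x2 i) \<psi> \<odot>\<^bsub>W (i + 1)\<^esub> y2 i = \<psi>"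
    and dual: "pr i (x1 i) (y1 i) = \<one>\<^bsub>K (i + 1)\<^esub>" "pr i (x1 i) (y2 i) = \<zero>\<^bsub>K (i + 1)\<^esub>"
      "pr i (x2 i) (y1 i) = \<zero>\<^bsub>K (i + 1)\<^esub>" "pr i (x2 i) (y2 i) = \<one>\<^bsub>K (i + 1)\<^esub>"

text \<open>Only the element of \<open>Q_i\<close> that belongs to the scalar 1 is required to
  vanish; \<open>kill_relators\<close> derives the rest.\<close>

locale dual_rep = dual_system K W pr x1 x2 y1 y2 + bimod_rep K W E k om
  for K :: "int \<Rightarrow> 'k ring" and W :: "int \<Rightarrow> ('k, 'w) bimod" and pr x1 x2 y1 y2
    and E :: "'e zring" and k om +
  assumes rel: "zmult E i (i + 1) (i + 2) (om i (x1 i)) (om (i + 1) (y1 i)) \<otimes>\<^bsub>comp E i (i + 2)\<^esub>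
    zmult E i (i + 1) (i + 2) (om i (x2 i)) (om (i + 1) (y2 i)) = \<one>\<^bsub>comp E i (i + 2)\<^esub>"

text \<open>The type of \<open>E\<close> in \<open>univ\<close> is the one needed for the endomorphism algebra of the module
  in \<open>exact\<close> below.\<close>

locale nc_algebra = dual_rep K W pr x1 x2 y1 y2 D k om
  for K :: "int \<Rightarrow> 'k ring" and W :: "int \<Rightarrow> ('k, 'w) bimod" and pr x1 x2 y1 y2
    and D :: "'d zring" and k om +
  assumes gen: "\<lbrakk>zsubring D B; \<And>i a. a \<in> carrier (K i) \<Longrightarrow> k i a \<in> B i i;
      \<And>i v. v \<in> carrier (W i) \<Longrightarrow> om i v \<in> B i (i + 1)\<rbrakk> \<Longrightarrow> B i j = carrier (comp D i j)"
    and univ: "dual_rep K W pr x1 x2 y1 y2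
        (E :: ('d \<times> ('d \<times> 'd) set \<Rightarrow> 'd \<times> ('d \<times> 'd) set) zring) k' om' \<Longrightarrow>
      \<exists>H. zhom D E H \<and> (\<forall>i. \<forall>a\<in>carrier (K i). H i i (k i a) = k' i a) \<and>
        (\<forall>i. \<forall>v\<in>carrier (W i). H i (i + 1) (om i v) = om' i v)"

section \<open>Generators and universal property of the non-commutative symmetric algebra\<close>

section \<open>Presentation of the non-commutative symmetric algebra\<close>

context dual_system
begin

abbreviation ev where "ev \<equiv> \<lambda>i \<psi> v. pr i v \<psi>"

abbreviation A where "A \<equiv> nc_symmetric_algebra K W ev"

definition projA where
  "projA i j x = zproj (tensor_algebra K W) (nc_ideal K W ev) i j
     (zproj (word_algebra K W) (tensor_ideal K W) i j x)"

definition kA where "kA i a = projA i i (frag_of (a, []))"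
definition omA where "omA i v = projA i (i + 1) (frag_of (\<one>\<^bsub>K i\<^esub>, [v]))"

sublocale TQ: zquotient "word_algebra K W" "tensor_ideal K W"
  unfolding zquotient_def zquotient_axioms_def using zalgebra_T zideal_tensor_ideal by blast

lemma tensor_algebra_eq: "zquot (word_algebra K W) (tensor_ideal K W) = tensor_algebra K W"
  by (simp add: tensor_algebra_def)

lemmas zalgebra_tensor = TQ.zalgebra_quot[unfolded tensor_algebra_eq]

sublocale TA: zalgebra "tensor_algebra K W" by (rule zalgebra_tensor)

lemma tensor_closed:
  "\<lbrakk>letters i vs; j = i + int (length vs)\<rbrakk> \<Longrightarrow> tensor K W i vs \<in> carrier (comp (tensor_algebra K W) i j)"
  unfolding tensor_def tensor_algebra_eq[symmetric]
  by (simp add: words_iff)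

lemma nc_relators_closed: "nc_relators K W ev i \<subseteq> carrier (comp (tensor_algebra K W) i (i + 2))"
proof -
  have "finprod (comp (tensor_algebra K W) i (i + 2)) (\<lambda>s. tensor K W i [u s, \<psi> s]) {..<n}
      \<in> carrier (comp (tensor_algebra K W) i (i + 2))"
    if "\<forall>s<n. u s \<in> carrier (W i) \<and> \<psi> s \<in> carrier (W (i + 1))" for n :: nat and u \<psi>
    using that by (intro TA.comp.finprod_closed) (auto intro!: tensor_closed)
  then show ?thesis unfolding nc_relators_def by blast
qed

lemma nc_family_closed:
  "(if j = i + 2 then nc_relators K W ev i else {}) \<subseteq> carrier (comp (tensor_algebra K W) i j)"
  using nc_relators_closed by auto

sublocale AQ: zquotient "tensor_algebra K W" "nc_ideal K W ev"
proof
  show "zideal (tensor_algebra K W) (nc_ideal K W ev)"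
    unfolding nc_ideal_def by (rule zideal_zideal_gen[OF zalgebra_tensor nc_family_closed])
qed

lemma nc_algebra_eq: "zquot (tensor_algebra K W) (nc_ideal K W ev) = A"
  by (simp add: nc_symmetric_algebra_def)

lemmas zalgebra_A = AQ.zalgebra_quot[unfolded nc_algebra_eq]

sublocale A: zalgebra A by (rule zalgebra_A)

lemma zhom_projA: "zhom (word_algebra K W) A projA"
  using zhom_compose[OF TQ.zhom_proj[unfolded tensor_algebra_eq] AQ.zhom_proj[unfolded nc_algebra_eq]]
  by (simp add: projA_def[abs_def])

lemma projA_surj:
  assumes "X \<in> carrier (comp A i j)"
  obtains x where "Poly_Mapping.keys x \<subseteq> words K W i j" "X = projA i j x"
  using assms AQ.carrier_quot[unfolded nc_algebra_eq] TQ.carrier_quot[unfolded tensor_algebra_eq]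
  unfolding projA_def by auto

lemma projA_tensor_ideal:
  assumes "x \<in> tensor_ideal K W i j"
  shows "projA i j x = \<one>\<^bsub>comp A i j\<^esub>"
  using TQ.proj_zero_iff[of x i j, unfolded tensor_algebra_eq] zidealD(2)[OF TQ.ideal assms] assms
    zhom_one_inv(1)[OF zalgebra_tensor zalgebra_A AQ.zhom_proj[unfolded nc_algebra_eq]]
  unfolding projA_def by metis

lemma projA_simps:
  "projA i j 0 = \<one>\<^bsub>comp A i j\<^esub>"
  "\<lbrakk>Poly_Mapping.keys x \<subseteq> words K W i j; Poly_Mapping.keys y \<subseteq> words K W i j\<rbrakk> \<Longrightarrow>
    projA i j (x - y) = projA i j x \<otimes>\<^bsub>comp A i j\<^esub> inv\<^bsub>comp A i j\<^esub> projA i j y"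
  "Poly_Mapping.keys x \<subseteq> words K W i j \<Longrightarrow> projA i j x \<in> carrier (comp A i j)"
proof -
  interpret group_hom "comp (word_algebra K W) i j" "comp A i j" "projA i j"
    using zhomD(1)[OF zhom_projA, of i j] A.comp.is_group by (simp add: group_hom_def group_hom_axioms_def)
  show "projA i j 0 = \<one>\<^bsub>comp A i j\<^esub>" using hom_one by simp
  show "Poly_Mapping.keys x \<subseteq> words K W i j \<Longrightarrow> projA i j x \<in> carrier (comp A i j)"
    using hom_closed by simp
  show "\<lbrakk>Poly_Mapping.keys x \<subseteq> words K W i j; Poly_Mapping.keys y \<subseteq> words K W i j\<rbrakk> \<Longrightarrow>
    projA i j (x - y) = projA i j x \<otimes>\<^bsub>comp A i j\<^esub> inv\<^bsub>comp A i j\<^esub> projA i j y"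
    using hom_mult[of x "- y"] hom_inv[of y] by simp
qed

lemma projA_eqI:
  assumes "frag_of p - frag_of q \<in> tensor_relators K W i j" "p \<in> words K W i j" "q \<in> words K W i j"
  shows "projA i j (frag_of p) = projA i j (frag_of q)"
proof -
  have "frag_of p - frag_of q \<in> tensor_ideal K W i j"
    using assms(1) unfolding tensor_ideal_def by (rule generate.incl)
  then have "projA i j (frag_of p) \<otimes>\<^bsub>comp A i j\<^esub> inv\<^bsub>comp A i j\<^esub> projA i j (frag_of q) = \<one>\<^bsub>comp A i j\<^esub>"
    using projA_tensor_ideal projA_simps(2)[of "frag_of p" i j "frag_of q"] assms(2,3) by simp
  then show ?thesis
    using projA_simps(3)[of "frag_of p" i j] projA_simps(3)[of "frag_of q" i j] assms(2,3)
      A.comp.inv_equality A.comp.inv_inv by (metis A.comp.inv_closed frag_of_in_free_Abelian_group carrier_free_Abelian_group_iff)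
qed

lemma projA_addI:
  assumes "frag_of p - frag_of q - frag_of r \<in> tensor_relators K W i j"
    "p \<in> words K W i j" "q \<in> words K W i j" "r \<in> words K W i j"
  shows "projA i j (frag_of p) = projA i j (frag_of q) \<otimes>\<^bsub>comp A i j\<^esub> projA i j (frag_of r)"
proof -
  have "frag_of p - frag_of q - frag_of r \<in> tensor_ideal K W i j"
    using assms(1) unfolding tensor_ideal_def by (rule generate.incl)
  moreover have c: "projA i j (frag_of p) \<in> carrier (comp A i j)" "projA i j (frag_of q) \<in> carrier (comp A i j)"
      "projA i j (frag_of r) \<in> carrier (comp A i j)"
    using projA_simps(3) assms(2-4) by simp_all
  ultimately have "projA i j (frag_of p) \<otimes>\<^bsub>comp A i j\<^esub> inv\<^bsub>comp A i j\<^esub> projA i j (frag_of q)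
      \<otimes>\<^bsub>comp A i j\<^esub> inv\<^bsub>comp A i j\<^esub> projA i j (frag_of r) = \<one>\<^bsub>comp A i j\<^esub>"
    using projA_tensor_ideal[of "frag_of p - frag_of q - frag_of r" i j]
      projA_simps(2)[of "frag_of p - frag_of q" i j "frag_of r"]
      projA_simps(2)[of "frag_of p" i j "frag_of q"] assms(2-4) by (simp add: keys_diff_le)
  then show ?thesis
    using c by (metis A.comp.inv_closed A.comp.inv_equality A.comp.inv_inv A.comp.inv_solve_right'
        A.comp.m_closed A.comp.m_comm)
qed

lemma projA_mult:
  assumes "p \<in> words K W i j" "q \<in> words K W j l"
  shows "zmult A i j l (projA i j (frag_of p)) (projA j l (frag_of q)) =
    projA i l (frag_of (word_mult K W i j p q))"
  using zhomD(4)[OF zhom_projA, of "frag_of p" i j "frag_of q" l] assms by simp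

lemma bimod_rep_A: "bimod_rep K W A kA omA"
proof (intro bimod_rep.intro bimod_rep_axioms.intro bimodules_axioms zalgebra_A)
  fix i a b assume a: "a \<in> carrier (K i)"
  then show "kA i a \<in> carrier (comp A i i)" by (simp add: kA_def projA_simps words_iff)
  assume b: "b \<in> carrier (K i)"
  show "kA i (a \<oplus>\<^bsub>K i\<^esub> b) = kA i a \<otimes>\<^bsub>comp A i i\<^esub> kA i b"
    unfolding kA_def by (rule projA_addI[OF relators1]) (use a b in \<open>simp_all add: words_iff\<close>)
  show "zmult A i i i (kA i a) (kA i b) = kA i (a \<otimes>\<^bsub>K i\<^esub> b)"
    using a b by (simp add: kA_def projA_mult words_iff word_mult_def)
next
  show "kA i \<one>\<^bsub>K i\<^esub> = zone A i" for i
    using zhomD(5)[OF zhom_projA] by (simp add: kA_def)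
next
  fix i v w assume v: "v \<in> carrier (W i)"
  then show "omA i v \<in> carrier (comp A i (i + 1))" by (simp add: omA_def projA_simps words_iff)
  assume w: "w \<in> carrier (W i)"
  show "omA i (v \<oplus>\<^bsub>W i\<^esub> w) = omA i v \<otimes>\<^bsub>comp A i (i + 1)\<^esub> omA i w"
    unfolding omA_def
    using relators2[of "\<one>\<^bsub>K i\<^esub>" "[]" v "[]" i "i + 1" w i] v w
    by (intro projA_addI) (simp_all add: words_iff)
next
  fix i a v assume a: "a \<in> carrier (K i)" and v: "v \<in> carrier (W i)"
  have "zmult A i i (i + 1) (kA i a) (omA i v) = projA i (i + 1) (frag_of (\<one>\<^bsub>K i\<^esub> \<otimes>\<^bsub>K i\<^esub> a, [v]))"
    using a v by (simp add: kA_def omA_def projA_mult words_iff word_mult_def)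
  also have "\<dots> = omA i (a \<odot>\<^bsub>W i\<^esub> v)"
    unfolding omA_def using relators3[of "\<one>\<^bsub>K i\<^esub>" v "[]" i "i + 1" a] a v
    by (intro projA_eqI) (simp_all add: words_iff)
  finally show "zmult A i i (i + 1) (kA i a) (omA i v) = omA i (a \<odot>\<^bsub>W i\<^esub> v)" .
next
  fix i v b assume "v \<in> carrier (W i)" "b \<in> carrier (K (i + 1))"
  then show "zmult A i (i + 1) (i + 1) (omA i v) (kA (i + 1) b) = omA i (v \<triangleleft>\<^bsub>W i\<^esub> b)"
    by (simp add: kA_def omA_def projA_mult words_iff word_mult_def)
qed

sublocale RA: bimod_rep K W A kA omA by (rule bimod_rep_A)

lemma nc_tensor_eq:
  "nc_tensor K W ev i vs = projA i (i + int (length vs)) (frag_of (\<one>\<^bsub>K i\<^esub>, vs))"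
  by (simp add: nc_tensor_def tensor_def projA_def)

lemma nc_tensor1: "nc_tensor K W ev i [v] = omA i v"
  by (simp add: nc_tensor_eq omA_def)

lemma projA_word: "letters i vs \<Longrightarrow> int (length vs) = j - i \<Longrightarrow>
    projA i j (frag_of (\<one>\<^bsub>K i\<^esub>, vs)) = RA.wv i j vs"
proof (induction vs arbitrary: i)
  case Nil
  then show ?case using zhomD(5)[OF zhom_projA] by simp
next
  case (Cons v vs)
  have "zmult A i (i + 1) j (omA i v) (projA (i + 1) j (frag_of (\<one>\<^bsub>K (i + 1)\<^esub>, vs))) =
      projA i j (frag_of (\<one>\<^bsub>K i\<^esub>, v # vs))"
    unfolding omA_def using Cons.prems by (subst projA_mult) (simp_all add: words_iff word_mult_def)
  then show ?case using Cons by simp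
qed

lemma nc_tensor2:
  assumes "v \<in> carrier (W i)" "w \<in> carrier (W (i + 1))"
  shows "nc_tensor K W ev i [v, w] = zmult A i (i + 1) (i + 2) (omA i v) (omA (i + 1) w)"
proof -
  have "nc_tensor K W ev i [v, w] = RA.wv i (i + 2) [v, w]"
    using projA_word[of i "[v, w]" "i + 2"] assms by (simp add: nc_tensor_eq)
  then show ?thesis
    using A.one_right[of "omA (i + 1) w" "i + 1" "i + 2"] RA.om_closed'[of w "i + 1" "i + 2"] assms by simp
qed

text \<open>An induction principle: a property that defines a subring and holds in degree zero and
  for the degree one generators holds for all elements.\<close>

lemma gen_A:
  assumes B: "zsubring A B" and "\<And>i a. a \<in> carrier (K i) \<Longrightarrow> kA i a \<in> B i i"
    and om: "\<And>i v. v \<in> carrier (W i) \<Longrightarrow> omA i v \<in> B i (i + 1)"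
  shows "B i j = carrier (comp A i j)"
proof
  have sub: "subgroup (B i j) (comp A i j)" for i j using B by (simp add: zsubring_def)
  show "B i j \<subseteq> carrier (comp A i j)" using subgroup.subset[OF sub] .
  have wv: "RA.wv i j vs \<in> B i j" if "letters i vs" "int (length vs) = j - i" for i j vs
    using that
  proof (induction vs arbitrary: i)
    case Nil
    then show ?case using B by (simp add: zsubring_def)
  next
    case (Cons v vs)
    then show ?case using B om by (simp add: zsubring_def)
  qed
  have word: "projA i j (frag_of p) \<in> B i j" if "p \<in> words K W i j" for p
  proof (cases p)
    case (Pair a vs)
    have w: "a \<in> carrier (K i)" "letters i vs" "int (length vs) = j - i"
      using that Pair by (auto simp: words_iff)
    have "projA i j (frag_of p) = zmult A i i j (kA i a) (projA i j (frag_of (\<one>\<^bsub>K i\<^esub>, vs)))"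
      unfolding kA_def Pair using w by (subst projA_mult) (simp_all add: words_iff word_mult_def)
    with w wv assms(2) B show ?thesis by (simp add: projA_word zsubring_def)
  qed
  show "carrier (comp A i j) \<subseteq> B i j"
  proof
    fix X assume "X \<in> carrier (comp A i j)"
    then obtain x where x: "Poly_Mapping.keys x \<subseteq> words K W i j" "X = projA i j x"
      by (rule projA_surj)
    from x(1) have "projA i j x \<in> B i j"
    proof (induction rule: words_induct)
      case zero
      then show ?case using subgroup.one_closed[OF sub] by (simp add: projA_simps)
    next
      case (diff u v)
      then show ?case
        using subgroup.m_closed[OF sub] subgroup.m_inv_closed[OF sub] by (simp add: projA_simps)
    qed (rule word)
    then show "X \<in> B i j" by (simp add: x)
  qed
qed

lemma rel_A: "zmult A i (i + 1) (i + 2) (omA i (x1 i)) (omA (i + 1) (y1 i)) \<otimes>\<^bsub>comp A i (i + 2)\<^esub>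
    zmult A i (i + 1) (i + 2) (omA i (x2 i)) (omA (i + 1) (y2 i)) = \<one>\<^bsub>comp A i (i + 2)\<^esub>"
proof -
  let ?u = "\<lambda>s::nat. if s = 0 then x1 i else x2 i" and ?p = "\<lambda>s::nat. if s = 0 then y1 i else y2 i"
  let ?C = "comp (tensor_algebra K W) i (i + 2)"
  have t: "tensor K W i [x1 i, y1 i] \<in> carrier ?C" "tensor K W i [x2 i, y2 i] \<in> carrier ?C"
    by (auto intro!: tensor_closed)
  have two: "{..<2::nat} = {0, 1}" by auto
  have fp: "finprod ?C (\<lambda>s. tensor K W i [?u s, ?p s]) {..<2} =
      tensor K W i [x1 i, y1 i] \<otimes>\<^bsub>?C\<^esub> tensor K W i [x2 i, y2 i]"
    using t unfolding two by (simp add: Pi_def)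
  \<comment> \<open>The endomorphism that belongs to the sum of the two tensors is the identity,
    which is left multiplication by 1.\<close>
  have fs: "(\<Oplus>\<^bsub>W i\<^esub>s\<in>{..<2::nat}. ?u s \<triangleleft>\<^bsub>W i\<^esub> pr i v (?p s)) = \<one>\<^bsub>K i\<^esub> \<odot>\<^bsub>W i\<^esub> v"
    if "v \<in> carrier (W i)" for v
  proof -
    have "x1 i \<triangleleft>\<^bsub>W i\<^esub> pr i v (y1 i) \<in> carrier (W i)" "x2 i \<triangleleft>\<^bsub>W i\<^esub> pr i v (y2 i) \<in> carrier (W i)"
      using that by (simp_all add: pr_closed)
    then show ?thesis
      using expand_left[OF that] that unfolding two by (simp add: Pi_def L.M.finsum_insert)
  qed
  have "finprod ?C (\<lambda>s. tensor K W i [?u s, ?p s]) {..<2} \<in> nc_relators K W ev i"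
    unfolding nc_relators_def
    by (rule CollectI, intro exI[of _ "2::nat"] exI[of _ ?u] exI[of _ ?p] conjI refl bexI[of _ "\<one>\<^bsub>K i\<^esub>"])
      (use fs in auto)
  then have "tensor K W i [x1 i, y1 i] \<otimes>\<^bsub>?C\<^esub> tensor K W i [x2 i, y2 i] \<in> nc_ideal K W ev i (i + 2)"
    using zideal_gen_incl[of "\<lambda>i j. if j = i + 2 then nc_relators K W ev i else {}" i "i + 2"] fp
    unfolding nc_ideal_def by auto
  then have "zproj (tensor_algebra K W) (nc_ideal K W ev) i (i + 2)
     (tensor K W i [x1 i, y1 i] \<otimes>\<^bsub>?C\<^esub> tensor K W i [x2 i, y2 i]) = \<one>\<^bsub>comp A i (i + 2)\<^esub>"
    using AQ.proj_zero_iff[unfolded nc_algebra_eq] t TA.comp.m_closed by blast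
  then have "nc_tensor K W ev i [x1 i, y1 i] \<otimes>\<^bsub>comp A i (i + 2)\<^esub> nc_tensor K W ev i [x2 i, y2 i] =
      \<one>\<^bsub>comp A i (i + 2)\<^esub>"
    using AQ.proj_add[unfolded nc_algebra_eq] t by (simp add: nc_tensor_def)
  then show ?thesis by (simp add: nc_tensor2)
qed

lemma dual_rep_A: "dual_rep K W pr x1 x2 y1 y2 A kA omA"
  by (intro dual_rep.intro dual_rep_axioms.intro dual_system_axioms bimod_rep_A rel_A)

end

context dual_rep
begin

lemma om_prod_closed:
  "\<lbrakk>u \<in> carrier (W i); \<psi> \<in> carrier (W (i + 1))\<rbrakk> \<Longrightarrow>
    zmult E i (i + 1) (i + 2) (om i u) (om (i + 1) \<psi>) \<in> carrier (comp E i (i + 2))"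
  using om_closed[of \<psi> "i + 1"] by (auto intro!: mult_closed om_closed)

lemma om_balanced:
  assumes "u \<in> carrier (W i)" "b \<in> carrier (K (i + 1))" "\<psi> \<in> carrier (W (i + 1))"
  shows "zmult E i (i + 1) (i + 2) (om i u) (om (i + 1) (b \<odot>\<^bsub>W (i + 1)\<^esub> \<psi>)) =
    zmult E i (i + 1) (i + 2) (om i (u \<triangleleft>\<^bsub>W i\<^esub> b)) (om (i + 1) \<psi>)"
  using mult_assoc[of "om i u" i "i + 1" "k (i + 1) b" "i + 1" "om (i + 1) \<psi>" "i + 2"]
    om_left[OF assms(2,3)] om_right[OF assms(1,2)] assms om_closed[of \<psi> "i + 1"]
  by (simp add: om_closed k_closed)

lemma om_expand:
  assumes u: "u \<in> carrier (W i)" and p: "\<psi> \<in> carrier (W (i + 1))"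
  shows "zmult E i (i + 1) (i + 2) (om i u) (om (i + 1) \<psi>) =
    zmult E i (i + 1) (i + 2) (om i (u \<triangleleft>\<^bsub>W i\<^esub> pr i (x1 i) \<psi>)) (om (i + 1) (y1 i)) \<otimes>\<^bsub>comp E i (i + 2)\<^esub>
    zmult E i (i + 1) (i + 2) (om i (u \<triangleleft>\<^bsub>W i\<^esub> pr i (x2 i) \<psi>)) (om (i + 1) (y2 i))"
proof -
  have c: "pr i (x1 i) \<psi> \<in> carrier (K (i + 1))" "pr i (x2 i) \<psi> \<in> carrier (K (i + 1))"
    using p by (simp_all add: pr_closed)
  have "om (i + 1) \<psi> = om (i + 1) (pr i (x1 i) \<psi> \<odot>\<^bsub>W (i + 1)\<^esub> y1 i) \<otimes>\<^bsub>comp E (i + 1) (i + 2)\<^esub>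
      om (i + 1) (pr i (x2 i) \<psi> \<odot>\<^bsub>W (i + 1)\<^esub> y2 i)"
    using om_add[of "pr i (x1 i) \<psi> \<odot>\<^bsub>W (i + 1)\<^esub> y1 i" "i + 1" "pr i (x2 i) \<psi> \<odot>\<^bsub>W (i + 1)\<^esub> y2 i"] c
      expand_right[OF p] by (simp add: L.smult_closed)
  then show ?thesis
    using c u om_closed[of "pr i (x1 i) \<psi> \<odot>\<^bsub>W (i + 1)\<^esub> y1 i" "i + 1"]
      om_closed[of "pr i (x2 i) \<psi> \<odot>\<^bsub>W (i + 1)\<^esub> y2 i" "i + 1"]
    by (simp add: mult_add_right om_closed om_balanced[symmetric] L.smult_closed)
qed

text \<open>Expanding every \<open>\<psi> s\<close> in the left basis \<open>y1 i\<close>,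
  \<open>y2 i\<close> and moving the coefficients across the tensor sign collects the sum into two
  terms. Their left factors are the values of the endomorphism at \<open>x1 i\<close> and
  \<open>x2 i\<close>, that is, \<open>a\<close> times these vectors. So the sum is \<open>a\<close>
  times the relation \<open>rel\<close>.\<close>

lemma kill_relators:
  assumes "\<forall>s<(n::nat). u s \<in> carrier (W i) \<and> \<psi> s \<in> carrier (W (i + 1))" and a: "a \<in> carrier (K i)"
    and eq: "\<forall>v\<in>carrier (W i). (\<Oplus>\<^bsub>W i\<^esub>s\<in>{..<n}. u s \<triangleleft>\<^bsub>W i\<^esub> pr i v (\<psi> s)) = a \<odot>\<^bsub>W i\<^esub> v"
  shows "finprod (comp E i (i + 2)) (\<lambda>s. zmult E i (i + 1) (i + 2) (om i (u s)) (om (i + 1) (\<psi> s))) {..<n} =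
    \<one>\<^bsub>comp E i (i + 2)\<^esub>"
proof -
  let ?S = "\<lambda>v m. \<Oplus>\<^bsub>W i\<^esub>s\<in>{..<m}. u s \<triangleleft>\<^bsub>W i\<^esub> pr i v (\<psi> s)"
  let ?m = "zmult E i (i + 1) (i + 2)"
  have c: "v \<in> carrier (W i) \<Longrightarrow> m \<le> n \<Longrightarrow> ?S v m \<in> carrier (W i)" for v m
    using assms(1) by (auto intro!: L.M.finsum_closed simp: pr_closed)
  \<comment> \<open>The hypothesis concerns the complete sum only, so the induction runs over
    partial sums, each kept in the form of its two coefficients.\<close>
  have "finprod (comp E i (i + 2)) (\<lambda>s. ?m (om i (u s)) (om (i + 1) (\<psi> s))) {..<m} =
    ?m (om i (?S (x1 i) m)) (om (i + 1) (y1 i)) \<otimes>\<^bsub>comp E i (i + 2)\<^esub>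
    ?m (om i (?S (x2 i) m)) (om (i + 1) (y2 i))" if "m \<le> n" for m
    using that
  proof (induction m)
    case 0
    have "om i \<zero>\<^bsub>W i\<^esub> = \<one>\<^bsub>comp E i (i + 1)\<^esub>"
      using om_add[of "\<zero>\<^bsub>W i\<^esub>" i "\<zero>\<^bsub>W i\<^esub>"] om_closed[of "\<zero>\<^bsub>W i\<^esub>" i] by (simp add: comp.l_cancel_one)
    then show ?case
      using om_closed[of "y1 i" "i + 1"] om_closed[of "y2 i" "i + 1"] by simp
  next
    case (Suc m)
    then have m: "u m \<in> carrier (W i)" "\<psi> m \<in> carrier (W (i + 1))" using assms(1) by auto
    have um: "u m \<triangleleft>\<^bsub>W i\<^esub> pr i v (\<psi> m) \<in> carrier (W i)" if "v \<in> carrier (W i)" for v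
      using m that by (simp add: pr_closed)
    have step: "?S v (Suc m) = u m \<triangleleft>\<^bsub>W i\<^esub> pr i v (\<psi> m) \<oplus>\<^bsub>W i\<^esub> ?S v m" if "v \<in> carrier (W i)" for v
      using assms(1) Suc.prems that um[OF that]
      by (simp add: lessThan_Suc L.M.finsum_insert Pi_def pr_closed)
    have pc: "?m (om i w) (om (i + 1) (y1 i)) \<in> carrier (comp E i (i + 2))"
      "?m (om i w) (om (i + 1) (y2 i)) \<in> carrier (comp E i (i + 2))" if "w \<in> carrier (W i)" for w
      using that by (simp_all add: om_prod_closed)
    have add: "?m (om i (w \<oplus>\<^bsub>W i\<^esub> w')) (om (i + 1) z) = ?m (om i w) (om (i + 1) z) \<otimes>\<^bsub>comp E i (i + 2)\<^esub>
        ?m (om i w') (om (i + 1) z)" if "w \<in> carrier (W i)" "w' \<in> carrier (W i)" "z \<in> carrier (W (i + 1))" for w w' z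
      using that om_closed[of z "i + 1"] by (simp add: om_add mult_add_left om_closed)
    have "finprod (comp E i (i + 2)) (\<lambda>s. ?m (om i (u s)) (om (i + 1) (\<psi> s))) {..<Suc m} =
      ?m (om i (u m)) (om (i + 1) (\<psi> m)) \<otimes>\<^bsub>comp E i (i + 2)\<^esub>
      finprod (comp E i (i + 2)) (\<lambda>s. ?m (om i (u s)) (om (i + 1) (\<psi> s))) {..<m}"
      using assms(1) Suc.prems by (simp add: lessThan_Suc om_prod_closed Pi_def)
    then show ?case
      using Suc c[of "x1 i" m] c[of "x2 i" m]
      by (simp add: step om_expand[OF m] add um pc comp.m_ac)
  qed
  from this[of n] have "finprod (comp E i (i + 2)) (\<lambda>s. ?m (om i (u s)) (om (i + 1) (\<psi> s))) {..<n} =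
    ?m (om i (a \<odot>\<^bsub>W i\<^esub> x1 i)) (om (i + 1) (y1 i)) \<otimes>\<^bsub>comp E i (i + 2)\<^esub>
    ?m (om i (a \<odot>\<^bsub>W i\<^esub> x2 i)) (om (i + 1) (y2 i))"
    using eq by simp
  also have "\<dots> = zmult E i i (i + 2) (k i a) (?m (om i (x1 i)) (om (i + 1) (y1 i)) \<otimes>\<^bsub>comp E i (i + 2)\<^esub>
    ?m (om i (x2 i)) (om (i + 1) (y2 i)))"
    using a om_closed[of "y1 i" "i + 1"] om_closed[of "y2 i" "i + 1"]
    by (simp add: mult_add_right k_closed om_prod_closed mult_assoc[symmetric] om_closed om_left)
  finally show ?thesis using a by (simp add: rel k_closed)
qed

text \<open>The map on words descends in two stages, through the tensor relations and then through
  \<open>nc_ideal\<close>, where \<open>kill_relators\<close> supplies the vanishing on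
  generators.\<close>

lemma univ_A:
  obtains H where "zhom A E H" "\<And>i a. a \<in> carrier (K i) \<Longrightarrow> H i i (kA i a) = k i a"
    "\<And>i v. v \<in> carrier (W i) \<Longrightarrow> H i (i + 1) (omA i v) = om i v"
proof -
  obtain H1 where H1: "zhom (tensor_algebra K W) E H1"
    and H1_eq: "\<And>i j x. x \<in> carrier (comp (word_algebra K W) i j) \<Longrightarrow>
      H1 i j (zproj (word_algebra K W) (tensor_ideal K W) i j x) = H0 i j x"
    using TQ.lift[OF zalgebra_axioms zhom_H0 H0_tensor_ideal] unfolding tensor_algebra_eq by blast
  have H1_tensor: "H1 i (i + 2) (tensor K W i [u, \<psi>]) = zmult E i (i + 1) (i + 2) (om i u) (om (i + 1) \<psi>)"
    if "u \<in> carrier (W i)" "\<psi> \<in> carrier (W (i + 1))" for i u \<psi>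
    using that H1_eq[of "frag_of (\<one>\<^bsub>K i\<^esub>, [u, \<psi>])" i "i + 2"] om_closed[of \<psi> "i + 1"] om_prod_closed[OF that]
    by (simp add: tensor_def words_iff H0_of val_def k_one one_left one_right)
  have "H1 k l s = \<one>\<^bsub>comp E k l\<^esub>" if "s \<in> (if l = k + 2 then nc_relators K W ev k else {})" for k l s
  proof -
    have l: "l = k + 2" and s: "s \<in> nc_relators K W ev k" using that by (auto split: if_splits)
    from s obtain n :: nat and u \<psi> a where
      s: "s = finprod (comp (tensor_algebra K W) k (k + 2)) (\<lambda>s. tensor K W k [u s, \<psi> s]) {..<n}"
      and m: "\<forall>s<n. u s \<in> carrier (W k) \<and> \<psi> s \<in> carrier (W (k + 1))" and a: "a \<in> carrier (K k)"
      and eq: "\<forall>v\<in>carrier (W k). (\<Oplus>\<^bsub>W k\<^esub>s\<in>{..<n}. u s \<triangleleft>\<^bsub>W k\<^esub> pr k v (\<psi> s)) = a \<odot>\<^bsub>W k\<^esub> v"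
      unfolding nc_relators_def by blast
    interpret h: group_hom "comp (tensor_algebra K W) k (k + 2)" "comp E k (k + 2)" "H1 k (k + 2)"
      using zhomD(1)[OF H1] TA.comp.is_group comp.is_group
      by (simp add: group_hom_def group_hom_axioms_def)
    have "H1 k (k + 2) (finprod (comp (tensor_algebra K W) k (k + 2)) (\<lambda>s. tensor K W k [u s, \<psi> s]) {..<r}) =
      finprod (comp E k (k + 2)) (\<lambda>s. zmult E k (k + 1) (k + 2) (om k (u s)) (om (k + 1) (\<psi> s))) {..<r}"
      if "r \<le> n" for r
      using that
    proof (induction r)
      case (Suc r)
      have t: "tensor K W k [u s, \<psi> s] \<in> carrier (comp (tensor_algebra K W) k (k + 2))" if "s < n" for s
        using that m by (auto intro!: tensor_closed)
      show ?case
        using Suc m t by (simp add: lessThan_Suc H1_tensor om_prod_closed Pi_def TA.comp.finprod_closed)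
    qed simp
    with kill_relators[OF m a eq] show ?thesis by (simp add: l s)
  qed
  then have "H1 i j x = \<one>\<^bsub>comp E i j\<^esub>" if "x \<in> nc_ideal K W ev i j" for i j x
    using zideal_gen_kernel[OF zalgebra_tensor zalgebra_axioms H1 nc_family_closed] that
    unfolding nc_ideal_def by blast
  then obtain H where H: "zhom A E H"
    and H_eq: "\<And>i j x. x \<in> carrier (comp (tensor_algebra K W) i j) \<Longrightarrow>
      H i j (zproj (tensor_algebra K W) (nc_ideal K W ev) i j x) = H1 i j x"
    using AQ.lift[OF zalgebra_axioms H1] unfolding nc_algebra_eq by blast
  have *: "H i j (projA i j (frag_of p)) = val i j p" if "p \<in> words K W i j" for i j p
    using that H_eq H1_eq TQ.proj_in[of "frag_of p" i j, unfolded tensor_algebra_eq]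
    by (simp add: projA_def H0_of)
  show thesis
  proof (rule that[OF H])
    show "H i i (kA i a) = k i a" if "a \<in> carrier (K i)" for i a
      using that * one_right[OF k_closed] by (simp add: kA_def words_iff val_def)
    show "H i (i + 1) (omA i v) = om i v" if "v \<in> carrier (W i)" for i v
      using that * one_right[OF om_closed] one_left[OF om_closed]
      by (simp add: omA_def words_iff val_def k_one)
  qed
qed

end

lemma (in dual_system) nc_algebra_A: "nc_algebra K W pr x1 x2 y1 y2 A kA omA"
proof (intro nc_algebra.intro nc_algebra_axioms.intro dual_rep_A)
  fix E :: "('z \<times> ('z \<times> 'z) set \<Rightarrow> 'z \<times> ('z \<times> 'z) set) zring" and k' om'
  assume "dual_rep K W pr x1 x2 y1 y2 E k' om'"
  then interpret E: dual_rep K W pr x1 x2 y1 y2 E k' om' .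
  show "\<exists>H. zhom A E H \<and> (\<forall>i. \<forall>a\<in>carrier (K i). H i i (kA i a) = k' i a) \<and>
      (\<forall>i. \<forall>v\<in>carrier (W i). H i (i + 1) (omA i v) = om' i v)"
    using E.univ_A by metis
qed (rule gen_A)

section \<open>Modules built by hand and exactness in the middle of the complex\<close>

section \<open>Exactness\<close>

text \<open>Maps are composed from left to right, so a homomorphism from an algebra \<open>D\<close>
  into \<open>endz M\<close> is a right \<open>D\<close>-module structure on the family
  \<open>M\<close>. Extensional functions make equality of maps depend on the carriers only.\<close>

definition endz :: "(int \<Rightarrow> 'm monoid) \<Rightarrow> ('m \<Rightarrow> 'm) zring" where
  "endz M = \<lparr>comp = (\<lambda>i j. \<lparr>carrier = hom (M i) (M j) \<inter> extensional (carrier (M i)),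
      monoid.mult = (\<lambda>f g. \<lambda>x\<in>carrier (M i). f x \<otimes>\<^bsub>M j\<^esub> g x),
      one = (\<lambda>x\<in>carrier (M i). \<one>\<^bsub>M j\<^esub>)\<rparr>),
    zmult = (\<lambda>i j l f g. \<lambda>x\<in>carrier (M i). g (f x)),
    zone = (\<lambda>i. \<lambda>x\<in>carrier (M i). x)\<rparr>"

lemma endz_simps:
  "carrier (comp (endz M) i j) = hom (M i) (M j) \<inter> extensional (carrier (M i))"
  "f \<otimes>\<^bsub>comp (endz M) i j\<^esub> g = (\<lambda>x\<in>carrier (M i). f x \<otimes>\<^bsub>M j\<^esub> g x)"
  "\<one>\<^bsub>comp (endz M) i j\<^esub> = (\<lambda>x\<in>carrier (M i). \<one>\<^bsub>M j\<^esub>)"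
  "zmult (endz M) i j l f g = (\<lambda>x\<in>carrier (M i). g (f x))"
  "zone (endz M) i = (\<lambda>x\<in>carrier (M i). x)"
  by (simp_all add: endz_def)

lemma hom_restrict_iff:
  assumes "group G"
  shows "restrict f (carrier G) \<in> hom G H \<longleftrightarrow> f \<in> hom G H"
proof -
  interpret group G by fact
  show ?thesis by (auto simp: hom_def Pi_def)
qed

lemma zalgebra_endz:
  assumes "\<And>i. comm_group (M i)"
  shows "zalgebra (endz M)"
proof -
  interpret M: comm_group "M i" for i by fact
  have hc: "f x \<in> carrier (M j)" if "f \<in> hom (M i) (M j)" "x \<in> carrier (M i)" for f i j x
    using that by (auto simp: hom_def)
  have hm: "f (x \<otimes>\<^bsub>M i\<^esub> y) = f x \<otimes>\<^bsub>M j\<^esub> f y"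
    if "f \<in> hom (M i) (M j)" "x \<in> carrier (M i)" "y \<in> carrier (M i)" for f i j x y
    using that by (auto simp: hom_def)
  show ?thesis
  proof (rule zalgebra.intro)
    fix i j
    show "comm_group (comp (endz M) i j)"
    proof (rule comm_groupI)
      fix f assume f: "f \<in> carrier (comp (endz M) i j)"
      then have fh: "f \<in> hom (M i) (M j)" by (simp add: endz_simps)
      have "(\<lambda>x. inv\<^bsub>M j\<^esub> f x) \<in> hom (M i) (M j)"
        by (rule homI) (simp_all add: hc[OF fh] hm[OF fh] M.inv_mult)
      then show "\<exists>g\<in>carrier (comp (endz M) i j). g \<otimes>\<^bsub>comp (endz M) i j\<^esub> f = \<one>\<^bsub>comp (endz M) i j\<^esub>"
        by (intro bexI[of _ "\<lambda>x\<in>carrier (M i). inv\<^bsub>M j\<^esub> f x"])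
          (auto simp: endz_simps hom_restrict_iff M.is_group hc[OF fh] intro!: ext)
    next
      fix f g assume "f \<in> carrier (comp (endz M) i j)" "g \<in> carrier (comp (endz M) i j)"
      then have fg: "f \<in> hom (M i) (M j)" "g \<in> hom (M i) (M j)" by (simp_all add: endz_simps)
      have "(\<lambda>x. f x \<otimes>\<^bsub>M j\<^esub> g x) \<in> hom (M i) (M j)"
        by (rule homI) (simp_all add: hc[OF fg(1)] hc[OF fg(2)] hm[OF fg(1)] hm[OF fg(2)] M.m_ac)
      then show "f \<otimes>\<^bsub>comp (endz M) i j\<^esub> g \<in> carrier (comp (endz M) i j)"
        by (simp add: endz_simps hom_restrict_iff M.is_group)
      show "f \<otimes>\<^bsub>comp (endz M) i j\<^esub> g = g \<otimes>\<^bsub>comp (endz M) i j\<^esub> f"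
        by (auto simp: endz_simps hc[OF fg(1)] hc[OF fg(2)] M.m_comm intro!: restrict_ext)
    next
      fix f assume "f \<in> carrier (comp (endz M) i j)"
      then have "f \<in> hom (M i) (M j)" "f \<in> extensional (carrier (M i))" by (simp_all add: endz_simps)
      then show "\<one>\<^bsub>comp (endz M) i j\<^esub> \<otimes>\<^bsub>comp (endz M) i j\<^esub> f = f"
        by (auto simp: endz_simps hc fun_eq_iff extensional_def)
    next
      show "\<one>\<^bsub>comp (endz M) i j\<^esub> \<in> carrier (comp (endz M) i j)"
        by (simp add: endz_simps hom_restrict_iff M.is_group) (simp add: hom_def)
    qed (auto simp: endz_simps hc M.m_assoc intro!: restrict_ext)
  next
    fix i j l f g assume "f \<in> carrier (comp (endz M) i j)" "g \<in> carrier (comp (endz M) j l)"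
    then show "zmult (endz M) i j l f g \<in> carrier (comp (endz M) i l)"
      using hom_compose[of f "M i" "M j" g "M l"]
      by (simp add: endz_simps hom_restrict_iff M.is_group o_def)
  next
    fix i show "zone (endz M) i \<in> carrier (comp (endz M) i i)"
      by (simp add: endz_simps hom_restrict_iff M.is_group) (simp add: hom_def)
  qed (auto simp: endz_simps hc hm fun_eq_iff extensional_def)
qed

text \<open>The rules for a right module given by actions of scalars and of letters; by the
  universal property they suffice to make the whole algebra act.\<close>

lemma (in dual_system) dual_rep_endz:
  assumes M: "\<And>m. comm_group (M m)"
    and kc: "\<And>m a z. \<lbrakk>a \<in> carrier (K m); z \<in> carrier (M m)\<rbrakk> \<Longrightarrow> \<kappa> m a z \<in> carrier (M m)"
    and kz: "\<And>m a z z'. \<lbrakk>a \<in> carrier (K m); z \<in> carrier (M m); z' \<in> carrier (M m)\<rbrakk> \<Longrightarrow>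
      \<kappa> m a (z \<otimes>\<^bsub>M m\<^esub> z') = \<kappa> m a z \<otimes>\<^bsub>M m\<^esub> \<kappa> m a z'"
    and ka: "\<And>m a b z. \<lbrakk>a \<in> carrier (K m); b \<in> carrier (K m); z \<in> carrier (M m)\<rbrakk> \<Longrightarrow>
      \<kappa> m (a \<oplus>\<^bsub>K m\<^esub> b) z = \<kappa> m a z \<otimes>\<^bsub>M m\<^esub> \<kappa> m b z"
    and km: "\<And>m a b z. \<lbrakk>a \<in> carrier (K m); b \<in> carrier (K m); z \<in> carrier (M m)\<rbrakk> \<Longrightarrow>
      \<kappa> m b (\<kappa> m a z) = \<kappa> m (a \<otimes>\<^bsub>K m\<^esub> b) z"
    and k1: "\<And>m z. z \<in> carrier (M m) \<Longrightarrow> \<kappa> m \<one>\<^bsub>K m\<^esub> z = z"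
    and oc: "\<And>m v z. \<lbrakk>v \<in> carrier (W m); z \<in> carrier (M m)\<rbrakk> \<Longrightarrow> \<omega> m v z \<in> carrier (M (m + 1))"
    and oz: "\<And>m v z z'. \<lbrakk>v \<in> carrier (W m); z \<in> carrier (M m); z' \<in> carrier (M m)\<rbrakk> \<Longrightarrow>
      \<omega> m v (z \<otimes>\<^bsub>M m\<^esub> z') = \<omega> m v z \<otimes>\<^bsub>M (m + 1)\<^esub> \<omega> m v z'"
    and oa: "\<And>m v w z. \<lbrakk>v \<in> carrier (W m); w \<in> carrier (W m); z \<in> carrier (M m)\<rbrakk> \<Longrightarrow>
      \<omega> m (v \<oplus>\<^bsub>W m\<^esub> w) z = \<omega> m v z \<otimes>\<^bsub>M (m + 1)\<^esub> \<omega> m w z"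
    and ol: "\<And>m a v z. \<lbrakk>a \<in> carrier (K m); v \<in> carrier (W m); z \<in> carrier (M m)\<rbrakk> \<Longrightarrow>
      \<omega> m v (\<kappa> m a z) = \<omega> m (a \<odot>\<^bsub>W m\<^esub> v) z"
    and or: "\<And>m a v z. \<lbrakk>a \<in> carrier (K (m + 1)); v \<in> carrier (W m); z \<in> carrier (M m)\<rbrakk> \<Longrightarrow>
      \<kappa> (m + 1) a (\<omega> m v z) = \<omega> m (v \<triangleleft>\<^bsub>W m\<^esub> a) z"
    and rel: "\<And>m z. z \<in> carrier (M m) \<Longrightarrow>
      \<omega> (m + 1) (y1 m) (\<omega> m (x1 m) z) \<otimes>\<^bsub>M (m + 2)\<^esub> \<omega> (m + 1) (y2 m) (\<omega> m (x2 m) z) = \<one>\<^bsub>M (m + 2)\<^esub>"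
  shows "dual_rep K W pr x1 x2 y1 y2 (endz M) (\<lambda>m a. restrict (\<kappa> m a) (carrier (M m)))
    (\<lambda>m v. restrict (\<omega> m v) (carrier (M m)))"
proof -
  have g: "Group.group (M m)" for m using M by (simp add: comm_group_def)
  have kh: "a \<in> carrier (K m) \<Longrightarrow> \<kappa> m a \<in> hom (M m) (M m)" for m a
    by (auto simp: hom_def kc kz)
  have oh: "v \<in> carrier (W m) \<Longrightarrow> \<omega> m v \<in> hom (M m) (M (m + 1))" for m v
    by (auto simp: hom_def oc oz)
  show ?thesis
    by (intro dual_rep.intro dual_rep_axioms.intro bimod_rep.intro bimod_rep_axioms.intro
        dual_system_axioms bimodules_axioms zalgebra_endz M)
      (auto simp: endz_simps hom_restrict_iff[OF g] kh oh kc oc ka km k1 oa ol or rel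
        intro!: restrict_ext)
qed

context dual_rep
begin

lemma K_add2 [simp]: "K (i + 2) = K i" by (rule period)

abbreviation GG where "GG s n \<equiv> comp E s (n + 1) \<times>\<times> comp E s (n + 1)"

lemma GG_group: "comm_group (GG s n)"
  by (rule group.group_comm_groupI) (auto simp: DirProd_group comp.is_group comp.m_comm)

sublocale GG: comm_group "GG s n" for s n by (rule GG_group)

text \<open>In the left basis \<open>y1 n\<close>, \<open>y2 n\<close>, the space \<open>GG s n\<close> is \<open>E\<^sub>s\<^sub>,\<^sub>n\<^sub>+\<^sub>1 \<otimes> W (n + 1)\<close>;
  \<open>ten s n p v\<close> is the tensor \<open>p \<otimes> v\<close>, \<open>ract\<close> the right scalar multiplication, \<open>Phi\<close> the map
  \<open>q \<mapsto> \<Sum> q x\<^sub>s \<otimes> y\<^sub>s\<close> and \<open>mulT\<close> the multiplication.\<close>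

definition ten where
  "ten s n p v = (zmult E s (n + 1) (n + 1) p (k (n + 1) (pr n (x1 n) v)),
    zmult E s (n + 1) (n + 1) p (k (n + 1) (pr n (x2 n) v)))"

definition ract where
  "ract s n a z = ten s n (fst z) (y1 n \<triangleleft>\<^bsub>W (n + 1)\<^esub> a) \<otimes>\<^bsub>GG s n\<^esub> ten s n (snd z) (y2 n \<triangleleft>\<^bsub>W (n + 1)\<^esub> a)"

definition Phi where
  "Phi s n q = (zmult E s n (n + 1) q (om n (x1 n)), zmult E s n (n + 1) q (om n (x2 n)))"

definition mulT where
  "mulT s n z = zmult E s (n + 1) (n + 2) (fst z) (om (n + 1) (y1 n)) \<otimes>\<^bsub>comp E s (n + 2)\<^esub>
    zmult E s (n + 1) (n + 2) (snd z) (om (n + 1) (y2 n))"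

lemma om_closed2: "v \<in> carrier (W (n + 1)) \<Longrightarrow> om (n + 1) v \<in> carrier (comp E (n + 1) (n + 2))"
  using om_closed[of v "n + 1"] by simp

lemma r_closed2 [simp]: "\<lbrakk>v \<in> carrier (W (n + 1)); a \<in> carrier (K n)\<rbrakk> \<Longrightarrow> v \<triangleleft>\<^bsub>W (n + 1)\<^esub> a \<in> carrier (W (n + 1))"
  using r_closed[of v "n + 1" a] by simp

lemmas clos = mult_closed k_closed om_closed om_closed2 pr_closed L.smult_closed comp.m_closed

lemma ten_closed: "\<lbrakk>p \<in> carrier (comp E s (n + 1)); v \<in> carrier (W (n + 1))\<rbrakk> \<Longrightarrow> ten s n p v \<in> carrier (GG s n)"
  by (simp add: ten_def clos)

lemma ten_add_left:
  "\<lbrakk>p \<in> carrier (comp E s (n + 1)); q \<in> carrier (comp E s (n + 1)); v \<in> carrier (W (n + 1))\<rbrakk> \<Longrightarrow>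
    ten s n (p \<otimes>\<^bsub>comp E s (n + 1)\<^esub> q) v = ten s n p v \<otimes>\<^bsub>GG s n\<^esub> ten s n q v"
  by (simp add: ten_def clos mult_add_left)

lemma ten_add_right:
  "\<lbrakk>p \<in> carrier (comp E s (n + 1)); v \<in> carrier (W (n + 1)); w \<in> carrier (W (n + 1))\<rbrakk> \<Longrightarrow>
    ten s n p (v \<oplus>\<^bsub>W (n + 1)\<^esub> w) = ten s n p v \<otimes>\<^bsub>GG s n\<^esub> ten s n p w"
  by (simp add: ten_def clos mult_add_right pr_add_right k_add)

lemma ten_bal:
  assumes "p \<in> carrier (comp E s (n + 1))" "b \<in> carrier (K (n + 1))" "v \<in> carrier (W (n + 1))"
  shows "ten s n (zmult E s (n + 1) (n + 1) p (k (n + 1) b)) v = ten s n p (b \<odot>\<^bsub>W (n + 1)\<^esub> v)"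
  using assms by (simp add: ten_def clos mult_assoc pr_left k_mult)

lemma ten_y:
  assumes "p \<in> carrier (comp E s (n + 1))"
  shows "ten s n p (y1 n) = (p, \<one>\<^bsub>comp E s (n + 1)\<^esub>)" "ten s n p (y2 n) = (\<one>\<^bsub>comp E s (n + 1)\<^esub>, p)"
proof -
  have "k (n + 1) \<zero>\<^bsub>K (n + 1)\<^esub> = \<one>\<^bsub>comp E (n + 1) (n + 1)\<^esub>"
    using k_add[of "\<zero>\<^bsub>K (n + 1)\<^esub>" "n + 1" "\<zero>\<^bsub>K (n + 1)\<^esub>"] k_closed[of "\<zero>\<^bsub>K (n + 1)\<^esub>" "n + 1"]
    by (simp add: comp.l_cancel_one)
  then show "ten s n p (y1 n) = (p, \<one>\<^bsub>comp E s (n + 1)\<^esub>)" "ten s n p (y2 n) = (\<one>\<^bsub>comp E s (n + 1)\<^esub>, p)"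
    using assms by (simp_all add: ten_def dual k_one one_right)
qed

lemma GG_decomp:
  assumes "z \<in> carrier (GG s n)"
  shows "z = ten s n (fst z) (y1 n) \<otimes>\<^bsub>GG s n\<^esub> ten s n (snd z) (y2 n)"
  using assms by (cases z) (simp add: ten_y)

lemma ract_closed: "\<lbrakk>a \<in> carrier (K n); z \<in> carrier (GG s n)\<rbrakk> \<Longrightarrow> ract s n a z \<in> carrier (GG s n)"
  unfolding ract_def by (intro GG.m_closed ten_closed) auto

lemma ract_add:
  assumes "a \<in> carrier (K n)" "z \<in> carrier (GG s n)" "z' \<in> carrier (GG s n)"
  shows "ract s n a (z \<otimes>\<^bsub>GG s n\<^esub> z') = ract s n a z \<otimes>\<^bsub>GG s n\<^esub> ract s n a z'"
proof -
  have c: "ten s n p (y1 n \<triangleleft>\<^bsub>W (n + 1)\<^esub> a) \<in> carrier (GG s n)" "ten s n p (y2 n \<triangleleft>\<^bsub>W (n + 1)\<^esub> a) \<in> carrier (GG s n)"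
    if "p \<in> carrier (comp E s (n + 1))" for p
    using that assms by (simp_all only: ten_closed r_closed2 y_in)
  have z: "fst z \<in> carrier (comp E s (n + 1))" "snd z \<in> carrier (comp E s (n + 1))"
    "fst z' \<in> carrier (comp E s (n + 1))" "snd z' \<in> carrier (comp E s (n + 1))"
    using assms by auto
  moreover have "fst (z \<otimes>\<^bsub>GG s n\<^esub> z') = fst z \<otimes>\<^bsub>comp E s (n + 1)\<^esub> fst z'"
    "snd (z \<otimes>\<^bsub>GG s n\<^esub> z') = snd z \<otimes>\<^bsub>comp E s (n + 1)\<^esub> snd z'"
    by (simp_all add: mult_DirProd')
  ultimately show ?thesis
    using c assms(1) unfolding ract_def
    by (simp only: ten_add_left r_closed2 y_in GG.m_ac GG.m_closed)
qed

text \<open>The action was defined through the basis \<open>y1 n\<close>, \<open>y2 n\<close>; on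
  tensors it is the expected right multiplication of the second factor.\<close>

lemma ract_ten:
  assumes p: "p \<in> carrier (comp E s (n + 1))" and v: "v \<in> carrier (W (n + 1))" and a: "a \<in> carrier (K n)"
  shows "ract s n a (ten s n p v) = ten s n p (v \<triangleleft>\<^bsub>W (n + 1)\<^esub> a)"
proof -
  let ?c1 = "pr n (x1 n) v" and ?c2 = "pr n (x2 n) v"
  have c: "?c1 \<in> carrier (K (n + 1))" "?c2 \<in> carrier (K (n + 1))" using v by (simp_all add: pr_closed)
  have "v \<triangleleft>\<^bsub>W (n + 1)\<^esub> a = (?c1 \<odot>\<^bsub>W (n + 1)\<^esub> y1 n \<oplus>\<^bsub>W (n + 1)\<^esub> ?c2 \<odot>\<^bsub>W (n + 1)\<^esub> y2 n) \<triangleleft>\<^bsub>W (n + 1)\<^esub> a"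
    using expand_right[OF v] by simp
  also have "\<dots> = ?c1 \<odot>\<^bsub>W (n + 1)\<^esub> (y1 n \<triangleleft>\<^bsub>W (n + 1)\<^esub> a) \<oplus>\<^bsub>W (n + 1)\<^esub> ?c2 \<odot>\<^bsub>W (n + 1)\<^esub> (y2 n \<triangleleft>\<^bsub>W (n + 1)\<^esub> a)"
    using c a r_add_left[of "?c1 \<odot>\<^bsub>W (n + 1)\<^esub> y1 n" "n + 1" "?c2 \<odot>\<^bsub>W (n + 1)\<^esub> y2 n" a]
      lr_assoc[of ?c1 "n + 1" "y1 n" a] lr_assoc[of ?c2 "n + 1" "y2 n" a]
    by (simp add: L.smult_closed)
  finally have "ten s n p (v \<triangleleft>\<^bsub>W (n + 1)\<^esub> a) = ten s n p (?c1 \<odot>\<^bsub>W (n + 1)\<^esub> (y1 n \<triangleleft>\<^bsub>W (n + 1)\<^esub> a)) \<otimes>\<^bsub>GG s n\<^esub>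
      ten s n p (?c2 \<odot>\<^bsub>W (n + 1)\<^esub> (y2 n \<triangleleft>\<^bsub>W (n + 1)\<^esub> a))"
    using p c a by (simp only: ten_add_right L.smult_closed r_closed2 y_in)
  then show ?thesis
    using p c a unfolding ract_def by (simp only: ten_bal[symmetric] r_closed2 y_in) (simp only: ten_def fst_conv snd_conv)
qed

lemma ract_arg_add:
  assumes "a \<in> carrier (K n)" "b \<in> carrier (K n)" "z \<in> carrier (GG s n)"
  shows "ract s n (a \<oplus>\<^bsub>K n\<^esub> b) z = ract s n a z \<otimes>\<^bsub>GG s n\<^esub> ract s n b z"
proof -
  have "y \<triangleleft>\<^bsub>W (n + 1)\<^esub> (a \<oplus>\<^bsub>K n\<^esub> b) = y \<triangleleft>\<^bsub>W (n + 1)\<^esub> a \<oplus>\<^bsub>W (n + 1)\<^esub> y \<triangleleft>\<^bsub>W (n + 1)\<^esub> b"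
    if "y \<in> carrier (W (n + 1))" for y
    using r_add_right[of y "n + 1" a b] that assms by simp
  moreover have "fst z \<in> carrier (comp E s (n + 1))" "snd z \<in> carrier (comp E s (n + 1))"
    using assms by auto
  ultimately show ?thesis
    using assms ten_closed unfolding ract_def
    by (simp only: y_in ten_add_right r_closed2 GG.m_ac GG.m_closed)
qed

lemma ract_mult:
  assumes "a \<in> carrier (K n)" "b \<in> carrier (K n)" "z \<in> carrier (GG s n)"
  shows "ract s n b (ract s n a z) = ract s n (a \<otimes>\<^bsub>K n\<^esub> b) z"
proof -
  have y: "y \<triangleleft>\<^bsub>W (n + 1)\<^esub> a \<triangleleft>\<^bsub>W (n + 1)\<^esub> b = y \<triangleleft>\<^bsub>W (n + 1)\<^esub> (a \<otimes>\<^bsub>K n\<^esub> b)"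
    if "y \<in> carrier (W (n + 1))" for y
    using r_assoc[of y "n + 1" a b] that assms by simp
  have z: "fst z \<in> carrier (comp E s (n + 1))" "snd z \<in> carrier (comp E s (n + 1))"
    using assms by auto
  have "ract s n b (ract s n a z) = ract s n b (ten s n (fst z) (y1 n \<triangleleft>\<^bsub>W (n + 1)\<^esub> a)) \<otimes>\<^bsub>GG s n\<^esub>
      ract s n b (ten s n (snd z) (y2 n \<triangleleft>\<^bsub>W (n + 1)\<^esub> a))"
    using z assms unfolding ract_def[of s n a] by (intro ract_add ten_closed) auto
  then show ?thesis
    using z assms by (simp only: ract_ten r_closed2 y_in y) (simp only: ract_def)
qed

lemma ract_one:
  assumes "z \<in> carrier (GG s n)"
  shows "ract s n \<one>\<^bsub>K n\<^esub> z = z"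
proof -
  have "y \<triangleleft>\<^bsub>W (n + 1)\<^esub> \<one>\<^bsub>K n\<^esub> = y" if "y \<in> carrier (W (n + 1))" for y
    using r_one[of y "n + 1"] that by simp
  then show ?thesis using GG_decomp[OF assms] by (simp add: ract_def)
qed

lemma Phi_closed: "q \<in> carrier (comp E s n) \<Longrightarrow> Phi s n q \<in> carrier (GG s n)"
  by (simp add: Phi_def clos)

lemma Phi_add: "\<lbrakk>q \<in> carrier (comp E s n); r \<in> carrier (comp E s n)\<rbrakk> \<Longrightarrow>
    Phi s n (q \<otimes>\<^bsub>comp E s n\<^esub> r) = Phi s n q \<otimes>\<^bsub>GG s n\<^esub> Phi s n r"
  by (simp add: Phi_def clos mult_add_left)

text \<open>The canonical element commutes with scalars: the sums of \<open>a x_s (x) y_s\<close>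
  and of \<open>x_s (x) y_s a\<close> agree, since both belong to left multiplication by
  \<open>a\<close>. Hence \<open>Phi\<close> is linear on the right.\<close>

lemma ract_Phi:
  assumes q: "q \<in> carrier (comp E s n)" and a: "a \<in> carrier (K n)"
  shows "ract s n a (Phi s n q) = Phi s n (zmult E s n n q (k n a))"
proof -
  let ?m = "zmult E s n (n + 1) q"
  have *: "zmult E s (n + 1) (n + 1) (?m (om n (x1 n))) (k (n + 1) (pr n x (y1 n \<triangleleft>\<^bsub>W (n + 1)\<^esub> a))) \<otimes>\<^bsub>comp E s (n + 1)\<^esub>
      zmult E s (n + 1) (n + 1) (?m (om n (x2 n))) (k (n + 1) (pr n x (y2 n \<triangleleft>\<^bsub>W (n + 1)\<^esub> a))) =
      zmult E s n (n + 1) (zmult E s n n q (k n a)) (om n x)" if x: "x \<in> carrier (W n)" for x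
  proof -
    have ax: "a \<odot>\<^bsub>W n\<^esub> x \<in> carrier (W n)" using a x by (simp add: L.smult_closed)
    have pc: "pr n (a \<odot>\<^bsub>W n\<^esub> x) (y1 n) \<in> carrier (K (n + 1))" "pr n (a \<odot>\<^bsub>W n\<^esub> x) (y2 n) \<in> carrier (K (n + 1))"
      using ax by (simp_all add: pr_closed)
    have "zmult E s n (n + 1) (zmult E s n n q (k n a)) (om n x) = ?m (om n (a \<odot>\<^bsub>W n\<^esub> x))"
      using q a x by (simp add: mult_assoc clos om_left)
    also have "\<dots> = ?m (om n (x1 n \<triangleleft>\<^bsub>W n\<^esub> pr n (a \<odot>\<^bsub>W n\<^esub> x) (y1 n) \<oplus>\<^bsub>W n\<^esub>
        x2 n \<triangleleft>\<^bsub>W n\<^esub> pr n (a \<odot>\<^bsub>W n\<^esub> x) (y2 n)))"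
      using expand_left[OF ax] by simp
    also have "\<dots> = zmult E s (n + 1) (n + 1) (?m (om n (x1 n))) (k (n + 1) (pr n (a \<odot>\<^bsub>W n\<^esub> x) (y1 n))) \<otimes>\<^bsub>comp E s (n + 1)\<^esub>
      zmult E s (n + 1) (n + 1) (?m (om n (x2 n))) (k (n + 1) (pr n (a \<odot>\<^bsub>W n\<^esub> x) (y2 n)))"
      using q pc by (simp add: om_add mult_add_right clos mult_assoc om_right)
    finally show ?thesis using a x by (simp add: pr_mid)
  qed
  show ?thesis
    using *[of "x1 n"] *[of "x2 n"] by (simp add: ract_def ten_def Phi_def)
qed

lemma mulT_closed: "z \<in> carrier (GG s n) \<Longrightarrow> mulT s n z \<in> carrier (comp E s (n + 2))"
  by (auto simp: mulT_def clos)

lemma mulT_add: "\<lbrakk>z \<in> carrier (GG s n); z' \<in> carrier (GG s n)\<rbrakk> \<Longrightarrow>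
    mulT s n (z \<otimes>\<^bsub>GG s n\<^esub> z') = mulT s n z \<otimes>\<^bsub>comp E s (n + 2)\<^esub> mulT s n z'"
  by (cases z; cases z') (simp add: mulT_def clos mult_add_left comp.m_ac)

lemma mulT_ten:
  assumes p: "p \<in> carrier (comp E s (n + 1))" and v: "v \<in> carrier (W (n + 1))"
  shows "mulT s n (ten s n p v) = zmult E s (n + 1) (n + 2) p (om (n + 1) v)"
proof -
  let ?c1 = "pr n (x1 n) v" and ?c2 = "pr n (x2 n) v"
  have c: "?c1 \<in> carrier (K (n + 1))" "?c2 \<in> carrier (K (n + 1))" using v by (simp_all add: pr_closed)
  have "zmult E s (n + 1) (n + 2) p (om (n + 1) v) =
      zmult E s (n + 1) (n + 2) p (om (n + 1) (?c1 \<odot>\<^bsub>W (n + 1)\<^esub> y1 n \<oplus>\<^bsub>W (n + 1)\<^esub> ?c2 \<odot>\<^bsub>W (n + 1)\<^esub> y2 n))"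
    using expand_right[OF v] by simp
  also have "\<dots> = mulT s n (ten s n p v)"
    using p c om_add[of "?c1 \<odot>\<^bsub>W (n + 1)\<^esub> y1 n" "n + 1" "?c2 \<odot>\<^bsub>W (n + 1)\<^esub> y2 n"]
      om_left[of ?c1 "n + 1" "y1 n"] om_left[of ?c2 "n + 1" "y2 n"]
    by (simp add: mulT_def ten_def clos mult_assoc mult_add_right)
  finally show ?thesis by simp
qed

lemma mulT_ract:
  assumes "z \<in> carrier (GG s n)" "a \<in> carrier (K n)"
  shows "mulT s n (ract s n a z) = zmult E s (n + 2) (n + 2) (mulT s n z) (k (n + 2) a)"
proof -
  have z: "fst z \<in> carrier (comp E s (n + 1))" "snd z \<in> carrier (comp E s (n + 1))"
    using assms by auto
  have o: "om (n + 1) (y \<triangleleft>\<^bsub>W (n + 1)\<^esub> a) = zmult E (n + 1) (n + 2) (n + 2) (om (n + 1) y) (k (n + 2) a)"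
    if "y \<in> carrier (W (n + 1))" for y
    using om_right[of y "n + 1" a] that assms by simp
  have kc: "k (n + 2) a \<in> carrier (comp E (n + 2) (n + 2))"
    using k_closed[of a "n + 2"] assms by simp
  have "mulT s n (ract s n a z) = mulT s n (ten s n (fst z) (y1 n \<triangleleft>\<^bsub>W (n + 1)\<^esub> a)) \<otimes>\<^bsub>comp E s (n + 2)\<^esub>
      mulT s n (ten s n (snd z) (y2 n \<triangleleft>\<^bsub>W (n + 1)\<^esub> a))"
    using z assms unfolding ract_def by (intro mulT_add ten_closed) auto
  then show ?thesis
    using z assms kc by (simp add: mulT_ten o mult_assoc[symmetric] clos) (simp add: mulT_def mult_add_left clos kc)
qed

lemma mulT_Phi:
  assumes "q \<in> carrier (comp E s n)"
  shows "mulT s n (Phi s n q) = \<one>\<^bsub>comp E s (n + 2)\<^esub>"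
proof -
  have "mulT s n (Phi s n q) = zmult E s n (n + 2) q
      (zmult E n (n + 1) (n + 2) (om n (x1 n)) (om (n + 1) (y1 n)) \<otimes>\<^bsub>comp E n (n + 2)\<^esub>
       zmult E n (n + 1) (n + 2) (om n (x2 n)) (om (n + 1) (y2 n)))"
    using assms by (simp add: mulT_def Phi_def mult_assoc clos mult_add_right)
  with assms show ?thesis by (simp add: rel)
qed

end


context nc_algebra
begin

text \<open>The family that is everything on and above the diagonal and zero below it is a subring
  containing the generators.\<close>

lemma lower_zero:
  assumes "j < i"
  shows "carrier (comp D i j) = {\<one>\<^bsub>comp D i j\<^esub>}"
proof -
  let ?B = "\<lambda>i j. if i \<le> j then carrier (comp D i j) else {\<one>\<^bsub>comp D i j\<^esub>}"
  have "zsubring D ?B"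
    unfolding zsubring_def
  proof (intro conjI allI ballI)
    show "subgroup (?B i j) (comp D i j)" for i j
      by (simp add: comp.subgroup_self comp.triv_subgroup)
    show "zmult D i j l x y \<in> ?B i l" if "x \<in> ?B i j" "y \<in> ?B j l" for i j l x y
      using that by (auto simp: mult_closed split: if_splits)
  qed (simp add: one_closed)
  from gen[OF this, of i j] assms show ?thesis
    by (simp add: k_closed om_closed)
qed

text \<open>A module is built that agrees with row \<open>s\<close> of \<open>D\<close> up to degree
  \<open>n + 1\<close>, is the cokernel of \<open>Phi\<close> in degree \<open>n + 2\<close> and
  vanishes beyond. The defining relation holds in it exactly because \<open>Phi\<close> was divided
  out, so \<open>D\<close> acts on it. The element \<open>mulT s n z\<close> sends the unit of
  degree \<open>s\<close> to the class of \<open>z\<close>; if it is zero, \<open>z\<close> lies in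
  the image of \<open>Phi\<close>.\<close>

lemma exact:
  assumes z: "z \<in> carrier (GG s n)" and z0: "mulT s n z = \<one>\<^bsub>comp D s (n + 2)\<^esub>"
  shows "\<exists>q\<in>carrier (comp D s n). z = Phi s n q"
proof (cases "s \<le> n + 1")
  case False
  then have "carrier (comp D s (n + 1)) = {\<one>\<^bsub>comp D s (n + 1)\<^esub>}" by (simp add: lower_zero)
  with z have "z = Phi s n \<one>\<^bsub>comp D s n\<^esub>" by (auto simp: Phi_def om_closed)
  then show ?thesis by blast
next
  case sn: True
  define H where "H = Phi s n ` carrier (comp D s n)"
  interpret P: group_hom "comp D s n" "GG s n" "Phi s n"
    by (intro group_hom.intro group_hom_axioms.intro comp.is_group GG.is_group homI Phi_closed Phi_add)
  have Hsub: "subgroup H (GG s n)" unfolding H_def by (rule P.img_is_subgroup)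
  then have Hn: "H \<lhd> GG s n" using GG.normal_iff_subgroup by blast
  define Q where "Q = GG s n Mod H"
  have Q: "comm_group Q" unfolding Q_def by (rule GG.abelian_FactGroup[OF Hsub])
  interpret Q: comm_group Q by (rule Q)
  define c where "c z = H #>\<^bsub>GG s n\<^esub> z" for z
  have c_add: "c (u \<otimes>\<^bsub>GG s n\<^esub> v) = c u \<otimes>\<^bsub>Q\<^esub> c v" if "u \<in> carrier (GG s n)" "v \<in> carrier (GG s n)" for u v
    using normal.rcos_sum[OF Hn that] by (simp add: c_def Q_def FactGroup_def)
  have c_in: "c u \<in> carrier Q" if "u \<in> carrier (GG s n)" for u
    using that by (auto simp: c_def Q_def FactGroup_def RCOSETS_def)
  have c_surj: "\<exists>u\<in>carrier (GG s n). X = c u" if "X \<in> carrier Q" for X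
    using that unfolding c_def Q_def FactGroup_def RCOSETS_def by auto
  have c_zero: "u \<in> H" if "u \<in> carrier (GG s n)" "c u = \<one>\<^bsub>Q\<^esub>" for u
    using GG.coset_join1[OF _ that(1) Hsub] that(2) by (simp add: c_def Q_def FactGroup_def)
  have c_H: "c u = \<one>\<^bsub>Q\<^esub>" if "u \<in> H" for u
    using GG.coset_join2[OF subgroup.mem_carrier[OF Hsub that] Hsub that]
    by (simp add: c_def Q_def FactGroup_def)
  \<comment> \<open>The right action of \<open>K n\<close> on the cokernel through representatives;
    by \<open>ract_Phi\<close> the image of \<open>Phi\<close> is stable, so the choice does not
    matter.\<close>
  define R where "R a X = c (ract s n a (SOME u. u \<in> carrier (GG s n) \<and> X = c u))" for a X
  have R: "R a (c u) = c (ract s n a u)" if u: "u \<in> carrier (GG s n)" and a: "a \<in> carrier (K n)" for a u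
  proof -
    define v where "v = (SOME v. v \<in> carrier (GG s n) \<and> c u = c v)"
    have v: "v \<in> carrier (GG s n)" "c u = c v"
      using someI[of "\<lambda>v. v \<in> carrier (GG s n) \<and> c u = c v" u] u unfolding v_def by auto
    have "v \<in> H #>\<^bsub>GG s n\<^esub> u" using v GG.rcos_self[OF v(1) Hsub] by (simp add: c_def)
    then obtain q where q: "q \<in> carrier (comp D s n)" "v = Phi s n q \<otimes>\<^bsub>GG s n\<^esub> u"
      unfolding r_coset_def H_def by blast
    have "c (ract s n a v) = c (Phi s n (zmult D s n n q (k n a))) \<otimes>\<^bsub>Q\<^esub> c (ract s n a u)"
      using q u a Phi_closed[OF q(1)] by (simp only: ract_add ract_Phi c_add ract_closed Phi_closed mult_closed k_closed)
    also have "\<dots> = c (ract s n a u)"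
      using c_H[of "Phi s n (zmult D s n n q (k n a))"] q a u c_in ract_closed
      by (simp add: H_def mult_closed k_closed)
    finally show ?thesis by (simp add: R_def v_def)
  qed
  \<comment> \<open>Elements of \<open>D\<close> and cosets have different types, so every degree is
    a product of two groups, with a one-element group in each place that is to vanish.\<close>
  define M where "M m = (if m \<le> n + 1 then comp D s m else singleton_group undefined) \<times>\<times>
    (if m = n + 2 then Q else singleton_group {})" for m :: int
  define \<kappa> where "\<kappa> m a z = (if m \<le> n + 1 then zmult D s m m (fst z) (k m a) else fst z,
    if m = n + 2 then R a (snd z) else snd z)" for m a and z :: "'d \<times> ('d \<times> 'd) set"
  define \<omega> where "\<omega> m v z = (if m \<le> n then zmult D s m (m + 1) (fst z) (om m v) else undefined,
    if m = n + 1 then c (ten s n (fst z) v) else {})" for m v and z :: "'d \<times> ('d \<times> 'd) set"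
  have Mg: "comm_group (M m)" for m
  proof -
    have "comm_group (A1 \<times>\<times> A2)" if "comm_group A1" "comm_group A2" for A1 :: "'d monoid" and A2 :: "('d \<times> 'd) set monoid"
      using that by (intro group.group_comm_groupI DirProd_group)
        (auto simp: comm_group_def comm_monoid.m_comm)
    then show ?thesis using comp_group Q by (simp add: M_def)
  qed
  have M1: "M m = comp D s m \<times>\<times> singleton_group {}" if "m \<le> n + 1" for m
    using that by (simp add: M_def)
  have M2: "M (n + 2) = singleton_group undefined \<times>\<times> Q" by (simp add: M_def)
  have M3: "M m = singleton_group undefined \<times>\<times> singleton_group {}" if "m > n + 2" for m
    using that by (simp add: M_def)
  have mcases: "(m \<le> n \<Longrightarrow> P) \<Longrightarrow> (m = n + 1 \<Longrightarrow> P) \<Longrightarrow> (m = n + 2 \<Longrightarrow> P) \<Longrightarrow> (m > n + 2 \<Longrightarrow> P) \<Longrightarrow> P" for m P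
    by linarith
  have sg [simp]: "u \<otimes>\<^bsub>singleton_group a\<^esub> v = a" "\<one>\<^bsub>singleton_group a\<^esub> = a" for u v and a :: 'z
    by (simp_all add: singleton_group_def)
  have sg' [simp]: "u \<otimes>\<^bsub>singleton_group a\<^esub> v = a" "\<one>\<^bsub>singleton_group a\<^esub> = a" for u v and a :: 'y
    by (simp_all add: singleton_group_def)
  note [simp del] = carrier_DirProd mult_DirProd one_DirProd
  have Mc [simp]: "m \<le> n + 1 \<Longrightarrow> carrier (M m) = carrier (comp D s m) \<times> {{}}"
    "carrier (M (n + 2)) = {undefined} \<times> carrier Q" "m > n + 2 \<Longrightarrow> carrier (M m) = {undefined} \<times> {{}}" for m
    by (simp_all add: M1 M2 M3 carrier_DirProd)
  have Mm [simp]: "m \<le> n + 1 \<Longrightarrow> (p, X) \<otimes>\<^bsub>M m\<^esub> (p', X') = (p \<otimes>\<^bsub>comp D s m\<^esub> p', {})"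
    "(p, X) \<otimes>\<^bsub>M (n + 2)\<^esub> (p', X') = (undefined, X \<otimes>\<^bsub>Q\<^esub> X')"
    "m > n + 2 \<Longrightarrow> (p, X) \<otimes>\<^bsub>M m\<^esub> (p', X') = (undefined, {})" for m p X p' X'
    by (simp_all add: M1 M2 M3 mult_DirProd)
  have Mo [simp]: "m \<le> n + 1 \<Longrightarrow> \<one>\<^bsub>M m\<^esub> = (\<one>\<^bsub>comp D s m\<^esub>, {})"
    "\<one>\<^bsub>M (n + 2)\<^esub> = (undefined, \<one>\<^bsub>Q\<^esub>)" "m > n + 2 \<Longrightarrow> \<one>\<^bsub>M m\<^esub> = (undefined, {})" for m
    by (simp_all add: M1 M2 M3 one_DirProd)
  have arith [simp]: "n + 1 + 1 = n + 2" "n + 2 + 1 = n + 3" by simp_all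
  have rep: "dual_rep K W pr x1 x2 y1 y2 (endz M) (\<lambda>m a. restrict (\<kappa> m a) (carrier (M m)))
    (\<lambda>m v. restrict (\<omega> m v) (carrier (M m)))"
  proof (rule dual_rep_endz[OF Mg])
    note [simp] = \<kappa>_def \<omega>_def clos mult_add_left mult_add_right k_add om_add mult_assoc k_mult k_one
      one_right om_left om_right
    note [simp] = R c_in ract_closed ten_closed ract_add ract_arg_add ract_mult ract_one ten_add_left
      ten_add_right ten_bal ract_ten c_add[symmetric]
    note [dest!] = c_surj
    show "\<kappa> m a z \<in> carrier (M m)" if "a \<in> carrier (K m)" "z \<in> carrier (M m)" for m a z
      by (rule mcases[of m]) (use that in auto)
    show "\<omega> m v z \<in> carrier (M (m + 1))" if "v \<in> carrier (W m)" "z \<in> carrier (M m)" for m v z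
      by (rule mcases[of m]) (use that in auto)
    show "\<kappa> m a (z \<otimes>\<^bsub>M m\<^esub> z') = \<kappa> m a z \<otimes>\<^bsub>M m\<^esub> \<kappa> m a z'"
      if "a \<in> carrier (K m)" "z \<in> carrier (M m)" "z' \<in> carrier (M m)" for m a z z'
      by (rule mcases[of m]) (use that in auto)
    show "\<kappa> m (a \<oplus>\<^bsub>K m\<^esub> b) z = \<kappa> m a z \<otimes>\<^bsub>M m\<^esub> \<kappa> m b z"
      if "a \<in> carrier (K m)" "b \<in> carrier (K m)" "z \<in> carrier (M m)" for m a b z
      by (rule mcases[of m]) (use that in auto)
    show "\<kappa> m b (\<kappa> m a z) = \<kappa> m (a \<otimes>\<^bsub>K m\<^esub> b) z"
      if "a \<in> carrier (K m)" "b \<in> carrier (K m)" "z \<in> carrier (M m)" for m a b z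
      by (rule mcases[of m]) (use that in auto)
    show "\<kappa> m \<one>\<^bsub>K m\<^esub> z = z" if "z \<in> carrier (M m)" for m z
      by (rule mcases[of m]) (use that in auto)
    show "\<omega> m v (z \<otimes>\<^bsub>M m\<^esub> z') = \<omega> m v z \<otimes>\<^bsub>M (m + 1)\<^esub> \<omega> m v z'"
      if "v \<in> carrier (W m)" "z \<in> carrier (M m)" "z' \<in> carrier (M m)" for m v z z'
      by (rule mcases[of m]) (use that in auto)
    show "\<omega> m (v \<oplus>\<^bsub>W m\<^esub> w) z = \<omega> m v z \<otimes>\<^bsub>M (m + 1)\<^esub> \<omega> m w z"
      if "v \<in> carrier (W m)" "w \<in> carrier (W m)" "z \<in> carrier (M m)" for m v w z
      by (rule mcases[of m]) (use that in auto)
    show "\<omega> m v (\<kappa> m a z) = \<omega> m (a \<odot>\<^bsub>W m\<^esub> v) z"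
      if "a \<in> carrier (K m)" "v \<in> carrier (W m)" "z \<in> carrier (M m)" for m a v z
      by (rule mcases[of m]) (use that in auto)
    show "\<kappa> (m + 1) a (\<omega> m v z) = \<omega> m (v \<triangleleft>\<^bsub>W m\<^esub> a) z"
      if "a \<in> carrier (K (m + 1))" "v \<in> carrier (W m)" "z \<in> carrier (M m)" for m a v z
      by (rule mcases[of m]) (use that in auto)
    show "\<omega> (m + 1) (y1 m) (\<omega> m (x1 m) z) \<otimes>\<^bsub>M (m + 2)\<^esub> \<omega> (m + 1) (y2 m) (\<omega> m (x2 m) z) = \<one>\<^bsub>M (m + 2)\<^esub>"
      if z: "z \<in> carrier (M m)" for m z
    proof -
      consider "m + 2 \<le> n + 1" | "m = n" | "m = n + 1" | "m = n + 2" | "m > n + 2" by linarith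
      then show ?thesis
      proof cases
        case 1
        then obtain p where p: "z = (p, {})" "p \<in> carrier (comp D s m)" using z by auto
        have "zmult D s m (m + 2) p (zmult D m (m + 1) (m + 2) (om m (x1 m)) (om (m + 1) (y1 m)) \<otimes>\<^bsub>comp D m (m + 2)\<^esub>
          zmult D m (m + 1) (m + 2) (om m (x2 m)) (om (m + 1) (y2 m))) = \<one>\<^bsub>comp D s (m + 2)\<^esub>"
          using p by (simp add: rel del: mult_add_right)
        with 1 p show ?thesis by simp
      next
        \<comment> \<open>Only here does the relation land in the cokernel, where it is the class of
          \<open>Phi s n p\<close>, hence zero. From \<open>m = n + 1\<close> on the target
          vanishes.\<close>
        case 2
        then obtain p where p: "z = (p, {})" "p \<in> carrier (comp D s n)" using z by auto
        have "c (Phi s n p) = \<one>\<^bsub>Q\<^esub>" using p c_H by (simp add: H_def)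
        moreover have "Phi s n p = ten s n (zmult D s n (n + 1) p (om n (x1 n))) (y1 n) \<otimes>\<^bsub>GG s n\<^esub>
            ten s n (zmult D s n (n + 1) p (om n (x2 n))) (y2 n)"
          using GG_decomp[OF Phi_closed[OF p(2)]] by (simp add: Phi_def)
        ultimately show ?thesis using 2 p by simp
      next
        case 3
        then show ?thesis using z by auto
      qed (use z in auto)
    qed
  qed
  obtain h where h: "zhom D (endz M) h"
    and hk: "\<And>i a. a \<in> carrier (K i) \<Longrightarrow> h i i (k i a) = restrict (\<kappa> i a) (carrier (M i))"
    and ho: "\<And>i v. v \<in> carrier (W i) \<Longrightarrow> h i (i + 1) (om i v) = restrict (\<omega> i v) (carrier (M i))"
    using univ[OF rep] by blast
  have E: "zalgebra (endz M)" by (rule zalgebra_endz[OF Mg])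
  \<comment> \<open>As long as both degrees stay at most \<open>n + 1\<close>, the action obtained
    from \<open>univ\<close> is the multiplication of \<open>D\<close>. This is known for the
    generators and extends to everything because it defines a subring.\<close>
  let ?P = "\<lambda>j m x. j \<le> n + 1 \<longrightarrow> m \<le> n + 1 \<longrightarrow>
    (\<forall>p\<in>carrier (comp D s j). h j m x (p, {}) = (zmult D s j m p x, {}))"
  let ?B = "\<lambda>j m. {x \<in> carrier (comp D j m). ?P j m x}"
  have hone: "h j m \<one>\<^bsub>comp D j m\<^esub> = restrict (\<lambda>_. \<one>\<^bsub>M m\<^esub>) (carrier (M j))" for j m
    using zhom_one_inv(1)[OF zalgebra_axioms E h] by (simp add: endz_simps)
  have hadd: "h j m (x \<otimes>\<^bsub>comp D j m\<^esub> y) z = h j m x z \<otimes>\<^bsub>M m\<^esub> h j m y z"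
    if "x \<in> carrier (comp D j m)" "y \<in> carrier (comp D j m)" "z \<in> carrier (M j)" for j m x y z
    using zhomD(3)[OF h that(1,2)] that(3) by (simp add: endz_simps)
  have hmult: "h j r (zmult D j m r x y) z = h m r y (h j m x z)"
    if "x \<in> carrier (comp D j m)" "y \<in> carrier (comp D m r)" "z \<in> carrier (M j)" for j m r x y z
    using zhomD(4)[OF h that(1,2)] that(3) by (simp add: endz_simps)
  have "zsubring D ?B"
    unfolding zsubring_def
  proof (intro conjI allI ballI)
    fix j m
    show "subgroup (?B j m) (comp D j m)"
    proof (rule comp.subgroupI)
      have "\<one>\<^bsub>comp D j m\<^esub> \<in> ?B j m" by (simp add: hone)
      then show "?B j m \<noteq> {}" by blast
      show "x \<otimes>\<^bsub>comp D j m\<^esub> y \<in> ?B j m" if "x \<in> ?B j m" "y \<in> ?B j m" for x y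
        using that by (simp add: hadd mult_add_right)
      show "inv\<^bsub>comp D j m\<^esub> x \<in> ?B j m" if x: "x \<in> ?B j m" for x
      proof -
        have "h j m (inv\<^bsub>comp D j m\<^esub> x) (p, {}) = (zmult D s j m p (inv\<^bsub>comp D j m\<^esub> x), {})"
          if "j \<le> n + 1" and m: "m \<le> n + 1" and p: "p \<in> carrier (comp D s j)" for p
        proof -
          interpret Mm: comm_group "M m" by (rule Mg)
          have xc: "x \<in> carrier (comp D j m)" using x by simp
          have z: "(p, {}) \<in> carrier (M j)" using that by simp
          have "h j m (inv\<^bsub>comp D j m\<^esub> x) \<in> carrier (comp (endz M) j m)"
            using zhomD(2)[OF h] xc by simp
          then have c: "h j m (inv\<^bsub>comp D j m\<^esub> x) (p, {}) \<in> carrier (M m)"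
            using z by (auto simp: endz_simps hom_def simp del: Mc)
          then obtain q where q: "h j m (inv\<^bsub>comp D j m\<^esub> x) (p, {}) = (q, {})" "q \<in> carrier (comp D s m)"
            using c Mc(1)[OF m] by auto
          have "h j m (inv\<^bsub>comp D j m\<^esub> x \<otimes>\<^bsub>comp D j m\<^esub> x) (p, {}) = \<one>\<^bsub>M m\<^esub>"
            using xc z by (simp add: hone del: Mc Mo)
          then have "(q, {}) \<otimes>\<^bsub>M m\<^esub> (zmult D s j m p x, {}) = \<one>\<^bsub>M m\<^esub>"
            using hadd[of "inv\<^bsub>comp D j m\<^esub> x" j m x "(p, {})"] x xc z q that by (simp del: Mc Mo Mm)
          then have "q \<otimes>\<^bsub>comp D s m\<^esub> zmult D s j m p x = \<one>\<^bsub>comp D s m\<^esub>"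
            using that by simp
          then have "q = inv\<^bsub>comp D s m\<^esub> (zmult D s j m p x)"
            by (rule comp.inv_equality[symmetric]) (use q(2) p xc in \<open>simp_all add: mult_closed\<close>)
          with q p xc show ?thesis by (simp add: mult_inv_right)
        qed
        with x show ?thesis by simp
      qed
    qed auto
  next
    fix j m r x y assume x: "x \<in> ?B j m" and y: "y \<in> ?B m r"
    have "?P j r (zmult D j m r x y)"
    proof (intro impI ballI)
      fix p assume jr: "j \<le> n + 1" "r \<le> n + 1" and p: "p \<in> carrier (comp D s j)"
      have z: "(p, {}) \<in> carrier (M j)" using jr p by simp
      show "h j r (zmult D j m r x y) (p, {}) = (zmult D s j r p (zmult D j m r x y), {})"
      proof (cases "m \<le> n + 1")
        case True
        then have "h j m x (p, {}) = (zmult D s j m p x, {})" using x p jr by blast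
        moreover have "h m r y (zmult D s j m p x, {}) = (zmult D s m r (zmult D s j m p x) y, {})"
          using y True jr x p by (simp add: mult_closed)
        ultimately show ?thesis
          using hmult[of x j m y r "(p, {})"] x y z p by (simp add: mult_assoc del: Mc)
      next
        \<comment> \<open>A product that passes through an index above \<open>n + 1\<close> and ends
          at most at \<open>n + 1\<close> has its second factor below the diagonal, where
          \<open>D\<close> vanishes.\<close>
        case False
        then have "y = \<one>\<^bsub>comp D m r\<^esub>" using y lower_zero[of r m] jr by auto
        then show ?thesis using x z p jr by (simp add: hone)
      qed
    qed
    with x y show "zmult D j m r x y \<in> ?B j r" by (simp add: mult_closed)
  next
    fix j
    have "h j j (zone D j) = zone (endz M) j" by (rule zhomD(5)[OF h])
    then show "zone D j \<in> ?B j j" by (simp add: one_closed endz_simps one_right)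
  qed
  then have "?B j m = carrier (comp D j m)" for j m
    by (rule gen) (simp_all add: k_closed om_closed hk ho \<kappa>_def \<omega>_def)
  then have hP: "?P j m x" if "x \<in> carrier (comp D j m)" for j m x
    using that by blast
  have one: "zone D s \<in> carrier (comp D s s)" by (rule one_closed)
  have hp: "h s (n + 1) p (zone D s, {}) = (p, {})" if "p \<in> carrier (comp D s (n + 1))" for p
    using hP[OF that] sn one that by (simp add: one_left)
  obtain p1 p2 where p: "z = (p1, p2)" "p1 \<in> carrier (comp D s (n + 1))" "p2 \<in> carrier (comp D s (n + 1))"
    using z by (auto simp: carrier_DirProd)
  have z1: "(zone D s, {}) \<in> carrier (M s)" using sn one by simp
  have ho2: "h (n + 1) (n + 2) (om (n + 1) v) (q, {}) = (undefined, c (ten s n q v))"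
    if "v \<in> carrier (W (n + 1))" "q \<in> carrier (comp D s (n + 1))" for v q
    using ho[OF that(1)] that(2) by (simp add: \<omega>_def)
  \<comment> \<open>The unit of degree \<open>s\<close> is the test vector: acting on it with
    \<open>mulT s n z\<close> returns the class of \<open>z\<close>.\<close>
  have "h s (n + 2) (mulT s n z) (zone D s, {}) = (undefined, c (ten s n p1 (y1 n)) \<otimes>\<^bsub>Q\<^esub> c (ten s n p2 (y2 n)))"
    using p z1 by (simp add: mulT_def hadd hmult clos hp ho2 del: Mc)
  also have "\<dots> = (undefined, c z)"
    using GG_decomp[OF z] p by (simp add: c_add[symmetric] ten_closed)
  finally have "c z = \<one>\<^bsub>Q\<^esub>"
    using z0 z1 hone[of s "n + 2"] by (simp del: Mc)
  then show ?thesis using c_zero[OF z] by (auto simp: H_def)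
qed

end

section \<open>Rank as the length of chains\<close>

section \<open>Chains and ranks\<close>

definition chain_in :: "'a set set \<Rightarrow> (nat \<Rightarrow> 'a set) \<Rightarrow> nat \<Rightarrow> bool" where
  "chain_in L X n \<longleftrightarrow> (\<forall>k\<le>n. X k \<in> L) \<and> (\<forall>k<n. X k \<subset> X (Suc k))"

definition bounded_rk :: "'a set set \<Rightarrow> 'a set \<Rightarrow> nat \<Rightarrow> bool" where
  "bounded_rk L N b \<longleftrightarrow> (\<forall>X n. chain_in L X n \<and> X n \<subseteq> N \<longrightarrow> n \<le> b)"

definition finrk :: "'a set set \<Rightarrow> 'a set \<Rightarrow> bool" where
  "finrk L N \<longleftrightarrow> N \<in> L \<and> (\<exists>b. bounded_rk L N b)"

text \<open>For the family of all subspaces of a vector space this is the dimension. Measuring by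
  chains works without bases and applies to any lattice of sets, so that images and preimages of
  subspaces can be compared directly.\<close>

definition rk :: "'a set set \<Rightarrow> 'a set \<Rightarrow> nat" where
  "rk L N = (GREATEST n. \<exists>X. chain_in L X n \<and> X n \<subseteq> N)"

lemma rk_ge:
  assumes "finrk L N" "chain_in L X n" "X n \<subseteq> N"
  shows "n \<le> rk L N"
proof -
  obtain b where "\<forall>X n. chain_in L X n \<and> X n \<subseteq> N \<longrightarrow> n \<le> b"
    using assms(1) by (auto simp: finrk_def bounded_rk_def)
  then show ?thesis
    unfolding rk_def using assms by (intro Greatest_le_nat[of _ n b]) blast+
qed

lemma rk_chain:
  assumes "finrk L N"
  obtains X where "chain_in L X (rk L N)" "X (rk L N) \<subseteq> N"
proof -
  have "chain_in L (\<lambda>_. N) 0" using assms by (simp add: chain_in_def finrk_def)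
  then have "\<exists>n X. chain_in L X n \<and> X n \<subseteq> N" by (metis order_refl)
  moreover obtain b where "\<forall>X n. chain_in L X n \<and> X n \<subseteq> N \<longrightarrow> n \<le> b"
    using assms by (auto simp: finrk_def bounded_rk_def)
  ultimately have "\<exists>X. chain_in L X (rk L N) \<and> X (rk L N) \<subseteq> N"
    unfolding rk_def by (intro GreatestI_ex_nat[of "\<lambda>n. \<exists>X. chain_in L X n \<and> X n \<subseteq> N" b]) blast+
  then show thesis using that by blast
qed

lemma rk_le:
  assumes "N \<in> L" "bounded_rk L N b"
  shows "finrk L N" "rk L N \<le> b"
proof -
  show f: "finrk L N" using assms by (auto simp: finrk_def)
  obtain X where "chain_in L X (rk L N)" "X (rk L N) \<subseteq> N" by (rule rk_chain[OF f])
  then show "rk L N \<le> b" using assms(2) by (auto simp: bounded_rk_def)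
qed

lemma finrk_mono: "\<lbrakk>finrk L N; N' \<in> L; N' \<subseteq> N\<rbrakk> \<Longrightarrow> finrk L N'"
  unfolding finrk_def bounded_rk_def by (meson subset_trans)

lemma rk_mono:
  assumes "finrk L N" "N' \<in> L" "N' \<subseteq> N"
  shows "rk L N' \<le> rk L N"
proof -
  obtain X where "chain_in L X (rk L N')" "X (rk L N') \<subseteq> N'" by (rule rk_chain[OF finrk_mono[OF assms]])
  then show ?thesis using rk_ge[OF assms(1)] assms(3) by blast
qed

lemma rk_strict:
  assumes "finrk L N" "N' \<in> L" "N' \<subset> N"
  shows "rk L N' < rk L N"
proof -
  let ?r = "rk L N'"
  obtain X where X: "chain_in L X ?r" "X ?r \<subseteq> N'"
    by (rule rk_chain[OF finrk_mono[OF assms(1,2)]]) (use assms(3) in auto)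
  let ?Y = "\<lambda>k. if k \<le> ?r then X k else N"
  have "chain_in L ?Y (Suc ?r)"
    using X assms by (auto simp: chain_in_def finrk_def less_Suc_eq_le le_Suc_eq Suc_le_eq)
  then show ?thesis using rk_ge[OF assms(1), of ?Y "Suc ?r"] by simp
qed

lemma rk_eq: "\<lbrakk>finrk L N; N' \<in> L; N' \<subseteq> N; rk L N \<le> rk L N'\<rbrakk> \<Longrightarrow> N' = N"
  using rk_strict[of L N N'] by force

text \<open>Every step raises at least one of the two ranks. This replaces the formula that the
  dimension of a space is that of its image plus that of its kernel: \<open>A\<close> will be the
  image of a chain and \<open>B\<close> its trace on the kernel.\<close>

lemma rk_sum:
  assumes A: "\<And>k. k \<le> n \<Longrightarrow> A k \<in> L" "finrk L (A n)" and B: "\<And>k. k \<le> n \<Longrightarrow> B k \<in> M" "finrk M (B n)"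
    and mono: "\<And>k. k < n \<Longrightarrow> A k \<subseteq> A (Suc k) \<and> B k \<subseteq> B (Suc k)"
    and strict: "\<And>k. k < n \<Longrightarrow> A k \<noteq> A (Suc k) \<or> B k \<noteq> B (Suc k)"
  shows "n \<le> rk L (A n) + rk M (B n)"
proof -
  have sub: "k \<le> m \<Longrightarrow> m \<le> n \<Longrightarrow> A k \<subseteq> A m \<and> B k \<subseteq> B m" for k m
  proof (induction m)
    case (Suc m)
    then show ?case using mono[of m] by (cases "k = Suc m") auto
  qed simp
  have "k \<le> n \<Longrightarrow> k \<le> rk L (A k) + rk M (B k)" for k
  proof (induction k)
    case (Suc k)
    have f: "finrk L (A (Suc k))" "finrk M (B (Suc k))"
      using finrk_mono[OF A(2)] finrk_mono[OF B(2)] A(1) B(1) sub[of "Suc k" n] Suc.prems by auto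
    have le: "rk L (A k) \<le> rk L (A (Suc k))" "rk M (B k) \<le> rk M (B (Suc k))"
      using rk_mono[OF f(1)] rk_mono[OF f(2)] A(1)[of k] B(1)[of k] mono[of k] Suc.prems by auto
    have "rk L (A k) < rk L (A (Suc k)) \<or> rk M (B k) < rk M (B (Suc k))"
      using rk_strict[OF f(1)] rk_strict[OF f(2)] A(1)[of k] B(1)[of k] mono[of k] strict[of k] Suc.prems
      by (auto simp: psubset_eq)
    then show ?case using Suc le by linarith
  qed simp
  then show ?thesis by blast
qed

text \<open>The ranks along the chain are bounded, so some member attains the largest one; from
  there on the chain is constant.\<close>

lemma finrk_stable:
  assumes f: "finrk L N" and X: "\<And>k. X k \<in> L" "\<And>k. X k \<subseteq> X (Suc k)" "\<And>k. X k \<subseteq> N"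
  shows "\<exists>k. \<forall>m\<ge>k. X m = X k"
proof -
  have fX: "finrk L (X k)" for k using finrk_mono[OF f X(1,3)] .
  have "\<forall>y. (\<exists>k. y = rk L (X k)) \<longrightarrow> y \<le> rk L N" using rk_mono[OF f X(1,3)] by blast
  then obtain k where k: "\<And>m. rk L (X m) \<le> rk L (X k)"
    using Greatest_le_nat[of "\<lambda>y. \<exists>k. y = rk L (X k)"] GreatestI_ex_nat[of "\<lambda>y. \<exists>k. y = rk L (X k)"]
    by (metis (mono_tags, lifting))
  have "X m = X k" if "m \<ge> k" for m
    using rk_eq[OF fX[of m] X(1)[of k] lift_Suc_mono_le[of X, OF X(2) that] k] by simp
  then show ?thesis by blast
qed

text \<open>Vector spaces whose addition is written multiplicatively and whose scalars act from the
  right, as in the components of the algebra and in \<open>GG s n\<close>.\<close>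

locale kspace = F: field F + G: comm_group G
  for F :: "'k ring" and G :: "'g monoid" and act :: "'k \<Rightarrow> 'g \<Rightarrow> 'g" +
  assumes act_closed: "\<lbrakk>a \<in> carrier F; x \<in> carrier G\<rbrakk> \<Longrightarrow> act a x \<in> carrier G"
    and act_add: "\<lbrakk>a \<in> carrier F; x \<in> carrier G; y \<in> carrier G\<rbrakk> \<Longrightarrow>
      act a (x \<otimes>\<^bsub>G\<^esub> y) = act a x \<otimes>\<^bsub>G\<^esub> act a y"
    and act_arg_add: "\<lbrakk>a \<in> carrier F; b \<in> carrier F; x \<in> carrier G\<rbrakk> \<Longrightarrow>
      act (a \<oplus>\<^bsub>F\<^esub> b) x = act a x \<otimes>\<^bsub>G\<^esub> act b x"
    and act_mult: "\<lbrakk>a \<in> carrier F; b \<in> carrier F; x \<in> carrier G\<rbrakk> \<Longrightarrow>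
      act b (act a x) = act (a \<otimes>\<^bsub>F\<^esub> b) x"
    and act_one: "x \<in> carrier G \<Longrightarrow> act \<one>\<^bsub>F\<^esub> x = x"
begin

definition subspaces :: "'g set set" where
  "subspaces = {N. subgroup N G \<and> (\<forall>a\<in>carrier F. \<forall>x\<in>N. act a x \<in> N)}"

definition line :: "'g \<Rightarrow> 'g set" where "line u = (\<lambda>a. act a u) ` carrier F"

lemma subspaces_sub: "N \<in> subspaces \<Longrightarrow> subgroup N G"
  by (simp add: subspaces_def)

lemma subspaces_mem: "\<lbrakk>N \<in> subspaces; x \<in> N\<rbrakk> \<Longrightarrow> x \<in> carrier G"
  by (rule subgroup.mem_carrier[OF subspaces_sub])

lemma subspaces_add: "\<lbrakk>N \<in> subspaces; x \<in> N; y \<in> N\<rbrakk> \<Longrightarrow> x \<otimes>\<^bsub>G\<^esub> y \<in> N"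
  by (rule subgroup.m_closed[OF subspaces_sub])

lemma subspaces_inv: "\<lbrakk>N \<in> subspaces; x \<in> N\<rbrakk> \<Longrightarrow> inv\<^bsub>G\<^esub> x \<in> N"
  by (rule subgroup.m_inv_closed[OF subspaces_sub])

lemma subspaces_one: "N \<in> subspaces \<Longrightarrow> \<one>\<^bsub>G\<^esub> \<in> N"
  by (rule subgroup.one_closed[OF subspaces_sub])

lemma subspaces_act: "\<lbrakk>N \<in> subspaces; a \<in> carrier F; x \<in> N\<rbrakk> \<Longrightarrow> act a x \<in> N"
  by (simp add: subspaces_def)

lemma subspacesI:
  assumes "N \<subseteq> carrier G" "\<one>\<^bsub>G\<^esub> \<in> N" "\<And>x y. \<lbrakk>x \<in> N; y \<in> N\<rbrakk> \<Longrightarrow> x \<otimes>\<^bsub>G\<^esub> y \<in> N"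
    "\<And>a x. \<lbrakk>a \<in> carrier F; x \<in> N\<rbrakk> \<Longrightarrow> act a x \<in> N"
  shows "N \<in> subspaces"
proof -
  have "inv\<^bsub>G\<^esub> x \<in> N" if x: "x \<in> N" for x
  proof -
    have xc: "x \<in> carrier G" using assms(1) x by blast
    have z: "act \<zero>\<^bsub>F\<^esub> x = \<one>\<^bsub>G\<^esub>"
      using act_arg_add[of "\<zero>\<^bsub>F\<^esub>" "\<zero>\<^bsub>F\<^esub>" x] act_closed[of "\<zero>\<^bsub>F\<^esub>" x] xc by (simp add: G.l_cancel_one)
    have "act (\<ominus>\<^bsub>F\<^esub> \<one>\<^bsub>F\<^esub>) x \<otimes>\<^bsub>G\<^esub> x = \<one>\<^bsub>G\<^esub>"
      using act_arg_add[of "\<ominus>\<^bsub>F\<^esub> \<one>\<^bsub>F\<^esub>" "\<one>\<^bsub>F\<^esub>" x] xc by (simp add: act_one F.l_neg z)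
    then have "inv\<^bsub>G\<^esub> x = act (\<ominus>\<^bsub>F\<^esub> \<one>\<^bsub>F\<^esub>) x"
      using xc by (intro G.inv_equality act_closed) auto
    then show ?thesis using assms(4) x by simp
  qed
  then show ?thesis unfolding subspaces_def using assms by (auto intro!: subgroup.intro)
qed

lemma act_zero: "x \<in> carrier G \<Longrightarrow> act \<zero>\<^bsub>F\<^esub> x = \<one>\<^bsub>G\<^esub>"
  using act_arg_add[of "\<zero>\<^bsub>F\<^esub>" "\<zero>\<^bsub>F\<^esub>" x] act_closed[of "\<zero>\<^bsub>F\<^esub>" x] by (simp add: G.l_cancel_one)

lemma act_of_one: "a \<in> carrier F \<Longrightarrow> act a \<one>\<^bsub>G\<^esub> = \<one>\<^bsub>G\<^esub>"
  using act_add[of a "\<one>\<^bsub>G\<^esub>" "\<one>\<^bsub>G\<^esub>"] act_closed[of a "\<one>\<^bsub>G\<^esub>"] by (simp add: G.l_cancel_one)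

lemma trivial_subspace: "{\<one>\<^bsub>G\<^esub>} \<in> subspaces"
  by (rule subspacesI) (auto simp: act_of_one)

lemma full_subspace: "carrier G \<in> subspaces"
  by (rule subspacesI) (auto simp: act_closed)

lemma Int_subspace: "\<lbrakk>M \<in> subspaces; N \<in> subspaces\<rbrakk> \<Longrightarrow> M \<inter> N \<in> subspaces"
  by (rule subspacesI) (auto intro: subspaces_mem subspaces_add subspaces_one subspaces_act)

lemma add_line_iff: "x \<in> N <#>\<^bsub>G\<^esub> line u \<longleftrightarrow> (\<exists>y\<in>N. \<exists>a\<in>carrier F. x = y \<otimes>\<^bsub>G\<^esub> act a u)"
  by (auto simp: set_mult_def line_def)

lemma add_line_subspace:
  assumes N: "N \<in> subspaces" and u: "u \<in> carrier G"
  shows "N <#>\<^bsub>G\<^esub> line u \<in> subspaces"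
proof (rule subspacesI)
  show "N <#>\<^bsub>G\<^esub> line u \<subseteq> carrier G"
    using N u by (auto simp: add_line_iff subspaces_mem act_closed)
  show "\<one>\<^bsub>G\<^esub> \<in> N <#>\<^bsub>G\<^esub> line u"
    unfolding add_line_iff using N u
    by (intro bexI[of _ "\<one>\<^bsub>G\<^esub>"] bexI[of _ "\<zero>\<^bsub>F\<^esub>"]) (auto simp: act_zero subspaces_one)
  fix x assume "x \<in> N <#>\<^bsub>G\<^esub> line u"
  then obtain y a where x: "y \<in> N" "a \<in> carrier F" "x = y \<otimes>\<^bsub>G\<^esub> act a u" unfolding add_line_iff by blast
  show "act b x \<in> N <#>\<^bsub>G\<^esub> line u" if "b \<in> carrier F" for b
    unfolding add_line_iff using x that N u
    by (intro bexI[of _ "act b y"] bexI[of _ "a \<otimes>\<^bsub>F\<^esub> b"])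
      (auto simp: act_add act_mult subspaces_act subspaces_mem act_closed)
  fix x' assume "x' \<in> N <#>\<^bsub>G\<^esub> line u"
  then obtain y' a' where x': "y' \<in> N" "a' \<in> carrier F" "x' = y' \<otimes>\<^bsub>G\<^esub> act a' u" unfolding add_line_iff by blast
  show "x \<otimes>\<^bsub>G\<^esub> x' \<in> N <#>\<^bsub>G\<^esub> line u"
    unfolding add_line_iff using x x' N u subspaces_mem[OF N]
    by (intro bexI[of _ "y \<otimes>\<^bsub>G\<^esub> y'"] bexI[of _ "a \<oplus>\<^bsub>F\<^esub> a'"])
      (auto simp: act_arg_add subspaces_add act_closed G.m_ac)
qed

lemma subset_add_line:
  assumes "N \<in> subspaces" "u \<in> carrier G"
  shows "N \<subseteq> N <#>\<^bsub>G\<^esub> line u"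
proof
  fix x assume "x \<in> N"
  then have "x = x \<otimes>\<^bsub>G\<^esub> act \<zero>\<^bsub>F\<^esub> u" using assms by (simp add: act_zero subspaces_mem)
  with \<open>x \<in> N\<close> show "x \<in> N <#>\<^bsub>G\<^esub> line u" unfolding add_line_iff by blast
qed

lemma mem_add_line:
  assumes "N \<in> subspaces" "u \<in> carrier G"
  shows "u \<in> N <#>\<^bsub>G\<^esub> line u"
  unfolding add_line_iff using assms
  by (intro bexI[of _ "\<one>\<^bsub>G\<^esub>"] bexI[of _ "\<one>\<^bsub>F\<^esub>"]) (auto simp: act_one subspaces_one)

lemma add_line_least:
  "\<lbrakk>M \<in> subspaces; N \<subseteq> M; u \<in> M\<rbrakk> \<Longrightarrow> N <#>\<^bsub>G\<^esub> line u \<subseteq> M"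
  by (auto simp: add_line_iff intro!: subspaces_add subspaces_act)

text \<open>Intersecting a chain with \<open>A\<close> destroys at most one strict inclusion, the
  one at which the chain leaves \<open>A\<close>. Once some \<open>X k\<close> contains a vector
  outside \<open>A\<close>, every new vector can be corrected by a multiple of it so as to fall into
  \<open>A\<close>.\<close>

lemma rk_add_line:
  assumes A: "finrk subspaces A" and B: "B \<in> subspaces" and u: "u \<in> carrier G"
    and BA: "B \<subseteq> A <#>\<^bsub>G\<^esub> line u"
  shows "finrk subspaces B" "rk subspaces B \<le> rk subspaces A + 1"
proof -
  have As: "A \<in> subspaces" using A by (simp add: finrk_def)
  have bd: "bounded_rk subspaces B (rk subspaces A + 1)"
    unfolding bounded_rk_def
  proof (intro allI impI, elim conjE)
    fix X n assume X: "chain_in subspaces X n" and XB: "X n \<subseteq> B"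
    have sub: "k \<le> m \<Longrightarrow> m \<le> n \<Longrightarrow> X k \<subseteq> X m" for k m
    proof (induction m)
      case (Suc m)
      have "X m \<subset> X (Suc m)" using X Suc.prems by (simp add: chain_in_def)
      then show ?case using Suc by (cases "k = Suc m") auto
    qed simp
    have "k \<le> n \<Longrightarrow> k \<le> rk subspaces (X k \<inter> A) + (if X k \<subseteq> A then 0 else 1)" for k
    proof (induction k)
      case (Suc k)
      let ?Y = "X k" and ?Z = "X (Suc k)"
      have YZ: "?Y \<in> subspaces" "?Z \<in> subspaces" "?Y \<subset> ?Z" "?Z \<subseteq> B"
        using X Suc.prems sub[of "Suc k" n] XB by (auto simp: chain_in_def)
      have fZ: "finrk subspaces (?Z \<inter> A)" by (rule finrk_mono[OF A]) (use YZ As in \<open>auto intro: Int_subspace\<close>)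
      have YA: "?Y \<inter> A \<in> subspaces" using YZ As Int_subspace by blast
      have le: "rk subspaces (?Y \<inter> A) \<le> rk subspaces (?Z \<inter> A)" by (rule rk_mono[OF fZ YA]) (use YZ in auto)
      consider "?Z \<subseteq> A" | "\<not> ?Z \<subseteq> A" "?Y \<subseteq> A" | "\<not> ?Y \<subseteq> A" by blast
      then show ?case
      proof cases
        case 1
        then have "?Y \<inter> A \<subset> ?Z \<inter> A" "?Y \<subseteq> A" using YZ by auto
        from rk_strict[OF fZ YA this(1)] this(2) 1 Suc show ?thesis by simp
      next
        case 2
        then show ?thesis using Suc le by simp
      next
        case 3
        then obtain x where x: "x \<in> ?Y" "x \<notin> A" by blast
        then obtain a c where a: "a \<in> A" "c \<in> carrier F" "x = a \<otimes>\<^bsub>G\<^esub> act c u"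
          using YZ BA unfolding add_line_iff[symmetric] subset_iff psubset_eq by (metis add_line_iff)
        have ac: "a \<in> carrier G" using a As subspaces_mem by blast
        have "c \<noteq> \<zero>\<^bsub>F\<^esub>" using a x u ac by (auto simp: act_zero)
        then have inv: "inv\<^bsub>F\<^esub> c \<in> carrier F" "c \<otimes>\<^bsub>F\<^esub> inv\<^bsub>F\<^esub> c = \<one>\<^bsub>F\<^esub>"
          using a(2) F.field_Units by auto
        obtain x' where x': "x' \<in> ?Z" "x' \<notin> ?Y" using YZ by blast
        then obtain a' c' where a': "a' \<in> A" "c' \<in> carrier F" "x' = a' \<otimes>\<^bsub>G\<^esub> act c' u"
          using YZ BA unfolding subset_iff psubset_eq by (metis add_line_iff)
        have ac': "a' \<in> carrier G" using a' As subspaces_mem by blast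
        \<comment> \<open>The multiple of \<open>x\<close> whose component along \<open>u\<close> is
          that of \<open>x'\<close>; the components cancel in \<open>?w\<close>, which therefore
          lies in \<open>A\<close> and in \<open>?Z\<close> but not in \<open>?Y\<close>.\<close>
        let ?d = "inv\<^bsub>F\<^esub> c \<otimes>\<^bsub>F\<^esub> c'"
        have d: "?d \<in> carrier F" "c \<otimes>\<^bsub>F\<^esub> ?d = c'"
          using inv a(2) a'(2) by (simp_all add: F.m_assoc[symmetric])
        let ?w = "x' \<otimes>\<^bsub>G\<^esub> inv\<^bsub>G\<^esub> (act ?d x)"
        have dx: "act ?d x = act ?d a \<otimes>\<^bsub>G\<^esub> act c' u"
          using a(2,3) d u ac by (simp add: act_add act_mult act_closed)
        have "?w = a' \<otimes>\<^bsub>G\<^esub> inv\<^bsub>G\<^esub> (act ?d a)"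
          using a'(2,3) d u ac ac' unfolding dx
          by (simp add: act_closed G.inv_mult G.m_assoc)
            (simp add: act_closed G.m_assoc[symmetric] G.m_comm[of "inv\<^bsub>G\<^esub> (act ?d a)"])
        then have wA: "?w \<in> A" using a(1) a'(1) d(1) As by (simp add: subspaces_add subspaces_inv subspaces_act)
        have dY: "act ?d x \<in> ?Y" using x YZ d by (simp add: subspaces_act)
        then have wZ: "?w \<in> ?Z" using x' YZ by (auto intro!: subspaces_add subspaces_inv)
        have "?w \<notin> ?Y"
        proof
          assume "?w \<in> ?Y"
          then have "?w \<otimes>\<^bsub>G\<^esub> act ?d x \<in> ?Y" using dY YZ by (simp add: subspaces_add)
          moreover have "?w \<otimes>\<^bsub>G\<^esub> act ?d x = x'"
            using x' dY YZ subspaces_mem by (simp add: G.m_assoc)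
          ultimately show False using x' by simp
        qed
        with wA wZ YZ have "?Y \<inter> A \<subset> ?Z \<inter> A" by blast
        from rk_strict[OF fZ YA this] Suc 3 YZ show ?thesis by auto
      qed
    qed simp
    from this[of n] have "n \<le> rk subspaces (X n \<inter> A) + 1" by (auto split: if_splits)
    moreover have "rk subspaces (X n \<inter> A) \<le> rk subspaces A"
      by (rule rk_mono[OF A]) (use X As in \<open>auto simp: chain_in_def intro: Int_subspace\<close>)
    ultimately show "n \<le> rk subspaces A + 1" by linarith
  qed
  show "finrk subspaces B" "rk subspaces B \<le> rk subspaces A + 1"
    using rk_le[OF B bd] by auto
qed

lemma finrk_trivial: "finrk subspaces {\<one>\<^bsub>G\<^esub>}" "rk subspaces {\<one>\<^bsub>G\<^esub>} = 0"
proof -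
  have "n = 0" if X: "chain_in subspaces X n" and "X n \<subseteq> {\<one>\<^bsub>G\<^esub>}" for X n
  proof (rule ccontr)
    assume "n \<noteq> 0"
    then have "X (n - 1) \<subset> X n" "X (n - 1) \<in> subspaces"
      using X unfolding chain_in_def by (auto simp: less_imp_diff_less split: nat_diff_split dest: spec[of _ "n - 1"])
    then show False using that(2) subspaces_one by blast
  qed
  then have "bounded_rk subspaces {\<one>\<^bsub>G\<^esub>} 0" by (auto simp: bounded_rk_def)
  from rk_le[OF trivial_subspace this] show "finrk subspaces {\<one>\<^bsub>G\<^esub>}" "rk subspaces {\<one>\<^bsub>G\<^esub>} = 0" by auto
qed

text \<open>A spanning sequence no longer than the rank: vectors are added greedily, and a flag that
  had not reached \<open>N\<close> after \<open>rk\<close> steps would be too long a chain.\<close>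

lemma generating_flag:
  assumes N: "finrk subspaces N"
  obtains X m u where "X 0 = {\<one>\<^bsub>G\<^esub>}" "X m = N" "m \<le> rk subspaces N"
    "\<And>k. k < m \<Longrightarrow> X (Suc k) = X k <#>\<^bsub>G\<^esub> line (u k)" "\<And>k. k < m \<Longrightarrow> u k \<in> carrier G"
    "\<And>k. X k \<in> subspaces"
proof -
  have Ns: "N \<in> subspaces" using N by (simp add: finrk_def)
  \<comment> \<open>A vector missing from \<open>Y\<close> as long as there is one, and the neutral
    element afterwards, so that the sequence is defined for all indices and remains in
    \<open>N\<close>.\<close>
  define w where "w Y = (if Y = N then \<one>\<^bsub>G\<^esub> else (SOME x. x \<in> N \<and> x \<notin> Y))" for Y
  define X where "X = rec_nat {\<one>\<^bsub>G\<^esub>} (\<lambda>_ Y. Y <#>\<^bsub>G\<^esub> line (w Y))"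
  have X0: "X 0 = {\<one>\<^bsub>G\<^esub>}" and XS: "X (Suc k) = X k <#>\<^bsub>G\<^esub> line (w (X k))" for k
    by (simp_all add: X_def)
  have w: "w Y \<in> N" "Y \<noteq> N \<Longrightarrow> w Y \<notin> Y" if "Y \<subseteq> N" for Y
    using someI_ex[of "\<lambda>x. x \<in> N \<and> x \<notin> Y"] that subspaces_one[OF Ns] unfolding w_def by auto
  have XN: "X k \<in> subspaces \<and> X k \<subseteq> N" for k
  proof (induction k)
    case 0
    then show ?case using trivial_subspace subspaces_one[OF Ns] by (simp add: X0)
  next
    case (Suc k)
    then show ?case
      using add_line_subspace add_line_least[OF Ns] w subspaces_mem[OF Ns] by (simp add: XS)
  qed
  have wc: "w (X k) \<in> carrier G" for k using w XN subspaces_mem[OF Ns] by blast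
  have strict: "X k \<subset> X (Suc k)" if "X k \<noteq> N" for k
    using subset_add_line[of "X k" "w (X k)"] mem_add_line[of "X k" "w (X k)"] XN[of k] w[of "X k"] that wc[of k]
    unfolding XS by blast
  have "\<exists>m\<le>rk subspaces N. X m = N"
  proof (rule ccontr)
    assume no: "\<not> (\<exists>m\<le>rk subspaces N. X m = N)"
    have "chain_in subspaces X (Suc (rk subspaces N))"
      unfolding chain_in_def using XN strict no by (simp add: less_Suc_eq_le)
    then show False using rk_ge[OF N, of X "Suc (rk subspaces N)"] XN by simp
  qed
  then obtain m where "m \<le> rk subspaces N" "X m = N" by blast
  then show thesis using X0 XS wc XN by (intro that[of X m "\<lambda>k. w (X k)"]) auto
qed

end

section \<open>Convexity and concavity of ranks\<close>

section \<open>Ranks in the non-commutative symmetric algebra\<close>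

context nc_algebra
begin

abbreviation act where "act s l \<equiv> \<lambda>a p. zmult D s l l p (k l a)"

lemma kspace_comp: "kspace (K l) (comp D s l) (act s l)"
  by (intro kspace.intro kspace_axioms.intro field_K comp_group)
    (auto simp: mult_closed k_closed mult_add_left mult_add_right k_add mult_assoc k_mult k_one one_right)

sublocale S: kspace "K l" "comp D s l" "act s l" for l s by (rule kspace_comp)

lemma kspace_GG: "kspace (K n) (GG s n) (ract s n)"
  by (intro kspace.intro kspace_axioms.intro field_K GG_group)
    (simp_all only: ract_closed ract_add ract_arg_add ract_mult ract_one)

sublocale T: kspace "K n" "GG s n" "ract s n" for n s by (rule kspace_GG)

abbreviation Sub where "Sub s l \<equiv> kspace.subspaces (K l) (comp D s l) (act s l)"
abbreviation SubG where "SubG s n \<equiv> kspace.subspaces (K n) (GG s n) (ract s n)"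

interpretation mT: group_hom "GG s n" "comp D s (n + 2)" "mulT s n" for s n
  by (intro group_hom.intro group_hom_axioms.intro comp.is_group GG.is_group homI mulT_closed mulT_add)

interpretation Ph: group_hom "comp D s n" "GG s n" "Phi s n" for s n
  by (intro group_hom.intro group_hom_axioms.intro comp.is_group GG.is_group homI Phi_closed Phi_add)

lemma k_group_hom: "group_hom (add_monoid (K i)) (comp D i i) (k i)"
  by (intro group_hom.intro group_hom_axioms.intro comp.is_group K.add.is_group homI)
    (simp_all add: k_closed k_add)

text \<open>Above the diagonal, degree \<open>j\<close> is degree \<open>j - 1\<close> times
  \<open>W (j - 1)\<close>: the family formed in this way is closed under products and contains the
  generators. The shift by two reflects that \<open>mulT i n\<close> takes values in degree
  \<open>n + 2\<close>.\<close>

lemma right_gen: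
  "(if j < i then {\<one>\<^bsub>comp D i j\<^esub>} else if i = j then k i ` carrier (K i)
    else mulT i (j - 2) ` carrier (GG i (j - 2))) = carrier (comp D i j)"
proof -
  let ?B = "\<lambda>i j. if j < i then {\<one>\<^bsub>comp D i j\<^esub>} else if i = j then k i ` carrier (K i)
    else mulT i (j - 2) ` carrier (GG i (j - 2))"
  have sub: "subgroup (?B i j) (comp D i j)" for i j
    using comp.triv_subgroup[of i j] group_hom.img_is_subgroup[OF k_group_hom, of j] mT.img_is_subgroup[of i "j - 2"]
    by simp
  have one: "\<one>\<^bsub>comp D i j\<^esub> \<in> ?B i j" for i j by (rule subgroup.one_closed[OF sub])
  have car: "x \<in> ?B i j \<Longrightarrow> x \<in> carrier (comp D i j)" for x i j by (rule subgroup.mem_carrier[OF sub])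
  have "zsubring D ?B"
    unfolding zsubring_def
  proof (intro conjI allI ballI sub)
    fix i j l x y assume x: "x \<in> ?B i j" and y: "y \<in> ?B j l"
    note c = car[OF x] car[OF y]
    consider "j < i" | "l < j" | "i \<le> j" "j = l" | "i \<le> j" "j < l" by linarith
    then show "zmult D i j l x y \<in> ?B i l"
    proof cases
      case 1
      then have "x = \<one>\<^bsub>comp D i j\<^esub>" using x by simp
      then show ?thesis using one c by (simp only: mult_zero_left)
    next
      case 2
      then have "y = \<one>\<^bsub>comp D j l\<^esub>" using y by simp
      then show ?thesis using one c by (simp only: mult_zero_right)
    next
      case 3
      then obtain b where b: "b \<in> carrier (K j)" "y = k j b" using y by auto
      show ?thesis
      proof (cases "i = j")
        case True
        then obtain a where "a \<in> carrier (K j)" "x = k j a" using x by auto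
        with b 3 True show ?thesis by (auto simp: k_mult)
      next
        case False
        then obtain z where z: "z \<in> carrier (GG i (j - 2))" "x = mulT i (j - 2) z" using x 3 by auto
        \<comment> \<open>The scalars of degree \<open>j\<close> act on \<open>GG i (j - 2)\<close>
          because the fields have period two.\<close>
        have b2: "b \<in> carrier (K (j - 2))" using b period[of "j - 2"] by simp
        have "zmult D i j l x y = mulT i (j - 2) (ract i (j - 2) b z)"
          using mulT_ract[OF z(1) b2] z b 3 by simp
        then show ?thesis using ract_closed[OF b2 z(1)] 3 False by auto
      qed
    next
      case 4
      then obtain p1 p2 where z: "p1 \<in> carrier (comp D j (l - 1))" "p2 \<in> carrier (comp D j (l - 1))"
        "y = mulT j (l - 2) (p1, p2)" using y by (auto simp: carrier_DirProd)
      have o: "om (l - 1) (y1 (l - 2)) \<in> carrier (comp D (l - 1) l)" "om (l - 1) (y2 (l - 2)) \<in> carrier (comp D (l - 1) l)"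
        using om_closed2[of "y1 (l - 2)" "l - 2"] om_closed2[of "y2 (l - 2)" "l - 2"] y_in[of "l - 2"] by simp_all
      have "zmult D i j l x y = mulT i (l - 2) (zmult D i j (l - 1) x p1, zmult D i j (l - 1) x p2)"
        using z o c(1) by (simp add: mulT_def mult_add_right mult_assoc mult_closed)
      moreover have "(zmult D i j (l - 1) x p1, zmult D i j (l - 1) x p2) \<in> carrier (GG i (l - 2))"
        using z c(1) by (simp add: mult_closed)
      ultimately show ?thesis using 4 by auto
    qed
  next
    show "zone D i \<in> ?B i i" for i using k_one[of i] by (metis (mono_tags, lifting) K.one_closed image_eqI less_irrefl)
  qed
  moreover have "om i v \<in> ?B i (i + 1)" if v: "v \<in> carrier (W i)" for i v
  proof -
    have o: "om i v = mulT i (i - 1) (ten i (i - 1) (zone D i) v)"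
      using mulT_ten[of "zone D i" i "i - 1" v] v one_closed[of i] by (simp add: one_left om_closed add.commute[of 1 i])
    have "ten i (i - 1) (zone D i) v \<in> carrier (GG i (i - 1))"
      using ten_closed[of "zone D i" i "i - 1" v] v one_closed[of i] by simp
    with o show ?thesis by simp
  qed
  ultimately show ?thesis
    using gen[of ?B] by auto
qed

lemma diag_gen: "x \<in> carrier (comp D i i) \<Longrightarrow> \<exists>a\<in>carrier (K i). x = k i a"
  using right_gen[of i i] by auto

lemma mulT_surj:
  assumes "s \<le> n + 1" "x \<in> carrier (comp D s (n + 2))"
  shows "\<exists>z\<in>carrier (GG s n). x = mulT s n z"
  using right_gen[of "n + 2" s] assms by (auto simp del: carrier_DirProd)

text \<open>In the coordinates of \<open>GG s n\<close> the square of \<open>N\<close> is N (x)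
  \<open>W (n + 1)\<close>. It is stable under \<open>K n\<close> because passing a scalar through
  the basis produces coefficients in \<open>K (n + 1)\<close>, under which \<open>N\<close> is
  stable.\<close>

lemma sq_sub:
  assumes N: "N \<in> Sub s (n + 1)"
  shows "N \<times> N \<in> SubG s n"
proof (rule T.subspacesI)
  show "N \<times> N \<subseteq> carrier (GG s n)" using S.subspaces_mem[OF N] by auto
  show "\<one>\<^bsub>GG s n\<^esub> \<in> N \<times> N" using S.subspaces_one[OF N] by simp
  show "x \<otimes>\<^bsub>GG s n\<^esub> y \<in> N \<times> N" if "x \<in> N \<times> N" "y \<in> N \<times> N" for x y
    using that S.subspaces_add[OF N] by auto
  show "ract s n a x \<in> N \<times> N" if a: "a \<in> carrier (K n)" and "x \<in> N \<times> N" for a x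
    using that S.subspaces_add[OF N] S.subspaces_act[OF N]
    by (auto simp: ract_def ten_def pr_closed)
qed

text \<open>If p (x) v lies in N (x) W, then both coordinates of \<open>v\<close> move
  \<open>p\<close> into \<open>N\<close>; a nonzero coordinate could be inverted and would put
  \<open>p\<close> itself into \<open>N\<close>.\<close>

lemma ten_sq:
  assumes N: "N \<in> Sub s (n + 1)" and p: "p \<in> carrier (comp D s (n + 1))" "p \<notin> N"
    and v: "v \<in> carrier (W (n + 1))" and "ten s n p v \<in> N \<times> N"
  shows "v = \<zero>\<^bsub>W (n + 1)\<^esub>"
proof -
  have *: "a = \<zero>\<^bsub>K (n + 1)\<^esub>" if a: "a \<in> carrier (K (n + 1))" and n: "act s (n + 1) a p \<in> N" for a
  proof (rule ccontr)
    assume "a \<noteq> \<zero>\<^bsub>K (n + 1)\<^esub>"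
    then have inv: "inv\<^bsub>K (n + 1)\<^esub> a \<in> carrier (K (n + 1))" "a \<otimes>\<^bsub>K (n + 1)\<^esub> inv\<^bsub>K (n + 1)\<^esub> a = \<one>\<^bsub>K (n + 1)\<^esub>"
      using a K.field_Units[of "n + 1"] by auto
    have "act s (n + 1) (inv\<^bsub>K (n + 1)\<^esub> a) (act s (n + 1) a p) = p"
      using S.act_mult[OF a inv(1) p(1)] S.act_one[OF p(1)] inv(2) by simp
    then show False using S.subspaces_act[OF N inv(1) n] p(2) by simp
  qed
  have "pr n (x1 n) v = \<zero>\<^bsub>K (n + 1)\<^esub>" "pr n (x2 n) v = \<zero>\<^bsub>K (n + 1)\<^esub>"
    using assms(5) v by (auto intro!: * simp: ten_def pr_closed)
  then show ?thesis using expand_right[OF v] by simp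
qed

text \<open>Here both bases of \<open>W (n + 1)\<close> meet: \<open>GG s n\<close> is built on the
  left basis \<open>y1 n\<close>, \<open>y2 n\<close>, but as a right space p (x) W is spanned by
  the tensors of \<open>p\<close> with the right basis \<open>x1 (n + 1)\<close>,
  \<open>x2 (n + 1)\<close>.\<close>

lemma ten_act_line:
  assumes "p \<in> carrier (comp D s (n + 1))" "v \<in> carrier (W (n + 1))"
  shows "ten s n p v = ract s n (pr (n + 1) v (y1 (n + 1))) (ten s n p (x1 (n + 1))) \<otimes>\<^bsub>GG s n\<^esub>
    ract s n (pr (n + 1) v (y2 (n + 1))) (ten s n p (x2 (n + 1)))"
proof -
  have b: "pr (n + 1) v (y1 (n + 1)) \<in> carrier (K n)" "pr (n + 1) v (y2 (n + 1)) \<in> carrier (K n)"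
    using pr_closed[of v "n + 1"] assms(2) y_in[of "n + 1"] by simp_all
  have "ten s n p v = ten s n p (x1 (n + 1) \<triangleleft>\<^bsub>W (n + 1)\<^esub> pr (n + 1) v (y1 (n + 1)) \<oplus>\<^bsub>W (n + 1)\<^esub>
      x2 (n + 1) \<triangleleft>\<^bsub>W (n + 1)\<^esub> pr (n + 1) v (y2 (n + 1)))"
    using expand_left[OF assms(2)] by simp
  then show ?thesis
    using assms(1) b by (simp only: ten_add_right r_closed2 x_in ract_ten)
qed

text \<open>Between X_m (x) W and X_{m+1} (x) W there is room for X_m (x) W plus the right line
  through p (x) x1, where \<open>p\<close> is new in X_{m+1}. By \<open>ten_sq\<close> both
  inclusions are strict, so tensoring with \<open>W\<close> at least doubles the rank.\<close>

lemma double_chain: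
  assumes N: "finrk (Sub s (n + 1)) N"
  shows "\<exists>Y. chain_in (SubG s n) Y (2 * rk (Sub s (n + 1)) N) \<and> Y (2 * rk (Sub s (n + 1)) N) \<subseteq> N \<times> N"
proof -
  let ?r = "rk (Sub s (n + 1)) N"
  obtain X where X: "chain_in (Sub s (n + 1)) X ?r" "X ?r \<subseteq> N" by (rule rk_chain[OF N])
  have Xs: "X m \<in> Sub s (n + 1)" if "m \<le> ?r" for m using X that by (simp add: chain_in_def)
  have Xlt: "X m \<subset> X (Suc m)" if "m < ?r" for m using X that by (simp add: chain_in_def)
  define p where "p m = (SOME p. p \<in> X (Suc m) \<and> p \<notin> X m)" for m
  have p: "p m \<in> X (Suc m)" "p m \<notin> X m" if "m < ?r" for m
    using Xlt[OF that] someI_ex[of "\<lambda>p. p \<in> X (Suc m) \<and> p \<notin> X m"] unfolding p_def by auto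
  have pc: "p m \<in> carrier (comp D s (n + 1))" if "m < ?r" for m
    using p[OF that] S.subspaces_mem[OF Xs[of "Suc m"]] that by auto
  let ?t = "\<lambda>m. ten s n (p m) (x1 (n + 1))"
  have tc: "?t m \<in> carrier (GG s n)" if "m < ?r" for m
    using ten_closed[OF pc[OF that]] by simp
  let ?mid = "\<lambda>m. X m \<times> X m <#>\<^bsub>GG s n\<^esub> T.line n s (?t m)"
  have mid: "?mid m \<in> SubG s n" if "m < ?r" for m
    using T.add_line_subspace[OF sq_sub[OF Xs] tc[OF that]] that by simp
  have s1: "X m \<times> X m \<subset> ?mid m" if m: "m < ?r" for m
  proof -
    have "?t m \<notin> X m \<times> X m"
    proof
      assume "?t m \<in> X m \<times> X m"
      then have "x1 (n + 1) = \<zero>\<^bsub>W (n + 1)\<^esub>"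
        using ten_sq[OF Xs pc[OF m] p(2)[OF m]] m by simp
      then have "pr (n + 1) (x1 (n + 1)) (y1 (n + 1)) = \<zero>\<^bsub>K (n + 2)\<^esub>"
        using pr_add_left[of "\<zero>\<^bsub>W (n + 1)\<^esub>" "n + 1" "\<zero>\<^bsub>W (n + 1)\<^esub>" "y1 (n + 1)"] y_in[of "n + 1"]
          pr_closed[of "\<zero>\<^bsub>W (n + 1)\<^esub>" "n + 1" "y1 (n + 1)"] K.add.l_cancel_one'[of _ "n + 2"]
        by (metis L.M.zero_closed L.M.l_zero add_one_one)
      then show False using dual(1)[of "n + 1"] K.one_not_zero[of "n + 2"] by simp
    qed
    moreover have sq: "X m \<times> X m \<in> SubG s n" using sq_sub[OF Xs] m by simp
    ultimately show ?thesis
      using T.subset_add_line[OF sq tc[OF m]] T.mem_add_line[OF sq tc[OF m]] by blast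
  qed
  have s2: "?mid m \<subset> X (Suc m) \<times> X (Suc m)" if m: "m < ?r" for m
  proof -
    have tX: "ten s n (p m) v \<in> X (Suc m) \<times> X (Suc m)" if "v \<in> carrier (W (n + 1))" for v
      using S.subspaces_act[OF Xs[of "Suc m"]] p(1)[OF m] m that by (auto simp: ten_def pr_closed)
    have "?mid m \<subseteq> X (Suc m) \<times> X (Suc m)"
      using T.add_line_least[OF sq_sub[OF Xs[of "Suc m"]], of "X m \<times> X m" "?t m"] Xlt[OF m] tX[of "x1 (n + 1)"] m by auto
    moreover have "ten s n (p m) (x2 (n + 1)) \<notin> ?mid m"
    proof
      let ?V = "W (n + 1)"
      assume "ten s n (p m) (x2 (n + 1)) \<in> ?mid m"
      then obtain y a where y: "y \<in> X m \<times> X m" and a: "a \<in> carrier (K n)"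
        and eq: "ten s n (p m) (x2 (n + 1)) = y \<otimes>\<^bsub>GG s n\<^esub> ract s n a (?t m)"
        unfolding T.add_line_iff by blast
      have yc: "y \<in> carrier (GG s n)" using T.subspaces_mem[OF sq_sub[OF Xs] y] m by simp
      \<comment> \<open>The assumed relation says that p (x) x2 minus (p (x) x1) a lies in X_m (x)
        W. This difference is p (x) \<open>?v\<close>, so \<open>?v\<close> vanishes by
        \<open>ten_sq\<close>, against its pairing with \<open>y2\<close>.\<close>
      let ?v = "x1 (n + 1) \<triangleleft>\<^bsub>?V\<^esub> (\<ominus>\<^bsub>K n\<^esub> a) \<oplus>\<^bsub>?V\<^esub> x2 (n + 1)"
      have na: "\<ominus>\<^bsub>K n\<^esub> a \<in> carrier (K n)" using a by simp
      have vc: "?v \<in> carrier ?V" using na by simp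
      have "ten s n (p m) ?v = ract s n (\<ominus>\<^bsub>K n\<^esub> a) (?t m) \<otimes>\<^bsub>GG s n\<^esub> (y \<otimes>\<^bsub>GG s n\<^esub> ract s n a (?t m))"
        using na pc[OF m] by (simp only: ten_add_right r_closed2 x_in ract_ten eq[symmetric])
      also have "\<dots> = y \<otimes>\<^bsub>GG s n\<^esub> ract s n (\<ominus>\<^bsub>K n\<^esub> a \<oplus>\<^bsub>K n\<^esub> a) (?t m)"
        using a na tc[OF m] yc by (simp only: ract_arg_add GG.m_lcomm ract_closed)
      also have "\<dots> = y" using a yc tc[OF m] by (simp only: K.l_neg T.act_zero GG.r_one)
      finally have "?v = \<zero>\<^bsub>?V\<^esub>" using ten_sq[OF Xs pc[OF m] p(2)[OF m] vc] y m by simp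
      moreover have "pr (n + 1) ?v (y2 (n + 1)) = \<one>\<^bsub>K (n + 2)\<^esub>"
      proof -
        have "pr (n + 1) ?v (y2 (n + 1)) = pr (n + 1) (x1 (n + 1) \<triangleleft>\<^bsub>?V\<^esub> (\<ominus>\<^bsub>K n\<^esub> a)) (y2 (n + 1)) \<oplus>\<^bsub>K (n + 2)\<^esub>
          pr (n + 1) (x2 (n + 1)) (y2 (n + 1))"
          using pr_add_left[of "x1 (n + 1) \<triangleleft>\<^bsub>?V\<^esub> (\<ominus>\<^bsub>K n\<^esub> a)" "n + 1" "x2 (n + 1)" "y2 (n + 1)"] na y_in[of "n + 1"] by simp
        also have "\<dots> = \<one>\<^bsub>K (n + 2)\<^esub>"
          using pr_right[of "x1 (n + 1)" "n + 1" "\<ominus>\<^bsub>K n\<^esub> a" "y2 (n + 1)"] dual[of "n + 1"] na y_in[of "n + 1"] by simp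
        finally show ?thesis .
      qed
      moreover have "pr (n + 1) \<zero>\<^bsub>?V\<^esub> (y2 (n + 1)) = \<zero>\<^bsub>K (n + 2)\<^esub>"
        using pr_add_left[of "\<zero>\<^bsub>W (n + 1)\<^esub>" "n + 1" "\<zero>\<^bsub>W (n + 1)\<^esub>" "y2 (n + 1)"] y_in[of "n + 1"]
          pr_closed[of "\<zero>\<^bsub>W (n + 1)\<^esub>" "n + 1" "y2 (n + 1)"] K.add.l_cancel_one'[of _ "n + 2"]
        by (metis L.M.zero_closed L.M.l_zero add_one_one)
      ultimately show False using K.one_not_zero[of "n + 2"] by simp
    qed
    ultimately show ?thesis using tX[of "x2 (n + 1)"] by auto
  qed
  let ?Y = "\<lambda>m. if even m then X (m div 2) \<times> X (m div 2) else ?mid (m div 2)"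
  have "chain_in (SubG s n) ?Y (2 * ?r)"
    unfolding chain_in_def
  proof (intro conjI allI impI)
    show "?Y m \<in> SubG s n" if "m \<le> 2 * ?r" for m
      using that sq_sub[OF Xs[of "m div 2"]] mid[of "m div 2"] by (auto elim!: oddE)
    show "?Y m \<subset> ?Y (Suc m)" if "m < 2 * ?r" for m
    proof (cases "even m")
      case True
      then have "m div 2 < ?r" "Suc m div 2 = m div 2" using that by auto
      with True s1[of "m div 2"] show ?thesis by simp
    next
      case False
      then have "m div 2 < ?r" "Suc m div 2 = Suc (m div 2)" using that by (auto elim!: oddE)
      with False s2[of "m div 2"] show ?thesis by simp
    qed
  qed
  moreover have "?Y (2 * ?r) \<subseteq> N \<times> N" using X(2) by auto
  ultimately show ?thesis by blast
qed

lemma preimage_Phi: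
  assumes Y: "Y \<in> SubG s n"
  shows "{q \<in> carrier (comp D s n). Phi s n q \<in> Y} \<in> Sub s n"
  by (rule S.subspacesI)
    (use T.subspaces_one[OF Y] T.subspaces_add[OF Y] T.subspaces_act[OF Y] in
      \<open>auto simp: Phi_add ract_Phi[symmetric] mult_closed k_closed simp del: one_DirProd mult_DirProd\<close>)

lemma image_mulT:
  assumes Y: "Y \<in> SubG s n"
  shows "mulT s n ` Y \<in> Sub s (n + 2)"
proof (rule S.subspacesI)
  have Yc: "\<And>y. y \<in> Y \<Longrightarrow> y \<in> carrier (GG s n)" by (rule T.subspaces_mem[OF Y])
  show "mulT s n ` Y \<subseteq> carrier (comp D s (n + 2))" using Yc mulT_closed by blast
  show "\<one>\<^bsub>comp D s (n + 2)\<^esub> \<in> mulT s n ` Y" using T.subspaces_one[OF Y] mT.hom_one by (metis image_eqI)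
  show "x \<otimes>\<^bsub>comp D s (n + 2)\<^esub> y \<in> mulT s n ` Y" if "x \<in> mulT s n ` Y" "y \<in> mulT s n ` Y" for x y
    using that
    by (auto simp: mulT_add[OF Yc Yc, symmetric] simp del: mult_DirProd intro!: imageI T.subspaces_add[OF Y])
  show "act s (n + 2) a x \<in> mulT s n ` Y" if "a \<in> carrier (K (n + 2))" "x \<in> mulT s n ` Y" for a x
    using that by (auto simp: mulT_ract[OF Yc, symmetric] intro!: imageI T.subspaces_act[OF Y])
qed

lemma preimage_mulT:
  assumes Y: "Y \<in> Sub s (n + 2)"
  shows "{z \<in> carrier (GG s n). mulT s n z \<in> Y} \<in> SubG s n"
proof (rule T.subspacesI)
  show "\<one>\<^bsub>GG s n\<^esub> \<in> {z \<in> carrier (GG s n). mulT s n z \<in> Y}"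
    using S.subspaces_one[OF Y] mT.hom_one[of s n] GG.one_closed by (metis (mono_tags, lifting) mem_Collect_eq)
  show "ract s n a x \<in> {z \<in> carrier (GG s n). mulT s n z \<in> Y}"
    if "a \<in> carrier (K n)" "x \<in> {z \<in> carrier (GG s n). mulT s n z \<in> Y}" for a x
    using that S.subspaces_act[OF Y, of a] by (auto simp: mulT_ract ract_closed simp del: carrier_DirProd)
qed (use S.subspaces_add[OF Y] in \<open>auto simp: mulT_add simp del: carrier_DirProd mult_DirProd intro: GG.m_closed\<close>)

text \<open>A dimension count: N (x) W has at least twice the rank of \<open>N\<close>; its image
  under multiplication lies in \<open>U\<close>, and by \<open>exact\<close> its part in the kernel
  comes from \<open>Z\<close> through \<open>Phi\<close>.\<close>

lemma convex:
  assumes N: "finrk (Sub s (n + 1)) N" and U: "finrk (Sub s (n + 2)) U" and Z: "finrk (Sub s n) Z"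
    and NU: "mulT s n ` (N \<times> N) \<subseteq> U" and NZ: "{q \<in> carrier (comp D s n). Phi s n q \<in> N \<times> N} \<subseteq> Z"
  shows "2 * rk (Sub s (n + 1)) N \<le> rk (Sub s (n + 2)) U + rk (Sub s n) Z"
proof -
  let ?r = "2 * rk (Sub s (n + 1)) N"
  obtain Y where Y: "chain_in (SubG s n) Y ?r" "Y ?r \<subseteq> N \<times> N" using double_chain[OF N] by blast
  have Ys: "Y m \<in> SubG s n" if "m \<le> ?r" for m using Y that by (simp add: chain_in_def)
  have Ylt: "Y m \<subset> Y (Suc m)" if "m < ?r" for m using Y that by (simp add: chain_in_def)
  let ?A = "\<lambda>m. mulT s n ` Y m" and ?B = "\<lambda>m. {q \<in> carrier (comp D s n). Phi s n q \<in> Y m}"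
  have As: "?A m \<in> Sub s (n + 2)" and Bs: "?B m \<in> Sub s n" if "m \<le> ?r" for m
    using image_mulT[OF Ys[OF that]] preimage_Phi[OF Ys[OF that]] by auto
  have AU: "?A ?r \<subseteq> U" and BZ: "?B ?r \<subseteq> Z" using Y(2) NU NZ by auto
  have fA: "finrk (Sub s (n + 2)) (?A ?r)" and fB: "finrk (Sub s n) (?B ?r)"
    using finrk_mono[OF U As AU] finrk_mono[OF Z Bs BZ] by auto
  have "?r \<le> rk (Sub s (n + 2)) (?A ?r) + rk (Sub s n) (?B ?r)"
  proof (rule rk_sum[where A = ?A and B = ?B and n = ?r, OF As fA Bs fB])
    fix m assume m: "m < ?r"
    show "?A m \<subseteq> ?A (Suc m) \<and> ?B m \<subseteq> ?B (Suc m)" using Ylt[OF m] by auto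
    \<comment> \<open>If image and kernel part both stood still, a new \<open>x\<close> would have
      the same product as some old \<open>y\<close>. By \<open>exact\<close> their difference is
      \<open>Phi s n q\<close>, and it already lies in \<open>Y m\<close> because the kernel part
      did not grow; hence \<open>x\<close> would be old.\<close>
    show "?A m \<noteq> ?A (Suc m) \<or> ?B m \<noteq> ?B (Suc m)"
    proof (rule ccontr)
      assume "\<not> ?thesis"
      then have eq: "?A m = ?A (Suc m)" "?B m = ?B (Suc m)" by auto
      obtain x where x: "x \<in> Y (Suc m)" "x \<notin> Y m" using Ylt[OF m] by blast
      then obtain y where y: "y \<in> Y m" "mulT s n x = mulT s n y" using eq(1) by (metis (no_types, lifting) image_iff)
      have "x \<in> carrier (GG s n)" by (rule T.subspaces_mem[OF Ys x(1)]) (use m in simp)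
      moreover have "y \<in> carrier (GG s n)" by (rule T.subspaces_mem[OF Ys y(1)]) (use m in simp)
      ultimately have c: "x \<in> carrier (GG s n)" "y \<in> carrier (GG s n)" by blast+
      let ?w = "x \<otimes>\<^bsub>GG s n\<^esub> inv\<^bsub>GG s n\<^esub> y"
      have w: "?w \<in> carrier (GG s n)" using c by (simp only: GG.m_closed GG.inv_closed)
      have "mulT s n ?w = \<one>\<^bsub>comp D s (n + 2)\<^esub>"
        using c y by (simp only: mulT_add mT.hom_inv GG.inv_closed) (simp only: comp.r_inv mulT_closed)
      then obtain q where q: "q \<in> carrier (comp D s n)" "?w = Phi s n q" using exact[OF w] by blast
      have yS: "y \<in> Y (Suc m)" using y Ylt[OF m] by blast
      have "?w \<in> Y (Suc m)"
        using T.subspaces_add[OF Ys x(1) T.subspaces_inv[OF Ys yS]] m by simp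
      then have "?w \<in> Y m" using eq(2) q by auto
      then have "?w \<otimes>\<^bsub>GG s n\<^esub> y \<in> Y m" using T.subspaces_add[OF Ys _ y(1)] m by simp
      then show False using x c by (simp only: GG.m_assoc GG.inv_closed GG.l_inv GG.r_one)
    qed
  qed
  also have "\<dots> \<le> rk (Sub s (n + 2)) U + rk (Sub s n) Z"
    using rk_mono[OF U As AU] rk_mono[OF Z Bs BZ] by simp
  finally show ?thesis .
qed

text \<open>The upper bound matching \<open>double_chain\<close>: every vector \<open>u\<close> of a
  spanning flag contributes the two right lines through u (x) x1 and u (x) x2.\<close>

lemma rk_GG:
  assumes f: "finrk (Sub s (n + 1)) (carrier (comp D s (n + 1)))"
  shows "finrk (SubG s n) (carrier (GG s n))"
    "rk (SubG s n) (carrier (GG s n)) \<le> 2 * rk (Sub s (n + 1)) (carrier (comp D s (n + 1)))"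
proof -
  obtain X m u where X: "X 0 = {\<one>\<^bsub>comp D s (n + 1)\<^esub>}" "X m = carrier (comp D s (n + 1))"
    "m \<le> rk (Sub s (n + 1)) (carrier (comp D s (n + 1)))"
    "\<And>k. k < m \<Longrightarrow> X (Suc k) = X k <#>\<^bsub>comp D s (n + 1)\<^esub> S.line (n + 1) s (u k)"
    "\<And>k. k < m \<Longrightarrow> u k \<in> carrier (comp D s (n + 1))" "\<And>k. X k \<in> Sub s (n + 1)"
    by (rule S.generating_flag[OF f]) (rule that, assumption+)
  have "finrk (SubG s n) (X j \<times> X j) \<and> rk (SubG s n) (X j \<times> X j) \<le> 2 * j" if "j \<le> m" for j
    using that
  proof (induction j)
    case 0
    have "X 0 \<times> X 0 = {\<one>\<^bsub>GG s n\<^esub>}" by (simp add: X(1))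
    then show ?case using T.finrk_trivial[of n s] by simp
  next
    case (Suc j)
    let ?u = "u j"
    have u: "?u \<in> carrier (comp D s (n + 1))" using X(5) Suc.prems by simp
    let ?t1 = "ten s n ?u (x1 (n + 1))" and ?t2 = "ten s n ?u (x2 (n + 1))"
    have t: "?t1 \<in> carrier (GG s n)" "?t2 \<in> carrier (GG s n)" using ten_closed[OF u] by simp_all
    have IH: "finrk (SubG s n) (X j \<times> X j)" "rk (SubG s n) (X j \<times> X j) \<le> 2 * j" using Suc by auto
    let ?B1 = "X j \<times> X j <#>\<^bsub>GG s n\<^esub> T.line n s ?t1"
    have B1: "?B1 \<in> SubG s n" by (rule T.add_line_subspace[OF sq_sub[OF X(6)] t(1)])
    have f1: "finrk (SubG s n) ?B1" "rk (SubG s n) ?B1 \<le> 2 * j + 1"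
      using T.rk_add_line[OF IH(1) B1 t(1) order_refl] IH(2) by auto
    have "X (Suc j) \<times> X (Suc j) \<subseteq> ?B1 <#>\<^bsub>GG s n\<^esub> T.line n s ?t2"
    proof
      fix z assume z: "z \<in> X (Suc j) \<times> X (Suc j)"
      have eq: "X (Suc j) = X j <#>\<^bsub>comp D s (n + 1)\<^esub> S.line (n + 1) s ?u" using X(4) Suc.prems by simp
      obtain a1 c1 a2 c2 where a: "a1 \<in> X j" "a2 \<in> X j" and c: "c1 \<in> carrier (K (n + 1))" "c2 \<in> carrier (K (n + 1))"
        and zz: "z = (a1 \<otimes>\<^bsub>comp D s (n + 1)\<^esub> act s (n + 1) c1 ?u, a2 \<otimes>\<^bsub>comp D s (n + 1)\<^esub> act s (n + 1) c2 ?u)"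
        using z unfolding eq mem_Times_iff S.add_line_iff by (metis prod.collapse)
      have ac: "(a1, a2) \<in> carrier (GG s n)" using a S.subspaces_mem[OF X(6)] by auto
      let ?v = "c1 \<odot>\<^bsub>W (n + 1)\<^esub> y1 n \<oplus>\<^bsub>W (n + 1)\<^esub> c2 \<odot>\<^bsub>W (n + 1)\<^esub> y2 n"
      have v: "?v \<in> carrier (W (n + 1))" using c by (simp add: L.smult_closed)
      have "ten s n ?u ?v = (act s (n + 1) c1 ?u, act s (n + 1) c2 ?u)"
        using c u ten_bal[OF u c(1) y_in(1), symmetric] ten_bal[OF u c(2) y_in(2), symmetric]
        by (simp add: ten_add_right L.smult_closed S.act_closed ten_y mult_closed k_closed)
      then have "z = (a1, a2) \<otimes>\<^bsub>GG s n\<^esub> ten s n ?u ?v" by (simp add: zz)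
      also have "\<dots> = ((a1, a2) \<otimes>\<^bsub>GG s n\<^esub> ract s n (pr (n + 1) ?v (y1 (n + 1))) ?t1) \<otimes>\<^bsub>GG s n\<^esub>
          ract s n (pr (n + 1) ?v (y2 (n + 1))) ?t2"
        using ten_act_line[OF u v] ac t ract_closed pr_closed[of ?v "n + 1"] v y_in[of "n + 1"]
        by (simp add: GG.m_assoc del: carrier_DirProd mult_DirProd)
      finally have zeq: "z = ((a1, a2) \<otimes>\<^bsub>GG s n\<^esub> ract s n (pr (n + 1) ?v (y1 (n + 1))) ?t1) \<otimes>\<^bsub>GG s n\<^esub>
          ract s n (pr (n + 1) ?v (y2 (n + 1))) ?t2" .
      have b: "pr (n + 1) ?v (y1 (n + 1)) \<in> carrier (K n)" "pr (n + 1) ?v (y2 (n + 1)) \<in> carrier (K n)"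
        using pr_closed[of ?v "n + 1"] v y_in[of "n + 1"] by simp_all
      have "(a1, a2) \<in> X j \<times> X j" using a by simp
      then have "(a1, a2) \<otimes>\<^bsub>GG s n\<^esub> ract s n (pr (n + 1) ?v (y1 (n + 1))) ?t1 \<in> ?B1"
        unfolding T.add_line_iff using b(1) by blast
      then show "z \<in> ?B1 <#>\<^bsub>GG s n\<^esub> T.line n s ?t2"
        unfolding T.add_line_iff[of z] using b(2) zeq by blast
    qed
    from T.rk_add_line[OF f1(1) sq_sub[OF X(6)] t(2) this] f1(2) show ?case by auto
  qed
  from this[of m] X(2,3) show "finrk (SubG s n) (carrier (GG s n))"
    "rk (SubG s n) (carrier (GG s n)) \<le> 2 * rk (Sub s (n + 1)) (carrier (comp D s (n + 1)))"
    by auto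
qed

lemma low_rk:
  assumes "l < s"
  shows "finrk (Sub s l) (carrier (comp D s l))" "rk (Sub s l) (carrier (comp D s l)) = 0"
  using S.finrk_trivial[of l s] lower_zero[OF assms] by simp_all

lemma diag_rk:
  "finrk (Sub s s) (carrier (comp D s s))" "rk (Sub s s) (carrier (comp D s s)) \<le> 1"
proof -
  have "carrier (comp D s s) \<subseteq> {\<one>\<^bsub>comp D s s\<^esub>} <#>\<^bsub>comp D s s\<^esub> S.line s s (zone D s)"
  proof
    fix x assume "x \<in> carrier (comp D s s)"
    then obtain a where "a \<in> carrier (K s)" "x = k s a" using diag_gen by blast
    then have "x = \<one>\<^bsub>comp D s s\<^esub> \<otimes>\<^bsub>comp D s s\<^esub> act s s a (zone D s)" by (simp add: one_left k_closed)
    with \<open>a \<in> carrier (K s)\<close> show "x \<in> {\<one>\<^bsub>comp D s s\<^esub>} <#>\<^bsub>comp D s s\<^esub> S.line s s (zone D s)"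
      unfolding S.add_line_iff by blast
  qed
  from S.rk_add_line[OF S.finrk_trivial(1) S.full_subspace one_closed this] S.finrk_trivial(2)[of s s]
  show "finrk (Sub s s) (carrier (comp D s s))" "rk (Sub s s) (carrier (comp D s s)) \<le> 1" by auto
qed

text \<open>Preimages under the surjection \<open>mulT\<close> keep a chain strict, so chains in
  degree \<open>n + 2\<close> are bounded by those in \<open>GG s n\<close>.\<close>

lemma finrk_step:
  assumes f: "finrk (Sub s (n + 1)) (carrier (comp D s (n + 1)))" and s: "s \<le> n + 1"
  shows "finrk (Sub s (n + 2)) (carrier (comp D s (n + 2)))"
proof -
  have "bounded_rk (Sub s (n + 2)) (carrier (comp D s (n + 2))) (rk (SubG s n) (carrier (GG s n)))"
    unfolding bounded_rk_def
  proof (intro allI impI, elim conjE)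
    fix X m assume X: "chain_in (Sub s (n + 2)) X m"
    let ?Y = "\<lambda>j. {z \<in> carrier (GG s n). mulT s n z \<in> X j}"
    have "chain_in (SubG s n) ?Y m"
      unfolding chain_in_def
    proof (intro conjI allI impI)
      show "?Y j \<in> SubG s n" if "j \<le> m" for j using X that by (intro preimage_mulT) (simp add: chain_in_def)
      fix j assume j: "j < m"
      then have lt: "X j \<subset> X (Suc j)" and c: "X (Suc j) \<in> Sub s (n + 2)" using X by (auto simp: chain_in_def)
      obtain x where x: "x \<in> X (Suc j)" "x \<notin> X j" using lt by blast
      obtain z where "z \<in> carrier (GG s n)" "x = mulT s n z"
        using mulT_surj[OF s S.subspaces_mem[OF c x(1)]] by blast
      with x lt show "?Y j \<subset> ?Y (Suc j)" by blast
    qed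
    then show "m \<le> rk (SubG s n) (carrier (GG s n))" by (rule rk_ge[OF rk_GG(1)[OF f]]) auto
  qed
  then show ?thesis by (rule rk_le[OF S.full_subspace])
qed

lemma finrk_comp: "finrk (Sub s l) (carrier (comp D s l))"
proof (cases "l < s")
  case False
  then have "s \<le> l" by simp
  then show ?thesis
  proof (induction l rule: int_ge_induct)
    case base
    show ?case by (rule diag_rk)
  next
    case (step l)
    then show ?case
      using finrk_step[where s = s and n = "l - 1"] by (simp add: add.commute[of 1 l])
  qed
qed (rule low_rk)

lemma finrk_sub: "N \<in> Sub s l \<Longrightarrow> finrk (Sub s l) N"
  using finrk_mono[OF finrk_comp] S.subspaces_mem by (metis subsetI)

text \<open>\<open>Phi\<close> tests only the products with \<open>x1 m\<close> and
  \<open>x2 m\<close>; these span \<open>W m\<close> on the right, so all products are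
  covered.\<close>

lemma Phi_mem:
  assumes Y: "Y \<in> Sub s (m + 1)" and p: "p \<in> carrier (comp D s m)" "Phi s m p \<in> Y \<times> Y"
    and v: "v \<in> carrier (W m)"
  shows "zmult D s m (m + 1) p (om m v) \<in> Y"
proof -
  let ?b1 = "pr m v (y1 m)" and ?b2 = "pr m v (y2 m)"
  have b: "?b1 \<in> carrier (K (m + 1))" "?b2 \<in> carrier (K (m + 1))" using v by (simp_all add: pr_closed)
  have "om m v = zmult D m (m + 1) (m + 1) (om m (x1 m)) (k (m + 1) ?b1) \<otimes>\<^bsub>comp D m (m + 1)\<^esub>
      zmult D m (m + 1) (m + 1) (om m (x2 m)) (k (m + 1) ?b2)"
    using om_right[of "x1 m" m ?b1] om_right[of "x2 m" m ?b2] b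
      om_add[of "x1 m \<triangleleft>\<^bsub>W m\<^esub> ?b1" m "x2 m \<triangleleft>\<^bsub>W m\<^esub> ?b2"] expand_left[OF v] by simp
  then have "zmult D s m (m + 1) p (om m v) =
      act s (m + 1) ?b1 (zmult D s m (m + 1) p (om m (x1 m))) \<otimes>\<^bsub>comp D s (m + 1)\<^esub>
      act s (m + 1) ?b2 (zmult D s m (m + 1) p (om m (x2 m)))"
    using p(1) b by (simp add: mult_add_right mult_assoc mult_closed om_closed k_closed)
  then show ?thesis
    using p(2) b S.subspaces_add[OF Y] S.subspaces_act[OF Y] by (simp add: Phi_def)
qed

text \<open>Suppose q W = 0 with q nonzero. Let U_{n+1} = 0 and let U_m consist of the elements
  whose products with \<open>W m\<close> lie in U_{m+1}. These spaces satisfy the hypotheses of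
  \<open>convex\<close>, their rank is 0 in degree n + 1 and at least 1 in degree n, so it keeps
  growing towards lower degrees. But below degree \<open>s\<close> all components are zero.\<close>

lemma torsion_free:
  assumes q: "q \<in> carrier (comp D s n)" and q0: "Phi s n q = \<one>\<^bsub>GG s n\<^esub>"
  shows "q = \<one>\<^bsub>comp D s n\<^esub>"
proof (rule ccontr)
  assume ne: "q \<noteq> \<one>\<^bsub>comp D s n\<^esub>"
  \<comment> \<open>\<open>Us j\<close> lives in degree \<open>n + 1 - j\<close>; the recursion runs
    downwards from the zero space of degree \<open>n + 1\<close>.\<close>
  define Us where "Us = rec_nat {\<one>\<^bsub>comp D s (n + 1)\<^esub>}
    (\<lambda>j Y. {p \<in> carrier (comp D s (n - int j)). Phi s (n - int j) p \<in> Y \<times> Y})"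
  define U where "U m = Us (nat (n + 1 - m))" for m
  have U0: "U (n + 1) = {\<one>\<^bsub>comp D s (n + 1)\<^esub>}" by (simp add: U_def Us_def)
  have US: "U m = {p \<in> carrier (comp D s m). Phi s m p \<in> U (m + 1) \<times> U (m + 1)}" if "m \<le> n" for m
  proof -
    have "nat (n + 1 - m) = Suc (nat (n - m))" "n + 1 - (m + 1) = n - m" "n - int (nat (n - m)) = m" using that by auto
    then show ?thesis unfolding U_def by (simp add: Us_def)
  qed
  have Usub: "U (n + 1 - int j) \<in> Sub s (n + 1 - int j)" for j
  proof (induction j)
    case 0
    then show ?case using S.trivial_subspace by (simp add: U0)
  next
    case (Suc j)
    let ?m = "n - int j"
    have e: "n + 1 - int (Suc j) = ?m" "n + 1 - int j = ?m + 1" by simp_all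
    show ?case
      using preimage_Phi[OF sq_sub[OF Suc[unfolded e]]] US[of ?m] unfolding e by simp
  qed
  have Us': "U m \<in> Sub s m" if "m \<le> n + 1" for m
    using Usub[of "nat (n + 1 - m)"] that by simp
  let ?r = "\<lambda>m. rk (Sub s m) (U m)"
  have conv: "2 * ?r (m + 1) \<le> ?r (m + 2) + ?r m" if "m + 1 \<le> n" for m
  proof (rule convex)
    show "finrk (Sub s (m + 1)) (U (m + 1))" "finrk (Sub s (m + 2)) (U (m + 2))" "finrk (Sub s m) (U m)"
      by (rule finrk_sub[OF Us'], use that in simp)+
    show "{q \<in> carrier (comp D s m). Phi s m q \<in> U (m + 1) \<times> U (m + 1)} \<subseteq> U m"
      using US[of m] that by simp
    have U2: "U (m + 2) \<in> Sub s (m + 2)" by (rule Us') (use that in simp)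
    have "zmult D s (m + 1) (m + 2) p (om (m + 1) y) \<in> U (m + 2)"
      if p: "p \<in> U (m + 1)" and y: "y \<in> carrier (W (m + 1))" for p y
      using Phi_mem[of "U (m + 2)" "m + 1" s p y] U2 p y US[of "m + 1"] \<open>m + 1 \<le> n\<close> by simp
    then show "mulT s m ` (U (m + 1) \<times> U (m + 1)) \<subseteq> U (m + 2)"
      using S.subspaces_add[OF U2] by (auto simp: mulT_def)
  qed
  have "q \<in> U n" using q q0 US[of n] by (simp add: U0)
  then have "{\<one>\<^bsub>comp D s n\<^esub>} \<subset> U n" using ne S.subspaces_one[OF Us'[of n]] by auto
  from rk_strict[OF finrk_sub[OF Us'[of n]] S.trivial_subspace this] have rn: "?r n \<ge> 1" by simp
  \<comment> \<open>By convexity the gain in rank from one degree to the next lower one never falls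
    below the first gain, which is at least 1.\<close>
  have "?r (n - int j) \<ge> Suc j \<and> ?r (n - int j) \<ge> Suc (?r (n + 1 - int j))" for j
  proof (induction j)
    case 0
    then show ?case using rn S.finrk_trivial(2)[of "n + 1" s] by (simp add: U0)
  next
    case (Suc j)
    have e: "n - int (Suc j) + 1 = n - int j" "n - int (Suc j) + 2 = n + 1 - int j"
      "n + 1 - int (Suc j) = n - int j" by simp_all
    have "2 * ?r (n - int j) \<le> ?r (n + 1 - int j) + ?r (n - int (Suc j))"
      using conv[of "n - int (Suc j)"] unfolding e by simp
    with Suc show ?case unfolding e by linarith
  qed
  note r = this
  obtain j where j: "n - int j < s"
    using that[of "nat (n - s + 1)"] by linarith
  define m where "m = n - int j"
  have m: "m < s" "m \<le> n + 1" using j by (simp_all add: m_def)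
  have "1 \<le> ?r m" using r[of j] unfolding m_def by linarith
  moreover have "?r m \<le> rk (Sub s m) (carrier (comp D s m))"
    using S.subspaces_mem[OF Us'[OF m(2)]] by (intro rk_mono[OF low_rk(1)[OF m(1)] Us'[OF m(2)]]) blast
  ultimately show False using low_rk(2)[OF m(1)] by simp
qed

text \<open>With \<open>Phi\<close> injective and \<open>mulT\<close> surjective, chains of degrees
  \<open>n\<close> and \<open>n + 2\<close> can be placed one after the other in
  \<open>GG s n\<close>, whose rank is at most twice that of degree \<open>n + 1\<close>.\<close>

lemma concave:
  assumes s: "s \<le> n + 1"
  shows "rk (Sub s (n + 2)) (carrier (comp D s (n + 2))) + rk (Sub s n) (carrier (comp D s n)) \<le>
    2 * rk (Sub s (n + 1)) (carrier (comp D s (n + 1)))"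
proof -
  let ?a = "rk (Sub s n) (carrier (comp D s n))" and ?b = "rk (Sub s (n + 2)) (carrier (comp D s (n + 2)))"
  obtain X where X: "chain_in (Sub s n) X ?a" by (rule rk_chain[OF finrk_comp])
  obtain Y where Y: "chain_in (Sub s (n + 2)) Y ?b" by (rule rk_chain[OF finrk_comp])
  have inj: "q = q'" if "q \<in> carrier (comp D s n)" "q' \<in> carrier (comp D s n)" "Phi s n q = Phi s n q'" for q q'
  proof -
    have "Phi s n (q \<otimes>\<^bsub>comp D s n\<^esub> inv\<^bsub>comp D s n\<^esub> q') = \<one>\<^bsub>GG s n\<^esub>"
      using that Phi_closed by (simp only: Phi_add Ph.hom_inv comp.inv_closed GG.r_inv)
    then have "q \<otimes>\<^bsub>comp D s n\<^esub> inv\<^bsub>comp D s n\<^esub> q' = \<one>\<^bsub>comp D s n\<^esub>"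
      using torsion_free that by simp
    then show ?thesis using that by (metis comp.inv_closed comp.inv_equality comp.inv_inv)
  qed
  let ?P = "\<lambda>j. Phi s n ` X j" and ?Q = "\<lambda>j. {z \<in> carrier (GG s n). mulT s n z \<in> Y j}"
  \<comment> \<open>A maximal chain of degree \<open>n\<close> carried over by \<open>Phi\<close>,
    continued by the preimages of a maximal chain of degree \<open>n + 2\<close>. At the junction
    the last image is replaced by the preimage of \<open>Y 0\<close>, which contains the kernel of
    \<open>mulT\<close> and hence this image.\<close>
  let ?C = "\<lambda>j. if j < ?a then ?P j else ?Q (j - ?a)"
  have P: "?P j \<in> SubG s n" if "j \<le> ?a" for j
  proof -
    have Xj: "X j \<in> Sub s n" using X that by (simp add: chain_in_def)
    show ?thesis
    proof (rule T.subspacesI)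
      show "?P j \<subseteq> carrier (GG s n)" using S.subspaces_mem[OF Xj] Phi_closed by blast
      show "\<one>\<^bsub>GG s n\<^esub> \<in> ?P j" using S.subspaces_one[OF Xj] Ph.hom_one by (metis image_eqI)
      show "x \<otimes>\<^bsub>GG s n\<^esub> y \<in> ?P j" if "x \<in> ?P j" "y \<in> ?P j" for x y
        using that
        by (auto simp: Phi_add[OF S.subspaces_mem[OF Xj] S.subspaces_mem[OF Xj], symmetric]
            simp del: mult_DirProd intro!: imageI S.subspaces_add[OF Xj])
      show "ract s n a x \<in> ?P j" if "a \<in> carrier (K n)" "x \<in> ?P j" for a x
        using that by (auto simp: ract_Phi[OF S.subspaces_mem[OF Xj]] intro!: imageI S.subspaces_act[OF Xj])
    qed
  qed
  have PQ: "?P ?a \<subseteq> ?Q 0"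
  proof -
    have "Y 0 \<in> Sub s (n + 2)" "X ?a \<in> Sub s n" using X Y by (auto simp: chain_in_def)
    then show ?thesis
      using S.subspaces_one[of "Y 0"] S.subspaces_mem[of "X ?a"] Phi_closed mulT_Phi by fastforce
  qed
  have "chain_in (SubG s n) ?C (?a + ?b)"
    unfolding chain_in_def
  proof (intro conjI allI impI)
    show "?C j \<in> SubG s n" if "j \<le> ?a + ?b" for j
      using P[of j] preimage_mulT[of "Y (j - ?a)"] Y that by (auto simp: chain_in_def simp del: carrier_DirProd)
    fix j assume j: "j < ?a + ?b"
    show "?C j \<subset> ?C (Suc j)"
    proof (cases "j < ?a")
      case True
      then have lt: "X j \<subset> X (Suc j)" "X (Suc j) \<in> Sub s n" using X by (auto simp: chain_in_def)
      obtain x where x: "x \<in> X (Suc j)" "x \<notin> X j" using lt by blast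
      have "Phi s n x \<notin> ?P j"
        using x inj S.subspaces_mem[OF lt(2)] lt(1) by blast
      then have PP: "?P j \<subset> ?P (Suc j)" using x lt by blast
      show ?thesis
      proof (cases "Suc j < ?a")
        case False
        then have "Suc j = ?a" using True by simp
        with PP PQ True show ?thesis by auto
      qed (use PP True in auto)
    next
      case False
      let ?i = "j - ?a"
      have lt: "Y ?i \<subset> Y (Suc ?i)" "Y (Suc ?i) \<in> Sub s (n + 2)" using Y False j by (auto simp: chain_in_def)
      obtain x where x: "x \<in> Y (Suc ?i)" "x \<notin> Y ?i" using lt by blast
      obtain z where "z \<in> carrier (GG s n)" "x = mulT s n z"
        using mulT_surj[OF s S.subspaces_mem[OF lt(2) x(1)]] by blast
      with x lt have "?Q ?i \<subset> ?Q (Suc ?i)" by blast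
      then show ?thesis using False by (simp add: Suc_diff_le)
    qed
  qed
  moreover have "?C (?a + ?b) \<subseteq> carrier (GG s n)" by auto
  ultimately have "?a + ?b \<le> rk (SubG s n) (carrier (GG s n))"
    by (rule rk_ge[OF rk_GG(1)[OF finrk_comp]])
  then show ?thesis using rk_GG(2)[OF finrk_comp, of n s] by linarith
qed

text \<open>The rank is 0 in degree \<open>s - 1\<close> and at most 1 in degree \<open>s\<close>;
  by \<open>concave\<close> its increments do not increase afterwards.\<close>

lemma rk_comp_le: "int (rk (Sub s (s - 1 + int t)) (carrier (comp D s (s - 1 + int t)))) \<le> int t"
proof -
  let ?h = "\<lambda>t. int (rk (Sub s (s - 1 + int t)) (carrier (comp D s (s - 1 + int t))))"
  have slope: "?h (Suc t) \<le> ?h t + 1" for t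
  proof (induction t)
    case 0
    then show ?case using diag_rk(2)[of s] low_rk(2)[of "s - 1" s] by simp
  next
    case (Suc t)
    have "s - 1 + int t + 1 = s - 1 + int (Suc t)" "s - 1 + int t + 2 = s - 1 + int (Suc (Suc t))" by simp_all
    with concave[of s "s - 1 + int t"] Suc show ?case by simp
  qed
  show ?thesis
  proof (induction t)
    case 0
    then show ?case using low_rk(2)[of "s - 1" s] by simp
  next
    case (Suc t)
    then show ?case using slope[of t] by simp
  qed
qed

end

section \<open>Saturated submodules and the ascending chain condition\<close>

section \<open>Noetherianity\<close>

text \<open>The increments are nondecreasing integers. They are at least 0 because
  \<open>f 0 = 0\<close>, and at most 1 because a larger increment would persist and break the bound
  \<open>f t \<le> int t\<close>. Hence they become constant.\<close>

lemma convex_eventually_linear: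
  fixes f :: "nat \<Rightarrow> int"
  assumes bound: "\<And>t. 0 \<le> f t" "\<And>t. f t \<le> int t"
    and conv: "\<And>t. 2 * f (Suc t) \<le> f (Suc (Suc t)) + f t"
  shows "\<exists>t0. \<forall>t\<ge>t0. f (Suc (Suc t)) + f t = 2 * f (Suc t)"
proof -
  define d where "d t = f (Suc t) - f t" for t
  have "d t \<le> d (Suc t)" for t using conv[of t] by (simp add: d_def)
  then have mono: "t \<le> t' \<Longrightarrow> d t \<le> d t'" for t t' by (rule lift_Suc_mono_le)
  have "d 0 \<ge> 0" using bound(1)[of "Suc 0"] bound(2)[of 0] by (simp add: d_def)
  then have d0: "0 \<le> d t" for t using mono[of 0 t] by simp
  have d1: "d t \<le> 1" for t
  proof (rule ccontr)
    assume "\<not> d t \<le> 1"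
    then have d2: "2 \<le> d t'" if "t \<le> t'" for t' using mono[OF that] by simp
    have "f (t + m) \<ge> 2 * int m" for m
    proof (induction m)
      case 0
      show ?case using bound(1)[of t] by simp
    next
      case (Suc m)
      then show ?case using d2[of "t + m"] by (simp add: d_def)
    qed
    \<comment> \<open>After t + 1 further steps the value is at least 2t + 2, at the argument 2t +
      1.\<close>
    from this[of "Suc t"] bound(2)[of "t + Suc t"] show False by simp
  qed
  have "\<exists>t0. \<forall>t\<ge>t0. d t = d t0"
  proof (cases "\<exists>t0. d t0 = 1")
    case True
    then obtain t0 where "d t0 = 1" by blast
    then show ?thesis using mono[of t0] d1 by (metis order_antisym)
  next
    case False
    then have "d t = 0" for t using d0[of t] d1[of t] by (metis int_one_le_iff_zero_less order_antisym order_le_less)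
    then show ?thesis by simp
  qed
  then obtain t0 where "\<forall>t\<ge>t0. d t = d t0" by blast
  then have "\<forall>t\<ge>t0. d (Suc t) = d t" by (metis le_SucI)
  then show ?thesis by (intro exI[of _ t0]) (simp add: d_def)
qed

lemma (in kspace) Union_subspace:
  assumes "\<And>j::nat. X j \<in> subspaces" and mono: "\<And>j. X j \<subseteq> X (Suc j)"
  shows "(\<Union>j. X j) \<in> subspaces"
proof (rule subspacesI)
  fix x y assume "x \<in> (\<Union>j. X j)" "y \<in> (\<Union>j. X j)"
  then obtain i j where "x \<in> X i" "y \<in> X j" by blast
  then have "x \<in> X (max i j)" "y \<in> X (max i j)"
    using lift_Suc_mono_le[of X, OF mono] by (meson max.cobounded1 max.cobounded2 subsetD)+
  then show "x \<otimes>\<^bsub>G\<^esub> y \<in> (\<Union>j. X j)" using subspaces_add[OF assms(1)] by blast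
qed (auto dest: subspaces_mem[OF assms(1)] intro: subspaces_one[OF assms(1)] subspaces_act[OF assms(1)])

context zalgebra
begin

lemma right_zmodule_principal: "right_zmodule D (principal_zmodule D s)"
  by (intro right_zmodule.intro right_zmodule_axioms.intro zalgebra_axioms)
    (simp_all add: principal_zmodule_def comp_group mult_closed mult_add_left mult_add_right mult_assoc one_right)

end

context nc_algebra
begin

text \<open>The union \<open>U\<close> of the chain need not satisfy the condition on
  \<open>Z\<close> in \<open>convex\<close>, but its saturation \<open>St\<close> does, with the
  same family in all three places. The finite generation found for \<open>St\<close> then returns to
  \<open>U\<close>: far enough up the two agree, and in the remaining degrees finite rank stops the
  chain.\<close>

lemma right_noetherian: "noetherian_zmodule D (principal_zmodule D s)"
  unfolding noetherian_zmodule_def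
proof (intro conjI allI impI right_zmodule_principal, elim conjE)
  fix N :: "nat \<Rightarrow> int \<Rightarrow> 'd set"
  assume "\<forall>n. zsubmodule D (principal_zmodule D s) (N n)" and inc: "\<forall>n i. N n i \<subseteq> N (Suc n) i"
  then have Nsub: "subgroup (N n l) (comp D s l)"
    and Nmult: "x \<in> N n l \<Longrightarrow> y \<in> carrier (comp D l m) \<Longrightarrow> zmult D s l m x y \<in> N n m" for n l m x y
    by (auto simp: zsubmodule_def principal_zmodule_def)
  have Nc: "x \<in> N n l \<Longrightarrow> x \<in> carrier (comp D s l)" for n l x
    by (rule subgroup.mem_carrier[OF Nsub])
  have NS: "N n l \<in> Sub s l" for n l
    by (rule S.subspacesI) (auto simp: Nc subgroup.one_closed[OF Nsub] subgroup.m_closed[OF Nsub] Nmult k_closed)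
  have Nmono: "n \<le> m \<Longrightarrow> N n l \<subseteq> N m l" for n m l
    using lift_Suc_mono_le[of "\<lambda>n. N n l"] inc by blast
  define U where "U l = (\<Union>n. N n l)" for l
  have US: "U l \<in> Sub s l" for l
    unfolding U_def by (rule S.Union_subspace[OF NS]) (use inc in blast)
  have Uc: "x \<in> U l \<Longrightarrow> x \<in> carrier (comp D s l)" for l x by (rule S.subspaces_mem[OF US])
  have Umult: "x \<in> U l \<Longrightarrow> y \<in> carrier (comp D l m) \<Longrightarrow> zmult D s l m x y \<in> U m" for l m x y
    using Nmult unfolding U_def by blast
  have Ustab: "\<exists>n. \<forall>m\<ge>n. N m l = U l" for l
  proof -
    obtain n where n: "\<forall>m\<ge>n. N m l = N n l"
      using finrk_stable[OF finrk_comp[of l s], of "\<lambda>n. N n l"] NS inc Nc by blast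
    have "U l \<subseteq> N n l"
      unfolding U_def using n Nmono[of _ "max _ n" l] by (metis UN_least max.cobounded1 max.cobounded2)
    with n show ?thesis unfolding U_def by (intro exI[of _ n]) blast
  qed
  \<comment> \<open>The elements that \<open>j\<close> successive multiplications by letters bring
    into \<open>U\<close>.\<close>
  define sat where "sat = rec_nat U (\<lambda>_ Y l. {p \<in> carrier (comp D s l). Phi s l p \<in> Y (l + 1) \<times> Y (l + 1)})"
  have sat0: "sat 0 = U" and satS: "sat (Suc j) l = {p \<in> carrier (comp D s l). Phi s l p \<in> sat j (l + 1) \<times> sat j (l + 1)}" for j l
    by (simp_all add: sat_def)
  have satSub: "sat j l \<in> Sub s l" for j l
  proof (induction j arbitrary: l)
    case 0
    then show ?case by (simp add: sat0 US)
  next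
    case (Suc j)
    then show ?case unfolding satS by (rule preimage_Phi[OF sq_sub])
  qed
  have satinc: "sat j l \<subseteq> sat (Suc j) l" for j l
  proof (induction j arbitrary: l)
    case 0
    then show ?case by (auto simp: satS sat0 Uc Phi_def intro!: Umult om_closed)
  next
    case (Suc j)
    then show ?case by (force simp: satS[of "Suc j"] satS[of j])
  qed
  have satmono: "i \<le> j \<Longrightarrow> sat i l \<subseteq> sat j l" for i j l
    using lift_Suc_mono_le[of "\<lambda>j. sat j l", OF satinc] .
  have sat_om: "zmult D s l (l + 1) p (om l v) \<in> sat j (l + 1)"
    if "p \<in> sat (Suc j) l" "v \<in> carrier (W l)" for p j l v
    using that Phi_mem[OF satSub[of j "l + 1"], of p v] by (auto simp: satS)
  define St where "St l = (\<Union>j. sat j l)" for l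
  have StS: "St l \<in> Sub s l" for l 
    unfolding St_def by (rule S.Union_subspace[where X = "\<lambda>j. sat j l", OF satSub satinc])
  have fSt: "finrk (Sub s l) (St l)" for l by (rule finrk_sub[OF StS])
  have St_om: "zmult D s l (l + 1) p (om l v) \<in> St (l + 1)"
    if p: "p \<in> St l" and v: "v \<in> carrier (W l)" for p l v
  proof -
    obtain j where "p \<in> sat j l" using p by (auto simp: St_def)
    then have "p \<in> sat (Suc j) l" using satinc by blast
    then show ?thesis using sat_om[OF _ v] by (auto simp: St_def)
  qed
  have St_mul: "mulT s l ` (St (l + 1) \<times> St (l + 1)) \<subseteq> St (l + 2)" for l
    using St_om[of _ "l + 1"] S.subspaces_add[OF StS[of "l + 2"]] by (auto simp: mulT_def)
  have St_Phi: "{q \<in> carrier (comp D s l). Phi s l q \<in> St (l + 1) \<times> St (l + 1)} \<subseteq> St l" for l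
  proof
    fix q assume "q \<in> {q \<in> carrier (comp D s l). Phi s l q \<in> St (l + 1) \<times> St (l + 1)}"
    then obtain i j where q: "q \<in> carrier (comp D s l)" "fst (Phi s l q) \<in> sat i (l + 1)" "snd (Phi s l q) \<in> sat j (l + 1)"
      by (auto simp: St_def mem_Times_iff)
    then have "Phi s l q \<in> sat (max i j) (l + 1) \<times> sat (max i j) (l + 1)"
      using satmono[of i "max i j" "l + 1"] satmono[of j "max i j" "l + 1"] by (auto simp: mem_Times_iff)
    then have "q \<in> sat (Suc (max i j)) l" using q(1) by (simp add: satS)
    then show "q \<in> St l" unfolding St_def by blast
  qed
  let ?h = "\<lambda>t. int (rk (Sub s (s - 1 + int t)) (St (s - 1 + int t)))"
  have idx: "s - 1 + int (Suc t) = s - 1 + int t + 1" "s - 1 + int (Suc (Suc t)) = s - 1 + int t + 2" for t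
    by simp_all
  have "\<exists>t0. \<forall>t\<ge>t0. ?h (Suc (Suc t)) + ?h t = 2 * ?h (Suc t)"
  proof (rule convex_eventually_linear)
    fix t
    have "rk (Sub s (s - 1 + int t)) (St (s - 1 + int t)) \<le> rk (Sub s (s - 1 + int t)) (carrier (comp D s (s - 1 + int t)))"
      by (rule rk_mono[OF finrk_comp StS]) (use S.subspaces_mem[OF StS] in blast)
    then show "?h t \<le> int t" using rk_comp_le[of s t] by linarith
    show "2 * ?h (Suc t) \<le> ?h (Suc (Suc t)) + ?h t"
      unfolding idx add_one_one using convex[OF fSt fSt fSt St_mul St_Phi, of "s - 1 + int t"] by linarith
  qed simp
  then obtain t0 where t0: "\<And>t. t0 \<le> t \<Longrightarrow> ?h (Suc (Suc t)) + ?h t = 2 * ?h (Suc t)" by blast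
  have St_gen: "St (l + 1) = mulT s (l - 1) ` (St l \<times> St l)" if l: "s + int t0 \<le> l" for l
  proof -
    define n where "n = l - 1"
    have n: "l = n + 1" "l + 1 = n + 2" "n = s - 1 + int (nat (n - s + 1))" "t0 \<le> nat (n - s + 1)"
      using l by (auto simp: n_def)
    have h: "int (rk (Sub s (n + 2)) (St (n + 2))) + int (rk (Sub s n) (St n)) = 2 * int (rk (Sub s (n + 1)) (St (n + 1)))"
      using t0[OF n(4)] unfolding idx add_one_one n(3)[symmetric] .
    \<comment> \<open>\<open>convex\<close> holds with \<open>?V\<close> in place of
      \<open>St (n + 2)\<close>; as equality holds for \<open>St (n + 2)\<close> itself,
      \<open>?V\<close> has the full rank.\<close>
    let ?V = "mulT s n ` (St (n + 1) \<times> St (n + 1))"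
    have V: "?V \<in> Sub s (n + 2)" by (rule image_mulT[OF sq_sub[OF StS]])
    have "2 * rk (Sub s (n + 1)) (St (n + 1)) \<le> rk (Sub s (n + 2)) ?V + rk (Sub s n) (St n)"
      by (rule convex[OF fSt finrk_sub[OF V] fSt order_refl St_Phi])
    with h have "rk (Sub s (n + 2)) (St (n + 2)) \<le> rk (Sub s (n + 2)) ?V" by linarith
    from rk_eq[OF fSt V St_mul this] show ?thesis
      by (simp only: n(2) n_def[symmetric]) (simp only: n(1))
  qed
  define l0 where "l0 = s + int t0"
  \<comment> \<open>In the single degree \<open>l0\<close> finite rank bounds the number of
    multiplications that bring \<open>St\<close> into \<open>U\<close>. As \<open>St\<close> is
    generated from \<open>l0\<close> on, this number drops by one with every further degree and
    reaches zero at \<open>l0 + j\<close>.\<close>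
  obtain j where j: "\<forall>m\<ge>j. sat m l0 = sat j l0"
    using finrk_stable[OF finrk_comp[of l0 s], of "\<lambda>j. sat j l0"] satSub satinc S.subspaces_mem[OF satSub] by blast
  have St0: "St l0 \<subseteq> sat j l0"
    unfolding St_def using j satmono[of _ "max _ j" l0] by (metis UN_least max.cobounded1 max.cobounded2)
  have St_sat: "r \<le> j \<Longrightarrow> St (l0 + int r) \<subseteq> sat (j - r) (l0 + int r)" for r
  proof (induction r)
    case 0
    then show ?case using St0 by simp
  next
    case (Suc r)
    let ?l = "l0 + int r"
    have e: "l0 + int (Suc r) = ?l + 1" "j - r = Suc (j - Suc r)" using Suc.prems by auto
    have IH: "St ?l \<subseteq> sat (Suc (j - Suc r)) ?l" using Suc e(2) by simp
    have y: "y1 (?l - 1) \<in> carrier (W ?l)" "y2 (?l - 1) \<in> carrier (W ?l)"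
      using y_in[of "?l - 1"] by simp_all
    have "zmult D s ?l (?l + 1) p (om ?l v) \<in> sat (j - Suc r) (?l + 1)" if "p \<in> St ?l" "v \<in> carrier (W ?l)" for p v
      by (rule sat_om) (use that IH in auto)
    then have "mulT s (?l - 1) (p, q) \<in> sat (j - Suc r) (?l + 1)" if "p \<in> St ?l" "q \<in> St ?l" for p q
      using S.subspaces_add[OF satSub] y that by (simp add: mulT_def add.commute[of 1 ?l])
    then show ?case
      unfolding e(1) using St_gen[of ?l] by (auto simp: l0_def)
  qed
  define l1 where "l1 = l0 + int j"
  have UStle: "U l \<subseteq> St l" for l unfolding St_def using sat0 by (metis UN_upper UNIV_I)
  have StU: "St l = U l" if "l1 \<le> l" for l
    using that
  proof (induction l rule: int_ge_induct)
    case base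
    show ?case using St_sat[of j] UStle[of l1] by (simp add: l1_def sat0)
  next
    case (step l)
    have y: "y1 (l - 1) \<in> carrier (W l)" "y2 (l - 1) \<in> carrier (W l)"
      using y_in[of "l - 1"] by simp_all
    have "mulT s (l - 1) (p, q) \<in> U (l + 1)" if "p \<in> U l" "q \<in> U l" for p q
      using S.subspaces_add[OF US] Umult[OF _ om_closed] that y by (simp add: mulT_def add.commute[of 1 l])
    then have "St (l + 1) \<subseteq> U (l + 1)"
      using St_gen[of l] step by (auto simp: l1_def l0_def)
    then show ?case using UStle[of "l + 1"] by blast
  qed
  have Ugen: "U (l + 1) = mulT s (l - 1) ` (U l \<times> U l)" if "l1 \<le> l" for l
    using St_gen[of l] StU[of l] StU[of "l + 1"] that by (auto simp: l1_def l0_def)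
  obtain \<nu> where \<nu>: "\<And>l m. \<nu> l \<le> m \<Longrightarrow> N m l = U l" using Ustab by metis
  \<comment> \<open>A common stage for the finitely many degrees from \<open>s\<close> to
    \<open>l1\<close>: below \<open>s\<close> everything vanishes, and above \<open>l1\<close>
    equality is propagated by \<open>Ugen\<close>.\<close>
  define n0 where "n0 = Max (\<nu> ` {s..l1} \<union> {0})"
  have n0: "N m l = U l" if "n0 \<le> m" for m l
  proof -
    consider "l < s" | "s \<le> l" "l \<le> l1" | "l1 \<le> l" by linarith
    then show ?thesis
    proof cases
      case 1
      have X: "X = {\<one>\<^bsub>comp D s l\<^esub>}" if "X \<in> Sub s l" for X
      proof -
        have "X \<subseteq> {\<one>\<^bsub>comp D s l\<^esub>}"
          using subsetI[of X, OF S.subspaces_mem[OF that]] unfolding lower_zero[OF 1] .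
        then show ?thesis using S.subspaces_one[OF that] by (simp add: subset_singleton_iff) blast
      qed
      show ?thesis using X[OF NS[of m l]] X[OF US[of l]] by simp
    next
      case 2
      then have "\<nu> l \<le> n0" unfolding n0_def by (intro Max_ge) auto
      then show ?thesis using \<nu> that by (meson order_trans)
    next
      case 3
      have "l1 \<ge> s" by (simp add: l1_def l0_def)
      from 3 show ?thesis
      proof (induction l rule: int_ge_induct)
        case base
        have "\<nu> l1 \<le> n0" unfolding n0_def using \<open>l1 \<ge> s\<close> by (intro Max_ge) auto
        then show ?case using \<nu> that by (meson order_trans)
      next
        case (step l)
        have y: "y1 (l - 1) \<in> carrier (W l)" "y2 (l - 1) \<in> carrier (W l)"
          using y_in[of "l - 1"] by simp_all
        have "mulT s (l - 1) (p, q) \<in> N m (l + 1)" if "p \<in> N m l" "q \<in> N m l" for p q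
          using S.subspaces_add[OF NS] Nmult[OF _ om_closed] that y by (simp add: mulT_def add.commute[of 1 l])
        then have "U (l + 1) \<subseteq> N m (l + 1)" using Ugen[of l] step by auto
        then show ?case unfolding U_def by blast
      qed
    qed
  qed
  have "N m = N n0" if "n0 \<le> m" for m
    using n0[OF that] n0[of n0] by (intro ext) simp
  then show "\<exists>n. \<forall>m\<ge>n. N m = N n" by blast
qed

end

section \<open>Exchange of left and right by negating the indices\<close>

subsection \<open>Reversal\<close>

text \<open>The opposite algebra \<open>zop D\<close> lives below the diagonal where
  \<open>D\<close> lives above it. Negating the indices as well restores the shape, so that the
  reversed algebra is again generated by letters from \<open>i\<close> to
  \<open>i + 1\<close>.\<close>

definition zrev :: "'d zring \<Rightarrow> 'd zring" where
  "zrev D = \<lparr>comp = (\<lambda>i j. comp D (- j) (- i)), zmult = (\<lambda>i j l x y. zmult D (- l) (- j) (- i) y x),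
    zone = (\<lambda>i. zone D (- i))\<rparr>"

lemma zrev_simps [simp]:
  "comp (zrev D) i j = comp D (- j) (- i)" "zmult (zrev D) i j l x y = zmult D (- l) (- j) (- i) y x"
  "zone (zrev D) i = zone D (- i)"
  by (simp_all add: zrev_def)

lemma zop_simps [simp]:
  "comp (zop D) i j = comp D j i" "zmult (zop D) i j l x y = zmult D l j i y x" "zone (zop D) i = zone D i"
  by (simp_all add: zop_def)

lemma zalgebra_zrev: "zalgebra D \<Longrightarrow> zalgebra (zrev D)"
  by (rule zalgebra.intro) (simp_all add: zalgebra.comp_group zalgebra.mult_closed zalgebra.one_closed
      zalgebra.mult_add_left zalgebra.mult_add_right zalgebra.mult_assoc zalgebra.one_left zalgebra.one_right)

lemma zalgebra_zop: "zalgebra D \<Longrightarrow> zalgebra (zop D)"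
  by (rule zalgebra.intro) (simp_all add: zalgebra.comp_group zalgebra.mult_closed zalgebra.one_closed
      zalgebra.mult_add_left zalgebra.mult_add_right zalgebra.mult_assoc zalgebra.one_left zalgebra.one_right)

definition op_bimod :: "('k, 'w) bimod \<Rightarrow> ('k, 'w) bimod" where
  "op_bimod U = U\<lparr>smult := (\<lambda>a v. v \<triangleleft>\<^bsub>U\<^esub> a), rsmult := (\<lambda>v a. a \<odot>\<^bsub>U\<^esub> v)\<rparr>"

lemma op_bimod_simps [simp]:
  "carrier (op_bimod U) = carrier U" "add (op_bimod U) = add U" "zero (op_bimod U) = zero U"
  "a \<odot>\<^bsub>op_bimod U\<^esub> v = v \<triangleleft>\<^bsub>U\<^esub> a" "v \<triangleleft>\<^bsub>op_bimod U\<^esub> a = a \<odot>\<^bsub>U\<^esub> v"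
  by (simp_all add: op_bimod_def)

lemma op_op [simp]: "op_bimod (op_bimod U) = U"
  by (simp add: op_bimod_def)

lemma vectorspace_cong:
  assumes "vectorspace F M" "carrier N = carrier M" "add N = add M" "zero N = zero M"
    "\<And>a v. a \<in> carrier F \<Longrightarrow> v \<in> carrier M \<Longrightarrow> a \<odot>\<^bsub>N\<^esub> v = a \<odot>\<^bsub>M\<^esub> v"
  shows "vectorspace F N"
proof -
  interpret vectorspace F M by fact
  have "abelian_group N"
    by (rule abelian_groupI) (use M.a_assoc M.a_comm M.l_neg assms in \<open>auto intro!: bexI[of _ "\<ominus>\<^bsub>M\<^esub> _"]\<close>)
  then show ?thesis
    by (intro vectorspace.intro module.intro module_axioms.intro field_axioms R.cring_axioms)
      (simp_all add: assms smult_closed smult_l_distr smult_r_distr smult_assoc1)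
qed

lemma bimodule_op:
  assumes "bimodule L M U"
  shows "bimodule M L (op_bimod U)"
proof -
  have L: "vectorspace L U" and M: "vectorspace M (right_mod U)" using assms by (simp_all add: bimodule_def)
  have "vectorspace M (op_bimod U)"
    by (rule vectorspace_cong[OF M]) (simp_all add: right_mod_def)
  moreover have "vectorspace L (right_mod (op_bimod U))"
    by (rule vectorspace_cong[OF L]) (simp_all add: right_mod_def)
  ultimately show ?thesis using assms by (simp add: bimodule_def)
qed

text \<open>The opposite of \<open>W (- 1 - i)\<close> has left scalars \<open>K (- i)\<close> and
  right scalars \<open>K (- 1 - i)\<close>, as required of \<open>W' i\<close>. The pairing at
  \<open>- 2 - i\<close> joins \<open>W (- 2 - i)\<close> and \<open>W (- 1 - i)\<close>, which are
  \<open>W' (i + 1)\<close> and \<open>W' i\<close>; vectors and functionals change roles, and with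
  them the bases \<open>x\<close> and \<open>y\<close>.\<close>

locale reversed =
  fixes K :: "int \<Rightarrow> 'k ring" and W :: "int \<Rightarrow> ('k, 'w) bimod" and pr :: "int \<Rightarrow> 'w \<Rightarrow> 'w \<Rightarrow> 'k"
    and x1 x2 y1 y2 :: "int \<Rightarrow> 'w"
begin

abbreviation "K' \<equiv> \<lambda>i::int. K (- i)"
abbreviation "W' \<equiv> \<lambda>i::int. op_bimod (W (- 1 - i))"
abbreviation "pr' \<equiv> \<lambda>(i::int) v \<psi>. pr (- 2 - i) \<psi> v"
abbreviation "x1' \<equiv> \<lambda>i::int. y1 (- 2 - i)"
abbreviation "x2' \<equiv> \<lambda>i::int. y2 (- 2 - i)"
abbreviation "y1' \<equiv> \<lambda>i::int. x1 (- 2 - i)"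
abbreviation "y2' \<equiv> \<lambda>i::int. x2 (- 2 - i)"

lemma dual_system_rev:
  assumes "dual_system K W pr x1 x2 y1 y2"
  shows "dual_system K' W' pr' x1' x2' y1' y2'"
proof -
  interpret dual_system K W pr x1 x2 y1 y2 by fact
  have e: "- 1 - (i + 1) = - 2 - i" "- 2 - i + 1 = - 1 - i" "- (i + 1) = - 1 - i" "- 2 - i + 2 = - i"
    "- 1 - i + 1 = - i" "- (i + 2) = - 2 - i" for i :: int by simp_all
  have p: "K (- 2 - i) = K (- i)" for i using period[of "- 2 - i"] by (simp add: e)
  note y = y_in[of "- 2 - i" for i, unfolded e]
  note fs = pr_closed[of _ "- 2 - i" for i, unfolded e] pr_add_left[of _ "- 2 - i" for i, unfolded e]
    pr_add_right[of _ "- 2 - i" for i, unfolded e] pr_right[of _ "- 2 - i" for i, unfolded e]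
    pr_left[of _ "- 2 - i" for i, unfolded e] pr_mid[of _ "- 2 - i" for i, unfolded e p]
    expand_left[of _ "- 2 - i" for i, unfolded e] expand_right[of _ "- 2 - i" for i, unfolded e]
    dual[of "- 2 - i" for i, unfolded e]
  show ?thesis
  proof (intro dual_system.intro dual_system_axioms.intro bimodules.intro)
    show "bimodule (K (- i)) (K (- (i + 1))) (W' i)" for i
      using bimodule_op[OF bimod[of "- 1 - i"]] by (simp only: e)
  qed (simp_all only: op_bimod_simps e p field_K, simp_all add: fs y K.m_comm)
qed

end

context reversed
begin

lemma dual_rep_rev:
  assumes "dual_rep K W pr x1 x2 y1 y2 E k om"
  shows "dual_rep K' W' pr' x1' x2' y1' y2' (zrev E) (\<lambda>i. k (- i)) (\<lambda>i. om (- 1 - i))"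
proof -
  interpret dual_rep K W pr x1 x2 y1 y2 E k om by fact
  interpret R: dual_system K' W' pr' x1' x2' y1' y2' by (rule dual_system_rev[OF dual_system_axioms])
  have e: "- 1 - (i + 1) = - 2 - i" "- 2 - i + 1 = - 1 - i" "- (i + 1) = - 1 - i" "- 2 - i + 2 = - i"
    "- 1 - i + 1 = - i" "- (i + 2) = - 2 - i" for i :: int by simp_all
  note fs = om_closed[of _ "- 1 - i" for i, unfolded e] om_add[of _ "- 1 - i" for i, unfolded e]
    om_left[of _ "- 1 - i" for i, unfolded e] om_right[of _ "- 1 - i" for i, unfolded e]
    rel[of "- 2 - i" for i, unfolded e]
  show ?thesis
    by (intro dual_rep.intro dual_rep_axioms.intro bimod_rep.intro bimod_rep_axioms.intro
        R.dual_system_axioms R.bimodules_axioms zalgebra_zrev zalgebra_axioms)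
      (simp_all only: zrev_simps op_bimod_simps e, simp_all add: fs k_closed k_add k_mult k_one K.m_comm)
qed

lemma nc_algebra_rev:
  fixes D :: "'d zring"
  assumes "nc_algebra K W pr x1 x2 y1 y2 D k om"
  shows "nc_algebra K' W' pr' x1' x2' y1' y2' (zrev D) (\<lambda>i. k (- i)) (\<lambda>i. om (- 1 - i))"
proof -
  interpret nc_algebra K W pr x1 x2 y1 y2 D k om by fact
  show ?thesis
  proof (intro nc_algebra.intro nc_algebra_axioms.intro dual_rep_rev[OF dual_rep_axioms])
    fix B i j
    assume B: "zsubring (zrev D) B" and kB: "\<And>i a. a \<in> carrier (K' i) \<Longrightarrow> k (- i) a \<in> B i i"
      and oB: "\<And>i v. v \<in> carrier (W' i) \<Longrightarrow> om (- 1 - i) v \<in> B i (i + 1)"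
    have sub: "subgroup (B i j) (comp D (- j) (- i))"
      and mul: "x \<in> B i j \<Longrightarrow> y \<in> B j l \<Longrightarrow> zmult D (- l) (- j) (- i) y x \<in> B i l"
      and one: "zone D (- i) \<in> B i i" for i j l x y
      using B by (auto simp: zsubring_def)
    have "zsubring D (\<lambda>i j. B (- j) (- i))"
      unfolding zsubring_def
    proof (intro conjI allI ballI)
      show "subgroup (B (- j) (- i)) (comp D i j)" for i j using sub[of "- j" "- i"] by simp
      show "zmult D i j l x y \<in> B (- l) (- i)" if "x \<in> B (- j) (- i)" "y \<in> B (- l) (- j)" for i j l x y
        using mul[OF that(2,1)] by simp
      show "zone D i \<in> B (- i) (- i)" for i using one[of "- i"] by simp
    qed
    moreover have "k i a \<in> B (- i) (- i)" if "a \<in> carrier (K i)" for i a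
      using kB[of a "- i"] that by simp
    moreover have "om i v \<in> B (- (i + 1)) (- i)" if "v \<in> carrier (W i)" for i v
      using oB[of v "- 1 - i"] that by (simp add: algebra_simps)
    ultimately have "B (- (- i)) (- (- j)) = carrier (comp D (- j) (- i))"
      by (rule gen[where B = "\<lambda>i j. B (- j) (- i)"])
    then show "B i j = carrier (comp (zrev D) i j)" by simp
  next
    fix E :: "('d \<times> ('d \<times> 'd) set \<Rightarrow> 'd \<times> ('d \<times> 'd) set) zring" and k' om'
    assume "dual_rep K' W' pr' x1' x2' y1' y2' E k' om'"
    \<comment> \<open>Reversal is an involution: reversing \<open>E\<close> brings it back to the
      original side, where \<open>univ\<close> applies.\<close>
    from reversed.dual_rep_rev[OF this]
    have r: "dual_rep K W pr x1 x2 y1 y2 (zrev E) (\<lambda>i. k' (- i)) (\<lambda>i. om' (- 1 - i))" by simp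
    obtain H where H: "zhom D (zrev E) H"
      "\<And>i a. a \<in> carrier (K i) \<Longrightarrow> H i i (k i a) = k' (- i) a"
      "\<And>i v. v \<in> carrier (W i) \<Longrightarrow> H i (i + 1) (om i v) = om' (- 1 - i) v"
      using univ[OF r] by blast
    let ?H = "\<lambda>i j. H (- j) (- i)"
    have "zhom (zrev D) E ?H"
      unfolding zhom_def
    proof (intro conjI allI ballI)
      show "?H i j \<in> hom (comp (zrev D) i j) (comp E i j)" for i j
        using zhomD(1)[OF H(1), of "- j" "- i"] by simp
      show "?H i l (zmult (zrev D) i j l x y) = zmult E i j l (?H i j x) (?H j l y)"
        if "x \<in> carrier (comp (zrev D) i j)" "y \<in> carrier (comp (zrev D) j l)" for i j l x y
        using zhomD(4)[OF H(1), of y "- l" "- j" x "- i"] that by simp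
      show "?H i i (zone (zrev D) i) = zone E i" for i
        using zhomD(5)[OF H(1), of "- i"] by simp
    qed
    moreover have "?H i i (k (- i) a) = k' i a" if "a \<in> carrier (K' i)" for i a
      using H(2)[OF that] by simp
    moreover have "?H i (i + 1) (om (- 1 - i) v) = om' i v" if "v \<in> carrier (W' i)" for i v
      using H(3)[of v "- 1 - i"] that by (simp add: algebra_simps)
    ultimately show "\<exists>H. zhom (zrev D) E H \<and> (\<forall>i. \<forall>a\<in>carrier (K' i). H i i (k (- i) a) = k' i a) \<and>
        (\<forall>i. \<forall>v\<in>carrier (W' i). H i (i + 1) (om (- 1 - i) v) = om' i v)"
      by (intro exI[of _ ?H]) blast
  qed
qed

end

theorem (in nc_algebra) noetherian: "noetherian_zring D"
  unfolding noetherian_zring_def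
proof (intro conjI allI)
  show "noetherian_zmodule D (principal_zmodule D i)" for i by (rule right_noetherian)
  interpret rev: nc_algebra "reversed.K' K" "reversed.W' W" "reversed.pr' pr" "reversed.x1' y1" "reversed.x2' y2"
    "reversed.y1' x1" "reversed.y2' x2" "zrev D" "\<lambda>i. k (- i)" "\<lambda>i. om (- 1 - i)"
    by (rule reversed.nc_algebra_rev[OF nc_algebra_axioms])
  interpret op: zalgebra "zop D" by (rule zalgebra_zop[OF zalgebra_axioms])
  fix i
  show "noetherian_zmodule (zop D) (principal_zmodule (zop D) i)"
    unfolding noetherian_zmodule_def
  proof (intro conjI allI impI op.right_zmodule_principal, elim conjE)
    fix N :: "nat \<Rightarrow> int \<Rightarrow> 'd set"
    assume N: "\<forall>n. zsubmodule (zop D) (principal_zmodule (zop D) i) (N n)" and inc: "\<forall>n i. N n i \<subseteq> N (Suc n) i"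
    have sub: "subgroup (N n l) (comp D l i)"
      and mul: "x \<in> N n l \<Longrightarrow> y \<in> carrier (comp D m l) \<Longrightarrow> zmult D m l i y x \<in> N n m" for n l m x y
      using N by (auto simp: zsubmodule_def principal_zmodule_def)
    \<comment> \<open>With degrees negated, a submodule of the left module at \<open>i\<close> is a
      submodule of the right module at \<open>- i\<close> of the reversed algebra.\<close>
    let ?N = "\<lambda>n l. N n (- l)"
    have "\<forall>n. zsubmodule (zrev D) (principal_zmodule (zrev D) (- i)) (?N n)"
      using sub mul by (auto simp: zsubmodule_def principal_zmodule_def)
    moreover have "\<forall>n i. ?N n i \<subseteq> ?N (Suc n) i" using inc by simp
    ultimately obtain n where n: "\<forall>m\<ge>n. ?N m = ?N n"
      using mp[OF spec[OF conjunct2[OF rev.right_noetherian[of "- i", unfolded noetherian_zmodule_def]], of ?N]]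
      by auto
    have "N m = N n" if "m \<ge> n" for m
    proof
      fix l show "N m l = N n l" using fun_cong[OF n[rule_format, OF that], of "- l"] by simp
    qed
    then show "\<exists>n. \<forall>m\<ge>n. N m = N n" by blast
  qed
qed

section \<open>Rank two and dual bases for all iterated duals\<close>

section \<open>Iterated duals of a bimodule of rank two\<close>

definition basis2 :: "('k, 'r) ring_scheme \<Rightarrow> ('k, 'w, 'z) module_scheme \<Rightarrow> 'w \<Rightarrow> 'w \<Rightarrow> bool" where
  "basis2 F V e f \<longleftrightarrow> e \<in> carrier V \<and> f \<in> carrier V \<and>
    (\<forall>v\<in>carrier V. \<exists>a\<in>carrier F. \<exists>b\<in>carrier F. v = a \<odot>\<^bsub>V\<^esub> e \<oplus>\<^bsub>V\<^esub> b \<odot>\<^bsub>V\<^esub> f) \<and>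
    (\<forall>a\<in>carrier F. \<forall>b\<in>carrier F. a \<odot>\<^bsub>V\<^esub> e \<oplus>\<^bsub>V\<^esub> b \<odot>\<^bsub>V\<^esub> f = \<zero>\<^bsub>V\<^esub> \<longrightarrow> a = \<zero>\<^bsub>F\<^esub> \<and> b = \<zero>\<^bsub>F\<^esub>)"

context vectorspace
begin

lemma lincomb_pair:
  assumes "e \<in> carrier V" "f \<in> carrier V" "e \<noteq> f" "a \<in> {e, f} \<rightarrow> carrier K"
  shows "lincomb a {e, f} = a e \<odot>\<^bsub>V\<^esub> e \<oplus>\<^bsub>V\<^esub> a f \<odot>\<^bsub>V\<^esub> f"
proof -
  have "a e \<odot>\<^bsub>V\<^esub> e \<in> carrier V" "a f \<odot>\<^bsub>V\<^esub> f \<in> carrier V" using assms by auto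
  then show ?thesis using assms(3) unfolding lincomb_def by (simp add: Pi_def)
qed

lemma span_single: "e \<in> carrier V \<Longrightarrow> span {e} = {a \<odot>\<^bsub>V\<^esub> e |a. a \<in> carrier K}"
proof
  assume e: "e \<in> carrier V"
  show "span {e} \<subseteq> {a \<odot>\<^bsub>V\<^esub> e |a. a \<in> carrier K}"
  proof
    fix v assume "v \<in> span {e}"
    then obtain a where "a \<in> {e} \<rightarrow> carrier K" "v = lincomb a {e}"
      using finite_span[of "{e}"] e by auto
    then show "v \<in> {a \<odot>\<^bsub>V\<^esub> e |a. a \<in> carrier K}" using e by (auto simp: lincomb_def)
  qed
  show "{a \<odot>\<^bsub>V\<^esub> e |a. a \<in> carrier K} \<subseteq> span {e}"
  proof
    fix v assume "v \<in> {a \<odot>\<^bsub>V\<^esub> e |a. a \<in> carrier K}"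
    then obtain a where a: "a \<in> carrier K" "v = a \<odot>\<^bsub>V\<^esub> e" by blast
    have "v = lincomb (\<lambda>_. a) {e}" using a e by (simp add: lincomb_def)
    then show "v \<in> span {e}" using finite_span[of "{e}"] e a by auto
  qed
qed

lemma basis2I:
  assumes fd: "fin_dim" and d: "dim = 2" and e: "e \<in> carrier V" "e \<noteq> \<zero>\<^bsub>V\<^esub>"
    and f: "f \<in> carrier V" "\<And>a. a \<in> carrier K \<Longrightarrow> f \<noteq> a \<odot>\<^bsub>V\<^esub> e"
  shows "basis2 K V e f"
proof -
  have ef: "e \<noteq> f" using f(2)[of "\<one>\<^bsub>K\<^esub>"] e(1) by auto
  have "lin_indpt {e}"
    using lin_dep_iff_in_span[of "{}" e] e by (simp add: span_empty finite_lin_indpt2)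
  moreover have "f \<notin> span {e}" using span_single[OF e(1)] f(2) by blast
  ultimately have li: "lin_indpt {e, f}"
    using lin_dep_iff_in_span[of "{e}" f] e f ef by (simp add: insert_commute)
  have b: "basis {e, f}"
    using dim_li_is_basis[OF fd, of "{e, f}"] li e f d ef by simp
  have ex: "\<exists>a\<in>carrier K. \<exists>b\<in>carrier K. v = a \<odot>\<^bsub>V\<^esub> e \<oplus>\<^bsub>V\<^esub> b \<odot>\<^bsub>V\<^esub> f" if "v \<in> carrier V" for v
  proof -
    have "v \<in> span {e, f}" using b that by (simp add: basis_def)
    then obtain a where "a \<in> {e, f} \<rightarrow> carrier K" "v = lincomb a {e, f}"
      using finite_span[of "{e, f}"] e f by auto
    then show ?thesis using lincomb_pair[OF e(1) f(1) ef] by auto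
  qed
  have indep: "a = \<zero>\<^bsub>K\<^esub> \<and> b = \<zero>\<^bsub>K\<^esub>"
    if ab: "a \<in> carrier K" "b \<in> carrier K" and z: "a \<odot>\<^bsub>V\<^esub> e \<oplus>\<^bsub>V\<^esub> b \<odot>\<^bsub>V\<^esub> f = \<zero>\<^bsub>V\<^esub>" for a b
  proof -
    let ?c = "\<lambda>v. if v = e then a else b"
    have "?c \<in> {e, f} \<rightarrow> {\<zero>\<^bsub>K\<^esub>}"
      by (rule not_lindepD[OF li]) (use ab e f ef z lincomb_pair[OF e(1) f(1) ef, of ?c] in auto)
    then show ?thesis using ef by auto
  qed
  show ?thesis unfolding basis2_def using e f ex indep by blast
qed

lemma basis2_exists:
  assumes fd: "fin_dim" and d: "dim = 2"
  shows "\<exists>e f. basis2 K V e f"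
proof -
  have "\<exists>e\<in>carrier V. e \<noteq> \<zero>\<^bsub>V\<^esub>"
  proof (rule ccontr)
    assume "\<not> ?thesis"
    then have c: "carrier V \<subseteq> {\<zero>\<^bsub>V\<^esub>}" by blast
    have "span {\<zero>\<^bsub>V\<^esub>} \<subseteq> carrier V" by (rule span_is_subset2) simp
    moreover have "\<zero>\<^bsub>V\<^esub> \<in> span {\<zero>\<^bsub>V\<^esub>}" using in_own_span[of "{\<zero>\<^bsub>V\<^esub>}"] by simp
    ultimately have "gen_set {\<zero>\<^bsub>V\<^esub>}" using c by blast
    then show False using dim0I d by simp
  qed
  then obtain e where e: "e \<in> carrier V" "e \<noteq> \<zero>\<^bsub>V\<^esub>" by blast
  have "\<exists>f\<in>carrier V. f \<notin> span {e}"
  proof (rule ccontr)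
    assume "\<not> ?thesis"
    moreover have "span {e} \<subseteq> carrier V" by (rule span_is_subset2) (simp add: e(1))
    ultimately have "gen_set {e}" by blast
    then show False using dim1I[of e] e d by simp
  qed
  then obtain f where "f \<in> carrier V" "f \<notin> span {e}" by blast
  then show ?thesis using basis2I[OF fd d e] span_single[OF e(1)] by blast
qed

end

lemma linear_iso_dim:
  assumes V: "vectorspace F V" and W: "vectorspace F W"
    and T: "\<And>v. v \<in> carrier V \<Longrightarrow> T v \<in> carrier W"
    "\<And>v w. \<lbrakk>v \<in> carrier V; w \<in> carrier V\<rbrakk> \<Longrightarrow> T (v \<oplus>\<^bsub>V\<^esub> w) = T v \<oplus>\<^bsub>W\<^esub> T w"
    "\<And>a v. \<lbrakk>a \<in> carrier F; v \<in> carrier V\<rbrakk> \<Longrightarrow> T (a \<odot>\<^bsub>V\<^esub> v) = a \<odot>\<^bsub>W\<^esub> T v"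
    and inj: "\<And>v. \<lbrakk>v \<in> carrier V; T v = \<zero>\<^bsub>W\<^esub>\<rbrakk> \<Longrightarrow> v = \<zero>\<^bsub>V\<^esub>"
    and surj: "\<And>w. w \<in> carrier W \<Longrightarrow> \<exists>v\<in>carrier V. w = T v"
    and fd: "vectorspace.fin_dim F V"
  shows "vectorspace.fin_dim F W \<and> vectorspace.dim F W = vectorspace.dim F V"
proof -
  interpret V: vectorspace F V by fact
  interpret W: vectorspace F W by fact
  interpret linear_map F V W T
    by (intro linear_map.intro mod_hom.intro mod_hom_axioms.intro V W V.module_axioms W.module_axioms)
      (auto simp: module_hom_def T)
  have s: "T ` carrier V = carrier W" using T(1) surj by blast
  have i: "inj_on T (carrier V)"
    by (rule Ke0_imp_inj) (use inj T(3)[of "\<zero>\<^bsub>F\<^esub>" "\<zero>\<^bsub>V\<^esub>"] T(1)[of "\<zero>\<^bsub>V\<^esub>"] in \<open>auto simp: ker_def\<close>)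
  show ?thesis using surj_fin_dim[OF fd s] dim_eq[OF fd i s] by simp
qed

text \<open>\<open>U'\<close> is the right dual of \<open>U\<close> through \<open>e\<close>,
  expressed by properties of \<open>e\<close> alone. This form also covers the negative indices,
  where the two bimodules change places and are replaced by their opposites.\<close>

locale perfect =
  fixes L M :: "'k ring" and U U' :: "('k, 'w) bimod" and e :: "'w \<Rightarrow> 'w \<Rightarrow> 'k"
  assumes field_L: "field L" and field_M: "field M"
    and bimod_U: "bimodule L M U" and bimod_U': "bimodule M L U'"
    and e_closed: "\<lbrakk>\<psi> \<in> carrier U'; v \<in> carrier U\<rbrakk> \<Longrightarrow> e \<psi> v \<in> carrier M"
    and e_add: "\<lbrakk>\<psi> \<in> carrier U'; v \<in> carrier U; w \<in> carrier U\<rbrakk> \<Longrightarrow> e \<psi> (v \<oplus>\<^bsub>U\<^esub> w) = e \<psi> v \<oplus>\<^bsub>M\<^esub> e \<psi> w"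
    and e_right: "\<lbrakk>\<psi> \<in> carrier U'; v \<in> carrier U; b \<in> carrier M\<rbrakk> \<Longrightarrow> e \<psi> (v \<triangleleft>\<^bsub>U\<^esub> b) = e \<psi> v \<otimes>\<^bsub>M\<^esub> b"
    and e_add': "\<lbrakk>\<psi> \<in> carrier U'; \<chi> \<in> carrier U'; v \<in> carrier U\<rbrakk> \<Longrightarrow> e (\<psi> \<oplus>\<^bsub>U'\<^esub> \<chi>) v = e \<psi> v \<oplus>\<^bsub>M\<^esub> e \<chi> v"
    and e_left: "\<lbrakk>\<psi> \<in> carrier U'; v \<in> carrier U; a \<in> carrier M\<rbrakk> \<Longrightarrow> e (a \<odot>\<^bsub>U'\<^esub> \<psi>) v = a \<otimes>\<^bsub>M\<^esub> e \<psi> v"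
    and e_mid: "\<lbrakk>\<psi> \<in> carrier U'; v \<in> carrier U; c \<in> carrier L\<rbrakk> \<Longrightarrow> e (\<psi> \<triangleleft>\<^bsub>U'\<^esub> c) v = e \<psi> (c \<odot>\<^bsub>U\<^esub> v)"
    and e_inj: "\<lbrakk>\<psi> \<in> carrier U'; \<chi> \<in> carrier U'; \<And>v. v \<in> carrier U \<Longrightarrow> e \<psi> v = e \<chi> v\<rbrakk> \<Longrightarrow> \<psi> = \<chi>"
    and e_surj: "\<lbrakk>\<And>v. v \<in> carrier U \<Longrightarrow> g v \<in> carrier M;
      \<And>v w. \<lbrakk>v \<in> carrier U; w \<in> carrier U\<rbrakk> \<Longrightarrow> g (v \<oplus>\<^bsub>U\<^esub> w) = g v \<oplus>\<^bsub>M\<^esub> g w;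
      \<And>v b. \<lbrakk>v \<in> carrier U; b \<in> carrier M\<rbrakk> \<Longrightarrow> g (v \<triangleleft>\<^bsub>U\<^esub> b) = g v \<otimes>\<^bsub>M\<^esub> b\<rbrakk> \<Longrightarrow>
      \<exists>\<psi>\<in>carrier U'. \<forall>v\<in>carrier U. e \<psi> v = g v"
begin

sublocale M: field M by (rule field_M)
sublocale L: field L by (rule field_L)
sublocale LU: vectorspace L U using bimod_U by (simp add: bimodule_def)
sublocale RU: vectorspace M "right_mod U" using bimod_U by (simp add: bimodule_def)
sublocale LU': vectorspace M U' using bimod_U' by (simp add: bimodule_def)
sublocale RU': vectorspace L "right_mod U'" using bimod_U' by (simp add: bimodule_def)

lemma U_closed [simp]:
  "\<lbrakk>v \<in> carrier U; b \<in> carrier M\<rbrakk> \<Longrightarrow> v \<triangleleft>\<^bsub>U\<^esub> b \<in> carrier U"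
  "\<lbrakk>v \<in> carrier U; a \<in> carrier L\<rbrakk> \<Longrightarrow> a \<odot>\<^bsub>U\<^esub> v \<in> carrier U"
  "\<lbrakk>\<psi> \<in> carrier U'; a \<in> carrier M\<rbrakk> \<Longrightarrow> a \<odot>\<^bsub>U'\<^esub> \<psi> \<in> carrier U'"
  "\<lbrakk>\<psi> \<in> carrier U'; c \<in> carrier L\<rbrakk> \<Longrightarrow> \<psi> \<triangleleft>\<^bsub>U'\<^esub> c \<in> carrier U'"
  using RU.smult_closed LU.smult_closed LU'.smult_closed RU'.smult_closed by auto

lemma U_right:
  "\<lbrakk>v \<in> carrier U; w \<in> carrier U; b \<in> carrier M\<rbrakk> \<Longrightarrow> (v \<oplus>\<^bsub>U\<^esub> w) \<triangleleft>\<^bsub>U\<^esub> b = v \<triangleleft>\<^bsub>U\<^esub> b \<oplus>\<^bsub>U\<^esub> w \<triangleleft>\<^bsub>U\<^esub> b"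
  "\<lbrakk>v \<in> carrier U; a \<in> carrier M; b \<in> carrier M\<rbrakk> \<Longrightarrow> v \<triangleleft>\<^bsub>U\<^esub> (a \<oplus>\<^bsub>M\<^esub> b) = v \<triangleleft>\<^bsub>U\<^esub> a \<oplus>\<^bsub>U\<^esub> v \<triangleleft>\<^bsub>U\<^esub> b"
  "\<lbrakk>v \<in> carrier U; a \<in> carrier M; b \<in> carrier M\<rbrakk> \<Longrightarrow> v \<triangleleft>\<^bsub>U\<^esub> a \<triangleleft>\<^bsub>U\<^esub> b = v \<triangleleft>\<^bsub>U\<^esub> (b \<otimes>\<^bsub>M\<^esub> a)"
  "v \<in> carrier U \<Longrightarrow> v \<triangleleft>\<^bsub>U\<^esub> \<one>\<^bsub>M\<^esub> = v"
  "v \<in> carrier U \<Longrightarrow> v \<triangleleft>\<^bsub>U\<^esub> \<zero>\<^bsub>M\<^esub> = \<zero>\<^bsub>U\<^esub>"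
  "\<lbrakk>a \<in> carrier L; v \<in> carrier U; b \<in> carrier M\<rbrakk> \<Longrightarrow> (a \<odot>\<^bsub>U\<^esub> v) \<triangleleft>\<^bsub>U\<^esub> b = a \<odot>\<^bsub>U\<^esub> (v \<triangleleft>\<^bsub>U\<^esub> b)"
  using RU.smult_r_distr RU.smult_l_distr RU.smult_assoc1 RU.smult_one RU.smult_l_null bimod_U
  by (simp_all add: bimodule_def)

definition coord1 :: "'w \<Rightarrow> 'w \<Rightarrow> 'w \<Rightarrow> 'k" where
  "coord1 x y v = (SOME a. a \<in> carrier M \<and> (\<exists>b\<in>carrier M. v = x \<triangleleft>\<^bsub>U\<^esub> a \<oplus>\<^bsub>U\<^esub> y \<triangleleft>\<^bsub>U\<^esub> b))"

definition coord2 :: "'w \<Rightarrow> 'w \<Rightarrow> 'w \<Rightarrow> 'k" where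
  "coord2 x y v = (SOME b. b \<in> carrier M \<and> v = x \<triangleleft>\<^bsub>U\<^esub> coord1 x y v \<oplus>\<^bsub>U\<^esub> y \<triangleleft>\<^bsub>U\<^esub> b)"

lemma coordinates:
  assumes B: "basis2 M (right_mod U) x y"
  shows "v \<in> carrier U \<Longrightarrow> coord1 x y v \<in> carrier M" "v \<in> carrier U \<Longrightarrow> coord2 x y v \<in> carrier M"
    "v \<in> carrier U \<Longrightarrow> x \<triangleleft>\<^bsub>U\<^esub> coord1 x y v \<oplus>\<^bsub>U\<^esub> y \<triangleleft>\<^bsub>U\<^esub> coord2 x y v = v"
    "\<lbrakk>a \<in> carrier M; b \<in> carrier M\<rbrakk> \<Longrightarrow> coord1 x y (x \<triangleleft>\<^bsub>U\<^esub> a \<oplus>\<^bsub>U\<^esub> y \<triangleleft>\<^bsub>U\<^esub> b) = a"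
    "\<lbrakk>a \<in> carrier M; b \<in> carrier M\<rbrakk> \<Longrightarrow> coord2 x y (x \<triangleleft>\<^bsub>U\<^esub> a \<oplus>\<^bsub>U\<^esub> y \<triangleleft>\<^bsub>U\<^esub> b) = b"
    "\<lbrakk>v \<in> carrier U; w \<in> carrier U\<rbrakk> \<Longrightarrow> coord1 x y (v \<oplus>\<^bsub>U\<^esub> w) = coord1 x y v \<oplus>\<^bsub>M\<^esub> coord1 x y w"
    "\<lbrakk>v \<in> carrier U; w \<in> carrier U\<rbrakk> \<Longrightarrow> coord2 x y (v \<oplus>\<^bsub>U\<^esub> w) = coord2 x y v \<oplus>\<^bsub>M\<^esub> coord2 x y w"
    "\<lbrakk>v \<in> carrier U; m \<in> carrier M\<rbrakk> \<Longrightarrow> coord1 x y (v \<triangleleft>\<^bsub>U\<^esub> m) = coord1 x y v \<otimes>\<^bsub>M\<^esub> m"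
    "\<lbrakk>v \<in> carrier U; m \<in> carrier M\<rbrakk> \<Longrightarrow> coord2 x y (v \<triangleleft>\<^bsub>U\<^esub> m) = coord2 x y v \<otimes>\<^bsub>M\<^esub> m"
proof -
  have x: "x \<in> carrier U" "y \<in> carrier U"
    and ex: "\<And>v. v \<in> carrier U \<Longrightarrow> \<exists>a\<in>carrier M. \<exists>b\<in>carrier M. v = x \<triangleleft>\<^bsub>U\<^esub> a \<oplus>\<^bsub>U\<^esub> y \<triangleleft>\<^bsub>U\<^esub> b"
    and ind: "\<And>a b. \<lbrakk>a \<in> carrier M; b \<in> carrier M; x \<triangleleft>\<^bsub>U\<^esub> a \<oplus>\<^bsub>U\<^esub> y \<triangleleft>\<^bsub>U\<^esub> b = \<zero>\<^bsub>U\<^esub>\<rbrakk> \<Longrightarrow> a = \<zero>\<^bsub>M\<^esub> \<and> b = \<zero>\<^bsub>M\<^esub>"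
    using B by (auto simp: basis2_def)
  let ?s = "\<lambda>a b. x \<triangleleft>\<^bsub>U\<^esub> a \<oplus>\<^bsub>U\<^esub> y \<triangleleft>\<^bsub>U\<^esub> b"
  have sc: "?s a b \<in> carrier U" if "a \<in> carrier M" "b \<in> carrier M" for a b using that x by simp
  have sadd: "?s a b \<oplus>\<^bsub>U\<^esub> ?s a' b' = ?s (a \<oplus>\<^bsub>M\<^esub> a') (b \<oplus>\<^bsub>M\<^esub> b')"
    if "a \<in> carrier M" "b \<in> carrier M" "a' \<in> carrier M" "b' \<in> carrier M" for a b a' b'
    using that x by (simp add: U_right LU.a_ac)
  have smul: "?s a b \<triangleleft>\<^bsub>U\<^esub> m = ?s (a \<otimes>\<^bsub>M\<^esub> m) (b \<otimes>\<^bsub>M\<^esub> m)"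
    if "a \<in> carrier M" "b \<in> carrier M" "m \<in> carrier M" for a b m
    using that x by (simp add: U_right M.m_comm)
  have uniq: "a = a' \<and> b = b'"
    if ab: "a \<in> carrier M" "b \<in> carrier M" "a' \<in> carrier M" "b' \<in> carrier M" and eq: "?s a b = ?s a' b'" for a b a' b'
  proof -
    have "?s (a \<oplus>\<^bsub>M\<^esub> \<ominus>\<^bsub>M\<^esub> a') (b \<oplus>\<^bsub>M\<^esub> \<ominus>\<^bsub>M\<^esub> b') = ?s a' b' \<oplus>\<^bsub>U\<^esub> ?s (\<ominus>\<^bsub>M\<^esub> a') (\<ominus>\<^bsub>M\<^esub> b')"
      using ab sadd[of a b "\<ominus>\<^bsub>M\<^esub> a'" "\<ominus>\<^bsub>M\<^esub> b'"] eq by simp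
    also have "\<dots> = \<zero>\<^bsub>U\<^esub>" using ab sadd[of a' b' "\<ominus>\<^bsub>M\<^esub> a'" "\<ominus>\<^bsub>M\<^esub> b'"] x by (simp add: M.r_neg U_right)
    finally have "a \<oplus>\<^bsub>M\<^esub> \<ominus>\<^bsub>M\<^esub> a' = \<zero>\<^bsub>M\<^esub> \<and> b \<oplus>\<^bsub>M\<^esub> \<ominus>\<^bsub>M\<^esub> b' = \<zero>\<^bsub>M\<^esub>" using ab by (intro ind) auto
    then show ?thesis using ab M.minus_equality M.minus_minus by (metis M.a_comm M.a_inv_closed)
  qed
  let ?c = "coord1 x y" and ?d = "coord2 x y"
  have *: "?c v \<in> carrier M \<and> (\<exists>b\<in>carrier M. v = ?s (?c v) b)" if "v \<in> carrier U" for v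
    unfolding coord1_def by (rule someI_ex) (use ex[OF that] in blast)
  have **: "?d v \<in> carrier M \<and> v = ?s (?c v) (?d v)" if "v \<in> carrier U" for v
    unfolding coord2_def[of x y v] by (rule someI_ex) (use *[OF that] in blast)
  have cd1: "?c v \<in> carrier M" "?d v \<in> carrier M" "?s (?c v) (?d v) = v" if "v \<in> carrier U" for v
    using *[OF that] **[OF that] by auto
  then show "v \<in> carrier U \<Longrightarrow> ?c v \<in> carrier M" "v \<in> carrier U \<Longrightarrow> ?d v \<in> carrier M"
    "v \<in> carrier U \<Longrightarrow> ?s (?c v) (?d v) = v" by blast+
  have cd2: "?c (?s a b) = a" "?d (?s a b) = b" if "a \<in> carrier M" "b \<in> carrier M" for a b
    using uniq[OF cd1(1,2)[OF sc[OF that]] that] cd1(3)[OF sc[OF that]] by simp_all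
  then show "\<lbrakk>a \<in> carrier M; b \<in> carrier M\<rbrakk> \<Longrightarrow> ?c (?s a b) = a"
    "\<lbrakk>a \<in> carrier M; b \<in> carrier M\<rbrakk> \<Longrightarrow> ?d (?s a b) = b" by blast+
  show "?c (v \<oplus>\<^bsub>U\<^esub> w) = ?c v \<oplus>\<^bsub>M\<^esub> ?c w" "?d (v \<oplus>\<^bsub>U\<^esub> w) = ?d v \<oplus>\<^bsub>M\<^esub> ?d w"
    if v: "v \<in> carrier U" and w: "w \<in> carrier U"
    using cd2[of "?c v \<oplus>\<^bsub>M\<^esub> ?c w" "?d v \<oplus>\<^bsub>M\<^esub> ?d w"]
      sadd[OF cd1(1,2)[OF v] cd1(1,2)[OF w]] cd1[OF v] cd1[OF w] by simp_all
  show "?c (v \<triangleleft>\<^bsub>U\<^esub> m) = ?c v \<otimes>\<^bsub>M\<^esub> m" "?d (v \<triangleleft>\<^bsub>U\<^esub> m) = ?d v \<otimes>\<^bsub>M\<^esub> m"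
    if v: "v \<in> carrier U" and b: "m \<in> carrier M"
    using cd2[of "?c v \<otimes>\<^bsub>M\<^esub> m" "?d v \<otimes>\<^bsub>M\<^esub> m"] smul[OF cd1(1,2)[OF v] b] cd1[OF v] b by simp_all
qed

definition dual_pair :: "'w \<Rightarrow> 'w \<Rightarrow> 'w \<Rightarrow> 'w \<Rightarrow> bool" where
  "dual_pair x1 x2 y1 y2 \<longleftrightarrow> x1 \<in> carrier U \<and> x2 \<in> carrier U \<and> y1 \<in> carrier U' \<and> y2 \<in> carrier U' \<and>
    e y1 x1 = \<one>\<^bsub>M\<^esub> \<and> e y1 x2 = \<zero>\<^bsub>M\<^esub> \<and> e y2 x1 = \<zero>\<^bsub>M\<^esub> \<and> e y2 x2 = \<one>\<^bsub>M\<^esub> \<and>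
    (\<forall>v\<in>carrier U. x1 \<triangleleft>\<^bsub>U\<^esub> e y1 v \<oplus>\<^bsub>U\<^esub> x2 \<triangleleft>\<^bsub>U\<^esub> e y2 v = v) \<and>
    (\<forall>\<psi>\<in>carrier U'. e \<psi> x1 \<odot>\<^bsub>U'\<^esub> y1 \<oplus>\<^bsub>U'\<^esub> e \<psi> x2 \<odot>\<^bsub>U'\<^esub> y2 = \<psi>)"

text \<open>The dual basis consists of the two coordinate functionals, which \<open>e_surj\<close>
  realises in \<open>U'\<close>.\<close>

lemma dual_basis:
  assumes B: "basis2 M (right_mod U) x1 x2"
  shows "\<exists>y1 y2. dual_pair x1 x2 y1 y2"
proof -
    define c d where "c = coord1 x1 x2" and "d = coord2 x1 x2"
    note coords = coordinates[OF B, folded c_def d_def]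
    note c = coords(1) and d = coords(2) and cd = coords(3) and cv = coords(4) and dv = coords(5)
      and ca = coords(6) and da = coords(7) and cm = coords(8) and dm = coords(9)
  have x: "x1 \<in> carrier U" "x2 \<in> carrier U" using B by (auto simp: basis2_def)
  obtain y1 where y1: "y1 \<in> carrier U'" "\<And>v. v \<in> carrier U \<Longrightarrow> e y1 v = c v"
    using e_surj[of c, OF c ca cm] by blast
  obtain y2 where y2: "y2 \<in> carrier U'" "\<And>v. v \<in> carrier U \<Longrightarrow> e y2 v = d v"
    using e_surj[of d, OF d da dm] by blast
  have x1: "c x1 = \<one>\<^bsub>M\<^esub>" "d x1 = \<zero>\<^bsub>M\<^esub>" using cv[of "\<one>\<^bsub>M\<^esub>" "\<zero>\<^bsub>M\<^esub>"] dv[of "\<one>\<^bsub>M\<^esub>" "\<zero>\<^bsub>M\<^esub>"] x by (simp_all add: U_right)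
  have x2: "c x2 = \<zero>\<^bsub>M\<^esub>" "d x2 = \<one>\<^bsub>M\<^esub>" using cv[of "\<zero>\<^bsub>M\<^esub>" "\<one>\<^bsub>M\<^esub>"] dv[of "\<zero>\<^bsub>M\<^esub>" "\<one>\<^bsub>M\<^esub>"] x by (simp_all add: U_right)
  have "e \<psi> x1 \<odot>\<^bsub>U'\<^esub> y1 \<oplus>\<^bsub>U'\<^esub> e \<psi> x2 \<odot>\<^bsub>U'\<^esub> y2 = \<psi>" if p: "\<psi> \<in> carrier U'" for \<psi>
  proof (rule e_inj)
    fix v assume v: "v \<in> carrier U"
    have "e \<psi> v = e \<psi> (x1 \<triangleleft>\<^bsub>U\<^esub> c v \<oplus>\<^bsub>U\<^esub> x2 \<triangleleft>\<^bsub>U\<^esub> d v)" using cd[OF v] by simp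
    also have "\<dots> = e \<psi> x1 \<otimes>\<^bsub>M\<^esub> c v \<oplus>\<^bsub>M\<^esub> e \<psi> x2 \<otimes>\<^bsub>M\<^esub> d v" using p x c[OF v] d[OF v] by (simp add: e_add e_right)
    finally show "e (e \<psi> x1 \<odot>\<^bsub>U'\<^esub> y1 \<oplus>\<^bsub>U'\<^esub> e \<psi> x2 \<odot>\<^bsub>U'\<^esub> y2) v = e \<psi> v"
      using p x y1 y2 v by (simp add: e_add' e_left e_closed)
  qed (use p x y1 y2 in \<open>simp_all add: e_closed\<close>)
  then have "dual_pair x1 x2 y1 y2" using y1 y2 x x1 x2 cd by (simp add: dual_pair_def)
  then show ?thesis by blast
qed

lemma dim_left_dual:
  assumes fd: "RU.fin_dim" and d: "RU.dim = 2"
  shows "LU'.fin_dim" "LU'.dim = 2"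
proof -
  obtain x1 x2 where B: "basis2 M (right_mod U) x1 x2" using RU.basis2_exists[OF fd d] by blast
  have x: "x1 \<in> carrier U" "x2 \<in> carrier U" using B by (auto simp: basis2_def)
  obtain y1 y2 where "dual_pair x1 x2 y1 y2" using dual_basis[OF B] by blast
  then have y: "y1 \<in> carrier U'" "y2 \<in> carrier U'"
    and xy: "e y1 x1 = \<one>\<^bsub>M\<^esub>" "e y1 x2 = \<zero>\<^bsub>M\<^esub>" "e y2 x1 = \<zero>\<^bsub>M\<^esub>" "e y2 x2 = \<one>\<^bsub>M\<^esub>"
    and exl: "\<And>v. v \<in> carrier U \<Longrightarrow> x1 \<triangleleft>\<^bsub>U\<^esub> e y1 v \<oplus>\<^bsub>U\<^esub> x2 \<triangleleft>\<^bsub>U\<^esub> e y2 v = v"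
    and exr: "\<And>\<psi>. \<psi> \<in> carrier U' \<Longrightarrow> e \<psi> x1 \<odot>\<^bsub>U'\<^esub> y1 \<oplus>\<^bsub>U'\<^esub> e \<psi> x2 \<odot>\<^bsub>U'\<^esub> y2 = \<psi>"
    by (simp_all add: dual_pair_def)
  \<comment> \<open>The map sending the basis \<open>x1\<close>, \<open>x2\<close> of the right
    space \<open>U\<close> to the dual basis of the left space \<open>U'\<close>.\<close>
  let ?T = "\<lambda>v. e y1 v \<odot>\<^bsub>U'\<^esub> y1 \<oplus>\<^bsub>U'\<^esub> e y2 v \<odot>\<^bsub>U'\<^esub> y2"
  have Tc: "?T v \<in> carrier U'" if "v \<in> carrier U" for v using that y by (simp add: e_closed)
  have eT: "e (?T v) x1 = e y1 v" "e (?T v) x2 = e y2 v" if "v \<in> carrier U" for v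
    using that y x xy by (simp_all add: e_add' e_left e_closed)
  have e0: "e \<zero>\<^bsub>U'\<^esub> v = \<zero>\<^bsub>M\<^esub>" if "v \<in> carrier U" for v
    using e_left[of "\<zero>\<^bsub>U'\<^esub>" v "\<zero>\<^bsub>M\<^esub>"] that by (simp add: e_closed)
  have *: "vectorspace.fin_dim M U' \<and> vectorspace.dim M U' = RU.dim"
  proof (rule linear_iso_dim[of M "right_mod U" U' ?T, OF RU.vectorspace_axioms LU'.vectorspace_axioms _ _ _ _ _ fd])
    fix v w assume "v \<in> carrier (right_mod U)" "w \<in> carrier (right_mod U)"
    then show "?T (v \<oplus>\<^bsub>right_mod U\<^esub> w) = ?T v \<oplus>\<^bsub>U'\<^esub> ?T w"
      using y by (simp add: e_add e_closed LU'.smult_l_distr LU'.a_ac)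
  next
    fix a v assume "a \<in> carrier M" "v \<in> carrier (right_mod U)"
    then show "?T (a \<odot>\<^bsub>right_mod U\<^esub> v) = a \<odot>\<^bsub>U'\<^esub> ?T v"
      using y by (simp add: e_right e_closed LU'.smult_r_distr LU'.smult_assoc1[symmetric] M.m_comm)
  next
    fix v assume v: "v \<in> carrier (right_mod U)" and "?T v = \<zero>\<^bsub>U'\<^esub>"
    then have "e y1 v = \<zero>\<^bsub>M\<^esub>" "e y2 v = \<zero>\<^bsub>M\<^esub>" using eT[of v] e0 x by simp_all
    then show "v = \<zero>\<^bsub>right_mod U\<^esub>" using exl[of v] v x by (simp add: U_right)
  next
    fix \<psi> assume p: "\<psi> \<in> carrier U'"
    let ?v = "x1 \<triangleleft>\<^bsub>U\<^esub> e \<psi> x1 \<oplus>\<^bsub>U\<^esub> x2 \<triangleleft>\<^bsub>U\<^esub> e \<psi> x2"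
    have "\<psi> = ?T ?v" using exr[OF p] p x y xy by (simp add: e_add e_right e_closed)
    moreover have "?v \<in> carrier (right_mod U)" using p x by (simp add: e_closed)
    ultimately show "\<exists>v\<in>carrier (right_mod U). \<psi> = ?T v" by blast
  qed (use Tc in auto)
  then show "LU'.fin_dim" "LU'.dim = 2" using d by auto
qed

text \<open>A nondegenerate form turns vectors into functionals, and invariance under
  \<open>L\<close> matches the left action on \<open>U\<close> with the right action on
  \<open>U'\<close>. So the right rank of the dual equals the left rank of \<open>U\<close>.\<close>

lemma form_dim:
  assumes fd: "LU.fin_dim" and d: "LU.dim = 2"
    and Bc: "\<And>v w. \<lbrakk>v \<in> carrier U; w \<in> carrier U\<rbrakk> \<Longrightarrow> B v w \<in> carrier M"
    and Badd: "\<And>u v w. \<lbrakk>u \<in> carrier U; v \<in> carrier U; w \<in> carrier U\<rbrakk> \<Longrightarrow> B u (v \<oplus>\<^bsub>U\<^esub> w) = B u v \<oplus>\<^bsub>M\<^esub> B u w"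
    and Bright: "\<And>u v b. \<lbrakk>u \<in> carrier U; v \<in> carrier U; b \<in> carrier M\<rbrakk> \<Longrightarrow> B u (v \<triangleleft>\<^bsub>U\<^esub> b) = B u v \<otimes>\<^bsub>M\<^esub> b"
    and Badd': "\<And>u v w. \<lbrakk>u \<in> carrier U; v \<in> carrier U; w \<in> carrier U\<rbrakk> \<Longrightarrow> B (u \<oplus>\<^bsub>U\<^esub> v) w = B u w \<oplus>\<^bsub>M\<^esub> B v w"
    and Binv: "\<And>u v c. \<lbrakk>u \<in> carrier U; v \<in> carrier U; c \<in> carrier L\<rbrakk> \<Longrightarrow> B (c \<odot>\<^bsub>U\<^esub> u) v = B u (c \<odot>\<^bsub>U\<^esub> v)"
    and Binj: "\<And>u. \<lbrakk>u \<in> carrier U; \<And>v. v \<in> carrier U \<Longrightarrow> B u v = \<zero>\<^bsub>M\<^esub>\<rbrakk> \<Longrightarrow> u = \<zero>\<^bsub>U\<^esub>"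
    and Bsurj: "\<And>\<psi>. \<psi> \<in> carrier U' \<Longrightarrow> \<exists>u\<in>carrier U. \<forall>v\<in>carrier U. e \<psi> v = B u v"
  shows "RU'.fin_dim \<and> RU'.dim = 2"
proof -
  have "\<exists>\<psi>\<in>carrier U'. \<forall>v\<in>carrier U. e \<psi> v = B u v" if "u \<in> carrier U" for u
    using that Bc Badd Bright by (intro e_surj) auto
  then obtain T where T: "\<And>u. u \<in> carrier U \<Longrightarrow> T u \<in> carrier U'"
    and eT: "\<And>u v. u \<in> carrier U \<Longrightarrow> v \<in> carrier U \<Longrightarrow> e (T u) v = B u v"
    by metis
  have e0: "e \<zero>\<^bsub>U'\<^esub> v = \<zero>\<^bsub>M\<^esub>" if "v \<in> carrier U" for v
    using e_left[of "\<zero>\<^bsub>U'\<^esub>" v "\<zero>\<^bsub>M\<^esub>"] that by (simp add: e_closed)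
  have "RU'.fin_dim \<and> RU'.dim = LU.dim"
  proof (rule linear_iso_dim[of L U "right_mod U'" T, OF LU.vectorspace_axioms RU'.vectorspace_axioms _ _ _ _ _ fd])
    fix v w assume "v \<in> carrier U" "w \<in> carrier U"
    then show "T (v \<oplus>\<^bsub>U\<^esub> w) = T v \<oplus>\<^bsub>right_mod U'\<^esub> T w"
      by (auto intro!: e_inj simp: T eT e_add' Badd')
  next
    fix a v assume "a \<in> carrier L" "v \<in> carrier U"
    then show "T (a \<odot>\<^bsub>U\<^esub> v) = a \<odot>\<^bsub>right_mod U'\<^esub> T v"
      by (auto intro!: e_inj simp: T eT e_mid Binv)
  next
    fix v assume "v \<in> carrier U" "T v = \<zero>\<^bsub>right_mod U'\<^esub>"
    then show "v = \<zero>\<^bsub>U\<^esub>" using Binj[of v] eT[of v] e0 by simp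
  next
    fix \<psi> assume p: "\<psi> \<in> carrier (right_mod U')"
    then obtain u where "u \<in> carrier U" "\<forall>v\<in>carrier U. e \<psi> v = B u v" using Bsurj by auto
    then show "\<exists>v\<in>carrier U. \<psi> = T v" using p eT T by (intro bexI[of _ u] e_inj) auto
  qed (use T in auto)
  then show ?thesis using d by auto
qed

text \<open>If \<open>L\<close> acts by scalars any nondegenerate symmetric form is \<open>L\<close>-invariant. Otherwise some
  \<open>a \<in> L\<close> has a cyclic vector \<open>x\<close>, the algebra \<open>M[a]\<close> is its own commutant and contains \<open>L\<close>, and
  \<open>U\<close> is a free \<open>M[a]\<close>-module of rank one, on which multiplication followed by a coordinate is
  an invariant form.\<close>

lemma dim_right_dual:
  assumes fd: "LU.fin_dim" and d: "LU.dim = 2" and fdr: "RU.fin_dim" and dr: "RU.dim = 2"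
  shows "RU'.fin_dim" "RU'.dim = 2"
proof -
  have "RU'.fin_dim \<and> RU'.dim = 2"
  proof (cases "\<forall>x\<in>carrier U. \<forall>a\<in>carrier L. \<exists>m\<in>carrier M. a \<odot>\<^bsub>U\<^esub> x = x \<triangleleft>\<^bsub>U\<^esub> m")
    case scalar: True
    obtain x y where B: "basis2 M (right_mod U) x y" using RU.basis2_exists[OF fdr dr] by blast
    have x: "x \<in> carrier U" "y \<in> carrier U" using B by (auto simp: basis2_def)
    define c d where "c = coord1 x y" and "d = coord2 x y"
    note coords = coordinates[OF B, folded c_def d_def]
    note c = coords(1) and dd = coords(2) and cd = coords(3) and cv = coords(4) and dv = coords(5)
      and ca = coords(6) and da = coords(7) and cm = coords(8) and dm = coords(9)
    have x1: "c x = \<one>\<^bsub>M\<^esub>" "d x = \<zero>\<^bsub>M\<^esub>" using cv[of "\<one>\<^bsub>M\<^esub>" "\<zero>\<^bsub>M\<^esub>"] dv[of "\<one>\<^bsub>M\<^esub>" "\<zero>\<^bsub>M\<^esub>"] x by (simp_all add: U_right)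
    have y1: "c y = \<zero>\<^bsub>M\<^esub>" "d y = \<one>\<^bsub>M\<^esub>" using cv[of "\<zero>\<^bsub>M\<^esub>" "\<one>\<^bsub>M\<^esub>"] dv[of "\<zero>\<^bsub>M\<^esub>" "\<one>\<^bsub>M\<^esub>"] x by (simp_all add: U_right)
    \<comment> \<open>The scalars by which \<open>a\<close> multiplies \<open>x\<close>,
      \<open>y\<close> and their sum coincide by linear independence, so \<open>a\<close> acts on
      all of \<open>U\<close> as one element of \<open>M\<close>.\<close>
    have scal: "\<exists>m\<in>carrier M. \<forall>v\<in>carrier U. a \<odot>\<^bsub>U\<^esub> v = v \<triangleleft>\<^bsub>U\<^esub> m" if a: "a \<in> carrier L" for a
    proof -
      obtain m1 m2 m3 where m: "m1 \<in> carrier M" "m2 \<in> carrier M" "m3 \<in> carrier M" "a \<odot>\<^bsub>U\<^esub> x = x \<triangleleft>\<^bsub>U\<^esub> m1"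
        "a \<odot>\<^bsub>U\<^esub> y = y \<triangleleft>\<^bsub>U\<^esub> m2" "a \<odot>\<^bsub>U\<^esub> (x \<oplus>\<^bsub>U\<^esub> y) = (x \<oplus>\<^bsub>U\<^esub> y) \<triangleleft>\<^bsub>U\<^esub> m3"
        using scalar a x by (metis LU.M.a_closed)
      have "x \<triangleleft>\<^bsub>U\<^esub> m1 \<oplus>\<^bsub>U\<^esub> y \<triangleleft>\<^bsub>U\<^esub> m2 = x \<triangleleft>\<^bsub>U\<^esub> m3 \<oplus>\<^bsub>U\<^esub> y \<triangleleft>\<^bsub>U\<^esub> m3"
        using m x a by (simp add: LU.smult_r_distr U_right)
      then have eq: "m1 = m3" "m2 = m3" using cv[OF m(1,2)] cv[OF m(3,3)] dv[OF m(1,2)] dv[OF m(3,3)] by auto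
      have "a \<odot>\<^bsub>U\<^esub> v = v \<triangleleft>\<^bsub>U\<^esub> m3" if v: "v \<in> carrier U" for v
      proof -
        have "a \<odot>\<^bsub>U\<^esub> (x \<triangleleft>\<^bsub>U\<^esub> c v \<oplus>\<^bsub>U\<^esub> y \<triangleleft>\<^bsub>U\<^esub> d v) = (a \<odot>\<^bsub>U\<^esub> x) \<triangleleft>\<^bsub>U\<^esub> c v \<oplus>\<^bsub>U\<^esub> (a \<odot>\<^bsub>U\<^esub> y) \<triangleleft>\<^bsub>U\<^esub> d v"
          using a x c[OF v] dd[OF v] by (simp add: LU.smult_r_distr U_right)
        also have "\<dots> = (x \<triangleleft>\<^bsub>U\<^esub> c v \<oplus>\<^bsub>U\<^esub> y \<triangleleft>\<^bsub>U\<^esub> d v) \<triangleleft>\<^bsub>U\<^esub> m3"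
          using m eq x c[OF v] dd[OF v] by (simp add: U_right M.m_comm)
        finally show ?thesis using cd[OF v] by simp
      qed
      then show ?thesis using m by blast
    qed
    \<comment> \<open>The standard symmetric form in the coordinates; it is invariant because
      \<open>L\<close> acts by scalars of \<open>M\<close>.\<close>
    let ?B = "\<lambda>v w. c v \<otimes>\<^bsub>M\<^esub> c w \<oplus>\<^bsub>M\<^esub> d v \<otimes>\<^bsub>M\<^esub> d w"
    show ?thesis
    proof (rule form_dim[of ?B, OF fd d])
      show "?B (a \<odot>\<^bsub>U\<^esub> u) v = ?B u (a \<odot>\<^bsub>U\<^esub> v)" if uva: "u \<in> carrier U" "v \<in> carrier U" "a \<in> carrier L" for u v a
      proof -
        obtain m where "m \<in> carrier M" "\<forall>v\<in>carrier U. a \<odot>\<^bsub>U\<^esub> v = v \<triangleleft>\<^bsub>U\<^esub> m" using scal uva(3) by blast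
        with uva c dd show ?thesis by (simp add: cm dm M.m_ac)
      qed
      show inj: "u = \<zero>\<^bsub>U\<^esub>" if u: "u \<in> carrier U" and z: "\<And>v. v \<in> carrier U \<Longrightarrow> ?B u v = \<zero>\<^bsub>M\<^esub>" for u
      proof -
        have "c u = \<zero>\<^bsub>M\<^esub>" "d u = \<zero>\<^bsub>M\<^esub>" using z[OF x(1)] z[OF x(2)] u c dd by (simp_all add: x1 y1)
        then show ?thesis using cd[OF u] x by (simp add: U_right)
      qed
      show surj: "\<exists>u\<in>carrier U. \<forall>v\<in>carrier U. e \<psi> v = ?B u v" if p: "\<psi> \<in> carrier U'" for \<psi>
      proof (intro bexI ballI)
        let ?u = "x \<triangleleft>\<^bsub>U\<^esub> e \<psi> x \<oplus>\<^bsub>U\<^esub> y \<triangleleft>\<^bsub>U\<^esub> e \<psi> y"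
        show "?u \<in> carrier U" using p x by (simp add: e_closed)
        fix v assume v: "v \<in> carrier U"
        have "e \<psi> v = e \<psi> (x \<triangleleft>\<^bsub>U\<^esub> c v \<oplus>\<^bsub>U\<^esub> y \<triangleleft>\<^bsub>U\<^esub> d v)" using cd[OF v] by simp
        also have "\<dots> = ?B ?u v" using p x c[OF v] dd[OF v] by (simp add: e_add e_right e_closed cv dv)
        finally show "e \<psi> v = ?B ?u v" .
      qed
    qed (simp_all add: c dd ca da cm dm M.r_distr M.l_distr M.a_ac M.m_ac)
  next
    case False
    then obtain x a where x: "x \<in> carrier U" and a: "a \<in> carrier L"
      and ne: "\<And>m. m \<in> carrier M \<Longrightarrow> a \<odot>\<^bsub>U\<^esub> x \<noteq> x \<triangleleft>\<^bsub>U\<^esub> m" by blast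
    let ?y = "a \<odot>\<^bsub>U\<^esub> x"
    have y: "?y \<in> carrier U" using x a by simp
    have x0: "x \<noteq> \<zero>\<^bsub>U\<^esub>"
    proof
      assume "x = \<zero>\<^bsub>U\<^esub>"
      then have "?y = x \<triangleleft>\<^bsub>U\<^esub> \<zero>\<^bsub>M\<^esub>" using a x by (simp add: U_right LU.smult_r_null)
      then show False using ne by simp
    qed
    have B: "basis2 M (right_mod U) x ?y"
      by (rule RU.basis2I[OF fdr dr]) (use x x0 y ne in auto)
    define c d where "c = coord1 x ?y" and "d = coord2 x ?y"
    note coords = coordinates[OF B, folded c_def d_def]
    note c = coords(1) and dd = coords(2) and cd = coords(3) and cv = coords(4) and dv = coords(5)
      and ca = coords(6) and da = coords(7) and cm = coords(8) and dm = coords(9)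
    have x1: "c x = \<one>\<^bsub>M\<^esub>" "d x = \<zero>\<^bsub>M\<^esub>" using cv[of "\<one>\<^bsub>M\<^esub>" "\<zero>\<^bsub>M\<^esub>"] dv[of "\<one>\<^bsub>M\<^esub>" "\<zero>\<^bsub>M\<^esub>"] x y by (simp_all add: U_right)
    have y1: "c ?y = \<zero>\<^bsub>M\<^esub>" "d ?y = \<one>\<^bsub>M\<^esub>" using cv[of "\<zero>\<^bsub>M\<^esub>" "\<one>\<^bsub>M\<^esub>"] dv[of "\<zero>\<^bsub>M\<^esub>" "\<one>\<^bsub>M\<^esub>"] x y by (simp_all add: U_right)
    \<comment> \<open>\<open>T v\<close> is the element of M[a], with coefficients the coordinates
      of \<open>v\<close>, that sends the cyclic vector \<open>x\<close> to
      \<open>v\<close>.\<close>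
    define T where "T v w = w \<triangleleft>\<^bsub>U\<^esub> c v \<oplus>\<^bsub>U\<^esub> (a \<odot>\<^bsub>U\<^esub> w) \<triangleleft>\<^bsub>U\<^esub> d v" for v w
    have Tc: "T v w \<in> carrier U" if "v \<in> carrier U" "w \<in> carrier U" for v w
      using that a c dd by (simp add: T_def)
    have Tadd: "T v (u \<oplus>\<^bsub>U\<^esub> w) = T v u \<oplus>\<^bsub>U\<^esub> T v w" if "v \<in> carrier U" "u \<in> carrier U" "w \<in> carrier U" for u v w
      using that a c dd by (simp add: T_def LU.smult_r_distr U_right LU.a_ac)
    have Tright: "T v (w \<triangleleft>\<^bsub>U\<^esub> m) = T v w \<triangleleft>\<^bsub>U\<^esub> m" if "v \<in> carrier U" "w \<in> carrier U" "m \<in> carrier M" for v w m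
      using that a c[of v] dd[of v] by (simp add: T_def U_right M.m_comm)
    have Tleft: "T v (b \<odot>\<^bsub>U\<^esub> w) = b \<odot>\<^bsub>U\<^esub> T v w" if "v \<in> carrier U" "w \<in> carrier U" "b \<in> carrier L" for v w b
      using that a c[of v] dd[of v]
      by (simp add: T_def LU.smult_r_distr U_right LU.smult_assoc1[symmetric] L.m_comm)
    have Tx: "T v x = v" if "v \<in> carrier U" for v using cd[OF that] by (simp add: T_def)
    have Tadd': "T (u \<oplus>\<^bsub>U\<^esub> v) w = T u w \<oplus>\<^bsub>U\<^esub> T v w" if "v \<in> carrier U" "u \<in> carrier U" "w \<in> carrier U" for u v w
      using that a c dd by (simp add: T_def ca da U_right LU.a_ac)
    have Tmul: "T (b \<odot>\<^bsub>U\<^esub> v) w = T v (b \<odot>\<^bsub>U\<^esub> w)" if v: "v \<in> carrier U" and w: "w \<in> carrier U" and b: "b \<in> carrier L" for v w b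
    proof -
      have bv: "b \<odot>\<^bsub>U\<^esub> v \<in> carrier U" using v b by simp
      \<comment> \<open>The right side is \<open>T w u\<close>, so this is the commutativity of the
        product. Combined with \<open>Tleft\<close> it carries \<open>b\<close> from one argument of
        \<open>T\<close> to the other.\<close>
      have exp: "T u w = T u x \<triangleleft>\<^bsub>U\<^esub> c w \<oplus>\<^bsub>U\<^esub> (a \<odot>\<^bsub>U\<^esub> T u x) \<triangleleft>\<^bsub>U\<^esub> d w" if u: "u \<in> carrier U" for u
      proof -
        have "T u w = T u (x \<triangleleft>\<^bsub>U\<^esub> c w \<oplus>\<^bsub>U\<^esub> ?y \<triangleleft>\<^bsub>U\<^esub> d w)" using cd[OF w] by simp
        then show ?thesis using u x y a c[OF w] dd[OF w] by (simp add: Tadd Tright Tleft del: Tx)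
      qed
      have "T v (b \<odot>\<^bsub>U\<^esub> w) = b \<odot>\<^bsub>U\<^esub> T v w" by (rule Tleft[OF v w b])
      also have "\<dots> = (b \<odot>\<^bsub>U\<^esub> v) \<triangleleft>\<^bsub>U\<^esub> c w \<oplus>\<^bsub>U\<^esub> (a \<odot>\<^bsub>U\<^esub> (b \<odot>\<^bsub>U\<^esub> v)) \<triangleleft>\<^bsub>U\<^esub> d w"
        using exp[OF v] v b a c[OF w] dd[OF w]
        by (simp add: Tx LU.smult_r_distr U_right LU.smult_assoc1[symmetric] L.m_comm)
      also have "\<dots> = T (b \<odot>\<^bsub>U\<^esub> v) w" using exp[OF bv] bv by (simp add: Tx)
      finally show ?thesis by simp
    qed
    let ?B = "\<lambda>v w. d (T v w)"
    show ?thesis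
    proof (rule form_dim[of ?B, OF fd d])
      show inj: "u = \<zero>\<^bsub>U\<^esub>" if u: "u \<in> carrier U" and z: "\<And>v. v \<in> carrier U \<Longrightarrow> ?B u v = \<zero>\<^bsub>M\<^esub>" for u
      proof -
        have d0: "d u = \<zero>\<^bsub>M\<^esub>" using z[OF x] Tx[OF u] by simp
        have "T u ?y = ?y \<triangleleft>\<^bsub>U\<^esub> c u" using d0 u y a c by (simp add: T_def U_right)
        then have "c u = \<zero>\<^bsub>M\<^esub>" using z[OF y] y u c by (simp add: dm y1)
        with d0 show ?thesis using cd[OF u] x y by (simp add: U_right)
      qed
      show surj: "\<exists>u\<in>carrier U. \<forall>v\<in>carrier U. e \<psi> v = ?B u v" if p: "\<psi> \<in> carrier U'" for \<psi>
      proof (intro bexI ballI)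
        let ?r = "d (a \<odot>\<^bsub>U\<^esub> ?y)"
        \<comment> \<open>The form satisfies \<open>?B u x = d u\<close> and
          \<open>?B u ?y = c u \<oplus> ?r \<otimes> d u\<close>. Solving for the prescribed values
          of \<open>e \<psi>\<close> at \<open>x\<close> and \<open>?y\<close> gives the coordinates
          of \<open>?u\<close>.\<close>
        let ?c = "e \<psi> ?y \<oplus>\<^bsub>M\<^esub> \<ominus>\<^bsub>M\<^esub> (?r \<otimes>\<^bsub>M\<^esub> e \<psi> x)"
        have r: "?r \<in> carrier M" using a y dd by simp
        have ec: "e \<psi> x \<in> carrier M" "e \<psi> ?y \<in> carrier M" using p x y by (simp_all add: e_closed)
        have cc: "?c \<in> carrier M" using r ec by simp
        let ?u = "x \<triangleleft>\<^bsub>U\<^esub> ?c \<oplus>\<^bsub>U\<^esub> ?y \<triangleleft>\<^bsub>U\<^esub> e \<psi> x"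
        show u: "?u \<in> carrier U" using cc ec x y by simp
        have cu: "c ?u = ?c" "d ?u = e \<psi> x" using cv[OF cc ec(1)] dv[OF cc ec(1)] by auto
        have Bx: "?B ?u x = e \<psi> x" using Tx[OF u] cu by simp
        have "T ?u ?y = ?y \<triangleleft>\<^bsub>U\<^esub> ?c \<oplus>\<^bsub>U\<^esub> (a \<odot>\<^bsub>U\<^esub> ?y) \<triangleleft>\<^bsub>U\<^esub> e \<psi> x" unfolding T_def cu ..
        then have "?B ?u ?y = ?c \<oplus>\<^bsub>M\<^esub> ?r \<otimes>\<^bsub>M\<^esub> e \<psi> x"
          using cc ec y a r by (simp add: da dm y1)
        also have "\<dots> = e \<psi> ?y" using r ec by (simp add: M.a_assoc M.l_neg)
        finally have By: "?B ?u ?y = e \<psi> ?y" .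
        fix v assume v: "v \<in> carrier U"
        have "e \<psi> v = e \<psi> (x \<triangleleft>\<^bsub>U\<^esub> c v \<oplus>\<^bsub>U\<^esub> ?y \<triangleleft>\<^bsub>U\<^esub> d v)" using cd[OF v] by simp
        also have "\<dots> = e \<psi> x \<otimes>\<^bsub>M\<^esub> c v \<oplus>\<^bsub>M\<^esub> e \<psi> ?y \<otimes>\<^bsub>M\<^esub> d v" using p x y c[OF v] dd[OF v] by (simp add: e_add e_right)
        also have "\<dots> = ?B ?u x \<otimes>\<^bsub>M\<^esub> c v \<oplus>\<^bsub>M\<^esub> ?B ?u ?y \<otimes>\<^bsub>M\<^esub> d v" unfolding Bx By ..
        also have "\<dots> = ?B ?u (x \<triangleleft>\<^bsub>U\<^esub> c v \<oplus>\<^bsub>U\<^esub> ?y \<triangleleft>\<^bsub>U\<^esub> d v)"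
        proof -
          have uu: "z \<in> carrier U \<Longrightarrow> T ?u z \<in> carrier U" for z using Tc u by blast
          show ?thesis
            unfolding Tadd[OF u U_closed(1)[OF x c[OF v]] U_closed(1)[OF y dd[OF v]]]
              Tright[OF u x c[OF v]] Tright[OF u y dd[OF v]]
            using uu[OF x] uu[OF y] c[OF v] dd[OF v] by (simp only: da dm U_closed)
        qed
        also have "\<dots> = ?B ?u v" using cd[OF v] by simp
        finally show "e \<psi> v = ?B ?u v" .
      qed
    qed (simp_all add: Tc dd Tadd Tright Tadd' Tmul da dm)
  qed
  then show "RU'.fin_dim" "RU'.dim = 2" by auto
qed

end

text \<open>The orthogonality relations make \<open>x1\<close>, \<open>x2\<close> independent, hence
  a basis in rank two, and determine the dual basis. Thus concretely given families can serve as
  dual bases.\<close>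

lemma (in perfect) dual_pairI:
  assumes fd: "RU.fin_dim" and d: "RU.dim = 2" and x: "x1 \<in> carrier U" "x2 \<in> carrier U"
    and y: "y1 \<in> carrier U'" "y2 \<in> carrier U'"
    and xy: "e y1 x1 = \<one>\<^bsub>M\<^esub>" "e y1 x2 = \<zero>\<^bsub>M\<^esub>" "e y2 x1 = \<zero>\<^bsub>M\<^esub>" "e y2 x2 = \<one>\<^bsub>M\<^esub>"
  shows "dual_pair x1 x2 y1 y2"
proof -
  have z: "e \<psi> (x1 \<triangleleft>\<^bsub>U\<^esub> \<zero>\<^bsub>M\<^esub>) = \<zero>\<^bsub>M\<^esub>" if "\<psi> \<in> carrier U'" for \<psi>
    using e_right[OF that x(1), of "\<zero>\<^bsub>M\<^esub>"] that x by (simp add: e_closed)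
  have "x1 \<noteq> \<zero>\<^bsub>U\<^esub>" using z[OF y(1)] xy(1) x by (auto simp: U_right)
  moreover have "x2 \<noteq> x1 \<triangleleft>\<^bsub>U\<^esub> b" if "b \<in> carrier M" for b
    using e_right[OF y(2) x(1) that] xy that by auto
  ultimately have "basis2 M (right_mod U) x1 x2" using x by (intro RU.basis2I[OF fd d]) auto
  then obtain z1 z2 where D: "dual_pair x1 x2 z1 z2" using dual_basis by blast
  then have z12: "z1 \<in> carrier U'" "z2 \<in> carrier U'"
    and ex: "\<And>\<psi>. \<psi> \<in> carrier U' \<Longrightarrow> e \<psi> x1 \<odot>\<^bsub>U'\<^esub> z1 \<oplus>\<^bsub>U'\<^esub> e \<psi> x2 \<odot>\<^bsub>U'\<^esub> z2 = \<psi>"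
    by (simp_all add: dual_pair_def)
  have "y1 = z1" "y2 = z2" using ex[OF y(1)] ex[OF y(2)] xy z12 by (simp_all add: LU'.smult_l_null)
  with D show ?thesis by simp
qed

lemma perfect_right_dual:
  assumes "field L" "field M" "bimodule L M U" "bimodule M L U'"
    and iso: "bimod_iso M L U' (right_dual M U) (\<lambda>\<psi>. \<lambda>v\<in>carrier U. e \<psi> v)"
  shows "perfect L M U U' e"
proof -
  let ?h = "\<lambda>\<psi>. \<lambda>v\<in>carrier U. e \<psi> v"
  have b: "bij_betw ?h (carrier U') (carrier (right_dual M U))"
    and add: "\<And>\<psi> \<chi>. \<psi> \<in> carrier U' \<Longrightarrow> \<chi> \<in> carrier U' \<Longrightarrow> ?h (\<psi> \<oplus>\<^bsub>U'\<^esub> \<chi>) = ?h \<psi> \<oplus>\<^bsub>right_dual M U\<^esub> ?h \<chi>"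
    and l: "\<And>a \<psi>. a \<in> carrier M \<Longrightarrow> \<psi> \<in> carrier U' \<Longrightarrow> ?h (a \<odot>\<^bsub>U'\<^esub> \<psi>) = a \<odot>\<^bsub>right_dual M U\<^esub> ?h \<psi>"
    and r: "\<And>a \<psi>. a \<in> carrier L \<Longrightarrow> \<psi> \<in> carrier U' \<Longrightarrow> ?h (\<psi> \<triangleleft>\<^bsub>U'\<^esub> a) = ?h \<psi> \<triangleleft>\<^bsub>right_dual M U\<^esub> a"
    using iso unfolding bimod_iso_def by blast+
  interpret U: vectorspace L U using assms(3) by (simp add: bimodule_def)
  interpret R: vectorspace M "right_mod U" using assms(3) by (simp add: bimodule_def)
  have cl: "?h \<psi> \<in> carrier (right_dual M U)" if "\<psi> \<in> carrier U'" for \<psi>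
    using b that by (rule bij_betw_apply)
  have rc: "v \<triangleleft>\<^bsub>U\<^esub> a \<in> carrier U" if "v \<in> carrier U" "a \<in> carrier M" for v a
    using R.smult_closed[of a v] that by simp
  show ?thesis
  proof
    fix \<psi> v assume p: "\<psi> \<in> carrier U'" and v: "v \<in> carrier U"
    have c: "\<And>u. u \<in> carrier U \<Longrightarrow> e \<psi> u \<in> carrier M"
      using cl[OF p] by (force simp: right_dual_def PiE_iff)
    show "e \<psi> v \<in> carrier M" using c v by blast
    show "e \<psi> (v \<oplus>\<^bsub>U\<^esub> w) = e \<psi> v \<oplus>\<^bsub>M\<^esub> e \<psi> w" if "w \<in> carrier U" for w
      using cl[OF p] v that by (simp add: right_dual_def)
    show "e \<psi> (v \<triangleleft>\<^bsub>U\<^esub> b) = e \<psi> v \<otimes>\<^bsub>M\<^esub> b" if "b \<in> carrier M" for b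
      using cl[OF p] v that rc by (simp add: right_dual_def)
    show "e (\<psi> \<oplus>\<^bsub>U'\<^esub> \<chi>) v = e \<psi> v \<oplus>\<^bsub>M\<^esub> e \<chi> v" if "\<chi> \<in> carrier U'" for \<chi>
      using fun_cong[OF add[OF p that], of v] v by (simp add: right_dual_def)
    show "e (a \<odot>\<^bsub>U'\<^esub> \<psi>) v = a \<otimes>\<^bsub>M\<^esub> e \<psi> v" if "a \<in> carrier M" for a
      using fun_cong[OF l[OF that p], of v] v by (simp add: right_dual_def)
    show "e (\<psi> \<triangleleft>\<^bsub>U'\<^esub> c) v = e \<psi> (c \<odot>\<^bsub>U\<^esub> v)" if "c \<in> carrier L" for c
      using fun_cong[OF r[OF that p], of v] v that by (simp add: right_dual_def)
  next
    fix \<psi> \<chi> assume p: "\<psi> \<in> carrier U'" "\<chi> \<in> carrier U'" and "\<And>v. v \<in> carrier U \<Longrightarrow> e \<psi> v = e \<chi> v"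
    then have "?h \<psi> = ?h \<chi>" by auto
    then show "\<psi> = \<chi>" using p b by (auto simp: bij_betw_def dest: inj_onD)
  next
    fix g :: "'b \<Rightarrow> 'a"
    assume g: "\<And>v. v \<in> carrier U \<Longrightarrow> g v \<in> carrier M"
      "\<And>v w. \<lbrakk>v \<in> carrier U; w \<in> carrier U\<rbrakk> \<Longrightarrow> g (v \<oplus>\<^bsub>U\<^esub> w) = g v \<oplus>\<^bsub>M\<^esub> g w"
      "\<And>v b. \<lbrakk>v \<in> carrier U; b \<in> carrier M\<rbrakk> \<Longrightarrow> g (v \<triangleleft>\<^bsub>U\<^esub> b) = g v \<otimes>\<^bsub>M\<^esub> b"
    have "(\<lambda>v\<in>carrier U. g v) \<in> carrier (right_dual M U)"
      using g rc by (simp add: right_dual_def)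
    then obtain \<psi> where "\<psi> \<in> carrier U'" "(\<lambda>v\<in>carrier U. g v) = ?h \<psi>"
      using b unfolding bij_betw_def by (metis (no_types, lifting) imageE)
    then show "\<exists>\<psi>\<in>carrier U'. \<forall>v\<in>carrier U. e \<psi> v = g v" by (metis (no_types, lifting) restrict_apply')
  qed (fact assms)+
qed

text \<open>As the fields are commutative, the opposite of a left dual is the right dual of the
  opposite bimodule.\<close>

lemma perfect_left_dual:
  assumes "field L" "field M" "bimodule L M U" "bimodule M L U'"
    and iso: "bimod_iso L M U (left_dual M U') (\<lambda>v. \<lambda>\<psi>\<in>carrier U'. e \<psi> v)"
  shows "perfect L M (op_bimod U') (op_bimod U) (\<lambda>v \<psi>. e \<psi> v)"
proof (rule perfect_right_dual)
  have eq: "op_bimod (left_dual M U') = right_dual M (op_bimod U')"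
  proof -
    interpret M: field M by fact
    have "(\<forall>v\<in>carrier U'. \<forall>a\<in>carrier M. \<phi> (a \<odot>\<^bsub>U'\<^esub> v) = a \<otimes>\<^bsub>M\<^esub> \<phi> v) \<longleftrightarrow>
        (\<forall>v\<in>carrier U'. \<forall>a\<in>carrier M. \<phi> (a \<odot>\<^bsub>U'\<^esub> v) = \<phi> v \<otimes>\<^bsub>M\<^esub> a)"
      if "\<phi> \<in> carrier U' \<rightarrow>\<^sub>E carrier M" for \<phi>
      using that by (simp add: PiE_iff M.m_comm)
    then show ?thesis by (simp add: op_bimod_def left_dual_def right_dual_def cong: conj_cong)
  qed
  have "bimod_iso M L (op_bimod U) (op_bimod (left_dual M U')) (\<lambda>v. \<lambda>\<psi>\<in>carrier U'. e \<psi> v)"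
    using iso by (simp add: bimod_iso_def)
  then show "bimod_iso M L (op_bimod U) (right_dual M (op_bimod U')) (\<lambda>v. \<lambda>\<psi>\<in>carrier (op_bimod U'). e \<psi> v)"
    unfolding eq by simp
qed (use assms bimodule_op in blast)+

lemma rank_two_op:
  assumes b: "bimodule L M U" and r: "rank_two L M U"
  shows "rank_two M L (op_bimod U)"
proof -
  have v: "vectorspace L U" "vectorspace M (right_mod U)" using b by (simp_all add: bimodule_def)
  have v': "vectorspace M (op_bimod U)" "vectorspace L (right_mod (op_bimod U))"
    using bimodule_op[OF b] by (simp_all add: bimodule_def)
  have "vectorspace.fin_dim L (right_mod (op_bimod U)) \<and>
      vectorspace.dim L (right_mod (op_bimod U)) = vectorspace.dim L U"
    by (rule linear_iso_dim[OF v(1) v'(2), of id]) (use r in \<open>auto simp: rank_two_def\<close>)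
  moreover have "vectorspace.fin_dim M (op_bimod U) \<and>
      vectorspace.dim M (op_bimod U) = vectorspace.dim M (right_mod U)"
    by (rule linear_iso_dim[OF v(2) v'(1), of id]) (use r in \<open>auto simp: rank_two_def\<close>)
  ultimately show ?thesis using r by (simp add: rank_two_def)
qed

lemma alt_simps [simp]:
  "even i \<Longrightarrow> alt x y i = x" "odd i \<Longrightarrow> alt x y i = y" "alt x y (i + 2) = alt x y i"
  by (simp_all add: alt_def)

locale duals =
  fixes K0 K1 :: "'k ring" and V :: "('k, 'w) bimod"
    and W :: "int \<Rightarrow> ('k, 'w) bimod" and ev :: "int \<Rightarrow> 'w \<Rightarrow> 'w \<Rightarrow> 'k"
  assumes field_K0: "field K0" and field_K1: "field K1"
    and rank_V: "rank_two K0 K1 V"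
    and duals: "iterated_duals (alt K0 K1) V W ev"
begin

abbreviation K where "K \<equiv> alt K0 K1"

lemma field_alt: "field (K i)" using field_K0 field_K1 by (simp add: alt_def)

lemma W_bimodule: "bimodule (K i) (K (i + 1)) (W i)" "bimodule (K (i + 1)) (K i) (W (i + 1))"
proof -
  show *: "bimodule (K i) (K (i + 1)) (W i)" for i using duals by (simp add: iterated_duals_def)
  show "bimodule (K (i + 1)) (K i) (W (i + 1))" using *[of "i + 1"] by simp
qed

lemma perfect_nonneg: "0 \<le> i \<Longrightarrow> perfect (K i) (K (i + 1)) (W i) (W (i + 1)) (ev i)"
  using duals by (intro perfect_right_dual field_alt W_bimodule) (simp add: iterated_duals_def)

lemma perfect_neg:
  "i < 0 \<Longrightarrow> perfect (K i) (K (i + 1)) (op_bimod (W (i + 1))) (op_bimod (W i)) (\<lambda>v \<psi>. ev i \<psi> v)"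
  using duals by (intro perfect_left_dual field_alt W_bimodule) (simp add: iterated_duals_def)

text \<open>The induction leaves 0 in both directions; downwards the same two rank formulas are
  applied to opposite bimodules.\<close>

lemma rank_two_W: "rank_two (K i) (K (i + 1)) (W i)"
proof (induction i rule: int_induct[of _ 0])
  case base
  then show ?case using rank_V duals by (simp add: iterated_duals_def)
next
  case (step1 i)
  interpret perfect "K i" "K (i + 1)" "W i" "W (i + 1)" "ev i" by (rule perfect_nonneg[OF step1(1)])
  have "rank_two (K (i + 1)) (K i) (W (i + 1))"
    using step1(2) dim_left_dual dim_right_dual unfolding rank_two_def by blast
  then show ?case by simp
next
  case (step2 i)
  let ?j = "i - 1"
  interpret perfect "K ?j" "K (?j + 1)" "op_bimod (W (?j + 1))" "op_bimod (W ?j)" "\<lambda>v \<psi>. ev ?j \<psi> v"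
    by (rule perfect_neg) (use step2 in simp)
  have k: "K (i + 1) = K (i - 1)" by (simp add: alt_def)
  have "rank_two (K ?j) (K i) (op_bimod (W i))"
    using rank_two_op[OF W_bimodule(1) step2(2)] unfolding k .
  then have "rank_two (K i) (K ?j) (op_bimod (W ?j))"
    using dim_left_dual dim_right_dual unfolding rank_two_def by simp
  from rank_two_op[OF _ this] bimodule_op[OF W_bimodule(1)[of ?j]] show ?case by simp
qed

abbreviation pr where "pr \<equiv> \<lambda>i v \<psi>. ev i \<psi> v"

definition dual_at where
  "dual_at i x1 x2 y1 y2 \<longleftrightarrow> x1 \<in> carrier (W i) \<and> x2 \<in> carrier (W i) \<and>
    y1 \<in> carrier (W (i + 1)) \<and> y2 \<in> carrier (W (i + 1)) \<and>
    ev i y1 x1 = \<one>\<^bsub>K (i + 1)\<^esub> \<and> ev i y2 x1 = \<zero>\<^bsub>K (i + 1)\<^esub> \<and>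
    ev i y1 x2 = \<zero>\<^bsub>K (i + 1)\<^esub> \<and> ev i y2 x2 = \<one>\<^bsub>K (i + 1)\<^esub>"

lemma dual_at_exists: "\<exists>x1 x2 y1 y2. dual_at i x1 x2 y1 y2"
proof (cases "0 \<le> i")
  case True
  interpret perfect "K i" "K (i + 1)" "W i" "W (i + 1)" "ev i" by (rule perfect_nonneg[OF True])
  obtain x1 x2 where "basis2 (K (i + 1)) (right_mod (W i)) x1 x2"
    using rank_two_W[of i] RU.basis2_exists unfolding rank_two_def by blast
  then obtain y1 y2 where "dual_pair x1 x2 y1 y2" using dual_basis by blast
  then have "dual_at i x1 x2 y1 y2" by (simp add: dual_pair_def dual_at_def)
  then show ?thesis by blast
next
  case False
  then interpret perfect "K i" "K (i + 1)" "op_bimod (W (i + 1))" "op_bimod (W i)" "\<lambda>v \<psi>. ev i \<psi> v"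
    by (intro perfect_neg) simp
  have "rank_two (K i) (K (i + 1)) (op_bimod (W (i + 1)))"
    using rank_two_op[OF W_bimodule(1) rank_two_W[of "i + 1"]] by simp
  then obtain y1 y2 where "basis2 (K (i + 1)) (right_mod (op_bimod (W (i + 1)))) y1 y2"
    using RU.basis2_exists unfolding rank_two_def by blast
  then obtain x1 x2 where "dual_pair y1 y2 x1 x2" using dual_basis by blast
  then have "dual_at i x1 x2 y1 y2" by (simp add: dual_pair_def dual_at_def)
  then show ?thesis by blast
qed

lemma dual_at_expand:
  assumes D: "dual_at i x1 x2 y1 y2"
  shows "v \<in> carrier (W i) \<Longrightarrow> x1 \<triangleleft>\<^bsub>W i\<^esub> ev i y1 v \<oplus>\<^bsub>W i\<^esub> x2 \<triangleleft>\<^bsub>W i\<^esub> ev i y2 v = v"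
    and "\<psi> \<in> carrier (W (i + 1)) \<Longrightarrow>
      ev i \<psi> x1 \<odot>\<^bsub>W (i + 1)\<^esub> y1 \<oplus>\<^bsub>W (i + 1)\<^esub> ev i \<psi> x2 \<odot>\<^bsub>W (i + 1)\<^esub> y2 = \<psi>"
proof -
  have "(\<forall>v\<in>carrier (W i). x1 \<triangleleft>\<^bsub>W i\<^esub> ev i y1 v \<oplus>\<^bsub>W i\<^esub> x2 \<triangleleft>\<^bsub>W i\<^esub> ev i y2 v = v) \<and>
      (\<forall>\<psi>\<in>carrier (W (i + 1)). ev i \<psi> x1 \<odot>\<^bsub>W (i + 1)\<^esub> y1 \<oplus>\<^bsub>W (i + 1)\<^esub> ev i \<psi> x2 \<odot>\<^bsub>W (i + 1)\<^esub> y2 = \<psi>)"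
  proof (cases "0 \<le> i")
    case True
    interpret perfect "K i" "K (i + 1)" "W i" "W (i + 1)" "ev i" by (rule perfect_nonneg[OF True])
    have "dual_pair x1 x2 y1 y2"
      using rank_two_W[of i] D unfolding rank_two_def dual_at_def by (intro dual_pairI) simp_all
    then show ?thesis by (simp add: dual_pair_def)
  next
    case False
    then interpret perfect "K i" "K (i + 1)" "op_bimod (W (i + 1))" "op_bimod (W i)" "\<lambda>v \<psi>. ev i \<psi> v"
      by (intro perfect_neg) simp
    have "rank_two (K i) (K (i + 1)) (op_bimod (W (i + 1)))"
      using rank_two_op[OF W_bimodule(1) rank_two_W[of "i + 1"]] by simp
    then have "dual_pair y1 y2 x1 x2"
      using D unfolding rank_two_def dual_at_def by (intro dual_pairI) simp_all
    then show ?thesis by (simp add: dual_pair_def)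
  qed
  then show "v \<in> carrier (W i) \<Longrightarrow> x1 \<triangleleft>\<^bsub>W i\<^esub> ev i y1 v \<oplus>\<^bsub>W i\<^esub> x2 \<triangleleft>\<^bsub>W i\<^esub> ev i y2 v = v"
    "\<psi> \<in> carrier (W (i + 1)) \<Longrightarrow>
      ev i \<psi> x1 \<odot>\<^bsub>W (i + 1)\<^esub> y1 \<oplus>\<^bsub>W (i + 1)\<^esub> ev i \<psi> x2 \<odot>\<^bsub>W (i + 1)\<^esub> y2 = \<psi>"
    by blast+
qed

lemma dual_systemI:
  assumes D: "\<And>i. dual_at i (x1 i) (x2 i) (y1 i) (y2 i)"
  shows "dual_system K W pr x1 x2 y1 y2"
proof (intro dual_system.intro bimodules.intro dual_system_axioms.intro field_alt W_bimodule(1))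
  show "K (i + 2) = K i" for i by simp
  fix i
  show "x1 i \<in> carrier (W i)" "x2 i \<in> carrier (W i)" "y1 i \<in> carrier (W (i + 1))" "y2 i \<in> carrier (W (i + 1))"
    "ev i (y1 i) (x1 i) = \<one>\<^bsub>K (i + 1)\<^esub>" "ev i (y2 i) (x1 i) = \<zero>\<^bsub>K (i + 1)\<^esub>"
    "ev i (y1 i) (x2 i) = \<zero>\<^bsub>K (i + 1)\<^esub>" "ev i (y2 i) (x2 i) = \<one>\<^bsub>K (i + 1)\<^esub>"
    using D[of i] by (simp_all add: dual_at_def)
  show "x1 i \<triangleleft>\<^bsub>W i\<^esub> ev i (y1 i) v \<oplus>\<^bsub>W i\<^esub> x2 i \<triangleleft>\<^bsub>W i\<^esub> ev i (y2 i) v = v" if "v \<in> carrier (W i)" for v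
    by (rule dual_at_expand(1)[OF D that])
  show "ev i \<psi> (x1 i) \<odot>\<^bsub>W (i + 1)\<^esub> y1 i \<oplus>\<^bsub>W (i + 1)\<^esub> ev i \<psi> (x2 i) \<odot>\<^bsub>W (i + 1)\<^esub> y2 i = \<psi>"
    if "\<psi> \<in> carrier (W (i + 1))" for \<psi>
    by (rule dual_at_expand(2)[OF D that])
  have perf: "(\<psi> \<in> carrier (W (i + 1)) \<longrightarrow> v \<in> carrier (W i) \<longrightarrow> ev i \<psi> v \<in> carrier (K (i + 1)) \<and>
      (\<forall>u\<in>carrier (W i). ev i \<psi> (u \<oplus>\<^bsub>W i\<^esub> v) = ev i \<psi> u \<oplus>\<^bsub>K (i + 1)\<^esub> ev i \<psi> v) \<and>
      (\<forall>\<chi>\<in>carrier (W (i + 1)). ev i (\<psi> \<oplus>\<^bsub>W (i + 1)\<^esub> \<chi>) v = ev i \<psi> v \<oplus>\<^bsub>K (i + 1)\<^esub> ev i \<chi> v) \<and>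
      (\<forall>b\<in>carrier (K (i + 1)). ev i \<psi> (v \<triangleleft>\<^bsub>W i\<^esub> b) = ev i \<psi> v \<otimes>\<^bsub>K (i + 1)\<^esub> b \<and>
        ev i (b \<odot>\<^bsub>W (i + 1)\<^esub> \<psi>) v = b \<otimes>\<^bsub>K (i + 1)\<^esub> ev i \<psi> v) \<and>
      (\<forall>c\<in>carrier (K i). ev i \<psi> (c \<odot>\<^bsub>W i\<^esub> v) = ev i (\<psi> \<triangleleft>\<^bsub>W (i + 1)\<^esub> c) v))" for v \<psi>
  proof (cases "0 \<le> i")
    case True
    interpret perfect "K i" "K (i + 1)" "W i" "W (i + 1)" "ev i" by (rule perfect_nonneg[OF True])
    show ?thesis by (simp add: e_closed e_add e_add' e_right e_left e_mid)
  next
    case False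
    then interpret perfect "K i" "K (i + 1)" "op_bimod (W (i + 1))" "op_bimod (W i)" "\<lambda>v \<psi>. ev i \<psi> v"
      by (intro perfect_neg) simp
    show ?thesis
      using e_closed[of v \<psi>] e_add[of v \<psi>] e_add'[of _ v \<psi>] e_right[of v \<psi>] e_left[of v \<psi>]
        e_mid[of v \<psi>] by (simp add: M.m_comm)
  qed
  show "v \<in> carrier (W i) \<Longrightarrow> \<psi> \<in> carrier (W (i + 1)) \<Longrightarrow> ev i \<psi> v \<in> carrier (K (i + 1))" for v \<psi>
    using perf by blast
  show "u \<in> carrier (W i) \<Longrightarrow> v \<in> carrier (W i) \<Longrightarrow> \<psi> \<in> carrier (W (i + 1)) \<Longrightarrow>
    ev i \<psi> (u \<oplus>\<^bsub>W i\<^esub> v) = ev i \<psi> u \<oplus>\<^bsub>K (i + 1)\<^esub> ev i \<psi> v" for u v \<psi>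
    using perf[of \<psi> v] by blast
  show "v \<in> carrier (W i) \<Longrightarrow> \<psi> \<in> carrier (W (i + 1)) \<Longrightarrow> \<chi> \<in> carrier (W (i + 1)) \<Longrightarrow>
    ev i (\<psi> \<oplus>\<^bsub>W (i + 1)\<^esub> \<chi>) v = ev i \<psi> v \<oplus>\<^bsub>K (i + 1)\<^esub> ev i \<chi> v" for v \<psi> \<chi>
    using perf[of \<psi> v] by blast
  show "v \<in> carrier (W i) \<Longrightarrow> b \<in> carrier (K (i + 1)) \<Longrightarrow> \<psi> \<in> carrier (W (i + 1)) \<Longrightarrow>
    ev i \<psi> (v \<triangleleft>\<^bsub>W i\<^esub> b) = ev i \<psi> v \<otimes>\<^bsub>K (i + 1)\<^esub> b" for v b \<psi>
    using perf[of \<psi> v] by blast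
  show "v \<in> carrier (W i) \<Longrightarrow> a \<in> carrier (K (i + 1)) \<Longrightarrow> \<psi> \<in> carrier (W (i + 1)) \<Longrightarrow>
    ev i (a \<odot>\<^bsub>W (i + 1)\<^esub> \<psi>) v = a \<otimes>\<^bsub>K (i + 1)\<^esub> ev i \<psi> v" for v a \<psi>
    using perf[of \<psi> v] by blast
  show "v \<in> carrier (W i) \<Longrightarrow> c \<in> carrier (K i) \<Longrightarrow> \<psi> \<in> carrier (W (i + 1)) \<Longrightarrow>
    ev i \<psi> (c \<odot>\<^bsub>W i\<^esub> v) = ev i (\<psi> \<triangleleft>\<^bsub>W (i + 1)\<^esub> c) v" for v c \<psi>
    using perf[of \<psi> v] by blast
qed

lemma dual_system_exists: "\<exists>x1 x2 y1 y2. dual_system K W pr x1 x2 y1 y2"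
proof -
  have "\<exists>x1 x2 y1 y2. \<forall>i. dual_at i (x1 i) (x2 i) (y1 i) (y2 i)"
    using dual_at_exists by metis
  then obtain x1 x2 y1 y2 where "\<And>i. dual_at i (x1 i) (x2 i) (y1 i) (y2 i)" by blast
  then have "dual_system K W pr x1 x2 y1 y2" by (rule dual_systemI)
  then show ?thesis by blast
qed

theorem nc_symmetric_noetherian: "noetherian_zring (nc_symmetric_algebra K W ev)"
proof -
  obtain x1 x2 y1 y2 where "dual_system K W pr x1 x2 y1 y2" using dual_system_exists by blast
  then interpret dual_system K W pr x1 x2 y1 y2 .
  from nc_algebra.noetherian[OF nc_algebra_A] show ?thesis .
qed

end

section \<open>Full twisted rings and a criterion for quotients\<close>

section \<open>Quotients that are twisted rings\<close>

lemma foldr_comp_app: "foldr (\<lambda>k h. f k \<circ> h) xs g = foldr (\<lambda>k h. f k \<circ> h) xs id \<circ> g"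
  by (induction xs) (auto simp: o_assoc)

locale twisted = field E for E :: "'e ring" +
  fixes \<theta> :: "int \<Rightarrow> 'e \<Rightarrow> 'e"
  assumes theta: "\<theta> i \<in> ring_iso E E"
begin

lemma theta_bij: "bij_betw (\<theta> i) (carrier E) (carrier E)"
  using theta by (simp add: ring_iso_def)

lemma theta_closed [simp]: "a \<in> carrier E \<Longrightarrow> \<theta> i a \<in> carrier E"
  using theta_bij by (rule bij_betw_apply)

lemma theta_hom: "\<theta> i \<in> ring_hom E E"
  using theta by (simp add: ring_iso_def)

lemma theta_surj: "a \<in> carrier E \<Longrightarrow> \<exists>b\<in>carrier E. a = \<theta> i b"
  using theta_bij[of i] by (auto simp: bij_betw_def)

abbreviation "tw \<equiv> twist E \<theta>"

lemma twist_same [simp]: "tw i i b = b"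
  by (simp add: twist_def)

text \<open>One recursion that holds on both sides of the diagonal, although \<open>twist\<close> is
  defined by two formulas. The homomorphism property and the identity \<open>twist_twist\<close>,
  which is associativity, follow from it by induction on integers.\<close>

lemma twist_step:
  assumes b: "b \<in> carrier E"
  shows "tw i (j + 1) b = tw i j (\<theta> (j + 1) b)"
proof (cases "i \<le> j")
  case True
  then have "[i + 1..j + 1] = [i + 1..j] @ [j + 1]" using upto_rec2[of "i + 1" "j + 1"] by simp
  with True show ?thesis
    by (simp add: twist_def foldr_comp_app[of _ _ "\<theta> (j + 1)"])
next
  case False
  let ?v = "\<lambda>k. inv_into (carrier E) (\<theta> k)"
  have "[j + 1..i] = (j + 1) # [j + 2..i]" using False upto_rec1[of "j + 1" i] by simp
  then have "tw i j c = foldr (\<lambda>k h. ?v k \<circ> h) (rev [j + 2..i]) id (?v (j + 1) c)" for c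
    using False by (simp add: twist_def foldr_comp_app[of _ _ "?v (j + 1)"])
  moreover have "tw i (j + 1) c = foldr (\<lambda>k h. ?v k \<circ> h) (rev [j + 2..i]) id c" for c
    using False by (auto simp: twist_def)
  moreover have "?v (j + 1) (\<theta> (j + 1) b) = b"
    using b theta_bij[of "j + 1"] by (auto simp: bij_betw_def inv_into_f_f)
  ultimately show ?thesis by simp
qed

lemma twist_next: "b \<in> carrier E \<Longrightarrow> tw i (i + 1) b = \<theta> (i + 1) b"
  by (simp add: twist_step)

lemma twist_hom: "tw i j \<in> ring_hom E E"
proof (induction j rule: int_induct[of _ i])
  case base
  show ?case by (rule ring_hom_memI) simp_all
next
  case (step1 j)
  have "tw i j \<circ> \<theta> (j + 1) \<in> ring_hom E E" by (rule ring_hom_trans[OF theta_hom step1(2)])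
  then show ?case by (rule ring_hom_restrict) (simp add: twist_step)
next
  case (step2 j)
  have inv: "inv_into (carrier E) (\<theta> j) \<in> ring_hom E E"
    using ring_iso_set_sym[OF ring_axioms theta[of j]] by (simp add: ring_iso_def)
  have "tw i j \<circ> inv_into (carrier E) (\<theta> j) \<in> ring_hom E E" by (rule ring_hom_trans[OF inv step2(2)])
  then show ?case
  proof (rule ring_hom_restrict)
    fix b assume b: "b \<in> carrier E"
    obtain c where "c \<in> carrier E" "b = \<theta> j c" using theta_surj[OF b] by blast
    then show "(tw i j \<circ> inv_into (carrier E) (\<theta> j)) b = tw i (j - 1) b"
      using twist_step[of c i "j - 1"] theta_bij[of j] by (simp add: bij_betw_def inv_into_f_f)
  qed
qed

lemma twist_closed [simp]: "b \<in> carrier E \<Longrightarrow> tw i j b \<in> carrier E"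
  using twist_hom by (rule ring_hom_closed)

lemma twist_twist: "b \<in> carrier E \<Longrightarrow> tw i j (tw j l b) = tw i l b"
proof (induction l arbitrary: b rule: int_induct[of _ j])
  case base
  then show ?case by simp
next
  case (step1 l)
  then show ?case by (simp add: twist_step)
next
  case (step2 l)
  obtain c where "c \<in> carrier E" "b = \<theta> l c" using theta_surj[OF step2(3)] by blast
  with step2(2)[of c] show ?case
    using twist_step[of c j "l - 1"] twist_step[of c i "l - 1"] by simp
qed

abbreviation C where "C \<equiv> full_twisted_ring E \<theta>"

lemma C_simps [simp]:
  "carrier (comp C i j) = carrier E" "a \<otimes>\<^bsub>comp C i j\<^esub> b = a \<oplus>\<^bsub>E\<^esub> b" "\<one>\<^bsub>comp C i j\<^esub> = \<zero>\<^bsub>E\<^esub>"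
  "zmult C i j l a b = a \<otimes>\<^bsub>E\<^esub> tw i j b" "zone C i = \<one>\<^bsub>E\<^esub>"
  by (simp_all add: full_twisted_ring_def)

lemma zalgebra_C: "zalgebra C"
proof (rule zalgebra.intro)
  fix i j
  show "comm_group (comp C i j)" using a_comm_group by (simp add: full_twisted_ring_def)
  fix l m x y z x'
  assume x: "x \<in> carrier (comp C i j)" "x' \<in> carrier (comp C i j)" and y: "y \<in> carrier (comp C j l)"
  show "zmult C i j l (x \<otimes>\<^bsub>comp C i j\<^esub> x') y = zmult C i j l x y \<otimes>\<^bsub>comp C i l\<^esub> zmult C i j l x' y"
    using x y by (simp add: l_distr)
next
  fix i j l m x y z
  assume "x \<in> carrier (comp C i j)" "y \<in> carrier (comp C j l)" "z \<in> carrier (comp C l m)"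
  then show "zmult C i l m (zmult C i j l x y) z = zmult C i j m x (zmult C j l m y z)"
    by (simp add: m_assoc ring_hom_mult[OF twist_hom] twist_twist)
qed (simp_all add: r_distr ring_hom_add[OF twist_hom] ring_hom_one[OF twist_hom])

text \<open>\<open>x\<close> is congruent to the product of \<open>p\<close> and \<open>c\<close>
  modulo \<open>I\<close>, and the image of \<open>c\<close> is a nonzero field element. So
  \<open>H\<close> vanishes at \<open>x\<close> only if it vanishes at \<open>p\<close>, and the
  question passes to the degree of \<open>p\<close>.\<close>

lemma kernel_step:
  assumes A: "zalgebra A" and I: "zideal A I" and H: "zhom A C H"
    and IH: "\<And>i j x. x \<in> I i j \<Longrightarrow> H i j x = \<zero>\<^bsub>E\<^esub>"
    and x: "x \<in> carrier (comp A i l)" and p: "p \<in> carrier (comp A i j)" and c: "c \<in> carrier (comp A j l)"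
    and eq: "zproj A I i l x = zproj A I i l (zmult A i j l p c)"
    and c0: "H j l c \<noteq> \<zero>\<^bsub>E\<^esub>" and x0: "H i l x = \<zero>\<^bsub>E\<^esub>"
    and pI: "H i j p = \<zero>\<^bsub>E\<^esub> \<Longrightarrow> p \<in> I i j"
  shows "x \<in> I i l"
proof -
  interpret Q: zquotient A I using A I by (simp add: zquotient_def zquotient_axioms_def)
  obtain h where "zhom (zquot A I) C h"
    and hp: "\<And>i j x. x \<in> carrier (comp A i j) \<Longrightarrow> h i j (zproj A I i j x) = H i j x"
    using Q.lift[OF zalgebra_C H] IH by auto
  have pc: "zmult A i j l p c \<in> carrier (comp A i l)" by (rule Q.mult_closed[OF p c])
  have Hc: "H i j p \<in> carrier E" "H j l c \<in> carrier E" using zhomD(2)[OF H] p c by auto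
  have "H i j p \<otimes>\<^bsub>E\<^esub> tw i j (H j l c) = \<zero>\<^bsub>E\<^esub>"
    using hp[OF x] hp[OF pc] eq x0 zhomD(4)[OF H p c] by simp
  moreover have "tw i j (H j l c) \<noteq> \<zero>\<^bsub>E\<^esub>"
  proof
    assume z: "tw i j (H j l c) = \<zero>\<^bsub>E\<^esub>"
    have "tw j i \<zero>\<^bsub>E\<^esub> = \<zero>\<^bsub>E\<^esub>" by (rule ring_hom_zero[OF twist_hom ring_axioms ring_axioms])
    then show False using twist_twist[OF Hc(2), of j i j] c0 z by simp
  qed
  ultimately have "p \<in> I i j" using pI Hc integral by force
  then have "zmult A i j l p c \<in> I i l" using zidealD(3)[OF I] c by blast
  then show ?thesis using eq Q.proj_zero_iff[OF pc] Q.proj_zero_iff[OF x] by simp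
qed

text \<open>The hypotheses make \<open>I\<close> the kernel of \<open>H\<close>. The subring asked
  for in the definition of a twisted ring is the image of \<open>H\<close>, and \<open>surj\<close>
  says that it is full from distance \<open>d\<close> on.\<close>

theorem twisted_ring_quotient:
  assumes A: "zalgebra A" and I: "zideal A I" and H: "zhom A C H"
    and IH: "\<And>i j x. x \<in> I i j \<Longrightarrow> H i j x = \<zero>\<^bsub>E\<^esub>"
    and HI: "\<And>i j x. \<lbrakk>x \<in> carrier (comp A i j); H i j x = \<zero>\<^bsub>E\<^esub>\<rbrakk> \<Longrightarrow> x \<in> I i j"
    and surj: "\<And>i j a. \<lbrakk>int d \<le> j - i; a \<in> carrier E\<rbrakk> \<Longrightarrow> \<exists>x\<in>carrier (comp A i j). H i j x = a"
  shows "twisted_ring_on E (zquot A I)"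
proof -
  interpret Q: zquotient A I using A I by (simp add: zquotient_def zquotient_axioms_def)
  interpret C: zalgebra C by (rule zalgebra_C)
  obtain h where h: "zhom (zquot A I) C h"
    and hp: "\<And>i j x. x \<in> carrier (comp A i j) \<Longrightarrow> h i j (zproj A I i j x) = H i j x"
    using Q.lift[OF zalgebra_C H] IH by auto
  define B where "B i j = H i j ` carrier (comp A i j)" for i j
  have hB: "h i j ` carrier (comp (zquot A I) i j) = B i j" for i j
    unfolding B_def Q.carrier_quot image_image by (simp add: hp)
  have Bsub: "subgroup (B i j) (comp C i j)" for i j
  proof -
    interpret group_hom "comp A i j" "comp C i j" "H i j"
      using zhomD(1)[OF H] by unfold_locales
    show ?thesis unfolding B_def by (rule img_is_subgroup)
  qed
  have B: "zsubring C B"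
    unfolding zsubring_def
  proof (intro conjI allI ballI Bsub)
    fix i j l x y assume "x \<in> B i j" "y \<in> B j l"
    then obtain x' y' where x': "x' \<in> carrier (comp A i j)" "x = H i j x'"
      and y': "y' \<in> carrier (comp A j l)" "y = H j l y'"
      unfolding B_def by (elim imageE)
    have "zmult C i j l x y = H i l (zmult A i j l x' y')"
      unfolding x' y' by (rule zhomD(4)[OF H x'(1) y'(1), symmetric])
    then show "zmult C i j l x y \<in> B i l"
      unfolding B_def using Q.mult_closed[OF x'(1) y'(1)] by (rule image_eqI)
  next
    show "zone C i \<in> B i i" for i
      unfolding B_def using zhomD(5)[OF H, symmetric] Q.one_closed by (rule image_eqI)
  qed
  interpret Z: zalgebra "zquot A I" by (rule Q.zalgebra_quot)
  have inj: "inj_on (h i j) (carrier (comp (zquot A I) i j))" for i j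
  proof -
    interpret group_hom "comp (zquot A I) i j" "comp C i j" "h i j"
      using zhomD(1)[OF h] by unfold_locales
    have "X = \<one>\<^bsub>comp (zquot A I) i j\<^esub>" if X: "X \<in> carrier (comp (zquot A I) i j)" and z: "h i j X = \<one>\<^bsub>comp C i j\<^esub>" for X
    proof -
      obtain x where x: "x \<in> carrier (comp A i j)" "X = zproj A I i j x" using Q.quot_elem[OF X] by blast
      then have "x \<in> I i j" using HI[OF x(1)] z hp by simp
      then show ?thesis using x Q.proj_zero_iff by simp
    qed
    then show ?thesis by (simp add: inj_on_one_iff)
  qed
  have "h i j \<in> iso (comp (zquot A I) i j) (comp (zrestrict C B) i j)" for i j
    using zhomD(1)[OF h, of i j] inj[of i j] hB[of i j]
    by (auto simp: iso_def hom_def bij_betw_def zrestrict_def)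
  then have "zring_iso (zquot A I) (zrestrict C B) h"
    using zhomD(4,5)[OF h] by (simp add: zring_iso_def zrestrict_def)
  moreover have "int d \<le> j - i \<longrightarrow> B i j = carrier E" for i j
    using surj[of j i] zhomD(2)[OF H, of _ i j] unfolding B_def by auto
  ultimately show ?thesis
    using field_axioms Q.zalgebra_quot theta B unfolding twisted_ring_on_def by blast
qed

end

context nc_algebra
begin

text \<open>Surjectivity of \<open>mulT\<close>, with the last letter expanded in the left basis
  \<open>y1 n\<close>, \<open>y2 n\<close> of \<open>W (n + 1)\<close>.\<close>

lemma split_last:
  assumes "i \<le> n + 1" "x \<in> carrier (comp D i (n + 2))"
  shows "\<exists>p\<in>carrier (comp D i (n + 1)). \<exists>q\<in>carrier (comp D i (n + 1)).
    x = zmult D i (n + 1) (n + 2) p (om (n + 1) (y1 n)) \<otimes>\<^bsub>comp D i (n + 2)\<^esub>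
      zmult D i (n + 1) (n + 2) q (om (n + 1) (y2 n))"
proof -
  from mulT_surj[OF assms] obtain z where z: "z \<in> carrier (GG i n)" "x = mulT i n z" by (elim bexE)
  show ?thesis
  proof (rule bexI[of _ "fst z"], rule bexI[of _ "snd z"])
    show "fst z \<in> carrier (comp D i (n + 1))" "snd z \<in> carrier (comp D i (n + 1))"
      using z(1) by (cases z, simp)+
    show "x = zmult D i (n + 1) (n + 2) (fst z) (om (n + 1) (y1 n)) \<otimes>\<^bsub>comp D i (n + 2)\<^esub>
        zmult D i (n + 1) (n + 2) (snd z) (om (n + 1) (y2 n))"
      using z(2) by (simp only: mulT_def)
  qed
qed

lemma degree_one:
  assumes "x \<in> carrier (comp D i (i + 1))"
  shows "\<exists>v\<in>carrier (W i). x = om i v"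
proof -
  have e: "i - 1 + 1 = i" "i - 1 + 2 = i + 1" by simp_all
  obtain p q where pq: "p \<in> carrier (comp D i i)" "q \<in> carrier (comp D i i)"
    and x: "x = zmult D i i (i + 1) p (om i (y1 (i - 1))) \<otimes>\<^bsub>comp D i (i + 1)\<^esub>
      zmult D i i (i + 1) q (om i (y2 (i - 1)))"
    using split_last[of i "i - 1" x, unfolded e, OF order_refl assms] by (elim bexE)
  obtain a where a: "a \<in> carrier (K i)" "p = k i a" using diag_gen[OF pq(1)] by (elim bexE)
  obtain b where b: "b \<in> carrier (K i)" "q = k i b" using diag_gen[OF pq(2)] by (elim bexE)
  have y: "y1 (i - 1) \<in> carrier (W i)" "y2 (i - 1) \<in> carrier (W i)" using y_in[of "i - 1"] by simp_all
  show ?thesis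
    by (rule bexI[of _ "a \<odot>\<^bsub>W i\<^esub> y1 (i - 1) \<oplus>\<^bsub>W i\<^esub> b \<odot>\<^bsub>W i\<^esub> y2 (i - 1)"])
      (use a b y x in \<open>simp_all add: om_left om_add\<close>)
qed

end

section \<open>Simple bimodules: reduction modulo the family g and the map to C(F; sigma)\<close>

section \<open>Simple bimodules\<close>

locale simple_case = duals K0 K1 V W ev
  for K0 K1 :: "'k ring" and V :: "('k, 'w) bimod" and W :: "int \<Rightarrow> ('k, 'w) bimod" and ev +
  fixes F :: "'f ring" and \<iota>0 \<iota>1 :: "'k \<Rightarrow> 'f" and \<sigma>0 \<sigma>1 :: "'f \<Rightarrow> 'f" and f :: "int \<Rightarrow> 'w \<Rightarrow> 'f"
    and w0 w1 :: 'f
  assumes char: "\<one>\<^bsub>K0\<^esub> \<oplus>\<^bsub>K0\<^esub> \<one>\<^bsub>K0\<^esub> \<noteq> \<zero>\<^bsub>K0\<^esub>" "\<one>\<^bsub>K1\<^esub> \<oplus>\<^bsub>K1\<^esub> \<one>\<^bsub>K1\<^esub> \<noteq> \<zero>\<^bsub>K1\<^esub>"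
    and presentation: "simple_presentation (alt K0 K1) W ev F (alt \<iota>0 \<iota>1) (alt \<sigma>0 \<sigma>1) f"
    and roots: "admissible_roots (alt K0 K1) F (alt \<iota>0 \<iota>1) (alt w0 w1)"
begin

abbreviation \<iota> where "\<iota> \<equiv> alt \<iota>0 \<iota>1"
abbreviation \<sigma> where "\<sigma> \<equiv> alt \<sigma>0 \<sigma>1"
abbreviation w where "w \<equiv> alt w0 w1"

sublocale field F using presentation by (simp add: simple_presentation_def)

lemma iota_hom: "\<iota> i \<in> ring_hom (K i) F"
  using presentation by (simp add: simple_presentation_def)

lemmas iota_simps = ring_hom_add[OF iota_hom] ring_hom_mult[OF iota_hom] ring_hom_one[OF iota_hom]

lemma iota_closed [simp]: "a \<in> carrier (K i) \<Longrightarrow> \<iota> i a \<in> carrier F"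
  by (rule ring_hom_closed[OF iota_hom])

lemma iota_zero [simp]: "\<iota> i \<zero>\<^bsub>K i\<^esub> = \<zero>\<^bsub>F\<^esub>"
proof -
  interpret K: field "K i" by (rule field_alt)
  show ?thesis by (rule ring_hom_zero[OF iota_hom K.ring_axioms ring_axioms])
qed

lemma iota_minus: "a \<in> carrier (K i) \<Longrightarrow> \<iota> i (\<ominus>\<^bsub>K i\<^esub> a) = \<ominus>\<^bsub>F\<^esub> \<iota> i a"
proof -
  assume a: "a \<in> carrier (K i)"
  interpret K: field "K i" by (rule field_alt)
  have "\<iota> i (\<ominus>\<^bsub>K i\<^esub> a) \<oplus>\<^bsub>F\<^esub> \<iota> i a = \<zero>\<^bsub>F\<^esub>"
    using a by (simp flip: iota_simps(1) add: K.l_neg)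
  then show ?thesis using a by (intro minus_equality[symmetric]) simp_all
qed

lemma iota_eq_zero: "\<lbrakk>a \<in> carrier (K i); \<iota> i a = \<zero>\<^bsub>F\<^esub>\<rbrakk> \<Longrightarrow> a = \<zero>\<^bsub>K i\<^esub>"
proof (rule ccontr)
  interpret K: field "K i" by (rule field_alt)
  assume a: "a \<in> carrier (K i)" "\<iota> i a = \<zero>\<^bsub>F\<^esub>" "a \<noteq> \<zero>\<^bsub>K i\<^esub>"
  then have u: "a \<in> Units (K i)" by (simp add: K.field_Units)
  have "\<iota> i a \<otimes>\<^bsub>F\<^esub> \<iota> i (inv\<^bsub>K i\<^esub> a) = \<one>\<^bsub>F\<^esub>"
    using u a(1) by (simp flip: iota_simps(2) add: K.Units_r_inv iota_simps(3))
  then show False using a u by simp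
qed

lemma iota_inj: "inj_on (\<iota> i) (carrier (K i))"
proof (rule inj_onI)
  interpret K: field "K i" by (rule field_alt)
  fix a b assume ab: "a \<in> carrier (K i)" "b \<in> carrier (K i)" "\<iota> i a = \<iota> i b"
  then have "\<iota> i (a \<ominus>\<^bsub>K i\<^esub> b) = \<zero>\<^bsub>F\<^esub>" by (simp add: a_minus_def iota_simps iota_minus r_neg)
  then have "a \<ominus>\<^bsub>K i\<^esub> b = \<zero>\<^bsub>K i\<^esub>" using ab by (intro iota_eq_zero) auto
  then show "a = b" using ab by simp
qed

lemma two: "\<one>\<^bsub>F\<^esub> \<oplus>\<^bsub>F\<^esub> \<one>\<^bsub>F\<^esub> \<noteq> \<zero>\<^bsub>F\<^esub>"
proof
  interpret K: field "K 0" by (rule field_alt)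
  assume "\<one>\<^bsub>F\<^esub> \<oplus>\<^bsub>F\<^esub> \<one>\<^bsub>F\<^esub> = \<zero>\<^bsub>F\<^esub>"
  then have "\<iota> 0 (\<one>\<^bsub>K 0\<^esub> \<oplus>\<^bsub>K 0\<^esub> \<one>\<^bsub>K 0\<^esub>) = \<zero>\<^bsub>F\<^esub>" by (simp only: iota_simps K.one_closed)
  from iota_eq_zero[OF K.a_closed[OF K.one_closed K.one_closed] this] char(1) show False by simp
qed

lemma f_bij: "bij_betw (f i) (carrier (W i)) (carrier F)"
  and f_add: "\<lbrakk>u \<in> carrier (W i); v \<in> carrier (W i)\<rbrakk> \<Longrightarrow> f i (u \<oplus>\<^bsub>W i\<^esub> v) = f i u \<oplus>\<^bsub>F\<^esub> f i v"
  and f_left: "\<lbrakk>a \<in> carrier (K i); v \<in> carrier (W i)\<rbrakk> \<Longrightarrow> f i (a \<odot>\<^bsub>W i\<^esub> v) = \<iota> i a \<otimes>\<^bsub>F\<^esub> f i v"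
  and f_right: "\<lbrakk>b \<in> carrier (K (i + 1)); v \<in> carrier (W i)\<rbrakk> \<Longrightarrow>
    f i (v \<triangleleft>\<^bsub>W i\<^esub> b) = f i v \<otimes>\<^bsub>F\<^esub> \<iota> (i + 1) b"
  using presentation by (simp_all add: simple_presentation_def bimod_iso_def field_bimod_def)

lemma f_closed [simp]: "v \<in> carrier (W i) \<Longrightarrow> f i v \<in> carrier F"
  using f_bij by (rule bij_betw_apply)

definition r where "r i = inv_into (carrier (W i)) (f i)"

lemma r_closed [simp]: "u \<in> carrier F \<Longrightarrow> r i u \<in> carrier (W i)"
  and f_r [simp]: "u \<in> carrier F \<Longrightarrow> f i (r i u) = u"
  and r_f [simp]: "v \<in> carrier (W i) \<Longrightarrow> r i (f i v) = v"
  using f_bij[of i] unfolding r_def bij_betw_def by (auto intro: inv_into_into simp: f_inv_into_f inv_into_f_f)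

lemma W_left: "vectorspace (K i) (W i)"
  using W_bimodule(1)[of i] by (simp add: bimodule_def)

lemma W_closed [simp]:
  "\<lbrakk>a \<in> carrier (K i); v \<in> carrier (W i)\<rbrakk> \<Longrightarrow> a \<odot>\<^bsub>W i\<^esub> v \<in> carrier (W i)"
  "\<lbrakk>v \<in> carrier (W i); b \<in> carrier (K (i + 1))\<rbrakk> \<Longrightarrow> v \<triangleleft>\<^bsub>W i\<^esub> b \<in> carrier (W i)"
  "\<lbrakk>u \<in> carrier (W i); v \<in> carrier (W i)\<rbrakk> \<Longrightarrow> u \<oplus>\<^bsub>W i\<^esub> v \<in> carrier (W i)"
  "\<zero>\<^bsub>W i\<^esub> \<in> carrier (W i)"
proof -
  interpret L: vectorspace "K i" "W i" by (rule W_left)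
  interpret R: vectorspace "K (i + 1)" "right_mod (W i)" using W_bimodule(1)[of i] by (simp add: bimodule_def)
  show "\<lbrakk>v \<in> carrier (W i); b \<in> carrier (K (i + 1))\<rbrakk> \<Longrightarrow> v \<triangleleft>\<^bsub>W i\<^esub> b \<in> carrier (W i)"
    using R.smult_closed[of b v] by simp
qed (use vectorspace.axioms(1)[OF W_left[of i]] module.smult_closed in
    \<open>auto simp: module_def module_axioms_def abelian_group_def abelian_monoid.a_closed abelian_monoid.zero_closed\<close>)

lemma f_zero: "f i \<zero>\<^bsub>W i\<^esub> = \<zero>\<^bsub>F\<^esub>"
proof -
  interpret L: vectorspace "K i" "W i" by (rule W_left)
  have "f i \<zero>\<^bsub>W i\<^esub> \<oplus>\<^bsub>F\<^esub> f i \<zero>\<^bsub>W i\<^esub> = f i \<zero>\<^bsub>W i\<^esub>" using f_add[of "\<zero>\<^bsub>W i\<^esub>" i "\<zero>\<^bsub>W i\<^esub>"] by simp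
  then show ?thesis using add.r_cancel_one' f_closed[of "\<zero>\<^bsub>W i\<^esub>" i] W_closed(4)[of i] by metis
qed

lemma f_eq_zero: "\<lbrakk>v \<in> carrier (W i); f i v = \<zero>\<^bsub>F\<^esub>\<rbrakk> \<Longrightarrow> v = \<zero>\<^bsub>W i\<^esub>"
  using r_f[of v i] r_f[of "\<zero>\<^bsub>W i\<^esub>" i] f_zero[of i] by simp

text \<open>\<open>f i\<close> carries the left rank of \<open>W i\<close> to \<open>F\<close>, so 1
  and any element outside the subfield form a basis of \<open>F\<close> over it.\<close>

lemma decompose:
  assumes t: "t \<in> carrier F" "t \<notin> \<iota> i ` carrier (K i)" and u: "u \<in> carrier F"
  obtains a b where "a \<in> carrier (K i)" "b \<in> carrier (K i)" "u = \<iota> i a \<oplus>\<^bsub>F\<^esub> \<iota> i b \<otimes>\<^bsub>F\<^esub> t"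
proof -
  interpret L: vectorspace "K i" "W i" by (rule W_left)
  have "r i \<one>\<^bsub>F\<^esub> \<noteq> \<zero>\<^bsub>W i\<^esub>" by (metis f_r f_zero one_closed one_not_zero)
  moreover have "r i t \<noteq> a \<odot>\<^bsub>W i\<^esub> r i \<one>\<^bsub>F\<^esub>" if a: "a \<in> carrier (K i)" for a
  proof
    assume "r i t = a \<odot>\<^bsub>W i\<^esub> r i \<one>\<^bsub>F\<^esub>"
    then have "t = \<iota> i a" using f_r[OF t(1), of i] f_left[OF a, of "r i \<one>\<^bsub>F\<^esub>"] a by simp
    then show False using t a by blast
  qed
  ultimately have "basis2 (K i) (W i) (r i \<one>\<^bsub>F\<^esub>) (r i t)"
    using rank_two_W[of i] t unfolding rank_two_def by (intro L.basis2I) auto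
  then obtain a b where ab: "a \<in> carrier (K i)" "b \<in> carrier (K i)"
    "r i u = a \<odot>\<^bsub>W i\<^esub> r i \<one>\<^bsub>F\<^esub> \<oplus>\<^bsub>W i\<^esub> b \<odot>\<^bsub>W i\<^esub> r i t"
    unfolding basis2_def using r_closed[OF u, of i] by blast
  then have "u = \<iota> i a \<oplus>\<^bsub>F\<^esub> \<iota> i b \<otimes>\<^bsub>F\<^esub> t"
    using f_r[OF u, of i] t by (simp add: f_add f_left)
  with ab that show thesis by blast
qed

lemma decompose_unique:
  assumes t: "t \<in> carrier F" "t \<notin> \<iota> i ` carrier (K i)" and ab: "a \<in> carrier (K i)" "b \<in> carrier (K i)"
    and z: "\<iota> i a \<oplus>\<^bsub>F\<^esub> \<iota> i b \<otimes>\<^bsub>F\<^esub> t = \<zero>\<^bsub>F\<^esub>"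
  shows "a = \<zero>\<^bsub>K i\<^esub> \<and> b = \<zero>\<^bsub>K i\<^esub>"
proof -
  interpret K: field "K i" by (rule field_alt)
  have "b = \<zero>\<^bsub>K i\<^esub>"
  proof (rule ccontr)
    assume "b \<noteq> \<zero>\<^bsub>K i\<^esub>"
    then have u: "b \<in> Units (K i)" using ab by (simp add: K.field_Units)
    have "t = \<iota> i (inv\<^bsub>K i\<^esub> b) \<otimes>\<^bsub>F\<^esub> (\<iota> i b \<otimes>\<^bsub>F\<^esub> t)"
      using u ab t by (simp add: m_assoc[symmetric] iota_simps(2)[symmetric] K.Units_l_inv iota_simps(3))
    also have "\<iota> i b \<otimes>\<^bsub>F\<^esub> t = \<ominus>\<^bsub>F\<^esub> \<iota> i a" using z ab t by (intro minus_equality[symmetric]) (simp_all add: a_comm)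
    also have "\<iota> i (inv\<^bsub>K i\<^esub> b) \<otimes>\<^bsub>F\<^esub> \<ominus>\<^bsub>F\<^esub> \<iota> i a = \<iota> i (inv\<^bsub>K i\<^esub> b \<otimes>\<^bsub>K i\<^esub> \<ominus>\<^bsub>K i\<^esub> a)"
      using u ab by (simp add: iota_simps(2) iota_minus)
    finally have "t \<in> \<iota> i ` carrier (K i)" by (rule image_eqI) (use u ab in simp)
    then show False using t by blast
  qed
  moreover from this have "\<iota> i a = \<zero>\<^bsub>F\<^esub>" using z ab t by simp
  ultimately show ?thesis using iota_eq_zero[OF ab(1)] by blast
qed

lemma sigma_iso: "\<sigma> i \<in> ring_iso F F"
  and sigma_fix: "a \<in> carrier (K i) \<Longrightarrow> \<sigma> i (\<iota> i a) = \<iota> i a"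
  and sigma_gen: "t \<in> gal F (\<iota> i ` carrier (K i)) \<Longrightarrow> \<exists>n. \<forall>x\<in>carrier F. t x = ((\<sigma> i) ^^ n) x"
  using presentation by (simp_all add: simple_presentation_def gal_generator_def gal_def)

sublocale T: twisted F \<sigma>
  by (unfold_locales) (rule sigma_iso)

lemmas sigma_simps = ring_hom_add[OF T.theta_hom] ring_hom_mult[OF T.theta_hom] ring_hom_one[OF T.theta_hom]

lemma w_in [simp]: "w i \<in> carrier F" and w_square: "w i \<otimes>\<^bsub>F\<^esub> w i \<in> \<iota> i ` carrier (K i)"
  using roots by (simp_all add: admissible_roots_def)

lemma w_notin: "w i \<notin> \<iota> j ` carrier (K j)"
proof -
  have "w i \<notin> \<iota> 0 ` carrier (K 0) \<union> \<iota> 1 ` carrier (K 1)"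
    using roots unfolding admissible_roots_def by blast
  then show ?thesis by (cases "even j") auto
qed

lemma w_nonzero: "w i \<noteq> \<zero>\<^bsub>F\<^esub>"
proof
  interpret K: field "K i" by (rule field_alt)
  assume "w i = \<zero>\<^bsub>F\<^esub>"
  then have "w i = \<iota> i \<zero>\<^bsub>K i\<^esub>" by simp
  then show False using w_notin[of i i] K.zero_closed by blast
qed

lemma w_unit [simp]: "w i \<in> Units F"
  using w_nonzero by (simp add: field_Units)

lemma inv_w [simp]: "inv\<^bsub>F\<^esub> w i \<in> carrier F" "inv\<^bsub>F\<^esub> w i \<otimes>\<^bsub>F\<^esub> w i = \<one>\<^bsub>F\<^esub>" "w i \<otimes>\<^bsub>F\<^esub> inv\<^bsub>F\<^esub> w i = \<one>\<^bsub>F\<^esub>"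
  using w_unit[of i] by (simp_all add: Units_l_inv Units_r_inv del: w_unit)

lemma inv_w_notin: "inv\<^bsub>F\<^esub> w i \<notin> \<iota> j ` carrier (K j)"
proof
  interpret K: field "K j" by (rule field_alt)
  assume "inv\<^bsub>F\<^esub> w i \<in> \<iota> j ` carrier (K j)"
  then obtain a where a: "a \<in> carrier (K j)" "inv\<^bsub>F\<^esub> w i = \<iota> j a" by blast
  have "a \<noteq> \<zero>\<^bsub>K j\<^esub>" using a inv_w(2)[of i] by auto
  then have u: "a \<in> Units (K j)" using a by (simp add: K.field_Units)
  have "w i = \<iota> j (inv\<^bsub>K j\<^esub> a) \<otimes>\<^bsub>F\<^esub> \<iota> j a \<otimes>\<^bsub>F\<^esub> w i"
    using u a(1) by (simp add: iota_simps(2)[symmetric] K.Units_l_inv iota_simps(3))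
  also have "\<dots> = \<iota> j (inv\<^bsub>K j\<^esub> a) \<otimes>\<^bsub>F\<^esub> (inv\<^bsub>F\<^esub> w i \<otimes>\<^bsub>F\<^esub> w i)"
    unfolding a(2)[symmetric] using u by (intro m_assoc) simp_all
  also have "\<dots> = \<iota> j (inv\<^bsub>K j\<^esub> a)" using u by simp
  finally show False using w_notin[of i j] u by blast
qed

text \<open>The map a + b w -> a - b w. A generator of the Galois group could a priori be the
  identity; this automorphism shows that the group is not trivial.\<close>

lemma conjugation:
  obtains t where "t \<in> gal F (\<iota> i ` carrier (K i))" "t (w i) = \<ominus>\<^bsub>F\<^esub> w i"
proof -
  interpret K: field "K i" by (rule field_alt)
  let ?w = "w i" and ?e = "\<iota> i"
  have "\<forall>u\<in>carrier F. \<exists>ab. fst ab \<in> carrier (K i) \<and> snd ab \<in> carrier (K i) \<and> u = ?e (fst ab) \<oplus>\<^bsub>F\<^esub> ?e (snd ab) \<otimes>\<^bsub>F\<^esub> ?w"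
  proof
    fix u assume "u \<in> carrier F"
    then obtain a b where "a \<in> carrier (K i)" "b \<in> carrier (K i)" "u = ?e a \<oplus>\<^bsub>F\<^esub> ?e b \<otimes>\<^bsub>F\<^esub> ?w"
      by (rule decompose[OF w_in w_notin])
    then show "\<exists>ab. fst ab \<in> carrier (K i) \<and> snd ab \<in> carrier (K i) \<and> u = ?e (fst ab) \<oplus>\<^bsub>F\<^esub> ?e (snd ab) \<otimes>\<^bsub>F\<^esub> ?w"
      by (intro exI[of _ "(a, b)"]) simp
  qed
  from bchoice[OF this] obtain g where g: "\<And>u. u \<in> carrier F \<Longrightarrow> fst (g u) \<in> carrier (K i) \<and> snd (g u) \<in> carrier (K i) \<and>
      u = ?e (fst (g u)) \<oplus>\<^bsub>F\<^esub> ?e (snd (g u)) \<otimes>\<^bsub>F\<^esub> ?w" by blast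
  define t where "t u = ?e (fst (g u)) \<ominus>\<^bsub>F\<^esub> ?e (snd (g u)) \<otimes>\<^bsub>F\<^esub> ?w" for u
  have t_eq: "t (?e a \<oplus>\<^bsub>F\<^esub> ?e b \<otimes>\<^bsub>F\<^esub> ?w) = ?e a \<ominus>\<^bsub>F\<^esub> ?e b \<otimes>\<^bsub>F\<^esub> ?w"
    if ab: "a \<in> carrier (K i)" "b \<in> carrier (K i)" for a b
  proof -
    let ?u = "?e a \<oplus>\<^bsub>F\<^esub> ?e b \<otimes>\<^bsub>F\<^esub> ?w"
    define c d where "c = fst (g ?u)" and "d = snd (g ?u)"
    have cd: "c \<in> carrier (K i)" "d \<in> carrier (K i)" "?u = ?e c \<oplus>\<^bsub>F\<^esub> ?e d \<otimes>\<^bsub>F\<^esub> ?w"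
      using g[of ?u] ab by (simp_all add: c_def d_def)
    have "?e (a \<ominus>\<^bsub>K i\<^esub> c) \<oplus>\<^bsub>F\<^esub> ?e (b \<ominus>\<^bsub>K i\<^esub> d) \<otimes>\<^bsub>F\<^esub> ?w = ?u \<ominus>\<^bsub>F\<^esub> (?e c \<oplus>\<^bsub>F\<^esub> ?e d \<otimes>\<^bsub>F\<^esub> ?w)"
      using ab cd(1,2) by (simp add: a_minus_def iota_simps iota_minus l_distr l_minus minus_add a_ac)
    also have "\<dots> = \<zero>\<^bsub>F\<^esub>" unfolding cd(3)[symmetric] using ab by (simp add: a_minus_def r_neg)
    finally have "a \<ominus>\<^bsub>K i\<^esub> c = \<zero>\<^bsub>K i\<^esub> \<and> b \<ominus>\<^bsub>K i\<^esub> d = \<zero>\<^bsub>K i\<^esub>"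
      using ab cd by (intro decompose_unique[OF w_in w_notin]) simp_all
    then have "a = c" "b = d" using ab cd by simp_all
    then show ?thesis unfolding t_def c_def[symmetric] d_def[symmetric] by simp
  qed
  have repr: "\<exists>a\<in>carrier (K i). \<exists>b\<in>carrier (K i). u = ?e a \<oplus>\<^bsub>F\<^esub> ?e b \<otimes>\<^bsub>F\<^esub> ?w" if "u \<in> carrier F" for u
    using g[OF that] by blast
  have tc: "t u \<in> carrier F" if "u \<in> carrier F" for u
    using g[OF that] by (simp add: t_def)
  have tt: "t (t u) = u" if u: "u \<in> carrier F" for u
  proof -
    obtain a b where ab: "a \<in> carrier (K i)" "b \<in> carrier (K i)" "u = ?e a \<oplus>\<^bsub>F\<^esub> ?e b \<otimes>\<^bsub>F\<^esub> ?w"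
      using repr[OF u] by blast
    have "t u = ?e a \<oplus>\<^bsub>F\<^esub> ?e (\<ominus>\<^bsub>K i\<^esub> b) \<otimes>\<^bsub>F\<^esub> ?w"
      unfolding ab(3) t_eq[OF ab(1,2)] using ab(1,2) by (simp add: a_minus_def iota_minus l_minus)
    then have "t (t u) = ?e a \<ominus>\<^bsub>F\<^esub> ?e (\<ominus>\<^bsub>K i\<^esub> b) \<otimes>\<^bsub>F\<^esub> ?w" using ab by (simp add: t_eq)
    then show ?thesis using ab by (simp add: a_minus_def iota_minus l_minus)
  qed
  obtain c where c: "c \<in> carrier (K i)" "?w \<otimes>\<^bsub>F\<^esub> ?w = ?e c" using w_square by blast
  have sq: "?w \<otimes>\<^bsub>F\<^esub> (?w \<otimes>\<^bsub>F\<^esub> x) = ?e c \<otimes>\<^bsub>F\<^esub> x" if "x \<in> carrier F" for x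
    using that by (simp add: m_assoc[symmetric] c)
  have hom: "t \<in> ring_hom F F"
  proof (rule ring_hom_memI)
    fix u v assume "u \<in> carrier F" and "v \<in> carrier F"
    then obtain a b a' b' where ab: "a \<in> carrier (K i)" "b \<in> carrier (K i)" "a' \<in> carrier (K i)" "b' \<in> carrier (K i)"
      and u: "u = ?e a \<oplus>\<^bsub>F\<^esub> ?e b \<otimes>\<^bsub>F\<^esub> ?w" and v: "v = ?e a' \<oplus>\<^bsub>F\<^esub> ?e b' \<otimes>\<^bsub>F\<^esub> ?w"
      using repr by meson
    have "u \<oplus>\<^bsub>F\<^esub> v = ?e (a \<oplus>\<^bsub>K i\<^esub> a') \<oplus>\<^bsub>F\<^esub> ?e (b \<oplus>\<^bsub>K i\<^esub> b') \<otimes>\<^bsub>F\<^esub> ?w"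
      unfolding u v using ab by (simp add: iota_simps l_distr a_ac)
    then have "t (u \<oplus>\<^bsub>F\<^esub> v) = ?e (a \<oplus>\<^bsub>K i\<^esub> a') \<ominus>\<^bsub>F\<^esub> ?e (b \<oplus>\<^bsub>K i\<^esub> b') \<otimes>\<^bsub>F\<^esub> ?w"
      using ab by (simp add: t_eq)
    then show "t (u \<oplus>\<^bsub>F\<^esub> v) = t u \<oplus>\<^bsub>F\<^esub> t v"
      unfolding u v t_eq[OF ab(1,2)] t_eq[OF ab(3,4)]
      using ab by (simp add: a_minus_def iota_simps l_distr minus_add a_ac)
    let ?p = "a \<otimes>\<^bsub>K i\<^esub> a' \<oplus>\<^bsub>K i\<^esub> c \<otimes>\<^bsub>K i\<^esub> (b \<otimes>\<^bsub>K i\<^esub> b')" and ?q = "a \<otimes>\<^bsub>K i\<^esub> b' \<oplus>\<^bsub>K i\<^esub> b \<otimes>\<^bsub>K i\<^esub> a'"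
    have pq: "?p \<in> carrier (K i)" "?q \<in> carrier (K i)" using ab c by simp_all
    have "u \<otimes>\<^bsub>F\<^esub> v = ?e ?p \<oplus>\<^bsub>F\<^esub> ?e ?q \<otimes>\<^bsub>F\<^esub> ?w"
      unfolding u v using ab c(1) by (simp add: iota_simps l_distr r_distr a_ac m_ac c(2) sq)
    then have "t (u \<otimes>\<^bsub>F\<^esub> v) = ?e ?p \<ominus>\<^bsub>F\<^esub> ?e ?q \<otimes>\<^bsub>F\<^esub> ?w" using t_eq[OF pq] by simp
    then show "t (u \<otimes>\<^bsub>F\<^esub> v) = t u \<otimes>\<^bsub>F\<^esub> t v"
      unfolding u v t_eq[OF ab(1,2)] t_eq[OF ab(3,4)]
      using ab c(1) by (simp add: a_minus_def iota_simps l_distr r_distr l_minus r_minus minus_add a_ac m_ac c(2) sq)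
  next
    show "t \<one>\<^bsub>F\<^esub> = \<one>\<^bsub>F\<^esub>" using t_eq[of "\<one>\<^bsub>K i\<^esub>" "\<zero>\<^bsub>K i\<^esub>"] by (simp add: iota_simps a_minus_def)
  qed (rule tc)
  have "bij_betw t (carrier F) (carrier F)"
    by (rule bij_betw_byWitness[of _ t]) (auto simp: tc tt)
  moreover have "t (?e a) = ?e a" if "a \<in> carrier (K i)" for a
    using t_eq[of a "\<zero>\<^bsub>K i\<^esub>"] that by (simp add: a_minus_def)
  ultimately have "t \<in> gal F (?e ` carrier (K i))" using hom by (auto simp: gal_def ring_iso_def)
  moreover have "t ?w = \<ominus>\<^bsub>F\<^esub> ?w"
    using t_eq[of "\<zero>\<^bsub>K i\<^esub>" "\<one>\<^bsub>K i\<^esub>"] by (simp add: iota_simps a_minus_def)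
  ultimately show thesis by (rule that)
qed

text \<open>\<open>\<sigma> i\<close> fixes the square of \<open>w i\<close>, so it sends
  \<open>w i\<close> to itself or to its negative. In the first case it is the identity with all its
  powers, but one of these is the conjugation, which moves \<open>w i\<close> since 2 is not
  zero.\<close>

lemma sigma_w: "\<sigma> i (w i) = \<ominus>\<^bsub>F\<^esub> w i"
proof -
  let ?w = "w i" and ?s = "\<sigma> i (w i)"
  obtain c where c: "c \<in> carrier (K i)" "?w \<otimes>\<^bsub>F\<^esub> ?w = \<iota> i c" using w_square by blast
  have s: "?s \<in> carrier F" by simp
  have "?s \<otimes>\<^bsub>F\<^esub> ?s = \<sigma> i (?w \<otimes>\<^bsub>F\<^esub> ?w)" by (simp add: sigma_simps)
  also have "\<dots> = ?w \<otimes>\<^bsub>F\<^esub> ?w" unfolding c(2) by (rule sigma_fix[OF c(1)])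
  finally have "(?s \<ominus>\<^bsub>F\<^esub> ?w) \<otimes>\<^bsub>F\<^esub> (?s \<oplus>\<^bsub>F\<^esub> ?w) = \<zero>\<^bsub>F\<^esub>"
    using s by (simp add: a_minus_def l_distr r_distr l_minus r_minus a_ac m_comm[of ?w ?s] r_neg r_neg1)
  then consider "?s \<ominus>\<^bsub>F\<^esub> ?w = \<zero>\<^bsub>F\<^esub>" | "?s \<oplus>\<^bsub>F\<^esub> ?w = \<zero>\<^bsub>F\<^esub>" using s by (auto dest: integral)
  then show ?thesis
  proof cases
    case 1
    then have fix_w: "?s = ?w" using s by simp
    have id: "\<sigma> i u = u" if u: "u \<in> carrier F" for u
    proof -
      obtain a b where "a \<in> carrier (K i)" "b \<in> carrier (K i)" "u = \<iota> i a \<oplus>\<^bsub>F\<^esub> \<iota> i b \<otimes>\<^bsub>F\<^esub> ?w"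
        by (rule decompose[OF w_in w_notin u])
      then show ?thesis by (simp add: sigma_simps sigma_fix fix_w)
    qed
    have pow: "((\<sigma> i) ^^ n) u = u" if "u \<in> carrier F" for n u
      using that by (induction n) (simp_all add: id)
    obtain t where t: "t \<in> gal F (\<iota> i ` carrier (K i))" "t ?w = \<ominus>\<^bsub>F\<^esub> ?w" by (rule conjugation)
    have "t ?w = ?w" using sigma_gen[OF t(1)] pow by auto
    then have "\<ominus>\<^bsub>F\<^esub> ?w = ?w" using t(2) by simp
    then have "?w \<oplus>\<^bsub>F\<^esub> ?w = \<zero>\<^bsub>F\<^esub>" using r_neg[of ?w] by simp
    then have "(\<one>\<^bsub>F\<^esub> \<oplus>\<^bsub>F\<^esub> \<one>\<^bsub>F\<^esub>) \<otimes>\<^bsub>F\<^esub> ?w = \<zero>\<^bsub>F\<^esub>" by (simp add: l_distr)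
    then show ?thesis using two w_nonzero integral[of "\<one>\<^bsub>F\<^esub> \<oplus>\<^bsub>F\<^esub> \<one>\<^bsub>F\<^esub>" ?w] by auto
  next
    case 2
    then show ?thesis using s by (intro minus_equality[symmetric]) simp_all
  qed
qed

lemma sigma_inv_w: "\<sigma> i (inv\<^bsub>F\<^esub> w i) = \<ominus>\<^bsub>F\<^esub> (inv\<^bsub>F\<^esub> w i)"
proof -
  have "\<sigma> i (inv\<^bsub>F\<^esub> w i) \<otimes>\<^bsub>F\<^esub> \<sigma> i (w i) = \<one>\<^bsub>F\<^esub>"
    by (simp add: sigma_simps(2)[symmetric] sigma_simps(3))
  then have "\<one>\<^bsub>F\<^esub> = \<sigma> i (inv\<^bsub>F\<^esub> w i) \<otimes>\<^bsub>F\<^esub> \<ominus>\<^bsub>F\<^esub> w i" by (simp add: sigma_w)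
  then have "\<sigma> i (inv\<^bsub>F\<^esub> w i) \<otimes>\<^bsub>F\<^esub> \<ominus>\<^bsub>F\<^esub> w i \<otimes>\<^bsub>F\<^esub> \<ominus>\<^bsub>F\<^esub> (inv\<^bsub>F\<^esub> w i) = \<ominus>\<^bsub>F\<^esub> (inv\<^bsub>F\<^esub> w i)"
    by (metis inv_w(1) a_inv_closed l_one)
  then show ?thesis by (simp add: m_assoc l_minus r_minus)
qed

end

text \<open>Makes the calculation rules for scalars and letters available in the quotient by
  \<open>I\<close>.\<close>

lemma bimod_rep_compose:
  assumes R: "bimod_rep K W D k om" and E: "zalgebra E" and h: "zhom D E h"
  shows "bimod_rep K W E (\<lambda>i a. h i i (k i a)) (\<lambda>i v. h i (i + 1) (om i v))"
proof -
  interpret R: bimod_rep K W D k om by fact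
  show ?thesis
  proof (intro bimod_rep.intro bimod_rep_axioms.intro R.bimodules_axioms E)
    fix i
    show "h i i (k i a) \<in> carrier (comp E i i)" if "a \<in> carrier (K i)" for a
      by (rule zhomD(2)[OF h R.k_closed[OF that]])
    show "h i i (k i (a \<oplus>\<^bsub>K i\<^esub> b)) = h i i (k i a) \<otimes>\<^bsub>comp E i i\<^esub> h i i (k i b)"
      if "a \<in> carrier (K i)" "b \<in> carrier (K i)" for a b
      unfolding R.k_add[OF that] by (rule zhomD(3)[OF h R.k_closed[OF that(1)] R.k_closed[OF that(2)]])
    show "zmult E i i i (h i i (k i a)) (h i i (k i b)) = h i i (k i (a \<otimes>\<^bsub>K i\<^esub> b))"
      if "a \<in> carrier (K i)" "b \<in> carrier (K i)" for a b
      unfolding R.k_mult[OF that, symmetric]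
      by (rule zhomD(4)[OF h R.k_closed[OF that(1)] R.k_closed[OF that(2)], symmetric])
    show "h i i (k i \<one>\<^bsub>K i\<^esub>) = zone E i" unfolding R.k_one by (rule zhomD(5)[OF h])
    show "h i (i + 1) (om i v) \<in> carrier (comp E i (i + 1))" if "v \<in> carrier (W i)" for v
      by (rule zhomD(2)[OF h R.om_closed[OF that]])
    show "h i (i + 1) (om i (v \<oplus>\<^bsub>W i\<^esub> w)) = h i (i + 1) (om i v) \<otimes>\<^bsub>comp E i (i + 1)\<^esub> h i (i + 1) (om i w)"
      if "v \<in> carrier (W i)" "w \<in> carrier (W i)" for v w
      unfolding R.om_add[OF that] by (rule zhomD(3)[OF h R.om_closed[OF that(1)] R.om_closed[OF that(2)]])
    show "zmult E i i (i + 1) (h i i (k i a)) (h i (i + 1) (om i v)) = h i (i + 1) (om i (a \<odot>\<^bsub>W i\<^esub> v))"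
      if "a \<in> carrier (K i)" "v \<in> carrier (W i)" for a v
      unfolding R.om_left[OF that, symmetric]
      by (rule zhomD(4)[OF h R.k_closed[OF that(1)] R.om_closed[OF that(2)], symmetric])
    show "zmult E i (i + 1) (i + 1) (h i (i + 1) (om i v)) (h (i + 1) (i + 1) (k (i + 1) b)) =
        h i (i + 1) (om i (v \<triangleleft>\<^bsub>W i\<^esub> b))"
      if "v \<in> carrier (W i)" "b \<in> carrier (K (i + 1))" for v b
      unfolding R.om_right[OF that, symmetric]
      by (rule zhomD(4)[OF h R.om_closed[OF that(1)] R.k_closed[OF that(2)], symmetric])
  qed
qed

context simple_case
begin

text \<open>Turns the evaluation of traces into equations in \<open>F\<close> that do not mention
  the inverse of 2.\<close>

lemma half_trace_eq:
  assumes "a \<in> carrier (K i)" "u \<in> carrier F" "u \<oplus>\<^bsub>F\<^esub> \<sigma> i u = \<iota> i a \<otimes>\<^bsub>F\<^esub> (\<one>\<^bsub>F\<^esub> \<oplus>\<^bsub>F\<^esub> \<one>\<^bsub>F\<^esub>)"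
  shows "half_trace (K i) F (\<iota> i) (\<sigma> i) u = a"
proof -
  have u: "\<one>\<^bsub>F\<^esub> \<oplus>\<^bsub>F\<^esub> \<one>\<^bsub>F\<^esub> \<in> Units F" using two by (simp add: field_Units)
  have "inv\<^bsub>F\<^esub> (\<one>\<^bsub>F\<^esub> \<oplus>\<^bsub>F\<^esub> \<one>\<^bsub>F\<^esub>) \<otimes>\<^bsub>F\<^esub> (u \<oplus>\<^bsub>F\<^esub> \<sigma> i u) = inv\<^bsub>F\<^esub> (\<one>\<^bsub>F\<^esub> \<oplus>\<^bsub>F\<^esub> \<one>\<^bsub>F\<^esub>) \<otimes>\<^bsub>F\<^esub> (\<one>\<^bsub>F\<^esub> \<oplus>\<^bsub>F\<^esub> \<one>\<^bsub>F\<^esub>) \<otimes>\<^bsub>F\<^esub> \<iota> i a"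
    unfolding assms(3) m_assoc[OF Units_inv_closed[OF u] a_closed[OF one_closed one_closed] iota_closed[OF assms(1)]]
    using assms(1) by (subst m_comm) simp_all
  also have "\<dots> = \<iota> i a" unfolding Units_l_inv[OF u] using assms(1) by simp
  finally show ?thesis using iota_inj assms(1) by (simp add: half_trace_def inv_into_f_f)
qed

lemma ev_r:
  assumes "u \<in> carrier F" "u' \<in> carrier F" "a \<in> carrier (K (i + 1))"
    "u \<otimes>\<^bsub>F\<^esub> u' \<oplus>\<^bsub>F\<^esub> \<sigma> (i + 1) (u \<otimes>\<^bsub>F\<^esub> u') = \<iota> (i + 1) a \<otimes>\<^bsub>F\<^esub> (\<one>\<^bsub>F\<^esub> \<oplus>\<^bsub>F\<^esub> \<one>\<^bsub>F\<^esub>)"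
  shows "ev i (r (i + 1) u') (r i u) = a"
proof -
  have "ev i (r (i + 1) u') (r i u) = half_trace (K (i + 1)) F (\<iota> (i + 1)) (\<sigma> (i + 1)) (u \<otimes>\<^bsub>F\<^esub> u')"
    using presentation assms(1,2) unfolding simple_presentation_def by simp
  then show ?thesis using half_trace_eq[OF assms(3) _ assms(4)] assms(1,2) by simp
qed

text \<open>With w = \<open>w (i + 1)\<close>, the bases 1, w^-1 and 1, w are dual for the trace
  form over \<open>K (i + 1)\<close>, because w and its inverse have trace zero. In these bases the
  relation of the algebra reads 1 (x) 1 + w^-1 (x) w = 0, which can be combined with the generator w
  (x) 1 + 1 (x) w.\<close>

abbreviation "x1 \<equiv> \<lambda>i. r i \<one>\<^bsub>F\<^esub>"
abbreviation "x2 \<equiv> \<lambda>i. r i (inv\<^bsub>F\<^esub> w (i + 1))"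
abbreviation "y1 \<equiv> \<lambda>i. r (i + 1) \<one>\<^bsub>F\<^esub>"
abbreviation "y2 \<equiv> \<lambda>i. r (i + 1) (w (i + 1))"

lemma dual_r: "dual_at i (x1 i) (x2 i) (y1 i) (y2 i)"
proof -
  interpret K: field "K (i + 1)" by (rule field_alt)
  show ?thesis
    unfolding dual_at_def
    by (intro conjI r_closed ev_r)
      (simp_all add: sigma_simps(3) iota_simps(3) sigma_w sigma_inv_w r_neg)
qed

sublocale DS: dual_system K W pr x1 x2 y1 y2
  by (rule dual_systemI[OF dual_r])

abbreviation "A \<equiv> nc_symmetric_algebra K W ev"

sublocale NA: nc_algebra K W pr x1 x2 y1 y2 A DS.kA DS.omA
  by (rule DS.nc_algebra_A)

text \<open>Right multiplication by \<open>K (i + 1)\<close> remains untwisted in \<open>T.C\<close>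
  because \<open>\<sigma> (i + 1)\<close> fixes this field; this is what the axiom on right scalars
  demands.\<close>

lemma rep_C: "dual_rep K W pr x1 x2 y1 y2 T.C \<iota> f"
proof (intro dual_rep.intro bimod_rep.intro bimod_rep_axioms.intro dual_rep_axioms.intro DS.dual_system_axioms
    DS.bimodules_axioms T.zalgebra_C)
  show "zmult T.C i (i + 1) (i + 2) (f i (x1 i)) (f (i + 1) (y1 i)) \<otimes>\<^bsub>comp T.C i (i + 2)\<^esub>
      zmult T.C i (i + 1) (i + 2) (f i (x2 i)) (f (i + 1) (y2 i)) = \<one>\<^bsub>comp T.C i (i + 2)\<^esub>" for i
    by (simp add: T.twist_next sigma_simps(3) sigma_w r_minus r_neg)
qed (simp_all add: iota_simps f_add f_left f_right T.twist_next sigma_fix)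

abbreviation "I \<equiv> simple_ideal K W ev F f w"

definition g where
  "g i = zmult A i (i + 1) (i + 2) (DS.omA i (r i (w (i + 1)))) (DS.omA (i + 1) (r (i + 1) \<one>\<^bsub>F\<^esub>))
    \<otimes>\<^bsub>comp A i (i + 2)\<^esub>
    zmult A i (i + 1) (i + 2) (DS.omA i (r i \<one>\<^bsub>F\<^esub>)) (DS.omA (i + 1) (r (i + 1) (w (i + 1))))"

lemma simple_g_eq: "simple_g K W ev F f w i = g i"
  unfolding simple_g_def Let_def r_def[symmetric] g_def by (simp add: DS.nc_tensor2)

lemma g_closed: "g i \<in> carrier (comp A i (i + 2))"
  unfolding g_def by (intro DS.A.comp.m_closed NA.om_prod_closed r_closed) simp_all

lemma ideal_I: "zideal A I"
  unfolding simple_ideal_def by (rule zideal_zideal_gen[OF DS.A.zalgebra_axioms]) (auto simp: simple_g_eq g_closed)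

lemma g_in_I: "g i \<in> I i (i + 2)"
proof -
  have "g i \<in> (if i + 2 = i + 2 then {simple_g K W ev F f w i} else {})" by (simp add: simple_g_eq)
  then show ?thesis unfolding simple_ideal_def by (rule subsetD[OF zideal_gen_incl])
qed

sublocale Q: zquotient A I
  using DS.A.zalgebra_axioms ideal_I by (simp add: zquotient_def zquotient_axioms_def)

abbreviation "QA \<equiv> zquot A I"
abbreviation "pj \<equiv> zproj A I"

sublocale QZ: zalgebra QA by (rule Q.zalgebra_quot)

sublocale R: bimod_rep K W QA "\<lambda>i a. pj i i (DS.kA i a)" "\<lambda>i v. pj i (i + 1) (DS.omA i v)"
  by (rule bimod_rep_compose[OF DS.RA.bimod_rep_axioms Q.zalgebra_quot Q.zhom_proj])

abbreviation "ob \<equiv> \<lambda>i v. pj i (i + 1) (DS.omA i v)"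
definition oo where "oo i v u = zmult QA i (i + 1) (i + 2) (ob i v) (ob (i + 1) u)"

lemma oo_proj:
  assumes "v \<in> carrier (W i)" "u \<in> carrier (W (i + 1))"
  shows "oo i v u = pj i (i + 2) (zmult A i (i + 1) (i + 2) (DS.omA i v) (DS.omA (i + 1) u))"
  unfolding oo_def
  using Q.proj_mult[OF DS.RA.om_closed[OF assms(1)] DS.RA.om_closed'[OF assms(2), of "i + 2"]] by simp

lemma oo_g: "oo i (r i (w (i + 1))) (r (i + 1) \<one>\<^bsub>F\<^esub>) \<otimes>\<^bsub>comp QA i (i + 2)\<^esub>
    oo i (r i \<one>\<^bsub>F\<^esub>) (r (i + 1) (w (i + 1))) = \<one>\<^bsub>comp QA i (i + 2)\<^esub>"
  using g_in_I[of i] Q.proj_zero_iff[OF g_closed] unfolding g_def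
  by (simp add: oo_proj Q.proj_add[OF NA.om_prod_closed NA.om_prod_closed])

lemma oo_rel: "oo i (r i \<one>\<^bsub>F\<^esub>) (r (i + 1) \<one>\<^bsub>F\<^esub>) \<otimes>\<^bsub>comp QA i (i + 2)\<^esub>
    oo i (r i (inv\<^bsub>F\<^esub> w (i + 1))) (r (i + 1) (w (i + 1))) = \<one>\<^bsub>comp QA i (i + 2)\<^esub>"
  using arg_cong[OF NA.rel[of i], of "pj i (i + 2)"]
    zhom_one_inv(1)[OF DS.A.zalgebra_axioms Q.zalgebra_quot Q.zhom_proj, of i "i + 2"]
  by (simp add: oo_proj Q.proj_add[OF NA.om_prod_closed NA.om_prod_closed])

lemma oo_closed: "\<lbrakk>v \<in> carrier (W i); u \<in> carrier (W (i + 1))\<rbrakk> \<Longrightarrow> oo i v u \<in> carrier (comp QA i (i + 2))"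
  by (simp add: oo_proj NA.om_prod_closed)

lemma ob_closed: "u \<in> carrier (W i) \<Longrightarrow> j = i + 1 \<Longrightarrow> ob i u \<in> carrier (comp QA i j)"
  using R.om_closed by simp

lemma oo_add_left:
  assumes "v \<in> carrier (W i)" "v' \<in> carrier (W i)" "u \<in> carrier (W (i + 1))"
  shows "oo i (v \<oplus>\<^bsub>W i\<^esub> v') u = oo i v u \<otimes>\<^bsub>comp QA i (i + 2)\<^esub> oo i v' u"
  unfolding oo_def R.om_add[OF assms(1,2)]
  by (rule QZ.mult_add_left[OF R.om_closed[OF assms(1)] R.om_closed[OF assms(2)] ob_closed[OF assms(3)]]) simp

lemma oo_add_right:
  assumes "v \<in> carrier (W i)" "u \<in> carrier (W (i + 1))" "u' \<in> carrier (W (i + 1))"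
  shows "oo i v (u \<oplus>\<^bsub>W (i + 1)\<^esub> u') = oo i v u \<otimes>\<^bsub>comp QA i (i + 2)\<^esub> oo i v u'"
proof -
  have c: "ob (i + 1) u \<in> carrier (comp QA (i + 1) (i + 2))" "ob (i + 1) u' \<in> carrier (comp QA (i + 1) (i + 2))"
    by (rule ob_closed[OF assms(2)] ob_closed[OF assms(3)]; simp)+
  show ?thesis
    unfolding oo_def using R.om_add[OF assms(2,3)] QZ.mult_add_right[OF R.om_closed[OF assms(1)] c] by simp
qed

lemma oo_scale:
  assumes a: "a \<in> carrier (K i)" and v: "v \<in> carrier (W i)" and u: "u \<in> carrier (W (i + 1))"
  shows "oo i (a \<odot>\<^bsub>W i\<^esub> v) u = zmult QA i i (i + 2) (pj i i (DS.kA i a)) (oo i v u)"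
  unfolding oo_def R.om_left[OF a v, symmetric]
  by (rule QZ.mult_assoc[OF R.k_closed[OF a] R.om_closed[OF v] ob_closed[OF u]]) simp

text \<open>Modulo \<open>I\<close> the generator gives 1 (x) w = - w (x) 1, and the relation of the
  algebra gives w^-1 (x) w = - 1 (x) 1. As 1 and w^-1 span \<open>F\<close> over \<open>K i\<close>
  on the left, v (x) w = - v w (x) 1 for all v. Writing u = b + c w and moving b and c across the
  tensor sign gives the general case, because \<open>\<sigma> (i + 1)\<close> fixes b and c and
  negates w.\<close>

lemma swap:
  assumes v: "v \<in> carrier (W i)" and u: "u \<in> carrier (W (i + 1))"
  shows "oo i v u = oo i (r i (f i v \<otimes>\<^bsub>F\<^esub> \<sigma> (i + 1) (f (i + 1) u))) (r (i + 1) \<one>\<^bsub>F\<^esub>)"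
proof -
  let ?k = "i + 1"
  let ?w = "w ?k" and ?G = "comp QA i (i + 2)"
  have swap_w: "oo i v (r ?k ?w) = inv\<^bsub>?G\<^esub> oo i (r i (f i v \<otimes>\<^bsub>F\<^esub> ?w)) (r ?k \<one>\<^bsub>F\<^esub>)" if v: "v \<in> carrier (W i)" for v
  proof -
    obtain a b where ab: "a \<in> carrier (K i)" "b \<in> carrier (K i)" "f i v = \<iota> i a \<oplus>\<^bsub>F\<^esub> \<iota> i b \<otimes>\<^bsub>F\<^esub> inv\<^bsub>F\<^esub> ?w"
      by (rule decompose[OF inv_w(1) inv_w_notin f_closed[OF v]])
    let ?v = "a \<odot>\<^bsub>W i\<^esub> r i \<one>\<^bsub>F\<^esub> \<oplus>\<^bsub>W i\<^esub> b \<odot>\<^bsub>W i\<^esub> r i (inv\<^bsub>F\<^esub> ?w)"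
    let ?v' = "a \<odot>\<^bsub>W i\<^esub> r i ?w \<oplus>\<^bsub>W i\<^esub> b \<odot>\<^bsub>W i\<^esub> r i \<one>\<^bsub>F\<^esub>"
    have "f i ?v = f i v" unfolding ab(3) using ab by (simp add: f_add f_left)
    then have v_eq: "v = ?v" using r_f[OF v] r_f[of ?v i] ab by simp
    have "f i ?v' = f i v \<otimes>\<^bsub>F\<^esub> ?w" unfolding ab(3) using ab by (simp add: f_add f_left l_distr m_assoc)
    then have v'_eq: "r i (f i v \<otimes>\<^bsub>F\<^esub> ?w) = ?v'" using r_f[of ?v' i] ab by simp
    let ?p = "oo i (r i \<one>\<^bsub>F\<^esub>) (r ?k \<one>\<^bsub>F\<^esub>)" and ?q = "oo i (r i ?w) (r ?k \<one>\<^bsub>F\<^esub>)"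
    have p: "?p \<in> carrier ?G" and q: "?q \<in> carrier ?G" by (simp_all add: oo_closed)
    have e1: "oo i (r i \<one>\<^bsub>F\<^esub>) (r ?k ?w) = inv\<^bsub>?G\<^esub> ?q"
      using oo_g[of i] q by (intro QZ.comp.inv_equality[symmetric]) (simp_all add: oo_closed QZ.comp.m_comm)
    have e2: "oo i (r i (inv\<^bsub>F\<^esub> ?w)) (r ?k ?w) = inv\<^bsub>?G\<^esub> ?p"
      using oo_rel[of i] p by (intro QZ.comp.inv_equality[symmetric]) (simp_all add: oo_closed QZ.comp.m_comm)
    have ka: "pj i i (DS.kA i a) \<in> carrier (comp QA i i)" "pj i i (DS.kA i b) \<in> carrier (comp QA i i)"
      using R.k_closed ab by blast+
    have "oo i v (r ?k ?w) = oo i ?v (r ?k ?w)" using v_eq by simp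
    also have "\<dots> = zmult QA i i (i + 2) (pj i i (DS.kA i a)) (inv\<^bsub>?G\<^esub> ?q) \<otimes>\<^bsub>?G\<^esub>
        zmult QA i i (i + 2) (pj i i (DS.kA i b)) (inv\<^bsub>?G\<^esub> ?p)"
      using ab by (simp add: oo_add_left oo_scale e1 e2)
    also have "\<dots> = inv\<^bsub>?G\<^esub> (zmult QA i i (i + 2) (pj i i (DS.kA i a)) ?q \<otimes>\<^bsub>?G\<^esub>
        zmult QA i i (i + 2) (pj i i (DS.kA i b)) ?p)"
      using ka p q by (simp add: QZ.mult_inv_right QZ.comp.inv_mult QZ.mult_closed)
    also have "\<dots> = inv\<^bsub>?G\<^esub> oo i ?v' (r ?k \<one>\<^bsub>F\<^esub>)" using ab by (simp add: oo_add_left oo_scale)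
    finally show ?thesis unfolding v'_eq .
  qed
  obtain b c where bc: "b \<in> carrier (K ?k)" "c \<in> carrier (K ?k)" "f ?k u = \<iota> ?k b \<oplus>\<^bsub>F\<^esub> \<iota> ?k c \<otimes>\<^bsub>F\<^esub> ?w"
    by (rule decompose[OF w_in w_notin f_closed[OF u]])
  let ?u = "b \<odot>\<^bsub>W ?k\<^esub> r ?k \<one>\<^bsub>F\<^esub> \<oplus>\<^bsub>W ?k\<^esub> c \<odot>\<^bsub>W ?k\<^esub> r ?k ?w"
  have "f ?k ?u = f ?k u" unfolding bc(3) using bc by (simp add: f_add f_left)
  then have u_eq: "u = ?u" using r_f[OF u] r_f[of ?u ?k] bc by simp
  have bal: "oo i v (d \<odot>\<^bsub>W ?k\<^esub> z) = oo i (v \<triangleleft>\<^bsub>W i\<^esub> d) z" if "d \<in> carrier (K ?k)" "z \<in> carrier (W ?k)" for d z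
    unfolding oo_def
    using QZ.mult_assoc[OF R.om_closed[OF v] R.k_closed[OF that(1)] ob_closed[OF that(2) refl]]
      R.om_right[OF v that(1)] R.om_left[OF that] by simp
  have vb: "v \<triangleleft>\<^bsub>W i\<^esub> b \<in> carrier (W i)" and vc: "v \<triangleleft>\<^bsub>W i\<^esub> c \<in> carrier (W i)" using v bc by simp_all
  let ?z = "r i (f i (v \<triangleleft>\<^bsub>W i\<^esub> c) \<otimes>\<^bsub>F\<^esub> ?w)"
  have z: "?z \<in> carrier (W i)" using vc by simp
  have neg: "inv\<^bsub>?G\<^esub> oo i ?z (r ?k \<one>\<^bsub>F\<^esub>) = oo i (r i (\<ominus>\<^bsub>F\<^esub> f i ?z)) (r ?k \<one>\<^bsub>F\<^esub>)"
  proof (rule QZ.comp.inv_equality)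
    have "r i (\<ominus>\<^bsub>F\<^esub> f i ?z) \<oplus>\<^bsub>W i\<^esub> ?z = \<zero>\<^bsub>W i\<^esub>"
      using z f_closed[OF z] by (intro f_eq_zero) (simp_all add: f_add l_neg)
    then have "oo i (r i (\<ominus>\<^bsub>F\<^esub> f i ?z)) (r ?k \<one>\<^bsub>F\<^esub>) \<otimes>\<^bsub>?G\<^esub> oo i ?z (r ?k \<one>\<^bsub>F\<^esub>) = oo i \<zero>\<^bsub>W i\<^esub> (r ?k \<one>\<^bsub>F\<^esub>)"
      using oo_add_left[of "r i (\<ominus>\<^bsub>F\<^esub> f i ?z)" i ?z "r ?k \<one>\<^bsub>F\<^esub>"] z f_closed[OF z] by simp
    moreover have "oo i \<zero>\<^bsub>W i\<^esub> (r ?k \<one>\<^bsub>F\<^esub>) \<otimes>\<^bsub>?G\<^esub> oo i \<zero>\<^bsub>W i\<^esub> (r ?k \<one>\<^bsub>F\<^esub>) = oo i \<zero>\<^bsub>W i\<^esub> (r ?k \<one>\<^bsub>F\<^esub>)"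
      using oo_add_left[of "\<zero>\<^bsub>W i\<^esub>" i "\<zero>\<^bsub>W i\<^esub>" "r ?k \<one>\<^bsub>F\<^esub>"] by simp
    then have "oo i \<zero>\<^bsub>W i\<^esub> (r ?k \<one>\<^bsub>F\<^esub>) = \<one>\<^bsub>?G\<^esub>"
      using QZ.comp.r_cancel_one'[OF oo_closed[of "\<zero>\<^bsub>W i\<^esub>" i "r ?k \<one>\<^bsub>F\<^esub>"] oo_closed[of "\<zero>\<^bsub>W i\<^esub>" i "r ?k \<one>\<^bsub>F\<^esub>"]] by simp
    ultimately show "oo i (r i (\<ominus>\<^bsub>F\<^esub> f i ?z)) (r ?k \<one>\<^bsub>F\<^esub>) \<otimes>\<^bsub>?G\<^esub> oo i ?z (r ?k \<one>\<^bsub>F\<^esub>) = \<one>\<^bsub>?G\<^esub>" by simp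
  qed (use z f_closed[OF z] in \<open>simp_all add: oo_closed\<close>)
  have "oo i v u = oo i v ?u" using u_eq by simp
  also have "\<dots> = oo i (v \<triangleleft>\<^bsub>W i\<^esub> b) (r ?k \<one>\<^bsub>F\<^esub>) \<otimes>\<^bsub>?G\<^esub> oo i (v \<triangleleft>\<^bsub>W i\<^esub> c) (r ?k ?w)"
    using v bc by (simp add: oo_add_right bal)
  also have "\<dots> = oo i (v \<triangleleft>\<^bsub>W i\<^esub> b) (r ?k \<one>\<^bsub>F\<^esub>) \<otimes>\<^bsub>?G\<^esub> oo i (r i (\<ominus>\<^bsub>F\<^esub> f i ?z)) (r ?k \<one>\<^bsub>F\<^esub>)"
    unfolding swap_w[OF vc] neg ..
  also have "\<dots> = oo i (v \<triangleleft>\<^bsub>W i\<^esub> b \<oplus>\<^bsub>W i\<^esub> r i (\<ominus>\<^bsub>F\<^esub> f i ?z)) (r ?k \<one>\<^bsub>F\<^esub>)"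
    using vb z f_closed[OF z] by (intro oo_add_left[symmetric]) simp_all
  also have "v \<triangleleft>\<^bsub>W i\<^esub> b \<oplus>\<^bsub>W i\<^esub> r i (\<ominus>\<^bsub>F\<^esub> f i ?z) = r i (f i v \<otimes>\<^bsub>F\<^esub> \<sigma> ?k (f ?k u))" (is "?l = _")
  proof -
    have "f i ?l = f i v \<otimes>\<^bsub>F\<^esub> \<sigma> ?k (f ?k u)"
      unfolding bc(3) using v bc vb vc
      by (simp add: f_add f_right sigma_simps sigma_fix sigma_w r_distr r_minus m_assoc)
    then show ?thesis using r_f[of ?l i] vb z f_closed[OF z] by simp
  qed
  finally show ?thesis .
qed

end

context simple_case
begin

text \<open>\<open>i \<le> m\<close> leaves two letters at the end. Splitting both off in the basis
  1, w, \<open>swap\<close> turns a last letter w into 1 and changes only the letter before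
  it.\<close>

lemma reduce:
  assumes im: "i \<le> m" and x: "x \<in> carrier (comp A i (m + 2))"
  shows "\<exists>p\<in>carrier (comp A i (m + 1)).
    pj i (m + 2) x = pj i (m + 2) (zmult A i (m + 1) (m + 2) p (DS.omA (m + 1) (r (m + 1) \<one>\<^bsub>F\<^esub>)))"
proof -
  let ?o1 = "DS.omA (m + 1) (r (m + 1) \<one>\<^bsub>F\<^esub>)" and ?ow = "DS.omA (m + 1) (r (m + 1) (w (m + 1)))"
  let ?G = "comp A i (m + 1)" and ?GQ = "comp QA i (m + 2)" and ?GQ' = "comp QA i (m + 1)"
  have o: "?o1 \<in> carrier (comp A (m + 1) (m + 2))" "?ow \<in> carrier (comp A (m + 1) (m + 2))"
    using DS.RA.om_closed'[of _ "m + 1" "m + 2"] by simp_all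
  have "\<exists>p\<in>carrier ?G. \<exists>q\<in>carrier ?G.
    x = zmult A i (m + 1) (m + 2) p ?o1 \<otimes>\<^bsub>comp A i (m + 2)\<^esub> zmult A i (m + 1) (m + 2) q ?ow"
    using im by (intro NA.split_last x) simp
  then obtain p q where p: "p \<in> carrier ?G" and q: "q \<in> carrier ?G"
    and x_eq: "x = zmult A i (m + 1) (m + 2) p ?o1 \<otimes>\<^bsub>comp A i (m + 2)\<^esub> zmult A i (m + 1) (m + 2) q ?ow"
    by (elim bexE)
  have e: "m - 1 + 1 = m" "m - 1 + 2 = m + 1" by simp_all
  have "\<exists>q1\<in>carrier (comp A i m). \<exists>q2\<in>carrier (comp A i m).
      q = zmult A i m (m + 1) q1 (DS.omA m (r m \<one>\<^bsub>F\<^esub>)) \<otimes>\<^bsub>?G\<^esub> zmult A i m (m + 1) q2 (DS.omA m (r m (w m)))"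
    using NA.split_last[of i "m - 1" q, unfolded e, OF im q] .
  then obtain q1 q2 where q12: "q1 \<in> carrier (comp A i m)" "q2 \<in> carrier (comp A i m)"
    and q_eq: "q = zmult A i m (m + 1) q1 (DS.omA m (r m \<one>\<^bsub>F\<^esub>)) \<otimes>\<^bsub>?G\<^esub>
      zmult A i m (m + 1) q2 (DS.omA m (r m (w m)))"
    by (elim bexE)
  have step: "\<exists>s\<in>carrier ?G. pj i (m + 2) (zmult A i (m + 1) (m + 2) (zmult A i m (m + 1) t (DS.omA m v)) ?ow) =
      pj i (m + 2) (zmult A i (m + 1) (m + 2) s ?o1)" if t: "t \<in> carrier (comp A i m)" and v: "v \<in> carrier (W m)" for t v
  proof -
    define v' where "v' = r m (f m v \<otimes>\<^bsub>F\<^esub> \<sigma> (m + 1) (w (m + 1)))"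
    have v': "v' \<in> carrier (W m)" using v by (simp add: v'_def)
    have sw: "oo m v (r (m + 1) (w (m + 1))) = oo m v' (r (m + 1) \<one>\<^bsub>F\<^esub>)"
      using swap[OF v, of "r (m + 1) (w (m + 1))"] by (simp add: v'_def)
    have a: "pj i (m + 2) (zmult A i (m + 1) (m + 2) (zmult A i m (m + 1) t (DS.omA m z)) (DS.omA (m + 1) u)) =
        zmult QA i m (m + 2) (pj i m t) (oo m z u)" if z: "z \<in> carrier (W m)" and u: "u \<in> carrier (W (m + 1))" for z u
      unfolding oo_proj[OF z u] DS.A.mult_assoc[OF t DS.RA.om_closed[OF z] DS.RA.om_closed'[OF u, of "m + 2", simplified]]
      using NA.om_prod_closed[OF z u] by (intro Q.proj_mult[OF t, symmetric])
    show ?thesis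
    proof (rule bexI)
      show "zmult A i m (m + 1) t (DS.omA m v') \<in> carrier ?G" by (rule DS.A.mult_closed[OF t DS.RA.om_closed[OF v']])
      show "pj i (m + 2) (zmult A i (m + 1) (m + 2) (zmult A i m (m + 1) t (DS.omA m v)) ?ow) =
        pj i (m + 2) (zmult A i (m + 1) (m + 2) (zmult A i m (m + 1) t (DS.omA m v')) ?o1)"
        using v v' by (simp only: a r_closed w_in one_closed sw)
    qed
  qed
  obtain s1 where s1: "s1 \<in> carrier ?G"
    "pj i (m + 2) (zmult A i (m + 1) (m + 2) (zmult A i m (m + 1) q1 (DS.omA m (r m \<one>\<^bsub>F\<^esub>))) ?ow) =
      pj i (m + 2) (zmult A i (m + 1) (m + 2) s1 ?o1)" using step[OF q12(1), of "r m \<one>\<^bsub>F\<^esub>"] by auto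
  obtain s2 where s2: "s2 \<in> carrier ?G"
    "pj i (m + 2) (zmult A i (m + 1) (m + 2) (zmult A i m (m + 1) q2 (DS.omA m (r m (w m)))) ?ow) =
      pj i (m + 2) (zmult A i (m + 1) (m + 2) s2 ?o1)" using step[OF q12(2), of "r m (w m)"] by auto
  have c: "zmult A i m (m + 1) q1 (DS.omA m (r m \<one>\<^bsub>F\<^esub>)) \<in> carrier ?G"
    "zmult A i m (m + 1) q2 (DS.omA m (r m (w m))) \<in> carrier ?G"
    using q12 DS.RA.om_closed[of _ m] by (auto intro!: DS.A.mult_closed)
  show ?thesis
  proof (rule bexI)
    show "p \<otimes>\<^bsub>?G\<^esub> (s1 \<otimes>\<^bsub>?G\<^esub> s2) \<in> carrier ?G" using p s1 s2 by simp
    have "pj i (m + 2) x = pj i (m + 2) (zmult A i (m + 1) (m + 2) p ?o1) \<otimes>\<^bsub>?GQ\<^esub>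
        (pj i (m + 2) (zmult A i (m + 1) (m + 2) s1 ?o1) \<otimes>\<^bsub>?GQ\<^esub> pj i (m + 2) (zmult A i (m + 1) (m + 2) s2 ?o1))"
      unfolding x_eq q_eq using p c o
      by (simp add: Q.proj_add DS.A.mult_closed DS.A.mult_add_left s1 s2)
    also have "\<dots> = pj i (m + 2) (zmult A i (m + 1) (m + 2) (p \<otimes>\<^bsub>?G\<^esub> (s1 \<otimes>\<^bsub>?G\<^esub> s2)) ?o1)"
      using p s1(1) s2(1) o by (simp add: Q.proj_add[symmetric] DS.A.mult_closed DS.A.mult_add_left)
    finally show "pj i (m + 2) x = pj i (m + 2) (zmult A i (m + 1) (m + 2) (p \<otimes>\<^bsub>?G\<^esub> (s1 \<otimes>\<^bsub>?G\<^esub> s2)) ?o1)" .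
  qed
qed

theorem simple_twisted: "twisted_ring_on F (zquot A I)"
proof -
  obtain H where H: "zhom A T.C H" and Hk: "\<And>i a. a \<in> carrier (K i) \<Longrightarrow> H i i (DS.kA i a) = \<iota> i a"
    and Ho: "\<And>i v. v \<in> carrier (W i) \<Longrightarrow> H i (i + 1) (DS.omA i v) = f i v"
    using dual_rep.univ_A[OF rep_C] by blast
  have Ho2: "H (i + 1) (i + 2) (DS.omA (i + 1) v) = f (i + 1) v" if "v \<in> carrier (W (i + 1))" for i v
    using Ho[OF that] by simp
  have oc: "DS.omA (i + 1) v \<in> carrier (comp A (i + 1) (i + 2))" if "v \<in> carrier (W (i + 1))" for i v
    using DS.RA.om_closed'[OF that, of "i + 2"] by simp
  have Hg: "H i (i + 2) (g i) = \<zero>\<^bsub>F\<^esub>" for i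
  proof -
    have "H i (i + 2) (g i) = H i (i + 2) (zmult A i (i + 1) (i + 2) (DS.omA i (r i (w (i + 1)))) (DS.omA (i + 1) (r (i + 1) \<one>\<^bsub>F\<^esub>)))
      \<otimes>\<^bsub>comp T.C i (i + 2)\<^esub>
      H i (i + 2) (zmult A i (i + 1) (i + 2) (DS.omA i (r i \<one>\<^bsub>F\<^esub>)) (DS.omA (i + 1) (r (i + 1) (w (i + 1)))))"
      unfolding g_def by (rule zhomD(3)[OF H]) (simp_all add: NA.om_prod_closed)
    then show ?thesis
      using zhomD(4)[OF H DS.RA.om_closed oc]
      by (simp add: Ho Ho2 T.twist_next sigma_simps(3) sigma_w r_neg)
  qed
  have IH: "H i j x = \<zero>\<^bsub>F\<^esub>" if "x \<in> I i j" for i j x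
  proof -
    have "H i j x = \<one>\<^bsub>comp T.C i j\<^esub>"
      by (rule zideal_gen_kernel[OF DS.A.zalgebra_axioms T.zalgebra_C H _ _ that[unfolded simple_ideal_def]])
        (auto simp: simple_g_eq g_closed Hg split: if_splits)
    then show ?thesis by simp
  qed
  have one_I: "\<one>\<^bsub>comp A i j\<^esub> \<in> I i j" for i j
    by (rule subgroup.one_closed[OF zidealD(1)[OF ideal_I]])
  \<comment> \<open>The induction starts one step above the diagonal, where \<open>H\<close> is the
    bijection \<open>f i\<close> on letters; \<open>reduce\<close> supplies the step. The diagonal
    itself is settled by the injectivity of \<open>\<iota> i\<close>.\<close>
  have HI1: "x \<in> I i j" if "i + 1 \<le> j" "x \<in> carrier (comp A i j)" "H i j x = \<zero>\<^bsub>F\<^esub>" for i j x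
    using that
  proof (induction j arbitrary: x rule: int_ge_induct)
    case base
    obtain v where v: "v \<in> carrier (W i)" "x = DS.omA i v" using NA.degree_one[OF base(1)] by blast
    then have "v = \<zero>\<^bsub>W i\<^esub>" using base Ho by (intro f_eq_zero) simp_all
    then have "x \<otimes>\<^bsub>comp A i (i + 1)\<^esub> x = x" using DS.RA.om_add[OF v(1) v(1)] v by simp
    then have "x = \<one>\<^bsub>comp A i (i + 1)\<^esub>" using base(1) by simp
    then show ?case using one_I by simp
  next
    case (step j)
    define m where "m = j - 1"
    have m: "j = m + 1" "j + 1 = m + 2" "i \<le> m" using step(1) by (simp_all add: m_def)
    have x: "x \<in> carrier (comp A i (m + 2))" using step(3) m(2) by simp
    obtain p where p: "p \<in> carrier (comp A i (m + 1))"
      "pj i (m + 2) x = pj i (m + 2) (zmult A i (m + 1) (m + 2) p (DS.omA (m + 1) (r (m + 1) \<one>\<^bsub>F\<^esub>)))"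
      using reduce[OF m(3) x] by (elim bexE)
    have "x \<in> I i (m + 2)"
    proof (rule T.kernel_step[OF DS.A.zalgebra_axioms ideal_I H IH x p(1) oc p(2)])
      show "H (m + 1) (m + 2) (DS.omA (m + 1) (r (m + 1) \<one>\<^bsub>F\<^esub>)) \<noteq> \<zero>\<^bsub>F\<^esub>" by (simp add: Ho2)
      show "H i (m + 2) x = \<zero>\<^bsub>F\<^esub>" using step(4) m(2) by simp
      show "p \<in> I i (m + 1)" if "H i (m + 1) p = \<zero>\<^bsub>F\<^esub>" using step(2)[of p] p(1) that m(1) by simp
    qed simp_all
    then show ?case unfolding m(2) .
  qed
  have HI: "x \<in> I i j" if x: "x \<in> carrier (comp A i j)" and x0: "H i j x = \<zero>\<^bsub>F\<^esub>" for i j x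
  proof -
    consider "j < i" | "i = j" | "i + 1 \<le> j" by linarith
    then show ?thesis
    proof cases
      case 1
      then show ?thesis using NA.lower_zero[OF 1] x one_I by simp
    next
      case 2
      have "x \<in> carrier (comp A i i)" using x 2 by simp
      then obtain a where a: "a \<in> carrier (K i)" "x = DS.kA i a" using NA.diag_gen by blast
      then have "a = \<zero>\<^bsub>K i\<^esub>" using x0 2 Hk by (intro iota_eq_zero) simp_all
      interpret K: field "K i" by (rule field_alt)
      have "x \<otimes>\<^bsub>comp A i i\<^esub> x = x" using DS.RA.k_add[OF a(1) a(1)] a \<open>a = \<zero>\<^bsub>K i\<^esub>\<close> by simp
      then have "x = \<one>\<^bsub>comp A i i\<^esub>" using x 2 by simp
      then show ?thesis using one_I 2 by simp
    next
      case 3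
      then show ?thesis using HI1 x x0 by blast
    qed
  qed
  have surj: "\<exists>x\<in>carrier (comp A i j). H i j x = a" if "i + 1 \<le> j" "a \<in> carrier F" for i j a
    using that
  proof (induction j rule: int_ge_induct)
    case base
    then show ?case using Ho[of "r i a" i] DS.RA.om_closed[of "r i a" i] by (intro bexI[of _ "DS.omA i (r i a)"]) simp_all
  next
    case (step j)
    then obtain x where x: "x \<in> carrier (comp A i j)" "H i j x = a" by blast
    have o: "DS.omA j (r j \<one>\<^bsub>F\<^esub>) \<in> carrier (comp A j (j + 1))" by (rule DS.RA.om_closed) simp
    have "H i (j + 1) (zmult A i j (j + 1) x (DS.omA j (r j \<one>\<^bsub>F\<^esub>))) = a"
      using zhomD(4)[OF H x(1) o] x step(3) Ho[of "r j \<one>\<^bsub>F\<^esub>" j] ring_hom_one[OF T.twist_hom] by simp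
    then show ?case using DS.A.mult_closed[OF x(1) o] by blast
  qed
  show ?thesis
    by (rule T.twisted_ring_quotient[OF DS.A.zalgebra_axioms ideal_I H IH HI, of 1]) (use surj in auto)
qed

end

section \<open>Non-simple bimodules: a normal family in degree one\<close>

section \<open>Non-simple bimodules\<close>

locale nonsimple_case = duals K0 K1 V W ev
  for K0 K1 :: "'k ring" and V :: "('k, 'w) bimod" and W :: "int \<Rightarrow> ('k, 'w) bimod" and ev +
  fixes E :: "'e ring" and \<kappa>0 \<kappa>1 :: "'k \<Rightarrow> 'e" and \<sigma> \<eta> \<tau> :: "'e \<Rightarrow> 'e" and f :: "'w \<Rightarrow> 'e \<times> 'e"
    and x y :: "int \<Rightarrow> 'w"
  assumes presentation: "nonsimple_presentation K0 K1 V E \<kappa>0 \<kappa>1 \<sigma> \<eta> \<tau> f"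
    and dual_xy: "dual_bases (alt K0 K1) W ev x y"
    and f_y: "f (y 0) = (\<zero>\<^bsub>E\<^esub>, \<one>\<^bsub>E\<^esub>)"
begin

abbreviation \<kappa> where "\<kappa> \<equiv> alt \<kappa>0 \<kappa>1"

text \<open>The alternation between \<open>y\<close> and \<open>x\<close> makes
  \<open>g (i + 1)\<close> the functional that vanishes at \<open>g i\<close>: the basis dual to
  \<open>z i\<close>, \<open>g i\<close> is \<open>g (i + 1)\<close>, \<open>z (i + 1)\<close>. The
  quadratic relation then reads z_i (x) g_{i+1} + g_i (x) z_{i+1} = 0, and both terms lie in the
  ideal of the family.\<close>

definition g where "g i = (if even i then y i else x i)" for i :: int
definition z where "z i = (if even i then x i else y i)" for i :: int

lemma dual_gz: "dual_at i (z i) (g i) (g (i + 1)) (z (i + 1))"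
  using dual_xy unfolding dual_bases_def dual_at_def g_def z_def by simp

sublocale DS: dual_system K W pr z g "\<lambda>i. g (i + 1)" "\<lambda>i. z (i + 1)"
  by (rule dual_systemI[OF dual_gz])

lemma gz_in [simp]: "g i \<in> carrier (W i)" "z i \<in> carrier (W i)"
  by (rule DS.x_in)+

lemma r_zero_right [simp]: "v \<in> carrier (W i) \<Longrightarrow> v \<triangleleft>\<^bsub>W i\<^esub> \<zero>\<^bsub>K (i + 1)\<^esub> = \<zero>\<^bsub>W i\<^esub>"
  using module.smult_l_null[OF vectorspace.axioms(1)[OF DS.right_vectorspace]] by simp

lemma V_eq: "W 0 = V"
  using duals by (simp add: iterated_duals_def)

sublocale E: field E
  using presentation by (simp add: nonsimple_presentation_def)

lemma kappa_iso: "\<kappa> i \<in> ring_iso (K i) E"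
  using presentation by (simp add: nonsimple_presentation_def alt_def)

lemma kappa_hom: "\<kappa> i \<in> ring_hom (K i) E"
  and kappa_bij: "bij_betw (\<kappa> i) (carrier (K i)) (carrier E)"
  using kappa_iso by (simp_all add: ring_iso_def)

lemmas kappa_simps = ring_hom_add[OF kappa_hom] ring_hom_mult[OF kappa_hom] ring_hom_one[OF kappa_hom]

lemma kappa_closed [simp]: "a \<in> carrier (K i) \<Longrightarrow> \<kappa> i a \<in> carrier E"
  by (rule ring_hom_closed[OF kappa_hom])

lemma kappa_zero [simp]: "\<kappa> i \<zero>\<^bsub>K i\<^esub> = \<zero>\<^bsub>E\<^esub>"
  by (rule ring_hom_zero[OF kappa_hom DS.K.ring_axioms E.ring_axioms])

lemma kappa_surj: "a \<in> carrier E \<Longrightarrow> \<exists>b\<in>carrier (K i). a = \<kappa> i b"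
  using kappa_bij[of i] by (auto simp: bij_betw_def)

lemma coordinates_left:
  assumes "a \<in> carrier (K (i + 1))"
  shows "ev i (a \<odot>\<^bsub>W (i + 1)\<^esub> g (i + 1)) (z i) = a" "ev i (a \<odot>\<^bsub>W (i + 1)\<^esub> g (i + 1)) (g i) = \<zero>\<^bsub>K (i + 1)\<^esub>"
    "ev i (a \<odot>\<^bsub>W (i + 1)\<^esub> z (i + 1)) (g i) = a"
  using DS.pr_left[OF gz_in(2) assms gz_in(1)] DS.pr_left[OF gz_in(1) assms gz_in(1)]
    DS.pr_left[OF gz_in(1) assms gz_in(2)] DS.dual[of i] assms by simp_all

lemma coordinates_right:
  assumes "c \<in> carrier (K (i + 1))"
  shows "ev i (g (i + 1)) (g i \<triangleleft>\<^bsub>W i\<^esub> c) = \<zero>\<^bsub>K (i + 1)\<^esub>" "ev i (z (i + 1)) (g i \<triangleleft>\<^bsub>W i\<^esub> c) = c"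
    "ev i (g (i + 1)) (z i \<triangleleft>\<^bsub>W i\<^esub> c) = c"
  using DS.pr_right[OF gz_in(1) assms gz_in(1)] DS.pr_right[OF gz_in(1) assms gz_in(2)]
    DS.pr_right[OF gz_in(2) assms gz_in(1)] DS.dual[of i] assms by simp_all

definition normal where
  "normal i \<longleftrightarrow> (\<forall>c\<in>carrier (K (i + 1)). \<exists>a\<in>carrier (K i). g i \<triangleleft>\<^bsub>W i\<^esub> c = a \<odot>\<^bsub>W i\<^esub> g i) \<and>
    (\<forall>a\<in>carrier (K i). \<exists>c\<in>carrier (K (i + 1)). a \<odot>\<^bsub>W i\<^esub> g i = g i \<triangleleft>\<^bsub>W i\<^esub> c)"

text \<open>The second row of the matrix is (0, \<tau>), so the line through \<open>y 0\<close> is a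
  subbimodule, on which scalars change sides through \<tau>.\<close>

lemma normal_zero: "normal 0"
proof -
  let ?P = "plane_bimod E \<kappa>0 \<kappa>1 \<sigma> \<eta> \<tau>"
  have iso: "bimod_iso K0 K1 V ?P f" and tau: "bij_betw \<tau> (carrier E) (carrier E)"
    and sig: "\<sigma> \<in> ring_iso E E"
    and eta: "(\<forall>a\<in>carrier E. \<eta> a = \<zero>\<^bsub>E\<^esub>) \<or> is_derivation E \<sigma> \<eta>"
    using presentation by (auto simp: nonsimple_presentation_def ring_iso_def)
  have g0: "g 0 = y 0" "g 0 \<in> carrier V" using gz_in(1)[of 0] V_eq by (simp_all add: g_def)
  have left: "f (a \<odot>\<^bsub>V\<^esub> g 0) = (\<zero>\<^bsub>E\<^esub>, \<kappa>0 a)" if "a \<in> carrier K0" for a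
    using iso that g0 f_y kappa_closed[of a 0] by (simp add: bimod_iso_def plane_bimod_def)
  have right: "f (g 0 \<triangleleft>\<^bsub>V\<^esub> c) = (\<zero>\<^bsub>E\<^esub>, \<tau> (\<kappa>1 c))" if c: "c \<in> carrier K1" for c
  proof -
    have k: "\<kappa>1 c \<in> carrier E" using kappa_closed[of c 1] c by simp
    have "\<eta> (\<kappa>1 c) \<in> carrier E" using eta k by (auto simp: is_derivation_def)
    moreover have "\<sigma> (\<kappa>1 c) \<in> carrier E" using sig k by (auto simp: ring_iso_def ring_hom_closed)
    moreover have "\<tau> (\<kappa>1 c) \<in> carrier E" using bij_betw_apply[OF tau k] .
    ultimately show ?thesis using iso c g0 f_y by (simp add: bimod_iso_def plane_bimod_def)
  qed
  have inj: "inj_on f (carrier V)" using iso by (simp add: bimod_iso_def bij_betw_def)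
  have cl: "a \<odot>\<^bsub>V\<^esub> g 0 \<in> carrier V" if "a \<in> carrier K0" for a
    using DS.L.smult_closed[of a 0 "g 0"] that V_eq g0(2) by simp
  have cr: "g 0 \<triangleleft>\<^bsub>V\<^esub> c \<in> carrier V" if "c \<in> carrier K1" for c
    using DS.r_closed[of "g 0" 0 c] that V_eq g0(2) by simp
  have eq: "a \<odot>\<^bsub>V\<^esub> g 0 = g 0 \<triangleleft>\<^bsub>V\<^esub> c" if "a \<in> carrier K0" "c \<in> carrier K1" "\<kappa>0 a = \<tau> (\<kappa>1 c)" for a c
    using inj_onD[OF inj _ cl[OF that(1)] cr[OF that(2)]] left right that by simp
  have "\<exists>a\<in>carrier K0. g 0 \<triangleleft>\<^bsub>V\<^esub> c = a \<odot>\<^bsub>V\<^esub> g 0" if c: "c \<in> carrier K1" for c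
  proof -
    have "\<tau> (\<kappa>1 c) \<in> carrier E" using kappa_closed[of c 1] c by (intro bij_betw_apply[OF tau]) simp
    then obtain a where a: "a \<in> carrier K0" "\<tau> (\<kappa>1 c) = \<kappa>0 a" using kappa_surj[of _ 0] by auto
    show ?thesis using eq[OF a(1) c a(2)[symmetric], symmetric] a(1) by blast
  qed
  moreover have "\<exists>c\<in>carrier K1. a \<odot>\<^bsub>V\<^esub> g 0 = g 0 \<triangleleft>\<^bsub>V\<^esub> c" if a: "a \<in> carrier K0" for a
  proof -
    have "\<kappa>0 a \<in> carrier E" using kappa_closed[of a 0] a by simp
    then obtain b where b: "b \<in> carrier E" "\<kappa>0 a = \<tau> b" using tau by (auto simp: bij_betw_def)
    then obtain c where "c \<in> carrier K1" "b = \<kappa>1 c" using kappa_surj[of b 1] by auto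
    then show ?thesis using eq[of a c] a b by auto
  qed
  ultimately show ?thesis by (simp add: normal_def V_eq)
qed

text \<open>The left line through \<open>g (i + 1)\<close> is the annihilator of \<open>g i\<close>.
  Since the line through \<open>g i\<close> is a subbimodule, its annihilator is stable under right
  scalars. Conversely, in \<open>a g = z p + g q\<close> the first summand annihilates
  \<open>g i\<close> as well; evaluating it there, after moving \<open>p\<close> across
  \<open>g i\<close>, forces \<open>p = 0\<close>.\<close>

lemma normal_up:
  assumes N: "normal i"
  shows "normal (i + 1)"
proof -
  let ?k = "i + 1"
  have right: "\<exists>a\<in>carrier (K ?k). g ?k \<triangleleft>\<^bsub>W ?k\<^esub> c = a \<odot>\<^bsub>W ?k\<^esub> g ?k" if c: "c \<in> carrier (K (?k + 1))" for c
  proof -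
    have c': "c \<in> carrier (K i)" using c by simp
    have gc: "g ?k \<triangleleft>\<^bsub>W ?k\<^esub> c \<in> carrier (W ?k)" by (rule DS.r_closed[OF gz_in(1) c])
    obtain d where d: "d \<in> carrier (K ?k)" "c \<odot>\<^bsub>W i\<^esub> g i = g i \<triangleleft>\<^bsub>W i\<^esub> d"
      using N c' unfolding normal_def by blast
    have "ev i (g ?k \<triangleleft>\<^bsub>W ?k\<^esub> c) (g i) = \<zero>\<^bsub>K ?k\<^esub>"
      using DS.pr_mid[OF gz_in(1) c' gz_in(1)] coordinates_right(1)[OF d(1)] d(2) by simp
    then have "ev i (g ?k \<triangleleft>\<^bsub>W ?k\<^esub> c) (z i) \<odot>\<^bsub>W ?k\<^esub> g ?k = g ?k \<triangleleft>\<^bsub>W ?k\<^esub> c"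
      using DS.expand_right[OF gc] DS.pr_closed[OF gz_in(2) gc] by (simp add: DS.L.smult_l_null)
    then show ?thesis using DS.pr_closed[OF gz_in(2) gc] by metis
  qed
  moreover have "\<exists>c\<in>carrier (K (?k + 1)). a \<odot>\<^bsub>W ?k\<^esub> g ?k = g ?k \<triangleleft>\<^bsub>W ?k\<^esub> c" if a: "a \<in> carrier (K ?k)" for a
  proof -
    let ?v = "a \<odot>\<^bsub>W ?k\<^esub> g ?k"
    define p q where "p = ev ?k (g (?k + 1)) ?v" and "q = ev ?k (z (?k + 1)) ?v"
    have v: "?v \<in> carrier (W ?k)" using a by simp
    have p: "p \<in> carrier (K (?k + 1))" and q: "q \<in> carrier (K (?k + 1))"
      unfolding p_def q_def by (intro DS.pr_closed v gz_in)+
    have ex: "?v = z ?k \<triangleleft>\<^bsub>W ?k\<^esub> p \<oplus>\<^bsub>W ?k\<^esub> g ?k \<triangleleft>\<^bsub>W ?k\<^esub> q"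
      using DS.expand_left[OF v] unfolding p_def q_def by simp
    have gi: "ev i \<psi> (g i) = \<zero>\<^bsub>K ?k\<^esub>" if "\<exists>a\<in>carrier (K ?k). \<psi> = a \<odot>\<^bsub>W ?k\<^esub> g ?k" for \<psi>
      using that coordinates_left(2) by blast
    have zp: "z ?k \<triangleleft>\<^bsub>W ?k\<^esub> p \<in> carrier (W ?k)" and gq: "g ?k \<triangleleft>\<^bsub>W ?k\<^esub> q \<in> carrier (W ?k)"
      by (rule DS.r_closed[OF gz_in(2) p], rule DS.r_closed[OF gz_in(1) q])
    have "ev i ?v (g i) = ev i (z ?k \<triangleleft>\<^bsub>W ?k\<^esub> p) (g i) \<oplus>\<^bsub>K ?k\<^esub> ev i (g ?k \<triangleleft>\<^bsub>W ?k\<^esub> q) (g i)"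
      unfolding ex by (rule DS.pr_add_right[OF gz_in(1) zp gq])
    then have zp0: "ev i (z ?k \<triangleleft>\<^bsub>W ?k\<^esub> p) (g i) = \<zero>\<^bsub>K ?k\<^esub>"
      using gi[of ?v] gi[OF right[OF q]] a DS.pr_closed[OF gz_in(1) zp] by auto
    have p': "p \<in> carrier (K i)" using p by simp
    obtain d where d: "d \<in> carrier (K ?k)" "p \<odot>\<^bsub>W i\<^esub> g i = g i \<triangleleft>\<^bsub>W i\<^esub> d"
      using N p' unfolding normal_def by blast
    have "ev i (z ?k \<triangleleft>\<^bsub>W ?k\<^esub> p) (g i) = d"
      using DS.pr_mid[OF gz_in(1) p' gz_in(2)] d coordinates_right(2)[OF d(1)] by simp
    then have "p \<odot>\<^bsub>W i\<^esub> g i = g i \<triangleleft>\<^bsub>W i\<^esub> \<zero>\<^bsub>K ?k\<^esub>" using zp0 d by simp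
    \<comment> \<open>\<open>coordinates_left\<close> speaks of the bimodule at a successor index,
      hence \<open>i\<close> is written as \<open>i - 1 + 1\<close>.\<close>
    then have "p \<odot>\<^bsub>W (i - 1 + 1)\<^esub> g (i - 1 + 1) = \<zero>\<^bsub>K i\<^esub> \<odot>\<^bsub>W (i - 1 + 1)\<^esub> g (i - 1 + 1)"
      using r_zero_right[OF gz_in(1)] by (simp add: DS.L.smult_l_null)
    then have "p = \<zero>\<^bsub>K i\<^esub>"
      using coordinates_left(1)[of p "i - 1"] coordinates_left(1)[of "\<zero>\<^bsub>K i\<^esub>" "i - 1"] p' by simp
    then have "?v = g ?k \<triangleleft>\<^bsub>W ?k\<^esub> q"
      using ex gq r_zero_right[of "z ?k" ?k] by simp
    then show ?thesis using q by blast
  qed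
  ultimately show ?thesis unfolding normal_def by blast
qed

text \<open>The mirror image of \<open>normal_up\<close>: the right line through \<open>g i\<close>
  is the set of vectors annihilated by \<open>g (i + 1)\<close>, and this set is stable under left
  scalars because the line of \<open>g (i + 1)\<close> is a subbimodule.\<close>

lemma normal_down:
  assumes N: "normal (i + 1)"
  shows "normal i"
proof -
  let ?k = "i + 1"
  have left: "\<exists>c\<in>carrier (K ?k). a \<odot>\<^bsub>W i\<^esub> g i = g i \<triangleleft>\<^bsub>W i\<^esub> c" if a: "a \<in> carrier (K i)" for a
  proof -
    have ag: "a \<odot>\<^bsub>W i\<^esub> g i \<in> carrier (W i)" using a by simp
    obtain d where d: "d \<in> carrier (K ?k)" "g ?k \<triangleleft>\<^bsub>W ?k\<^esub> a = d \<odot>\<^bsub>W ?k\<^esub> g ?k"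
      using N a unfolding normal_def by auto
    have "ev i (g ?k) (a \<odot>\<^bsub>W i\<^esub> g i) = \<zero>\<^bsub>K ?k\<^esub>"
      using DS.pr_mid[OF gz_in(1) a gz_in(1)] coordinates_left(2)[OF d(1)] d(2) by simp
    then have "g i \<triangleleft>\<^bsub>W i\<^esub> ev i (z ?k) (a \<odot>\<^bsub>W i\<^esub> g i) = a \<odot>\<^bsub>W i\<^esub> g i"
      using DS.expand_left[OF ag] DS.pr_closed[OF ag gz_in(2)] by (simp add: r_zero_right)
    then show ?thesis using DS.pr_closed[OF ag gz_in(2)] by metis
  qed
  moreover have "\<exists>a\<in>carrier (K i). g i \<triangleleft>\<^bsub>W i\<^esub> c = a \<odot>\<^bsub>W i\<^esub> g i" if c: "c \<in> carrier (K ?k)" for c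
  proof -
    let ?v = "g i \<triangleleft>\<^bsub>W i\<^esub> c"
    have e: "i - 1 + 1 = i" by simp
    define p q where "p = ev (i - 1) ?v (z (i - 1))" and "q = ev (i - 1) ?v (g (i - 1))"
    have v: "?v \<in> carrier (W i)" using c by simp
    have p: "p \<in> carrier (K i)" and q: "q \<in> carrier (K i)"
      unfolding p_def q_def using DS.pr_closed[of _ "i - 1" ?v] v by simp_all
    have ex: "?v = p \<odot>\<^bsub>W i\<^esub> g i \<oplus>\<^bsub>W i\<^esub> q \<odot>\<^bsub>W i\<^esub> z i"
      using DS.expand_right[of ?v "i - 1"] v unfolding p_def q_def by simp
    have gi: "ev i (g ?k) \<psi> = \<zero>\<^bsub>K ?k\<^esub>" if "\<exists>c\<in>carrier (K ?k). \<psi> = g i \<triangleleft>\<^bsub>W i\<^esub> c" for \<psi>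
      using that coordinates_right(1) by blast
    have pg: "p \<odot>\<^bsub>W i\<^esub> g i \<in> carrier (W i)" and qz: "q \<odot>\<^bsub>W i\<^esub> z i \<in> carrier (W i)" using p q by simp_all
    have "ev i (g ?k) ?v = ev i (g ?k) (p \<odot>\<^bsub>W i\<^esub> g i) \<oplus>\<^bsub>K ?k\<^esub> ev i (g ?k) (q \<odot>\<^bsub>W i\<^esub> z i)"
      unfolding ex by (rule DS.pr_add_left[OF pg qz gz_in(1)])
    then have qz0: "ev i (g ?k) (q \<odot>\<^bsub>W i\<^esub> z i) = \<zero>\<^bsub>K ?k\<^esub>"
      using gi[of ?v] gi[OF left[OF p]] c DS.pr_closed[OF qz gz_in(1)] by auto
    obtain d where d: "d \<in> carrier (K ?k)" "g ?k \<triangleleft>\<^bsub>W ?k\<^esub> q = d \<odot>\<^bsub>W ?k\<^esub> g ?k"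
      using N q unfolding normal_def by auto
    have "ev i (g ?k) (q \<odot>\<^bsub>W i\<^esub> z i) = d"
      using DS.pr_mid[OF gz_in(2) q gz_in(1)] d coordinates_left(1)[OF d(1)] by simp
    then have "d = \<zero>\<^bsub>K ?k\<^esub>" using qz0 by simp
    then have "g ?k \<triangleleft>\<^bsub>W ?k\<^esub> q = \<zero>\<^bsub>W ?k\<^esub>" unfolding d(2) by (simp add: DS.L.smult_l_null)
    then have "g ?k \<triangleleft>\<^bsub>W ?k\<^esub> q = g ?k \<triangleleft>\<^bsub>W ?k\<^esub> \<zero>\<^bsub>K (?k + 1)\<^esub>"
      using r_zero_right[of "g ?k" ?k] by simp
    then have "q = \<zero>\<^bsub>K i\<^esub>"
      using coordinates_right(2)[of q ?k] coordinates_right(2)[of "\<zero>\<^bsub>K (?k + 1)\<^esub>" ?k] q by simp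
    then have "?v = p \<odot>\<^bsub>W i\<^esub> g i" using ex pg by (simp add: DS.L.smult_l_null)
    then show ?thesis using p by blast
  qed
  ultimately show ?thesis unfolding normal_def by blast
qed

lemma normal: "normal i"
proof (induction i rule: int_induct[of _ 0])
  case (step2 i)
  then show ?case using normal_down[of "i - 1"] by simp
qed (rule normal_zero, rule normal_up)

text \<open>The inverse of the automorphism by which scalars pass the normal element \<open>g i\<close>.\<close>

definition s where "s i a = ev i (z (i + 1)) (a \<odot>\<^bsub>W i\<^esub> g i)"

lemma s_closed [simp]: "a \<in> carrier (K i) \<Longrightarrow> s i a \<in> carrier (K (i + 1))"
  unfolding s_def by (intro DS.pr_closed gz_in) simp

lemma s_eq: "a \<in> carrier (K i) \<Longrightarrow> a \<odot>\<^bsub>W i\<^esub> g i = g i \<triangleleft>\<^bsub>W i\<^esub> s i a"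
  using normal[of i] coordinates_right(2) unfolding normal_def s_def by metis

lemma g_cancel:
  assumes "a \<in> carrier (K i)" "b \<in> carrier (K i)" "a \<odot>\<^bsub>W i\<^esub> g i = b \<odot>\<^bsub>W i\<^esub> g i"
  shows "a = b"
  using coordinates_left(1)[of a "i - 1"] coordinates_left(1)[of b "i - 1"] assms by simp

text \<open>The line through \<open>g i\<close> is free of rank one on both sides, so scalars cross
  \<open>g i\<close> bijectively, and the bimodule axioms make the crossing a ring
  homomorphism.\<close>

lemma s_iso: "s i \<in> ring_iso (K i) (K (i + 1))"
proof -
  have r: "s i a = c" if "c \<in> carrier (K (i + 1))" "a \<odot>\<^bsub>W i\<^esub> g i = g i \<triangleleft>\<^bsub>W i\<^esub> c" for a c
    unfolding s_def that(2) by (rule coordinates_right(2)[OF that(1)])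
  have "s i \<in> ring_hom (K i) (K (i + 1))"
  proof (rule ring_hom_memI)
    fix a b assume ab: "a \<in> carrier (K i)" "b \<in> carrier (K i)"
    show "s i (a \<otimes>\<^bsub>K i\<^esub> b) = s i a \<otimes>\<^bsub>K (i + 1)\<^esub> s i b"
    proof (rule r)
      have "(a \<otimes>\<^bsub>K i\<^esub> b) \<odot>\<^bsub>W i\<^esub> g i = a \<odot>\<^bsub>W i\<^esub> (g i \<triangleleft>\<^bsub>W i\<^esub> s i b)"
        using DS.L.smult_assoc1[OF ab gz_in(1)] s_eq[OF ab(2)] by simp
      also have "\<dots> = (g i \<triangleleft>\<^bsub>W i\<^esub> s i a) \<triangleleft>\<^bsub>W i\<^esub> s i b"
        using ab DS.lr_assoc[of a i "g i" "s i b"] by (simp add: s_eq)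
      also have "\<dots> = g i \<triangleleft>\<^bsub>W i\<^esub> (s i a \<otimes>\<^bsub>K (i + 1)\<^esub> s i b)" using ab by (intro DS.r_assoc) simp_all
      finally show "(a \<otimes>\<^bsub>K i\<^esub> b) \<odot>\<^bsub>W i\<^esub> g i = g i \<triangleleft>\<^bsub>W i\<^esub> (s i a \<otimes>\<^bsub>K (i + 1)\<^esub> s i b)" .
    qed (use ab in simp)
    show "s i (a \<oplus>\<^bsub>K i\<^esub> b) = s i a \<oplus>\<^bsub>K (i + 1)\<^esub> s i b"
    proof (rule r)
      have "(a \<oplus>\<^bsub>K i\<^esub> b) \<odot>\<^bsub>W i\<^esub> g i = g i \<triangleleft>\<^bsub>W i\<^esub> s i a \<oplus>\<^bsub>W i\<^esub> g i \<triangleleft>\<^bsub>W i\<^esub> s i b"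
        using DS.L.smult_l_distr[OF ab gz_in(1)] s_eq[OF ab(1)] s_eq[OF ab(2)] by simp
      then show "(a \<oplus>\<^bsub>K i\<^esub> b) \<odot>\<^bsub>W i\<^esub> g i = g i \<triangleleft>\<^bsub>W i\<^esub> (s i a \<oplus>\<^bsub>K (i + 1)\<^esub> s i b)"
        using ab by (simp add: DS.r_add_right)
    qed (use ab in simp)
  next
    show "s i \<one>\<^bsub>K i\<^esub> = \<one>\<^bsub>K (i + 1)\<^esub>" by (rule r) simp_all
  qed simp
  moreover have "bij_betw (s i) (carrier (K i)) (carrier (K (i + 1)))"
    unfolding bij_betw_def
  proof
    show "inj_on (s i) (carrier (K i))"
      by (rule inj_onI) (metis g_cancel s_eq)
    show "s i ` carrier (K i) = carrier (K (i + 1))"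
    proof
      show "carrier (K (i + 1)) \<subseteq> s i ` carrier (K i)"
      proof
        fix c assume c: "c \<in> carrier (K (i + 1))"
        then obtain a where "a \<in> carrier (K i)" "g i \<triangleleft>\<^bsub>W i\<^esub> c = a \<odot>\<^bsub>W i\<^esub> g i"
          using normal[of i] unfolding normal_def by blast
        then show "c \<in> s i ` carrier (K i)" using r[OF c] by (metis image_eqI)
      qed
    qed auto
  qed
  ultimately show ?thesis by (simp add: ring_iso_def)
qed

text \<open>Forced by \<open>om_right\<close>: evaluating \<open>v b\<close> at
  \<open>g (i - 1)\<close> gives the value of \<open>v\<close> at \<open>b g (i - 1)\<close>, and
  there \<open>b\<close> crosses \<open>g (i - 1)\<close> through \<open>s (i - 1)\<close>. So the
  twist at \<open>i + 1\<close> is \<open>s (i - 1)\<close>, transported to \<open>E\<close>; the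
  shift by two uses that the fields have period two.\<close>

definition \<theta> where "\<theta> i = \<kappa> (i - 1) \<circ> s (i - 2) \<circ> inv_into (carrier (K i)) (\<kappa> i)"

lemma K_back: "K (i - 2) = K i" "K (i - 2 + 1) = K (i - 1)"
  using alt_simps(3)[of K0 K1 "i - 2"] by simp_all

lemma theta_kappa: "b \<in> carrier (K i) \<Longrightarrow> \<theta> i (\<kappa> i b) = \<kappa> (i - 1) (s (i - 2) b)"
  using kappa_bij[of i] by (simp add: \<theta>_def bij_betw_def inv_into_f_f)

lemma theta_iso: "\<theta> i \<in> ring_iso E E"
proof -
  have "inv_into (carrier (K i)) (\<kappa> i) \<in> ring_iso E (K i)"
    by (rule ring_iso_set_sym[OF DS.K.ring_axioms kappa_iso])
  then show ?thesis
    unfolding \<theta>_def using ring_iso_set_trans[OF _ ring_iso_set_trans[OF s_iso[of "i - 2", unfolded K_back] kappa_iso]]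
    by blast
qed

sublocale T: twisted E \<theta>
  by unfold_locales (rule theta_iso)

text \<open>The coefficient at \<open>z i\<close> in the left basis \<open>g i\<close>,
  \<open>z i\<close>: the vector \<open>g (i - 1)\<close> pairs to 0 with \<open>g i\<close> and to
  1 with \<open>z i\<close>.\<close>

definition om where "om i v = \<kappa> i (ev (i - 1) v (g (i - 1)))"

abbreviation "A \<equiv> nc_symmetric_algebra K W ev"

sublocale NA: nc_algebra K W pr z g "\<lambda>i. g (i + 1)" "\<lambda>i. z (i + 1)" A DS.kA DS.omA
  by (rule DS.nc_algebra_A)

lemma ev_prev_closed: "v \<in> carrier (W i) \<Longrightarrow> ev (i - 1) v (g (i - 1)) \<in> carrier (K i)"
  using DS.pr_closed[of "g (i - 1)" "i - 1" v] by simp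

lemma om_gz: "om i (g i) = \<zero>\<^bsub>E\<^esub>" "om i (z i) = \<one>\<^bsub>E\<^esub>"
  using DS.dual[of "i - 1"] by (simp_all add: om_def kappa_simps(3))

lemma om_right:
  assumes v: "v \<in> carrier (W i)" and b: "b \<in> carrier (K (i + 1))"
  shows "om i (v \<triangleleft>\<^bsub>W i\<^esub> b) = om i v \<otimes>\<^bsub>E\<^esub> \<theta> (i + 1) (\<kappa> (i + 1) b)"
proof -
  let ?j = "i - 1"
  have e: "?j + 1 = i" "i + 1 - 2 = ?j" "i + 1 - 1 = i" by simp_all
  have K: "K ?j = K (i + 1)" using K_back(1)[of "i + 1"] by simp
  have b': "b \<in> carrier (K ?j)" using b unfolding K .
  have s: "s ?j b \<in> carrier (K i)" using s_closed[OF b'] by simp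
  have v': "v \<in> carrier (W (?j + 1))" using v by simp
  have "ev ?j (v \<triangleleft>\<^bsub>W i\<^esub> b) (g ?j) = ev ?j v (b \<odot>\<^bsub>W ?j\<^esub> g ?j)"
    using DS.pr_mid[OF gz_in(1) b' v'] by simp
  also have "\<dots> = ev ?j v (g ?j) \<otimes>\<^bsub>K i\<^esub> s ?j b"
    unfolding s_eq[OF b'] using DS.pr_right[OF gz_in(1) s_closed[OF b'] v'] by simp
  finally show ?thesis
    unfolding om_def theta_kappa[OF b] e using s ev_prev_closed[OF v] by (simp add: kappa_simps)
qed

lemma rep_C: "dual_rep K W pr z g (\<lambda>i. g (i + 1)) (\<lambda>i. z (i + 1)) T.C \<kappa> om"
proof (intro dual_rep.intro bimod_rep.intro bimod_rep_axioms.intro dual_rep_axioms.intro DS.dual_system_axioms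
    DS.bimodules_axioms T.zalgebra_C)
  show "om i v \<in> carrier (comp T.C i (i + 1))" if "v \<in> carrier (W i)" for i v
    using ev_prev_closed[OF that] by (simp add: om_def)
  show "om i (u \<oplus>\<^bsub>W i\<^esub> v) = om i u \<otimes>\<^bsub>comp T.C i (i + 1)\<^esub> om i v"
    if "u \<in> carrier (W i)" "v \<in> carrier (W i)" for i u v
    using DS.pr_add_right[of "g (i - 1)" "i - 1" u v] that ev_prev_closed by (simp add: om_def kappa_simps)
  show "zmult T.C i i (i + 1) (\<kappa> i a) (om i v) = om i (a \<odot>\<^bsub>W i\<^esub> v)"
    if "a \<in> carrier (K i)" "v \<in> carrier (W i)" for i a v
    using DS.pr_left[of "g (i - 1)" "i - 1" a v] that ev_prev_closed by (simp add: om_def kappa_simps)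
  show "zmult T.C i (i + 1) (i + 1) (om i v) (\<kappa> (i + 1) b) = om i (v \<triangleleft>\<^bsub>W i\<^esub> b)"
    if "v \<in> carrier (W i)" "b \<in> carrier (K (i + 1))" for i v b
    using om_right[OF that] that by (simp add: T.twist_next)
  \<comment> \<open>Each of the two terms contains the value of \<open>om\<close> at some
    \<open>g\<close>, which is zero.\<close>
  show "zmult T.C i (i + 1) (i + 2) (om i (z i)) (om (i + 1) (g (i + 1))) \<otimes>\<^bsub>comp T.C i (i + 2)\<^esub>
      zmult T.C i (i + 1) (i + 2) (om i (g i)) (om (i + 1) (z (i + 1))) = \<one>\<^bsub>comp T.C i (i + 2)\<^esub>" for i
    using ring_hom_zero[OF T.twist_hom E.ring_axioms E.ring_axioms] by (simp add: om_gz)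
qed (simp_all add: kappa_simps)

abbreviation "I \<equiv> nonsimple_ideal K W ev x y"

lemma nonsimple_g_eq: "nonsimple_g K W ev x y i = DS.omA i (g i)"
  unfolding nonsimple_g_def g_def[symmetric] by (rule DS.nc_tensor1)

lemma omA_closed: "v \<in> carrier (W i) \<Longrightarrow> DS.omA i v \<in> carrier (comp A i (i + 1))"
  by (rule DS.RA.om_closed)

lemma ideal_I: "zideal A I"
  unfolding nonsimple_ideal_def
  by (rule zideal_zideal_gen[OF DS.A.zalgebra_axioms]) (auto simp: nonsimple_g_eq omA_closed)

lemma g_in_I: "DS.omA i (g i) \<in> I i (i + 1)"
proof -
  have "DS.omA i (g i) \<in> (if i + 1 = i + 1 then {nonsimple_g K W ev x y i} else {})" by (simp add: nonsimple_g_eq)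
  then show ?thesis unfolding nonsimple_ideal_def by (rule subsetD[OF zideal_gen_incl])
qed

text \<open>With the last letter expanded in \<open>g j\<close>, \<open>z j\<close>, the part ending
  in \<open>g j\<close> already lies in the ideal.\<close>

lemma reduce:
  assumes ij: "i \<le> j" and X: "X \<in> carrier (comp A i (j + 1))"
  shows "\<exists>p\<in>carrier (comp A i j). zproj A I i (j + 1) X = zproj A I i (j + 1) (zmult A i j (j + 1) p (DS.omA j (z j)))"
proof -
  interpret Q: zquotient A I
    using DS.A.zalgebra_axioms ideal_I by (simp add: zquotient_def zquotient_axioms_def)
  have e: "j - 1 + 1 = j" "j - 1 + 2 = j + 1" by simp_all
  let ?G = "comp A i (j + 1)"
  have "\<exists>p\<in>carrier (comp A i j). \<exists>q\<in>carrier (comp A i j).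
      X = zmult A i j (j + 1) p (DS.omA j (g j)) \<otimes>\<^bsub>?G\<^esub> zmult A i j (j + 1) q (DS.omA j (z j))"
    using NA.split_last[of i "j - 1" X, unfolded e, OF ij X] .
  then obtain p q where pq: "p \<in> carrier (comp A i j)" "q \<in> carrier (comp A i j)"
    and x_eq: "X = zmult A i j (j + 1) p (DS.omA j (g j)) \<otimes>\<^bsub>?G\<^esub> zmult A i j (j + 1) q (DS.omA j (z j))"
    by (elim bexE)
  let ?a = "zmult A i j (j + 1) p (DS.omA j (g j))" and ?b = "zmult A i j (j + 1) q (DS.omA j (z j))"
  have c: "?a \<in> carrier ?G" "?b \<in> carrier ?G"
    by (rule DS.A.mult_closed[OF pq(1) omA_closed[OF gz_in(1)]], rule DS.A.mult_closed[OF pq(2) omA_closed[OF gz_in(2)]])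
  have "?a \<in> I i (j + 1)" by (rule zidealD(4)[OF ideal_I pq(1) g_in_I])
  then have "?a \<otimes>\<^bsub>?G\<^esub> ?b \<otimes>\<^bsub>?G\<^esub> inv\<^bsub>?G\<^esub> ?b \<in> I i (j + 1)" using c by (simp add: DS.A.comp.m_assoc)
  then have "zproj A I i (j + 1) X = zproj A I i (j + 1) ?b"
    unfolding x_eq using Q.proj_eq_iff[OF DS.A.comp.m_closed[OF c] c(2)] by blast
  then show ?thesis using pq(2) by blast
qed

theorem nonsimple_twisted: "twisted_ring_on E (zquot A I)"
proof -
  obtain H where H: "zhom A T.C H" and Hk: "\<And>i a. a \<in> carrier (K i) \<Longrightarrow> H i i (DS.kA i a) = \<kappa> i a"
    and Ho: "\<And>i v. v \<in> carrier (W i) \<Longrightarrow> H i (i + 1) (DS.omA i v) = om i v"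
    using dual_rep.univ_A[OF rep_C] by blast
  have IH: "H i j x = \<zero>\<^bsub>E\<^esub>" if "x \<in> I i j" for i j x
  proof -
    have "H i j x = \<one>\<^bsub>comp T.C i j\<^esub>"
      by (rule zideal_gen_kernel[OF DS.A.zalgebra_axioms T.zalgebra_C H _ _ that[unfolded nonsimple_ideal_def]])
        (auto simp: nonsimple_g_eq omA_closed Ho om_gz split: if_splits)
    then show ?thesis by simp
  qed
  have one_I: "\<one>\<^bsub>comp A i j\<^esub> \<in> I i j" for i j
    by (rule subgroup.one_closed[OF zidealD(1)[OF ideal_I]])
  have HI1: "x \<in> I i j" if "i \<le> j" "x \<in> carrier (comp A i j)" "H i j x = \<zero>\<^bsub>E\<^esub>" for i j x
    using that
  proof (induction j arbitrary: x rule: int_ge_induct)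
    case base
    obtain a where a: "a \<in> carrier (K i)" "x = DS.kA i a" using NA.diag_gen[OF base(1)] by blast
    then have "\<kappa> i a = \<kappa> i \<zero>\<^bsub>K i\<^esub>" using base(2) Hk by simp
    then have a0: "a = \<zero>\<^bsub>K i\<^esub>"
      using inj_onD[OF bij_betw_imp_inj_on[OF kappa_bij]] a(1) DS.K.zero_closed by blast
    have "x \<otimes>\<^bsub>comp A i i\<^esub> x = x" using DS.RA.k_add[OF a(1) a(1)] a a0 by simp
    then have "x = \<one>\<^bsub>comp A i i\<^esub>" using base(1) by simp
    then show ?case using one_I by simp
  next
    case (step j)
    obtain p where p: "p \<in> carrier (comp A i j)"
      "zproj A I i (j + 1) x = zproj A I i (j + 1) (zmult A i j (j + 1) p (DS.omA j (z j)))"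
      using reduce[OF step(1,3)] by (elim bexE)
    show ?case
      by (rule T.kernel_step[OF DS.A.zalgebra_axioms ideal_I H IH step(3) p(1) omA_closed[OF gz_in(2)] p(2) _ step(4)
            step(2)[OF p(1)]]) (simp_all add: Ho om_gz)
  qed
  have HI: "x \<in> I i j" if x: "x \<in> carrier (comp A i j)" and x0: "H i j x = \<zero>\<^bsub>E\<^esub>" for i j x
  proof (cases "j < i")
    case True
    then show ?thesis using NA.lower_zero[OF True] x one_I by simp
  next
    case False
    then show ?thesis using HI1 x x0 by simp
  qed
  have surj: "\<exists>x\<in>carrier (comp A i j). H i j x = a" if "i \<le> j" "a \<in> carrier E" for i j a
    using that
  proof (induction j rule: int_ge_induct)
    case base
    then obtain b where "b \<in> carrier (K i)" "a = \<kappa> i b" using kappa_surj by blast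
    then show ?case using Hk DS.RA.k_closed by blast
  next
    case (step j)
    then obtain x where x: "x \<in> carrier (comp A i j)" "H i j x = a" by blast
    have o: "DS.omA j (z j) \<in> carrier (comp A j (j + 1))" by (rule omA_closed) simp
    have "H i (j + 1) (zmult A i j (j + 1) x (DS.omA j (z j))) = a"
      using zhomD(4)[OF H x(1) o] x step(3) ring_hom_one[OF T.twist_hom] by (simp add: Ho om_gz)
    then show ?case using DS.A.mult_closed[OF x(1) o] by blast
  qed
  show ?thesis
    \<comment> \<open>The distance is 0: \<open>\<kappa> i\<close> maps the diagonal component onto
      all of \<open>E\<close>.\<close>
    by (rule T.twisted_ring_quotient[OF DS.A.zalgebra_axioms ideal_I H IH HI, of 0]) (use surj in auto)
qed

end

section \<open>Twisted quotients in the two cases, together with noetherianity\<close>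

theorem theorem5p2:
  fixes K0 K1 :: "'k ring" and V :: "('k, 'w) bimod"
    and W :: "int \<Rightarrow> ('k, 'w) bimod" and ev :: "int \<Rightarrow> 'w \<Rightarrow> 'w \<Rightarrow> 'k"
  assumes "field K0" and "field K1"
    and "\<one>\<^bsub>K0\<^esub> \<oplus>\<^bsub>K0\<^esub> \<one>\<^bsub>K0\<^esub> \<noteq> \<zero>\<^bsub>K0\<^esub>" and "\<one>\<^bsub>K1\<^esub> \<oplus>\<^bsub>K1\<^esub> \<one>\<^bsub>K1\<^esub> \<noteq> \<zero>\<^bsub>K1\<^esub>"
    and "bimodule K0 K1 V" and "rank_two K0 K1 V"
    and "iterated_duals (alt K0 K1) V W ev"
  shows "let K = alt K0 K1; A = nc_symmetric_algebra K W ev in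
    (simple_bimodule K0 K1 V \<longrightarrow>
       (\<forall>(F :: 'f ring) \<iota>0 \<iota>1 \<sigma>0 \<sigma>1 f w0 w1.
          simple_presentation K W ev F (alt \<iota>0 \<iota>1) (alt \<sigma>0 \<sigma>1) f \<and>
          admissible_roots K F (alt \<iota>0 \<iota>1) (alt w0 w1) \<longrightarrow>
          twisted_ring_on F (zquot A (simple_ideal K W ev F f (alt w0 w1))))) \<and>
    (\<not> simple_bimodule K0 K1 V \<longrightarrow>
       (\<forall>(E :: 'e ring) \<kappa>0 \<kappa>1 \<sigma> \<eta> \<tau> f x y.
          nonsimple_presentation K0 K1 V E \<kappa>0 \<kappa>1 \<sigma> \<eta> \<tau> f \<and>
          dual_bases K W ev x y \<and>
          f (x 0) = (\<one>\<^bsub>E\<^esub>, \<zero>\<^bsub>E\<^esub>) \<and> f (y 0) = (\<zero>\<^bsub>E\<^esub>, \<one>\<^bsub>E\<^esub>) \<longrightarrow>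
          twisted_ring_on E (zquot A (nonsimple_ideal K W ev x y)))) \<and>
    noetherian_zring A"
proof -
  interpret duals K0 K1 V W ev
    using assms by (intro duals.intro)
  have "twisted_ring_on F (zquot (nc_symmetric_algebra (alt K0 K1) W ev)
      (simple_ideal (alt K0 K1) W ev F f (alt w0 w1)))"
    if "simple_presentation (alt K0 K1) W ev F (alt \<iota>0 \<iota>1) (alt \<sigma>0 \<sigma>1) f"
      "admissible_roots (alt K0 K1) F (alt \<iota>0 \<iota>1) (alt w0 w1)"
    for F :: "'f ring" and \<iota>0 \<iota>1 \<sigma>0 \<sigma>1 f w0 w1
    using that assms by (intro simple_case.simple_twisted[where V = V] simple_case.intro simple_case_axioms.intro duals_axioms)
  moreover have "twisted_ring_on E (zquot (nc_symmetric_algebra (alt K0 K1) W ev)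
      (nonsimple_ideal (alt K0 K1) W ev x y))"
    if "nonsimple_presentation K0 K1 V E \<kappa>0 \<kappa>1 \<sigma> \<eta> \<tau> f" "dual_bases (alt K0 K1) W ev x y"
      "f (y 0) = (\<zero>\<^bsub>E\<^esub>, \<one>\<^bsub>E\<^esub>)"
    for E :: "'e ring" and \<kappa>0 \<kappa>1 \<sigma> \<eta> \<tau> f x y
    using that
    by (intro nonsimple_case.nonsimple_twisted[where V = V] nonsimple_case.intro nonsimple_case_axioms.intro duals_axioms)
  ultimately show ?thesis
    unfolding Let_def using nc_symmetric_noetherian by blast
qed

end
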